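(* Let $k>0$ and let $\rho\in L^\infty(\mathbb{R}^2)$ be a real-valued medium with $\rho-1$ compactly supported, that has an admissible 2-split corner. Then $\rho$ scatters every incident wave that is nonzero at the corner tip: if $u_{\mathrm{in}}$ satisfies $\Delta u_{\mathrm{in}}+k^2u_{\mathrm{in}}=0$ in $\mathbb{R}^2$ and $u_{\mathrm{in}}(x_0)\neq0$, where $x_0$ is the tip of the corner, then the far-field pattern of the corresponding scattered field $u_{\mathrm{sc}}$ is not identically zero.
   Context: Medium scattering problem: given an incident field $u_{\mathrm{in}}$ with $\Delta u_{\mathrm{in}}+k^2u_{\mathrm{in}}=0$ in $\mathbb{R}^2$, the total field $u=u_{\mathrm{in}}+u_{\mathrm{sc}}\in H^1_{\mathrm{loc}}(\mathbb{R}^2)$ solves $\Delta u+k^2\rho u=0$ in $\mathbb{R}^2$, with $u_{\mathrm{sc}}$ satisfying the Sommerfeld radiation condition $\lim_{r\to\infty} r^{1/2}(\partial_r u_{\mathrm{sc}}-ik u_{\mathrm{sc}})=0$, $r=|x|$, uniformly in all directions. The far-field pattern $u_\infty$ is defined by $u_{\mathrm{sc}}(x)=|x|^{-1/2}e^{ik|x|}(u_\infty(\hat x)+O(|x|^{-1}))$ as $|x|\to\infty$, $\hat x=x/|x|$. The medium scatters $u_{\mathrm{in}}$ if $u_\infty\not\equiv0$. The medium is denoted $(\rho-1,\Sigma)$ with $\Sigma:=\mathrm{supp}_t(\rho-1)$ compact, where the total support of a compactly supported $f\in L^2(\mathbb{R}^2)$ is $\mathrm{supp}_t f:=\mathbb{R}^2\setminus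 G$, with $G$ the unbounded connected component of $\mathbb{R}^2\setminus\mathrm{supp} f$. It is assumed that $\overline{\Sigma^\circ}=\Sigma$. Circular wedge: for $R>0$ and $\theta_0,\theta_1\in[-\pi,\pi)$ with $0<\theta_1-\theta_0<2\pi$, in polar coordinates $\mathcal{K}_{\theta_0,\theta_1,R}:=\{x\in\mathbb{R}^2:\theta_0<\theta<\theta_1,\ 0<r<R\}$. The medium has a corner $\mathcal{K}$ if, up to a rigid change of coordinates, $0\in\partial\Sigma^\circ$ and $B_R(0)\cap\Sigma^\circ=\mathcal{K}=\mathcal{K}_{\theta_0,\theta_2,R}$ for some $R>0$ (tip $0$, aperture $\omega=\theta_2-\theta_0$; $\omega=\pi$ is allowed). The corner is 2-split if there is $\theta_1$ with $\theta_0<\theta_1<\theta_2$ and $|(\rho(x)-1)-p_j|\le C_j|x|^{\alpha_j}$ a.e. in $\mathcal{K}_{\theta_{j-1},\theta_j,R}$, $j=1,2$, for some real $p_j$ and positive $C_j,\alpha_j$. Here $\omega_j:=\theta_j-\theta_{j-1}$, and $(p_1,p_2)$ is the limiting value of $\rho-1$ ($p_1=p_2$ is allowed). A 2-split corner is admissible if one of the following holds: (i) $\omega=\pi$ and $p_1\ne p_2$; (ii) $\omega\ne\pi$ and, for $j=1$ or $j=2$, $p_j\neq 0$ and ($\omega_j\ne\pi$ or $\omega_{j+1}=\pi$), where $\omega_3:=\omega_1$. *)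

theory Defs
  imports "HOL-Analysis.Analysis" "HOL-Library.Landau_Symbols"
begin

section \<open>Classical and weak derivatives\<close>

definition dir_deriv ::
    "'a::euclidean_space \<Rightarrow> ('a \<Rightarrow> 'b::real_normed_vector) \<Rightarrow> 'a \<Rightarrow> 'b" where
  "dir_deriv v f x = frechet_derivative f (at x) v"

definition laplacian ::
    "('a::euclidean_space \<Rightarrow> 'b::real_normed_vector) \<Rightarrow> 'a \<Rightarrow> 'b" where
  "laplacian f x = (\<Sum>b\<in>Basis. dir_deriv b (dir_deriv b f) x)"

primrec C_diff :: "nat \<Rightarrow> ('a::euclidean_space \<Rightarrow> 'b::real_normed_vector) \<Rightarrow> bool" where
  "C_diff 0 f \<longleftrightarrow> continuous_on UNIV f"
| "C_diff (Suc n) f \<longleftrightarrow> (\<forall>x. f differentiable (at x)) \<and> (\<forall>v. C_diff n (dir_deriv v f))"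

definition test_function :: "('a::euclidean_space \<Rightarrow> complex) \<Rightarrow> bool" where
  "test_function \<phi> \<longleftrightarrow> (\<forall>n. C_diff n \<phi>) \<and> compact (closure {x. \<phi> x \<noteq> 0})"

definition L2_loc :: "('a::euclidean_space \<Rightarrow> complex) \<Rightarrow> bool" where
  "L2_loc f \<longleftrightarrow> f \<in> borel_measurable lebesgue \<and>
     (\<forall>K. compact K \<longrightarrow> set_integrable lebesgue K (\<lambda>x. (cmod (f x))\<^sup>2))"

definition weak_dir_deriv ::
    "'a::euclidean_space \<Rightarrow> ('a \<Rightarrow> complex) \<Rightarrow> ('a \<Rightarrow> complex) \<Rightarrow> bool" where
  "weak_dir_deriv v f g \<longleftrightarrow>
     (\<forall>\<phi>. test_function \<phi> \<longrightarrow>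
        (LINT x|lebesgue. f x * dir_deriv v \<phi> x) = - (LINT x|lebesgue. g x * \<phi> x))"

definition H1_loc :: "('a::euclidean_space \<Rightarrow> complex) \<Rightarrow> bool" where
  "H1_loc f \<longleftrightarrow> L2_loc f \<and> (\<forall>b\<in>Basis. \<exists>g. L2_loc g \<and> weak_dir_deriv b f g)"

section \<open>The medium\<close>

definition L_infinity :: "('a::euclidean_space \<Rightarrow> real) \<Rightarrow> bool" where
  "L_infinity f \<longleftrightarrow> f \<in> borel_measurable lebesgue \<and> (\<exists>M. AE x in lebesgue. \<bar>f x\<bar> \<le> M)"

text \<open>The support of a function that is only determined almost everywhere: the complement of
  the largest open set on which it vanishes almost everywhere.\<close>

definition ess_supp :: "('a::euclidean_space \<Rightarrow> real) \<Rightarrow> 'a set" where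
  "ess_supp f = - \<Union>{U. open U \<and> (AE x in lebesgue. x \<in> U \<longrightarrow> f x = 0)}"

text \<open>\<^term>\<open>outside S\<close> is the union of the unbounded components of the complement of \<open>S\<close>.  For
  bounded \<open>S\<close> in dimension at least 2 there is exactly one such component.\<close>

definition total_supp :: "('a::euclidean_space \<Rightarrow> real) \<Rightarrow> 'a set" where
  "total_supp f = - outside (ess_supp f)"

section \<open>The scattering problem\<close>

text \<open>Incident waves have point values, so they are taken as classical solutions.\<close>

definition incident_wave :: "real \<Rightarrow> (real^2 \<Rightarrow> complex) \<Rightarrow> bool" where
  "incident_wave k u \<longleftrightarrow>
     C_diff 2 u \<and> (\<forall>x. laplacian u x + of_real (k\<^sup>2) * u x = 0)"

text \<open>The equation \<open>\<Delta>u + k\<^sup>2 \<rho> u = 0\<close> in the sense of distributions.\<close>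

definition medium_equation :: "real \<Rightarrow> (real^2 \<Rightarrow> real) \<Rightarrow> (real^2 \<Rightarrow> complex) \<Rightarrow> bool" where
  "medium_equation k \<rho> u \<longleftrightarrow>
     (\<forall>\<phi>. test_function \<phi> \<longrightarrow>
        (LINT x|lebesgue. u x * laplacian \<phi> x + of_real (k\<^sup>2 * \<rho> x) * u x * \<phi> x) = 0)"

text \<open>The filter \<^term>\<open>at_infinity\<close> expresses that the limit is uniform in all directions.
  Radiation condition and far-field pattern refer to point values near infinity, where a field
  in \<open>H1_loc\<close> is represented by its smooth version.\<close>

definition sommerfeld :: "real \<Rightarrow> (real^2 \<Rightarrow> complex) \<Rightarrow> bool" where
  "sommerfeld k w \<longleftrightarrow>
     (\<forall>\<^sub>F x in at_infinity. w differentiable (at x)) \<and>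
     ((\<lambda>x. of_real (sqrt (norm x)) * (dir_deriv (sgn x) w x - \<i> * of_real k * w x))
        \<longlongrightarrow> 0) at_infinity"

definition total_field ::
    "real \<Rightarrow> (real^2 \<Rightarrow> real) \<Rightarrow> (real^2 \<Rightarrow> complex) \<Rightarrow> (real^2 \<Rightarrow> complex) \<Rightarrow> bool" where
  "total_field k \<rho> u_in u \<longleftrightarrow>
     H1_loc u \<and> medium_equation k \<rho> u \<and> sommerfeld k (\<lambda>x. u x - u_in x)"

text \<open>Only the values of \<open>w_inf\<close> on the unit circle matter.\<close>

definition far_field_pattern ::
    "real \<Rightarrow> (real^2 \<Rightarrow> complex) \<Rightarrow> (real^2 \<Rightarrow> complex) \<Rightarrow> bool" where
  "far_field_pattern k w w_inf \<longleftrightarrow>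
     (\<exists>e \<in> O[at_infinity](\<lambda>x. of_real (1 / norm x)).
        \<forall>\<^sub>F x in at_infinity.
          w x = of_real (norm x powr (-1/2)) * exp (\<i> * of_real (k * norm x)) *
                (w_inf (sgn x) + e x))"

section \<open>Corners\<close>

definition wedge :: "real \<Rightarrow> real \<Rightarrow> real \<Rightarrow> (real^2) set" where
  "wedge \<theta>\<^sub>0 \<theta>\<^sub>1 R =
     {vector [r * cos \<theta>, r * sin \<theta>] | r \<theta>. \<theta>\<^sub>0 < \<theta> \<and> \<theta> < \<theta>\<^sub>1 \<and> 0 < r \<and> r < R}"

text \<open>The rigid change of coordinates is \<open>y \<mapsto> x0 + Q y\<close> with \<open>Q\<close> orthogonal; \<open>x0\<close> is the tip.\<close>

definition has_corner ::
    "(real^2) set \<Rightarrow> real^2 \<Rightarrow> (real^2 \<Rightarrow> real^2) \<Rightarrow> real \<Rightarrow> real \<Rightarrow> real \<Rightarrow> bool" where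
  "has_corner \<Sigma> x0 Q R \<theta>\<^sub>0 \<theta>\<^sub>2 \<longleftrightarrow>
     orthogonal_transformation Q \<and> R > 0 \<and>
     \<theta>\<^sub>0 \<in> {-pi..<pi} \<and> \<theta>\<^sub>2 \<in> {-pi..<pi} \<and> 0 < \<theta>\<^sub>2 - \<theta>\<^sub>0 \<and> \<theta>\<^sub>2 - \<theta>\<^sub>0 < 2 * pi \<and>
     x0 \<in> frontier (interior \<Sigma>) \<and>
     ball x0 R \<inter> interior \<Sigma> = (\<lambda>y. x0 + Q y) ` wedge \<theta>\<^sub>0 \<theta>\<^sub>2 R"

definition holder_limit :: "(real^2 \<Rightarrow> real) \<Rightarrow> (real^2) set \<Rightarrow> real \<Rightarrow> bool" where
  "holder_limit f K p \<longleftrightarrow>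
     (\<exists>C>0. \<exists>\<alpha>>0. AE y in lebesgue. y \<in> K \<longrightarrow> \<bar>f y - p\<bar> \<le> C * norm y powr \<alpha>)"

definition two_split_corner ::
    "(real^2 \<Rightarrow> real) \<Rightarrow> real^2 \<Rightarrow> real \<Rightarrow> real \<Rightarrow> real \<Rightarrow> real \<Rightarrow> real \<Rightarrow> bool" where
  "two_split_corner \<rho> x0 \<theta>\<^sub>0 \<theta>\<^sub>1 \<theta>\<^sub>2 p\<^sub>1 p\<^sub>2 \<longleftrightarrow>
     (\<exists>Q R. has_corner (total_supp (\<lambda>x. \<rho> x - 1)) x0 Q R \<theta>\<^sub>0 \<theta>\<^sub>2 \<and>
        \<theta>\<^sub>0 < \<theta>\<^sub>1 \<and> \<theta>\<^sub>1 < \<theta>\<^sub>2 \<and>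
        holder_limit (\<lambda>y. \<rho> (x0 + Q y) - 1) (wedge \<theta>\<^sub>0 \<theta>\<^sub>1 R) p\<^sub>1 \<and>
        holder_limit (\<lambda>y. \<rho> (x0 + Q y) - 1) (wedge \<theta>\<^sub>1 \<theta>\<^sub>2 R) p\<^sub>2)"

definition admissible :: "real \<Rightarrow> real \<Rightarrow> real \<Rightarrow> real \<Rightarrow> bool" where
  "admissible \<omega>\<^sub>1 \<omega>\<^sub>2 p\<^sub>1 p\<^sub>2 \<longleftrightarrow>
     \<omega>\<^sub>1 + \<omega>\<^sub>2 = pi \<and> p\<^sub>1 \<noteq> p\<^sub>2 \<or>
     \<omega>\<^sub>1 + \<omega>\<^sub>2 \<noteq> pi \<and>
       (p\<^sub>1 \<noteq> 0 \<and> (\<omega>\<^sub>1 \<noteq> pi \<or> \<omega>\<^sub>2 = pi) \<or> p\<^sub>2 \<noteq> 0 \<and> (\<omega>\<^sub>2 \<noteq> pi \<or> \<omega>\<^sub>1 = pi))"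

definition admissible_two_split_corner :: "(real^2 \<Rightarrow> real) \<Rightarrow> real^2 \<Rightarrow> bool" where
  "admissible_two_split_corner \<rho> x0 \<longleftrightarrow>
     (\<exists>\<theta>\<^sub>0 \<theta>\<^sub>1 \<theta>\<^sub>2 p\<^sub>1 p\<^sub>2. two_split_corner \<rho> x0 \<theta>\<^sub>0 \<theta>\<^sub>1 \<theta>\<^sub>2 p\<^sub>1 p\<^sub>2 \<and>
        admissible (\<theta>\<^sub>1 - \<theta>\<^sub>0) (\<theta>\<^sub>2 - \<theta>\<^sub>1) p\<^sub>1 p\<^sub>2)"

end

theory Submission
  imports Defs
begin

text \<open>
Suppose that the far-field pattern vanishes.  Let \<open>\<Sigma>\<close> be the total support of \<open>\<rho> - 1\<close> and
\<open>w = u - u_in\<close> the scattered field.  The contradiction is read off at the corner tip \<open>x0\<close>.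

\<^item> \<^emph>\<open>The scattered field vanishes outside \<open>\<Sigma>\<close>.\<close>  A Fourier coefficient of \<open>w\<close> over circles of radius
  \<open>r\<close> solves Bessel's equation.  After multiplication by \<open>sqrt r\<close> it solves
  \<open>g'' = (c / r\<^sup>2 - k\<^sup>2) g\<close>, whose energy \<open>g'\<^sup>2 + k\<^sup>2 g\<^sup>2\<close> changes only by a bounded factor on
  \<open>{r..}\<close>.  The vanishing far field makes \<open>sqrt r w\<close> tend to zero, so the energy is zero and \<open>w\<close>
  vanishes near infinity (\<open>helmholtz_rellich\<close>).  The same energy shows that a solution which
  vanishes on a small ball vanishes on every concentric ball on which it solves the equation
  (\<open>helmholtz_unique_continuation_ball\<close>), and this carries the zero set through the connected exterior.
  Weak solutions are treated by mollification (\<open>weak_helmholtz_vanishes_outside\<close>).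

\<^item> \<^emph>\<open>The field is small at the tip.\<close>  Now \<open>w\<close> has compact support and solves \<open>\<Delta>w = f\<close> weakly with
  \<open>f = k\<^sup>2 (u_in - \<rho> u)\<close> in \<open>L\<^sup>2\<close>.  Hence \<open>w\<close> is a multiple of the logarithmic potential of \<open>f\<close> and
  satisfies a Hoelder condition of exponent \<open>1/2\<close> (\<open>hoelder_representative\<close>).  As \<open>w\<close> vanishes
  outside \<open>\<Sigma>\<close>, it vanishes at \<open>x0\<close>, so in the \<open>j\<close>-th sector
  \<open>f = - k\<^sup>2 p\<^sub>j u_in(x0) + O(|x - x0| powr \<beta>)\<close> for some \<open>\<beta> > 0\<close>.

\<^item> \<^emph>\<open>Testing with a double pole.\<close>  In a complex coordinate \<open>z\<close> centred at the tip, the function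
  \<open>inverse ((z - \<zeta>)\<^sup>2)\<close> is harmonic away from \<open>\<zeta>\<close>.  Put \<open>\<zeta>\<close> at distance \<open>t\<close> from the tip, on the
  exterior bisector of the corner.  There \<open>w = 0\<close>, so a cut-off around \<open>\<zeta>\<close> costs nothing, and the
  integral of \<open>f\<close> against this function over a fixed ball about the tip stays bounded as \<open>t\<close> tends to
  zero (\<open>tip_pairing_bounded\<close>).  On the other hand the function is homogeneous of degree \<open>-2\<close> in
  \<open>(z, \<zeta>)\<close>, so that every halving of \<open>t\<close> adds, in the limit, the integral of \<open>- k\<^sup>2 p\<^sub>j u_in(x0) / z\<^sup>2\<close>
  over an annular sector.  Bounded sums force this increment to be zero (\<open>corner_condition\<close>), and
  since \<open>u_in(x0) \<noteq> 0\<close>,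
  \<open>p\<^sub>1 (exp(-2 \<i> \<theta>\<^sub>1) - exp(-2 \<i> \<theta>\<^sub>0)) + p\<^sub>2 (exp(-2 \<i> \<theta>\<^sub>2) - exp(-2 \<i> \<theta>\<^sub>1)) = 0\<close>.

\<^item> \<^emph>\<open>Trigonometry.\<close>  The real and imaginary parts of this relation are
  \<open>p\<^sub>1 sin\<^sup>2 \<omega>\<^sub>1 = p\<^sub>2 sin\<^sup>2 \<omega>\<^sub>2\<close> and \<open>p\<^sub>1 sin \<omega>\<^sub>1 cos \<omega>\<^sub>1 = - p\<^sub>2 sin \<omega>\<^sub>2 cos \<omega>\<^sub>2\<close>; admissibility
  rules them out (\<open>admissible_excludes_relation\<close>).\<close>

section \<open>Functions of class C^n on an open set\<close>

text \<open>The localisation of \<open>C_diff\<close> to a set (see \<open>C_diff_eq_Ck\<close>): kernels with a pole, and solutions of the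
Helmholtz equation outside a disc, are smooth only on an open subset of the plane.\<close>

primrec Ck :: "nat \<Rightarrow> 'a::euclidean_space set \<Rightarrow> ('a \<Rightarrow> 'b::real_normed_vector) \<Rightarrow> bool" where
  "Ck 0 S f \<longleftrightarrow> continuous_on S f"
| "Ck (Suc n) S f \<longleftrightarrow> (\<forall>x\<in>S. f differentiable (at x)) \<and> (\<forall>v. Ck n S (dir_deriv v f))"

lemma C_diff_eq_Ck: "C_diff n f \<longleftrightarrow> Ck n UNIV f"
  by (induction n arbitrary: f) auto

lemma dir_deriv_eqI: "(f has_derivative f') (at x) \<Longrightarrow> dir_deriv v f x = f' v"
  unfolding dir_deriv_def by (metis frechet_derivative_at)

lemma dir_deriv_works:
  "f differentiable (at x) \<Longrightarrow> (f has_derivative (\<lambda>v. dir_deriv v f x)) (at x)"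
  unfolding dir_deriv_def by (simp add: frechet_derivative_works)

lemma dir_deriv_cong:
  assumes "open S" "x \<in> S" "\<And>y. y \<in> S \<Longrightarrow> f y = g y"
  shows "dir_deriv v f x = dir_deriv v g x"
proof -
  have "(f has_derivative D) (at x) \<longleftrightarrow> (g has_derivative D) (at x)" for D
    by (metis assms has_derivative_transform_within_open)
  thus ?thesis by (simp add: dir_deriv_def frechet_derivative_def)
qed

lemma differentiable_cong_open:
  assumes "open S" "x \<in> S" "\<And>y. y \<in> S \<Longrightarrow> f y = g y"
  shows "f differentiable (at x) \<longleftrightarrow> g differentiable (at x)"
  unfolding differentiable_def by (metis assms has_derivative_transform_within_open)

lemma Ck_cong:
  assumes "open S" "\<And>y. y \<in> S \<Longrightarrow> f y = g y"
  shows "Ck n S f \<longleftrightarrow> Ck n S g"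
  using assms(2)
proof (induction n arbitrary: f g)
  case 0
  thus ?case by (simp cong: continuous_on_cong)
next
  case (Suc n)
  have "Ck n S (dir_deriv v f) = Ck n S (dir_deriv v g)" for v
    by (rule Suc.IH) (use dir_deriv_cong[OF \<open>open S\<close>] Suc.prems in blast)
  moreover have "f differentiable (at x) \<longleftrightarrow> g differentiable (at x)" if "x \<in> S" for x
    using differentiable_cong_open[OF \<open>open S\<close> that] Suc.prems by blast
  ultimately show ?case by simp
qed

lemma Ck_mono: "Ck n S f \<Longrightarrow> T \<subseteq> S \<Longrightarrow> Ck n T f"
  by (induction n arbitrary: f) (auto intro: continuous_on_subset)

lemma Ck_Un: "open S \<Longrightarrow> open T \<Longrightarrow> Ck n S f \<Longrightarrow> Ck n T f \<Longrightarrow> Ck n (S \<union> T) f"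
  by (induction n arbitrary: f) (auto intro: continuous_on_open_Un)

lemma Ck_imp_continuous_on: "Ck n S f \<Longrightarrow> continuous_on S f"
  by (cases n) (auto intro!: continuous_at_imp_continuous_on differentiable_imp_continuous_within)

lemma Ck_Suc_imp: "Ck (Suc n) S f \<Longrightarrow> Ck n S f"
proof (induction n arbitrary: f)
  case 0
  thus ?case using Ck_imp_continuous_on by (auto simp del: Ck.simps(2))
next
  case (Suc n)
  thus ?case by simp
qed

lemma Ck_le: "Ck n S f \<Longrightarrow> m \<le> n \<Longrightarrow> Ck m S f"
  by (induction n arbitrary: m) (use Ck_Suc_imp le_Suc_eq in blast)+

text \<open>Smoothness proofs proceed by giving a formula for the derivative that is valid on the open set only;
elsewhere \<open>dir_deriv\<close> may be junk.\<close>

lemma Ck_SucI: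
  assumes "open S" "\<And>x. x \<in> S \<Longrightarrow> (f has_derivative (\<lambda>v. D v x)) (at x)" "\<And>v. Ck n S (D v)"
  shows "Ck (Suc n) S f"
proof -
  have "Ck n S (dir_deriv v f)" for v
    using Ck_cong[OF assms(1), of "dir_deriv v f" "D v"] assms dir_deriv_eqI[OF assms(2)] by simp
  thus ?thesis using assms(2) by (auto simp: differentiable_def)
qed

lemma Ck_SucD:
  assumes "Ck (Suc n) S f"
  shows "\<And>x. x \<in> S \<Longrightarrow> (f has_derivative (\<lambda>v. dir_deriv v f x)) (at x)" "Ck n S (dir_deriv v f)"
  using assms by (auto intro: dir_deriv_works)

lemma Ck_const [simp]: "Ck n S (\<lambda>x. c)"
proof (induction n arbitrary: c)
  case (Suc n)
  have "dir_deriv v (\<lambda>x. c) = (\<lambda>x. 0)" for v :: 'a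
    by (rule ext) (rule dir_deriv_eqI[where f'="\<lambda>_. 0"], simp)
  thus ?case using Suc by simp
qed simp

lemma Ck_bounded_linear:
  assumes "bounded_linear L" "open S" "Ck n S f"
  shows "Ck n S (\<lambda>x. L (f x))"
  using assms(3)
proof (induction n arbitrary: f)
  case 0
  thus ?case using bounded_linear.continuous_on[OF assms(1)] by simp
next
  case (Suc n)
  show ?case
    by (rule Ck_SucI[OF assms(2), where D="\<lambda>v x. L (dir_deriv v f x)"])
       (use Suc in \<open>auto intro!: dir_deriv_works bounded_linear.has_derivative[OF assms(1)]\<close>)
qed

lemma Ck_id_linear:
  assumes "bounded_linear L"
  shows "Ck n UNIV L"
proof (cases n)
  case 0
  thus ?thesis using assms by (simp add: linear_continuous_on)
next
  case (Suc m)
  show ?thesis unfolding Suc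
    by (rule Ck_SucI[where D="\<lambda>v x. L v"]) (auto intro: bounded_linear_imp_has_derivative assms)
qed

lemma Ck_add:
  assumes "open S" "Ck n S f" "Ck n S g"
  shows "Ck n S (\<lambda>x. f x + g x)"
  using assms(2,3)
proof (induction n arbitrary: f g)
  case (Suc n)
  show ?case
    by (rule Ck_SucI[OF assms(1), where D="\<lambda>v x. dir_deriv v f x + dir_deriv v g x"])
       (use Suc in \<open>auto intro!: has_derivative_add dir_deriv_works\<close>)
qed (auto intro: continuous_intros)

lemma Ck_minus:
  assumes "open S" "Ck n S f"
  shows "Ck n S (\<lambda>x. - f x)"
  by (rule Ck_bounded_linear[OF bounded_linear_minus[OF bounded_linear_ident] assms])

lemma Ck_diff:
  assumes "open S" "Ck n S f" "Ck n S g"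
  shows "Ck n S (\<lambda>x. f x - g x)"
  using Ck_add[OF assms(1,2) Ck_minus[OF assms(1,3)]] by simp

lemma Ck_sum:
  assumes "open S" "\<And>i. i \<in> I \<Longrightarrow> Ck n S (f i)"
  shows "Ck n S (\<lambda>x. \<Sum>i\<in>I. f i x)"
  using assms(2) by (induction I rule: infinite_finite_induct) (auto intro!: Ck_add assms(1))

lemma Ck_mult:
  fixes f g :: "'a::euclidean_space \<Rightarrow> 'b::real_normed_algebra"
  assumes "open S" "Ck n S f" "Ck n S g"
  shows "Ck n S (\<lambda>x. f x * g x)"
  using assms(2,3)
proof (induction n arbitrary: f g)
  case (Suc n)
  show ?case
  proof (rule Ck_SucI[OF assms(1), where D="\<lambda>v x. f x * dir_deriv v g x + dir_deriv v f x * g x"])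
    show "Ck n S (\<lambda>x. f x * dir_deriv v g x + dir_deriv v f x * g x)" for v
      by (rule Ck_add[OF assms(1)]) (use Suc Ck_Suc_imp[OF Suc.prems(1)] Ck_Suc_imp[OF Suc.prems(2)] in auto)
  qed (use Suc in \<open>auto intro!: has_derivative_mult dir_deriv_works\<close>)
qed (auto intro: continuous_intros)

lemma Ck_prod:
  fixes f :: "'i \<Rightarrow> 'a::euclidean_space \<Rightarrow> 'b::{real_normed_algebra,comm_ring_1}"
  assumes "open S" "\<And>i. i \<in> I \<Longrightarrow> Ck n S (f i)"
  shows "Ck n S (\<lambda>x. \<Prod>i\<in>I. f i x)"
  using assms(2) by (induction I rule: infinite_finite_induct) (auto intro!: Ck_mult assms(1))

lemma Ck_inverse:
  fixes f :: "'a::euclidean_space \<Rightarrow> 'b::real_normed_field"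
  assumes "open S" "Ck n S f" "\<And>x. x \<in> S \<Longrightarrow> f x \<noteq> 0"
  shows "Ck n S (\<lambda>x. inverse (f x))"
  using assms(2)
proof (induction n)
  case 0
  thus ?case using assms(3) by (auto intro: continuous_intros)
next
  case (Suc n)
  show ?case
  proof (rule Ck_SucI[OF assms(1), where D="\<lambda>v x. - (inverse (f x) * dir_deriv v f x * inverse (f x))"])
    show "Ck n S (\<lambda>x. - (inverse (f x) * dir_deriv v f x * inverse (f x)))" for v
      by (intro Ck_minus Ck_mult assms(1)) (use Suc Ck_Suc_imp[OF Suc.prems] in auto)
    show "((\<lambda>x. inverse (f x)) has_derivative (\<lambda>v. - (inverse (f x) * dir_deriv v f x * inverse (f x)))) (at x)"
      if "x \<in> S" for x
      using Deriv.has_derivative_inverse[OF assms(3)[OF that] Ck_SucD(1)[OF Suc.prems that]] .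
  qed
qed

lemma Ck_ln:
  fixes f :: "'a::euclidean_space \<Rightarrow> real"
  assumes "open S" "Ck n S f" "\<And>x. x \<in> S \<Longrightarrow> f x > 0"
  shows "Ck n S (\<lambda>x. ln (f x))"
proof (cases n)
  case 0
  thus ?thesis using assms(2,3) by (force intro!: continuous_intros)
next
  case (Suc m)
  have f0: "f x \<noteq> 0" if "x \<in> S" for x using assms(3)[OF that] by simp
  show ?thesis unfolding Suc
  proof (rule Ck_SucI[OF assms(1), where D="\<lambda>v x. inverse (f x) * dir_deriv v f x"])
    show "Ck m S (\<lambda>x. inverse (f x) * dir_deriv v f x)" for v
      using assms Ck_le[OF assms(2), of m] Ck_SucD(2)[of m S f v] Suc
      by (intro Ck_mult assms(1) Ck_inverse f0) auto
    show "((\<lambda>x. ln (f x)) has_derivative (\<lambda>v. inverse (f x) * dir_deriv v f x)) (at x)"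
      if "x \<in> S" for x
      using has_derivative_ln[OF assms(3)[OF that] Ck_SucD(1)[of m S f x]] assms(2) that Suc
      by (auto simp: mult.commute divide_inverse)
  qed
qed

lemma Ck_of_real:
  assumes "open S" "Ck n S f"
  shows "Ck n S (\<lambda>x. complex_of_real (f x))"
  by (rule Ck_bounded_linear[OF bounded_linear_of_real assms])

lemma has_derivative_translate:
  assumes "(f has_derivative D) (at (x - a))"
  shows "((\<lambda>y. f (y - a)) has_derivative D) (at x)"
proof -
  have "((\<lambda>y. y - a) has_derivative (\<lambda>h. h)) (at x)" by (auto intro!: derivative_eq_intros)
  from has_derivative_compose[OF this assms] show ?thesis .
qed

lemma dir_deriv_translate:
  "f differentiable (at (x - a)) \<Longrightarrow> dir_deriv v (\<lambda>y. f (y - a)) x = dir_deriv v f (x - a)"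
  by (rule dir_deriv_eqI[OF has_derivative_translate[OF dir_deriv_works]])

lemma Ck_translate:
  assumes "Ck n UNIV f"
  shows "Ck n UNIV (\<lambda>y. f (y - a))"
  using assms
proof (induction n arbitrary: f)
  case 0
  thus ?case by (auto intro!: continuous_intros continuous_on_compose2[of UNIV f])
next
  case (Suc n)
  show ?case
    by (rule Ck_SucI[where D="\<lambda>v y. dir_deriv v f (y - a)"])
       (use Suc in \<open>auto intro!: has_derivative_translate dir_deriv_works\<close>)
qed

lemma laplacian_cong:
  assumes "open S" "x \<in> S" "\<And>y. y \<in> S \<Longrightarrow> f y = g y"
  shows "laplacian f x = laplacian g x"
  unfolding laplacian_def
  by (intro sum.cong refl dir_deriv_cong[OF assms(1,2)] dir_deriv_cong[OF assms(1) _ assms(3)])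

lemma dir_deriv_mult:
  fixes f g :: "'a::euclidean_space \<Rightarrow> 'b::real_normed_algebra"
  assumes "f differentiable (at x)" "g differentiable (at x)"
  shows "dir_deriv v (\<lambda>x. f x * g x) x = f x * dir_deriv v g x + dir_deriv v f x * g x"
  by (intro dir_deriv_eqI has_derivative_mult dir_deriv_works assms)

lemma dir_deriv_add:
  assumes "f differentiable (at x)" "g differentiable (at x)"
  shows "dir_deriv v (\<lambda>x. f x + g x) x = dir_deriv v f x + dir_deriv v g x"
  by (intro dir_deriv_eqI has_derivative_add dir_deriv_works assms)

text \<open>The algebra need not have a unit, hence no numeral \<open>2\<close>: the cross term appears as two equal sums.\<close>

lemma laplacian_mult_at:
  fixes f g :: "'a::euclidean_space \<Rightarrow> 'b::{real_normed_algebra,comm_ring}"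
  assumes S: "open S" "x \<in> S" and f: "Ck 2 S f" and g: "Ck 2 S g"
  shows "laplacian (\<lambda>x. f x * g x) x = f x * laplacian g x + laplacian f x * g x
           + (\<Sum>b\<in>Basis. dir_deriv b f x * dir_deriv b g x) + (\<Sum>b\<in>Basis. dir_deriv b f x * dir_deriv b g x)"
proof -
  have f1: "f differentiable (at y)" "dir_deriv b f differentiable (at y)" if "y \<in> S" for y b
    using f that by (auto simp: numeral_2_eq_2)
  have g1: "g differentiable (at y)" "dir_deriv b g differentiable (at y)" if "y \<in> S" for y b
    using g that by (auto simp: numeral_2_eq_2)
  have "dir_deriv b (dir_deriv b (\<lambda>x. f x * g x)) x =
      f x * dir_deriv b (dir_deriv b g) x + dir_deriv b (dir_deriv b f) x * g x
      + dir_deriv b f x * dir_deriv b g x + dir_deriv b f x * dir_deriv b g x" for b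
  proof -
    have "dir_deriv b (dir_deriv b (\<lambda>x. f x * g x)) x
        = dir_deriv b (\<lambda>x. f x * dir_deriv b g x + dir_deriv b f x * g x) x"
      by (rule dir_deriv_cong[OF S]) (use f1 g1 in \<open>auto simp: dir_deriv_mult\<close>)
    also have "\<dots> = dir_deriv b (\<lambda>x. f x * dir_deriv b g x) x + dir_deriv b (\<lambda>x. dir_deriv b f x * g x) x"
      by (intro dir_deriv_add differentiable_mult f1 g1 S)
    also have "\<dots> = f x * dir_deriv b (dir_deriv b g) x + dir_deriv b f x * dir_deriv b g x
       + (dir_deriv b f x * dir_deriv b g x + dir_deriv b (dir_deriv b f) x * g x)"
      by (simp add: dir_deriv_mult f1 g1 S)
    finally show ?thesis by (simp add: algebra_simps)
  qed
  thus ?thesis unfolding laplacian_def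
    by (simp add: sum.distrib sum_distrib_left sum_distrib_right)
qed

lemma Ck_laplacian: "open S \<Longrightarrow> Ck (Suc (Suc n)) S f \<Longrightarrow> Ck n S (laplacian f)"
  unfolding laplacian_def[abs_def] by (intro Ck_sum) auto

section \<open>Smooth cut-off functions\<close>

text \<open>For \<open>m = 0\<close> this is the standard flat function \<open>exp (- 1/t)\<close>.  The powers of \<open>1/t\<close> are included to make
the family closed under differentiation, so that smoothness follows by induction.\<close>

definition bump_exp :: "nat \<Rightarrow> real \<Rightarrow> real" where
  "bump_exp m t = (if t > 0 then inverse t ^ m * exp (- inverse t) else 0)"

lemma bump_exp_tendsto_0: "(bump_exp m \<longlongrightarrow> 0) (at_right 0)"
proof -
  have "((\<lambda>s::real. s ^ m / exp s) \<longlongrightarrow> 0) at_top" by (rule tendsto_power_div_exp_0)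
  hence "((\<lambda>t::real. inverse t ^ m / exp (inverse t)) \<longlongrightarrow> 0) (at_right 0)"
    by (rule filterlim_compose[OF _ filterlim_inverse_at_top_right])
  moreover have "eventually (\<lambda>t::real. inverse t ^ m / exp (inverse t) = bump_exp m t) (at_right 0)"
    unfolding eventually_at_right_field
    by (rule exI[of _ 1]) (auto simp: bump_exp_def exp_minus divide_inverse)
  ultimately show ?thesis by (rule Lim_transform_eventually)
qed

lemma bump_exp_has_derivative:
  "(bump_exp m has_real_derivative (bump_exp (m+2) t - real m * bump_exp (m+1) t)) (at t)"
proof (cases t "0::real" rule: linorder_cases)
  case less
  have "((\<lambda>_. 0) has_real_derivative 0) (at t)" by simp
  hence "(bump_exp m has_real_derivative 0) (at t)"
    by (rule has_field_derivative_transform_within_open[where S="{..<0}"])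
       (use less in \<open>auto simp: bump_exp_def\<close>)
  thus ?thesis using less by (simp add: bump_exp_def)
next
  case equal
  have "((\<lambda>h. (bump_exp m (0 + h) - bump_exp m 0) / h) \<longlongrightarrow> 0) (at 0)"
  proof (rule filterlim_split_at)
    have "((\<lambda>_. 0::real) \<longlongrightarrow> 0) (at_left 0)" by simp
    thus "((\<lambda>h. (bump_exp m (0 + h) - bump_exp m 0) / h) \<longlongrightarrow> 0) (at_left 0)"
      by (rule Lim_transform_eventually)
         (auto simp: eventually_at_left_field bump_exp_def intro!: exI[of _ "-1"])
    show "((\<lambda>h. (bump_exp m (0 + h) - bump_exp m 0) / h) \<longlongrightarrow> 0) (at_right 0)"
      by (rule Lim_transform_eventually[OF bump_exp_tendsto_0[of "Suc m"]])
         (auto simp: eventually_at_right_field bump_exp_def divide_inverse intro!: exI[of _ 1])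
  qed
  thus ?thesis using equal by (simp add: DERIV_def bump_exp_def)
next
  case greater
  have "((\<lambda>t. inverse t ^ m * exp (- inverse t)) has_real_derivative
         (bump_exp (m+2) t - real m * bump_exp (m+1) t)) (at t)"
    using greater
    by (auto intro!: derivative_eq_intros simp: bump_exp_def) (cases m; simp add: algebra_simps power2_eq_square)
  thus ?thesis
    by (rule has_field_derivative_transform_within_open[where S="{0<..}"])
       (use greater in \<open>auto simp: bump_exp_def\<close>)
qed

lemma Ck_bump_exp:
  fixes f :: "'a::euclidean_space \<Rightarrow> real"
  assumes "open S" "Ck n S f"
  shows "Ck n S (\<lambda>x. bump_exp m (f x))"
  using assms(2)
proof (induction n arbitrary: m)
  case 0
  have "continuous_on UNIV (bump_exp m)"
    using bump_exp_has_derivative DERIV_isCont by (blast intro: continuous_at_imp_continuous_on)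
  thus ?case using 0 continuous_on_compose2[of UNIV "bump_exp m"] by auto
next
  case (Suc n)
  show ?case
  proof (rule Ck_SucI[OF assms(1), where
        D="\<lambda>v x. (bump_exp (m+2) (f x) - real m * bump_exp (m+1) (f x)) * dir_deriv v f x"])
    show "Ck n S (\<lambda>x. (bump_exp (m+2) (f x) - real m * bump_exp (m+1) (f x)) * dir_deriv v f x)" for v
      using Suc.IH[OF Ck_Suc_imp[OF Suc.prems]] Suc.prems
      by (intro Ck_mult Ck_diff assms(1) Ck_const) auto
    show "((\<lambda>x. bump_exp m (f x)) has_derivative
        (\<lambda>v. (bump_exp (m+2) (f x) - real m * bump_exp (m+1) (f x)) * dir_deriv v f x)) (at x)"
      if "x \<in> S" for x
      using has_derivative_compose[OF Ck_SucD(1)[OF Suc.prems that]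
          bump_exp_has_derivative[of m "f x", unfolded has_field_derivative_def]] .
  qed
qed

lemma Ck_norm_sq: "Ck n UNIV (\<lambda>x::'a::euclidean_space. (norm (x - a))\<^sup>2)"
proof -
  have "(\<lambda>x::'a. (norm (x - a))\<^sup>2) = (\<lambda>x. \<Sum>b\<in>Basis. ((x - a) \<bullet> b) * ((x - a) \<bullet> b))"
    by (simp add: power2_norm_eq_inner fun_eq_iff) (use euclidean_inner in blast)
  moreover have "Ck n UNIV (\<lambda>x. (x - a) \<bullet> b)" for b :: 'a
    using Ck_diff[OF _ Ck_id_linear[OF bounded_linear_inner_left[of b]] Ck_const[of n UNIV "a \<bullet> b"]]
    by (simp add: inner_diff_left)
  ultimately show ?thesis by (auto intro!: Ck_sum Ck_mult)
qed

text \<open>The two bumps in the denominator vanish for \<open>|x - a| \<ge> 2 r\<close> and for \<open>|x - a| \<le> r\<close>, respectively, hence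
never together.  The result is \<open>1\<close> on the ball of radius \<open>r\<close> and \<open>0\<close> off the ball of radius \<open>2 r\<close>.\<close>

definition cutoff :: "'a::euclidean_space \<Rightarrow> real \<Rightarrow> 'a \<Rightarrow> real" where
  "cutoff a r x = bump_exp 0 (4 * r\<^sup>2 - (norm (x - a))\<^sup>2) *
     inverse (bump_exp 0 (4 * r\<^sup>2 - (norm (x - a))\<^sup>2) + bump_exp 0 ((norm (x - a))\<^sup>2 - r\<^sup>2))"

lemma bump_exp_0_pos [simp]: "t > 0 \<Longrightarrow> bump_exp 0 t > 0" "bump_exp m t \<ge> 0" "t \<le> 0 \<Longrightarrow> bump_exp m t = 0"
  by (auto simp: bump_exp_def)

lemma cutoff_props:
  assumes "r > 0"
  shows Ck_cutoff: "Ck n UNIV (cutoff a r)"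
    and cutoff_eq_1: "norm (x - a) \<le> r \<Longrightarrow> cutoff a r x = 1"
    and cutoff_eq_0: "norm (x - a) \<ge> 2 * r \<Longrightarrow> cutoff a r x = 0"
    and cutoff_nonneg: "cutoff a r x \<ge> 0" and cutoff_le_1: "cutoff a r x \<le> 1"
proof -
  have pos: "bump_exp 0 (4 * r\<^sup>2 - (norm (x - a))\<^sup>2) + bump_exp 0 ((norm (x - a))\<^sup>2 - r\<^sup>2) > 0" for x
  proof (cases "norm (x - a) > r")
    case True
    hence "(norm (x - a))\<^sup>2 - r\<^sup>2 > 0" using assms by (simp add: power_strict_mono)
    thus ?thesis by (intro add_nonneg_pos) auto
  next
    case False
    hence "(norm (x - a))\<^sup>2 \<le> r\<^sup>2" by (simp add: power_mono)
    moreover have "r\<^sup>2 > 0" using assms by simp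
    ultimately have "4 * r\<^sup>2 - (norm (x - a))\<^sup>2 > 0" by linarith
    thus ?thesis by (intro add_pos_nonneg) auto
  qed
  show "Ck n UNIV (cutoff a r)"
    unfolding cutoff_def[abs_def]
    by (intro Ck_mult Ck_inverse Ck_add Ck_bump_exp Ck_diff Ck_const Ck_norm_sq) (use pos in \<open>auto simp: less_imp_neq[symmetric]\<close>)
  show "cutoff a r x = 1" if "norm (x - a) \<le> r"
  proof -
    have "(norm (x - a))\<^sup>2 - r\<^sup>2 \<le> 0" using that by (simp add: power_mono)
    thus ?thesis using pos[of x] by (simp add: cutoff_def)
  qed
  show "cutoff a r x = 0" if "norm (x - a) \<ge> 2 * r"
  proof -
    have "(2 * r)\<^sup>2 \<le> (norm (x - a))\<^sup>2" using that assms by (intro power_mono) auto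
    thus ?thesis by (simp add: cutoff_def power_mult_distrib)
  qed
  show "cutoff a r x \<ge> 0" "cutoff a r x \<le> 1"
    using pos[of x] by (auto simp: cutoff_def divide_inverse[symmetric])
qed

section \<open>Test functions\<close>

lemma test_functionI:
  assumes "\<And>n. Ck n UNIV \<phi>" "\<And>x. x \<notin> K \<Longrightarrow> \<phi> x = 0" "compact K"
  shows "test_function \<phi>"
proof -
  have "closure {x. \<phi> x \<noteq> 0} \<subseteq> K"
    using assms(2,3) by (intro closure_minimal) (auto intro: compact_imp_closed)
  thus ?thesis unfolding test_function_def C_diff_eq_Ck
    using assms compact_Int_closed[OF assms(3), of "closure {x. \<phi> x \<noteq> 0}"] by (auto simp: Int_absorb1)
qed

lemma test_function_Ck: "test_function \<phi> \<Longrightarrow> Ck n UNIV \<phi>"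
  by (simp add: test_function_def C_diff_eq_Ck)

lemma test_function_support:
  assumes "test_function \<phi>"
  obtains r where "r > 0" "\<And>x. norm x \<ge> r \<Longrightarrow> \<phi> x = 0"
proof -
  have "bounded (closure {x. \<phi> x \<noteq> 0})"
    using assms by (simp add: test_function_def compact_imp_bounded)
  then obtain r where r: "\<And>x. x \<in> closure {x. \<phi> x \<noteq> 0} \<Longrightarrow> norm x \<le> r"
    unfolding bounded_iff by blast
  have "\<phi> x = 0" if "norm x \<ge> max 1 (r + 1)" for x
    using that r[of x] closure_subset[of "{x. \<phi> x \<noteq> 0}"] by (cases "\<phi> x = 0") auto
  thus ?thesis using that[of "max 1 (r+1)"] by auto
qed

lemma dir_deriv_zero_open:
  assumes "open S" "x \<in> S" "\<And>y. y \<in> S \<Longrightarrow> f y = 0"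
  shows "dir_deriv v f x = 0"
  using dir_deriv_cong[OF assms(1,2), of f "\<lambda>_. 0"] assms(3) dir_deriv_eqI[of "\<lambda>_. 0" "\<lambda>_. 0" x v] by simp

lemma test_function_dir_deriv:
  assumes "test_function \<phi>"
  shows "test_function (dir_deriv v \<phi>)"
proof -
  let ?K = "closure {x. \<phi> x \<noteq> 0}"
  show ?thesis
  proof (rule test_functionI[of _ ?K])
    show "Ck n UNIV (dir_deriv v \<phi>)" for n using test_function_Ck[OF assms, of "Suc n"] by simp
    show "dir_deriv v \<phi> x = 0" if "x \<notin> ?K" for x
      by (rule dir_deriv_zero_open[of "- ?K"]) (use that closure_subset[of "{x. \<phi> x \<noteq> 0}"] in auto)
  qed (use assms in \<open>simp add: test_function_def\<close>)
qed

lemma test_function_add: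
  assumes "test_function \<phi>" "test_function \<psi>"
  shows "test_function (\<lambda>x. \<phi> x + \<psi> x)"
proof -
  obtain r where "\<And>x. norm x \<ge> r \<Longrightarrow> \<phi> x = 0" using test_function_support[OF assms(1)] by auto
  moreover obtain s where "\<And>x. norm x \<ge> s \<Longrightarrow> \<psi> x = 0" using test_function_support[OF assms(2)] by auto
  moreover have "Ck n UNIV (\<lambda>x. \<phi> x + \<psi> x)" for n
    by (rule Ck_add) (simp_all add: test_function_Ck assms)
  ultimately show ?thesis
    by (intro test_functionI[of _ "cball 0 (max r s)"]) auto
qed

lemma test_function_zero: "test_function (\<lambda>x. 0)"
  by (rule test_functionI[of _ "{}"]) auto

lemma test_function_sum:
  assumes "\<And>i. i \<in> I \<Longrightarrow> test_function (\<phi> i)"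
  shows "test_function (\<lambda>x. \<Sum>i\<in>I. \<phi> i x)"
  using assms by (induction I rule: infinite_finite_induct) (auto intro: test_function_add test_function_zero)

lemma test_function_laplacian: "test_function \<phi> \<Longrightarrow> test_function (laplacian \<phi>)"
  unfolding laplacian_def[abs_def] by (intro test_function_sum test_function_dir_deriv)

lemma test_function_translate:
  assumes "test_function \<phi>"
  shows "test_function (\<lambda>y. \<phi> (y - a))"
proof -
  obtain r where r: "r > 0" "\<And>x. norm x \<ge> r \<Longrightarrow> \<phi> x = 0" using test_function_support[OF assms] by blast
  show ?thesis
    by (rule test_functionI[of _ "cball a r"])
       (simp_all add: Ck_translate test_function_Ck assms r dist_norm norm_minus_commute)
qed

section \<open>Integration against test functions\<close>

text \<open>Borel rather than Lebesgue measurability: a measurable field is replaced once by a Borel version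
(\<open>ex_borel_version\<close>), after which translations, rotations and Fubini's theorem apply over \<open>lborel\<close>.\<close>

definition locally_integrable :: "('a::euclidean_space \<Rightarrow> complex) \<Rightarrow> bool" where
  "locally_integrable w \<longleftrightarrow> w \<in> borel_measurable borel \<and> (\<forall>r. set_integrable lborel (cball 0 r) w)"

lemma locally_integrable_norm:
  "locally_integrable w \<Longrightarrow> integrable lborel (\<lambda>x. norm (indicator (cball 0 r) x *\<^sub>R w x))"
  unfolding locally_integrable_def set_integrable_def by (intro integrable_norm) blast

lemma integrable_mult_bounded_support:
  fixes w \<psi> :: "'a::euclidean_space \<Rightarrow> complex"
  assumes w: "locally_integrable w" and m: "\<psi> \<in> borel_measurable borel"
    and b: "\<And>x. norm (\<psi> x) \<le> B" and s: "\<And>x. norm x > r \<Longrightarrow> \<psi> x = 0"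
  shows "integrable lborel (\<lambda>x. w x * \<psi> x)"
proof -
  have wi: "integrable lborel (\<lambda>x. B * norm (indicator (cball 0 r) x *\<^sub>R w x))"
    by (rule integrable_mult_right) (rule locally_integrable_norm[OF w])
  have [measurable]: "w \<in> borel_measurable borel" using w by (simp add: locally_integrable_def)
  show ?thesis
  proof (rule Bochner_Integration.integrable_bound[OF wi])
    show "AE x in lborel. norm (w x * \<psi> x) \<le> norm (B * norm (indicator (cball 0 r) x *\<^sub>R w x))"
    proof (rule AE_I2)
      fix x
      have "0 \<le> B" using b[of x] norm_ge_zero order_trans by blast
      show "norm (w x * \<psi> x) \<le> norm (B * norm (indicator (cball 0 r) x *\<^sub>R w x))"
      proof (cases "norm x \<le> r")
        case True
        thus ?thesis using b[of x] \<open>0 \<le> B\<close>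
          by (simp add: norm_mult mult.commute mult_right_mono)
      qed (use s in auto)
    qed
  qed (use m in measurable)
qed

lemma bounded_of_continuous_support:
  fixes \<psi> :: "'a::euclidean_space \<Rightarrow> complex"
  assumes c: "continuous_on UNIV \<psi>" and s: "\<And>x. norm x > r \<Longrightarrow> \<psi> x = 0"
  obtains B where "B > 0" "\<And>x. norm (\<psi> x) \<le> B"
proof -
  have "compact (\<psi> ` cball 0 r)" using c by (intro compact_continuous_image) (auto intro: continuous_on_subset)
  then obtain B where B: "B > 0" "\<forall>y\<in>\<psi> ` cball 0 r. norm y \<le> B"
    using compact_imp_bounded bounded_pos by blast
  have "norm (\<psi> x) \<le> B" for x
    using B s[of x] by (cases "norm x \<le> r") auto
  thus ?thesis using that B by blast
qed

lemma integrable_mult_continuous_support: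
  fixes w \<psi> :: "'a::euclidean_space \<Rightarrow> complex"
  assumes w: "locally_integrable w" and c: "continuous_on UNIV \<psi>" and s: "\<And>x. norm x > r \<Longrightarrow> \<psi> x = 0"
  shows "integrable lborel (\<lambda>x. w x * \<psi> x)"
proof -
  obtain B where "\<And>x. norm (\<psi> x) \<le> B" using bounded_of_continuous_support[OF c s] by blast
  thus ?thesis using integrable_mult_bounded_support[OF w borel_measurable_continuous_onI[OF c]] s by blast
qed

lemma test_function_continuous: "test_function \<phi> \<Longrightarrow> continuous_on UNIV \<phi>"
  using test_function_Ck[of \<phi> 0] by simp

lemma integrable_mult_test:
  fixes w \<phi> :: "'a::euclidean_space \<Rightarrow> complex"
  assumes "locally_integrable w" "test_function \<phi>"
  shows "integrable lborel (\<lambda>x. w x * \<phi> x)"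
proof -
  obtain r where "\<And>x. norm x \<ge> r \<Longrightarrow> \<phi> x = 0" using test_function_support[OF assms(2)] by auto
  thus ?thesis
    using integrable_mult_continuous_support[OF assms(1) test_function_continuous[OF assms(2)], of r]
    by simp
qed

lemma locally_integrable_continuous:
  "continuous_on UNIV w \<Longrightarrow> locally_integrable w"
  unfolding locally_integrable_def set_integrable_def
  by (auto intro!: borel_integrable_compact borel_measurable_continuous_onI intro: continuous_on_subset)

lemma lborel_integral_translate:
  fixes f :: "'a::euclidean_space \<Rightarrow> 'b::{banach, second_countable_topology}"
  assumes [measurable]: "f \<in> borel_measurable borel"
  shows "(\<integral>x. f (x + c) \<partial>lborel) = (\<integral>x. f x \<partial>lborel)"
proof -
  have "(\<integral>x. f x \<partial>lborel) = (\<integral>x. f x \<partial>distr lborel borel ((+) c))" by (simp add: lborel_distr_plus)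
  also have "\<dots> = (\<integral>x. f (c + x) \<partial>lborel)" by (subst integral_distr) auto
  finally show ?thesis by (simp add: add.commute)
qed

lemma onorm_le_sum_Basis:
  fixes D :: "'a::euclidean_space \<Rightarrow> 'b::real_normed_vector"
  assumes "linear D"
  shows "onorm D \<le> (\<Sum>b\<in>Basis. norm (D b))"
proof (rule onorm_le)
  fix v :: 'a
  have "D v = (\<Sum>b\<in>Basis. (v \<bullet> b) *\<^sub>R D b)"
    by (metis (no_types, lifting) euclidean_representation linear_sum linear_scale assms sum.cong)
  hence "norm (D v) \<le> (\<Sum>b\<in>Basis. \<bar>v \<bullet> b\<bar> * norm (D b))"
    by (metis (no_types, lifting) norm_sum norm_scaleR order.trans order_refl sum.cong)
  also have "\<dots> \<le> (\<Sum>b\<in>Basis. norm v * norm (D b))"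
    by (intro sum_mono mult_right_mono) (auto simp: Basis_le_norm)
  finally show "norm (D v) \<le> (\<Sum>b\<in>Basis. norm (D b)) * norm v"
    by (simp add: sum_distrib_left mult.commute)
qed

lemma lipschitz_of_compact_support:
  fixes \<psi> :: "'a::euclidean_space \<Rightarrow> complex"
  assumes C: "Ck 1 UNIV \<psi>" and s: "\<And>x. norm x > r \<Longrightarrow> \<psi> x = 0"
  obtains L where "L > 0" "\<And>x y. norm (\<psi> x - \<psi> y) \<le> L * norm (x - y)"
proof -
  have C1: "\<And>x. (\<psi> has_derivative (\<lambda>v. dir_deriv v \<psi> x)) (at x)"
    and C0: "continuous_on UNIV (dir_deriv v \<psi>)" for v
    using C by (auto intro: dir_deriv_works)
  have ds: "dir_deriv v \<psi> x = 0" if "norm x > r" for v x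
    by (rule dir_deriv_zero_open[of "- cball 0 r"]) (use that s in auto)
  have "\<exists>B>0. \<forall>x. norm (dir_deriv b \<psi> x) \<le> B" for b
    using bounded_of_continuous_support[OF C0 ds, of r b] by metis
  then obtain B where B: "\<And>b. B b > 0" "\<And>b x. norm (dir_deriv b \<psi> x) \<le> B b" by metis
  let ?L = "\<Sum>b\<in>Basis. B b"
  have on: "onorm (\<lambda>v. dir_deriv v \<psi> x) \<le> ?L" for x
    using onorm_le_sum_Basis[OF has_derivative_linear[OF C1[of x]]] sum_mono[of Basis "\<lambda>b. norm (dir_deriv b \<psi> x)" B] B(2)
    by fastforce
  have "norm (\<psi> x - \<psi> y) \<le> ?L * norm (x - y)" for x y
    by (rule differentiable_bound[where S=UNIV and f'="\<lambda>x v. dir_deriv v \<psi> x"]) (use C1 on in auto)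
  moreover have "?L > 0" by (intro sum_pos) (use B in auto)
  ultimately show ?thesis using that by blast
qed

text \<open>By translation invariance every difference quotient of \<open>\<psi>\<close> has integral zero, and a Lipschitz bound
dominates the quotients in the limit.\<close>

lemma integral_dir_deriv_eq_0:
  fixes \<psi> :: "'a::euclidean_space \<Rightarrow> complex"
  assumes C: "Ck 1 UNIV \<psi>" and s: "\<And>x. norm x > r \<Longrightarrow> \<psi> x = 0"
  shows "(\<integral>x. dir_deriv v \<psi> x \<partial>lborel) = 0"
proof -
  have C1: "\<And>x. (\<psi> has_derivative (\<lambda>v. dir_deriv v \<psi> x)) (at x)" using C by (auto intro: dir_deriv_works)
  have cont: "continuous_on UNIV \<psi>" using Ck_imp_continuous_on[OF C] .
  have [measurable]: "\<psi> \<in> borel_measurable borel" "dir_deriv v \<psi> \<in> borel_measurable borel"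
    using borel_measurable_continuous_onI[OF cont] C by (auto intro: borel_measurable_continuous_onI)
  obtain L where L: "L > 0" "\<And>x y. norm (\<psi> x - \<psi> y) \<le> L * norm (x - y)"
    using lipschitz_of_compact_support[OF C s] by blast
  have int: "integrable lborel \<psi>"
    using integrable_mult_continuous_support[OF locally_integrable_continuous cont s, of "\<lambda>_. 1"] by simp
  define q where "q n x = (of_nat (Suc n)) * (\<psi> (x + (1 / real (Suc n)) *\<^sub>R v) - \<psi> x)" for n x
  have "(\<lambda>n. \<integral>x. q n x \<partial>lborel) \<longlonglongrightarrow> (\<integral>x. dir_deriv v \<psi> x \<partial>lborel)"
  proof (rule integral_dominated_convergence[where w="\<lambda>x. indicator (cball 0 (r + norm v)) x *\<^sub>R (L * norm v)"])
    show "integrable lborel (\<lambda>x::'a. indicator (cball 0 (r + norm v)) x *\<^sub>R (L * norm v))"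
      by (rule borel_integrable_compact) auto
    show "AE x in lborel. (\<lambda>n. q n x) \<longlonglongrightarrow> dir_deriv v \<psi> x"
    proof (rule AE_I2)
      fix x
      have "((\<lambda>t. \<psi> (x + t *\<^sub>R v)) has_vector_derivative dir_deriv v \<psi> x) (at 0)"
      proof -
        have "((\<lambda>t. x + t *\<^sub>R v) has_derivative (\<lambda>t. t *\<^sub>R v)) (at 0)"
          by (auto intro!: derivative_eq_intros)
        moreover have "(\<psi> has_derivative (\<lambda>v. dir_deriv v \<psi> x)) (at (x + 0 *\<^sub>R v))" using C1 by simp
        ultimately have "((\<lambda>t. \<psi> (x + t *\<^sub>R v)) has_derivative (\<lambda>t. dir_deriv (t *\<^sub>R v) \<psi> x)) (at 0)"
          by (rule has_derivative_compose)
        thus ?thesis unfolding has_vector_derivative_def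
          using linear_scale[OF has_derivative_linear[OF C1[of x]]] by simp
      qed
      hence "((\<lambda>t. (\<psi> (x + t *\<^sub>R v) - \<psi> x) /\<^sub>R t) \<longlongrightarrow> dir_deriv v \<psi> x) (at 0)"
      proof -
        have "((\<lambda>t. norm (\<psi> (x + t *\<^sub>R v) - \<psi> x - t *\<^sub>R dir_deriv v \<psi> x) / norm t) \<longlongrightarrow> 0) (at 0)"
          if "((\<lambda>t. \<psi> (x + t *\<^sub>R v)) has_vector_derivative dir_deriv v \<psi> x) (at 0)"
          using that by (simp add: has_vector_derivative_def has_derivative_at)
        moreover have "norm (\<psi> (x + t *\<^sub>R v) - \<psi> x - t *\<^sub>R d) / norm t = norm ((\<psi> (x + t *\<^sub>R v) - \<psi> x) /\<^sub>R t - d)"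
          if "t \<noteq> 0" for t d
        proof -
          have "(\<psi> (x + t *\<^sub>R v) - \<psi> x) /\<^sub>R t - d = (\<psi> (x + t *\<^sub>R v) - \<psi> x - t *\<^sub>R d) /\<^sub>R t"
            using that by (simp add: scaleR_diff_right)
          thus ?thesis by (simp add: divide_inverse)
        qed
        ultimately have "((\<lambda>t. norm ((\<psi> (x + t *\<^sub>R v) - \<psi> x) /\<^sub>R t - dir_deriv v \<psi> x)) \<longlongrightarrow> 0) (at 0)"
          if "((\<lambda>t. \<psi> (x + t *\<^sub>R v)) has_vector_derivative dir_deriv v \<psi> x) (at 0)"
          using that by (simp cong: LIM_cong)
        thus "((\<lambda>t. \<psi> (x + t *\<^sub>R v)) has_vector_derivative dir_deriv v \<psi> x) (at 0) \<Longrightarrow> ?thesis"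
          by (simp add: tendsto_norm_zero_iff LIM_zero_iff)
      qed
      moreover have "filterlim (\<lambda>n. 1 / real (Suc n)) (at 0) sequentially"
        unfolding filterlim_at using lim_inverse_n' LIMSEQ_Suc[OF lim_1_over_n] by (auto simp: filterlim_at)
      ultimately have "(\<lambda>n. (\<psi> (x + (1 / real (Suc n)) *\<^sub>R v) - \<psi> x) /\<^sub>R (1 / real (Suc n))) \<longlonglongrightarrow> dir_deriv v \<psi> x"
        by (rule filterlim_compose)
      thus "(\<lambda>n. q n x) \<longlonglongrightarrow> dir_deriv v \<psi> x"
        by (simp add: q_def scaleR_conv_of_real)
    qed
    show "AE x in lborel. norm (q n x) \<le> indicator (cball 0 (r + norm v)) x *\<^sub>R (L * norm v)" for n
    proof (rule AE_I2)
      fix x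
      show "norm (q n x) \<le> indicator (cball 0 (r + norm v)) x *\<^sub>R (L * norm v)"
      proof (cases "norm x \<le> r + norm v")
        case True
        have "norm (q n x) = real (Suc n) * norm (\<psi> (x + (1 / real (Suc n)) *\<^sub>R v) - \<psi> x)"
          unfolding q_def norm_mult norm_of_nat ..
        also have "\<dots> \<le> real (Suc n) * (L * norm ((1 / real (Suc n)) *\<^sub>R v))"
          using L(2)[of "x + (1 / real (Suc n)) *\<^sub>R v" x] by (intro mult_left_mono) auto
        also have "\<dots> = L * norm v" by (simp del: of_nat_Suc)
        finally show ?thesis using True by simp
      next
        case False
        have "norm ((1 / real (Suc n)) *\<^sub>R v) \<le> norm v"
          by (simp add: divide_simps mult_le_cancel_right2 del: of_nat_Suc) (simp add: algebra_simps)
        hence "norm (x + (1 / real (Suc n)) *\<^sub>R v) > r"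
          using False norm_triangle_ineq4[of "x + (1 / real (Suc n)) *\<^sub>R v" "(1 / real (Suc n)) *\<^sub>R v"] by simp
        moreover have "norm x > r" using False norm_ge_zero[of v] by linarith
        ultimately have "q n x = 0" using s unfolding q_def by simp
        thus ?thesis using L(1) by simp
      qed
    qed
  qed (auto simp: q_def)
  moreover have "(\<integral>x. q n x \<partial>lborel) = 0" for n
  proof -
    have "integrable lborel (\<lambda>x. \<psi> (x + (1 / real (Suc n)) *\<^sub>R v))"
    proof (rule integrable_mult_continuous_support[OF locally_integrable_continuous, of "\<lambda>_. 1", simplified])
      show "continuous_on UNIV (\<lambda>x. \<psi> (x + (1 / real (Suc n)) *\<^sub>R v))"
        by (intro continuous_on_compose2[OF cont] continuous_intros) auto
      show "\<psi> (x + (1 / real (Suc n)) *\<^sub>R v) = 0" if "norm x > r + norm ((1 / real (Suc n)) *\<^sub>R v)" for x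
        using that norm_triangle_ineq4[of "x + (1 / real (Suc n)) *\<^sub>R v" "(1 / real (Suc n)) *\<^sub>R v"]
        by (intro s) simp
    qed
    thus ?thesis unfolding q_def
      using int lborel_integral_translate[of \<psi> "(1 / real (Suc n)) *\<^sub>R v"] by simp
  qed
  ultimately show ?thesis using LIMSEQ_unique by (simp add: LIMSEQ_const_iff)
qed

text \<open>The difference of the integrands is the divergence of the compactly supported field with components
\<open>u \<partial>\<^sub>b\<phi> - \<phi> \<partial>\<^sub>bu\<close>, called \<open>D b\<close> in the proof.\<close>

lemma integral_laplacian_symmetric:
  fixes u \<phi> :: "'a::euclidean_space \<Rightarrow> complex"
  assumes u: "Ck 2 UNIV u" and \<phi>: "test_function \<phi>"
  shows "(\<integral>x. u x * laplacian \<phi> x \<partial>lborel) = (\<integral>x. laplacian u x * \<phi> x \<partial>lborel)"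
proof -
  obtain r where r: "\<And>x. norm x \<ge> r \<Longrightarrow> \<phi> x = 0" using test_function_support[OF \<phi>] by auto
  have \<phi>2: "Ck 2 UNIV \<phi>" using test_function_Ck[OF \<phi>] .
  have d: "u differentiable at x" "dir_deriv b u differentiable at x"
          "\<phi> differentiable at x" "dir_deriv b \<phi> differentiable at x" for x b
    using u \<phi>2 by (auto simp: numeral_2_eq_2)
  have c1: "Ck 1 UNIV u" "Ck 1 UNIV (dir_deriv b u)" "Ck 1 UNIV \<phi>" "Ck 1 UNIV (dir_deriv b \<phi>)" for b
    using u \<phi>2 Ck_le[OF u, of 1] Ck_le[OF \<phi>2, of 1] by (auto simp: numeral_2_eq_2)
  define D where "D b x = u x * dir_deriv b \<phi> x - dir_deriv b u x * \<phi> x" for b x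
  have Ds: "D b x = 0" if "norm x > r" for b x
    using r[of x] that dir_deriv_zero_open[of "- cball 0 r" x \<phi> b] r by (auto simp: D_def)
  have D1: "Ck 1 UNIV (D b)" for b
    unfolding D_def[abs_def] using c1 by (intro Ck_diff Ck_mult) auto
  have eq: "dir_deriv b (D b) x = u x * dir_deriv b (dir_deriv b \<phi>) x - dir_deriv b (dir_deriv b u) x * \<phi> x" for b x
  proof -
    have "(D b has_derivative (\<lambda>v. (u x * dir_deriv v (dir_deriv b \<phi>) x + dir_deriv v u x * dir_deriv b \<phi> x)
        - (dir_deriv b u x * dir_deriv v \<phi> x + dir_deriv v (dir_deriv b u) x * \<phi> x))) (at x)"
      unfolding D_def[abs_def] by (intro has_derivative_diff has_derivative_mult dir_deriv_works d)
    from dir_deriv_eqI[OF this] show ?thesis by simp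
  qed
  have "u x * laplacian \<phi> x - laplacian u x * \<phi> x = (\<Sum>b\<in>Basis. dir_deriv b (D b) x)" for x
    by (simp add: laplacian_def eq sum_subtractf sum_distrib_left sum_distrib_right)
  moreover have "integrable lborel (dir_deriv b (D b))" for b
  proof -
    have "dir_deriv b (D b) x = 0" if "norm x > r" for x
      by (rule dir_deriv_zero_open[of "- cball 0 r"]) (use that Ds in auto)
    thus ?thesis
      using integrable_mult_continuous_support[OF locally_integrable_continuous, of "\<lambda>_. 1" "dir_deriv b (D b)" r]
        D1[of b] by auto
  qed
  ultimately have "(\<integral>x. u x * laplacian \<phi> x - laplacian u x * \<phi> x \<partial>lborel) = 0"
    using integral_dir_deriv_eq_0[OF D1 Ds] by (simp add: Bochner_Integration.integral_sum)
  moreover have "integrable lborel (\<lambda>x. u x * laplacian \<phi> x)"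
    by (intro integrable_mult_test locally_integrable_continuous test_function_laplacian \<phi> Ck_imp_continuous_on[OF u])
  moreover have "integrable lborel (\<lambda>x. laplacian u x * \<phi> x)"
    using Ck_laplacian[of UNIV 0 u] u
    by (intro integrable_mult_test locally_integrable_continuous \<phi>) (auto simp: numeral_2_eq_2)
  ultimately show ?thesis by simp
qed

section \<open>The fundamental lemma of the calculus of variations\<close>

definition vanishes_weakly :: "'a::euclidean_space set \<Rightarrow> ('a \<Rightarrow> complex) \<Rightarrow> bool" where
  "vanishes_weakly U w \<longleftrightarrow>
     (\<forall>\<phi> K. test_function \<phi> \<and> compact K \<and> K \<subseteq> U \<and> (\<forall>x. x \<notin> K \<longrightarrow> \<phi> x = 0) \<longrightarrow> (\<integral>x. w x * \<phi> x \<partial>lborel) = 0)"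

text \<open>Products of one-dimensional bumps, sharpened by the factor \<open>n + 1\<close>, are test functions supported in the
closed box and converge boundedly to the indicator of the open box.\<close>

lemma vanishes_weakly_integral_box:
  fixes w :: "'a::euclidean_space \<Rightarrow> complex"
  assumes w: "locally_integrable w" and v: "vanishes_weakly U w" and lu: "cbox l u \<subseteq> U"
  shows "(\<integral>x. indicator (box l u) x *\<^sub>R w x \<partial>lborel) = 0"
proof -
  define \<psi> where "\<psi> n x = (\<Prod>b\<in>Basis. bump_exp 0 (real (Suc n) * ((x - l) \<bullet> b)) * bump_exp 0 (real (Suc n) * ((u - x) \<bullet> b)))" for n and x :: 'a
  have lin: "Ck k UNIV (\<lambda>x. real (Suc n) * ((x - l) \<bullet> b))" "Ck k UNIV (\<lambda>x. real (Suc n) * ((u - x) \<bullet> b))" for k n and b :: 'a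
    unfolding inner_diff_left
    by (intro Ck_mult Ck_diff Ck_const Ck_id_linear bounded_linear_inner_left open_UNIV)+
  have sm: "Ck k UNIV (\<psi> n)" for k n
    unfolding \<psi>_def[abs_def] by (intro Ck_prod Ck_mult Ck_bump_exp lin open_UNIV)
  have z: "\<psi> n x = 0" if "x \<notin> box l u" for n x
  proof -
    have "\<exists>b\<in>Basis. \<not> (l \<bullet> b < x \<bullet> b \<and> x \<bullet> b < u \<bullet> b)" using that unfolding mem_box by blast
    then obtain b :: 'a where b: "b \<in> Basis" "(x - l) \<bullet> b \<le> 0 \<or> (u - x) \<bullet> b \<le> 0"
      by (auto simp: inner_diff_left not_less)
    hence "real (Suc n) * ((x - l) \<bullet> b) \<le> 0 \<or> real (Suc n) * ((u - x) \<bullet> b) \<le> 0"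
      by (auto simp: mult_le_0_iff)
    hence "bump_exp 0 (real (Suc n) * ((x - l) \<bullet> b)) * bump_exp 0 (real (Suc n) * ((u - x) \<bullet> b)) = 0"
      by (auto simp del: of_nat_Suc)
    thus ?thesis unfolding \<psi>_def using b(1) by (intro prod_zero) auto
  qed
  have le1: "bump_exp 0 t \<le> 1" for t by (simp add: bump_exp_def)
  have b01: "0 \<le> \<psi> n x" "\<psi> n x \<le> 1" for n x
    unfolding \<psi>_def by (intro prod_nonneg prod_le_1 ballI conjI mult_nonneg_nonneg mult_le_one le1 bump_exp_0_pos; simp)+
  have lim: "(\<lambda>n. \<psi> n x) \<longlonglongrightarrow> indicator (box l u) x" for x
  proof (cases "x \<in> box l u")
    case True
    have one: "(\<lambda>n. bump_exp 0 (real (Suc n) * t)) \<longlonglongrightarrow> 1" if "t > 0" for t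
    proof -
      have "(\<lambda>n. inverse (real (Suc n)) * inverse t) \<longlonglongrightarrow> 0 * inverse t"
        by (intro tendsto_mult LIMSEQ_inverse_real_of_nat tendsto_const)
      hence "(\<lambda>n. exp (- (inverse (real (Suc n)) * inverse t))) \<longlonglongrightarrow> exp (-0)"
        by (intro tendsto_intros) simp
      thus ?thesis using that by (simp add: bump_exp_def del: of_nat_Suc)
    qed
    have "(\<lambda>n. \<psi> n x) \<longlonglongrightarrow> (\<Prod>b\<in>(Basis::'a set). 1 * 1)"
      unfolding \<psi>_def using True
      by (intro tendsto_prod tendsto_mult one) (auto simp: mem_box inner_diff_left)
    thus ?thesis using True by simp
  qed (simp add: z)
  have int0: "(\<integral>x. w x * of_real (\<psi> n x) \<partial>lborel) = 0" for n
  proof -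
    have "test_function (\<lambda>x. complex_of_real (\<psi> n x))"
    proof (rule test_functionI[of _ "cbox l u"])
      show "complex_of_real (\<psi> n x) = 0" if "x \<notin> cbox l u" for x
        using z[of x n] that box_subset_cbox[of l u] by auto
    qed (auto intro!: Ck_of_real sm)
    thus ?thesis using v lu z box_subset_cbox[of l u] unfolding vanishes_weakly_def
      by (metis compact_cbox in_mono of_real_0)
  qed
  obtain R where R: "cbox l u \<subseteq> cball 0 R" using bounded_cbox[of l u] by (auto simp: bounded_iff subset_iff)
  have [measurable]: "w \<in> borel_measurable borel" using w by (simp add: locally_integrable_def)
  have [measurable]: "\<psi> n \<in> borel_measurable borel" for n
    using sm[of 0 n] by (intro borel_measurable_continuous_onI) simp
  have "(\<lambda>n. \<integral>x. w x * of_real (\<psi> n x) \<partial>lborel) \<longlonglongrightarrow> (\<integral>x. w x * of_real (indicator (box l u) x) \<partial>lborel)"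
  proof (rule integral_dominated_convergence[where w="\<lambda>x. norm (indicator (cball 0 R) x *\<^sub>R w x)"])
    show "integrable lborel (\<lambda>x. norm (indicator (cball 0 R) x *\<^sub>R w x))"
      by (rule locally_integrable_norm[OF w])
    show "AE x in lborel. (\<lambda>n. w x * complex_of_real (\<psi> n x)) \<longlonglongrightarrow> w x * of_real (indicator (box l u) x)"
      by (intro AE_I2 tendsto_intros lim)
    show "AE x in lborel. norm (w x * complex_of_real (\<psi> n x)) \<le> norm (indicator (cball 0 R) x *\<^sub>R w x)" for n
    proof (rule AE_I2)
      fix x
      show "norm (w x * complex_of_real (\<psi> n x)) \<le> norm (indicator (cball 0 R) x *\<^sub>R w x)"
        using z[of x n] b01[of n x] R box_subset_cbox[of l u]
        by (cases "x \<in> box l u") (auto simp: norm_mult mult_left_le)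
    qed
  qed measurable
  hence "(\<integral>x. w x * of_real (indicator (box l u) x) \<partial>lborel) = 0"
    using int0 by (simp add: LIMSEQ_const_iff)
  thus ?thesis by (simp add: scaleR_conv_of_real mult.commute)
qed

text \<open>Boxes form an intersection-stable generator of the Borel sets, so all integrals over Borel sets vanish.\<close>

lemma AE_zero_if_box_integrals_zero:
  fixes f :: "'a::euclidean_space \<Rightarrow> complex"
  assumes f: "integrable lborel f" and box0: "\<And>l u. (\<integral>x. indicator (box l u) x *\<^sub>R f x \<partial>lborel) = 0"
    and tot: "integral\<^sup>L lborel f = 0"
  shows "AE x in lborel. f x = 0"
proof (rule sigma_finite_measure.density_zero[OF sigma_finite_lborel f])
  fix A :: "'a set" assume "A \<in> sets lborel"
  have [measurable]: "f \<in> borel_measurable lborel" using f by auto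
  have si: "set_integrable lborel A f" if "A \<in> sets borel" for A
    unfolding set_integrable_def using f that by (intro integrable_mult_indicator) auto
  let ?E = "range (\<lambda>(a, b). box a b::'a set)"
  have "Int_stable ?E" by (auto simp: Int_stable_def box_Int_box)
  moreover have "?E \<subseteq> Pow UNIV" by simp
  moreover have "A \<in> sigma_sets UNIV ?E" using \<open>A \<in> sets lborel\<close> by (simp add: borel_eq_box)
  ultimately show "set_lebesgue_integral lborel A f = 0"
  proof (induction rule: sigma_sets_induct_disjoint)
    case (basic A)
    thus ?case using box0 by (auto simp: set_lebesgue_integral_def)
  next
    case empty
    show ?case by (simp add: set_lebesgue_integral_def)
  next
    case (compl A)
    have A: "A \<in> sets borel" using compl by (simp add: borel_eq_box)
    have "set_lebesgue_integral lborel (UNIV - A) f = integral\<^sup>L lborel f - set_lebesgue_integral lborel A f"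
      using set_integral_Un[of A "UNIV - A" lborel f] si[OF A] si[of "UNIV - A"] A
      by (auto simp: set_lebesgue_integral_def)
    thus ?case using compl tot by simp
  next
    case (union A)
    have A: "A i \<in> sets lborel" for i using union by (auto simp: borel_eq_box)
    have "(LINT x:(\<Union>i. A i)|lborel. f x) = (\<Sum>i. (LINT x:(A i)|lborel. f x))"
      by (rule lebesgue_integral_countable_add) (use A union(1) si[of "\<Union>i. A i"] in \<open>auto simp: disjoint_family_on_def\<close>)
    thus ?case using union by simp
  qed
qed

text \<open>The open set \<open>U\<close> is a countable union of closed boxes, so it suffices to consider one of them.  Sub-boxes
of it are again boxes inside \<open>U\<close>.\<close>

theorem fundamental_lemma_calculus_variations:
  fixes w :: "'a::euclidean_space \<Rightarrow> complex"
  assumes w: "locally_integrable w" and v: "vanishes_weakly U w" and U: "open U"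
  shows "AE x in lborel. x \<in> U \<longrightarrow> w x = 0"
proof -
  have [measurable]: "w \<in> borel_measurable borel" using w by (simp add: locally_integrable_def)
  have cb: "AE x in lborel. x \<in> cbox l u \<longrightarrow> w x = 0" if lu: "cbox l u \<subseteq> U" for l u :: 'a
  proof -
    let ?f = "\<lambda>x. indicator (box l u) x *\<^sub>R w x"
    obtain R where R: "cbox l u \<subseteq> cball 0 R" using bounded_cbox[of l u] by (auto simp: bounded_iff subset_iff)
    have "AE x in lborel. ?f x = 0"
    proof (rule AE_zero_if_box_integrals_zero)
      show "integrable lborel ?f"
        using set_integrable_subset[of lborel "cball 0 R" w "box l u"] w R box_subset_cbox[of l u]
        unfolding locally_integrable_def set_integrable_def by auto
      show "integral\<^sup>L lborel ?f = 0" by (rule vanishes_weakly_integral_box[OF w v lu])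
      show "(\<integral>x. indicator (box l' u') x *\<^sub>R ?f x \<partial>lborel) = 0" for l' u'
      proof -
        have "\<exists>c d. box l' u' \<inter> box l u = box c d \<and> cbox l' u' \<inter> cbox l u = cbox c d"
          unfolding box_Int_box Int_interval by blast
        then obtain c d where cd: "box l' u' \<inter> box l u = box c d" "cbox l' u' \<inter> cbox l u = cbox c d"
          by blast
        hence "cbox c d \<subseteq> U" using lu by auto
        from vanishes_weakly_integral_box[OF w v this]
        show ?thesis by (simp flip: cd(1) indicator_inter_arith)
      qed
    qed
    moreover have "AE x in lborel. x \<notin> cbox l u - box l u"
      using negligible_frontier_interval[of l u] AE_completion_iff[of "\<lambda>x. x \<notin> cbox l u - box l u" lborel]
        AE_not_in[of "cbox l u - box l u" lebesgue] negligible_iff_null_sets by blast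
    ultimately show ?thesis by eventually_elim (auto simp: indicator_def)
  qed
  obtain \<D> where \<D>: "countable \<D>" "\<D> \<subseteq> Pow U" "\<And>X. X \<in> \<D> \<Longrightarrow> \<exists>a b. X = cbox a b" "\<Union>\<D> = U"
    using open_countable_Union_open_cbox[OF U] by metis
  have "AE x in lborel. \<forall>X\<in>\<D>. x \<in> X \<longrightarrow> w x = 0"
    using \<D>(1)
  proof (subst AE_ball_countable, safe)
    fix X assume "X \<in> \<D>"
    thus "AE x in lborel. x \<in> X \<longrightarrow> w x = 0" using \<D>(2,3) cb by blast
  qed
  thus ?thesis by eventually_elim (use \<D>(4) in blast)
qed

section \<open>Mollification\<close>

text \<open>The kernel is evaluated at \<open>y - x\<close>, which makes the mollification at \<open>x\<close> the pairing of \<open>w\<close> with a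
translate of \<open>\<phi>\<close>; the price is a sign in first derivatives.\<close>

definition mollify :: "('a::euclidean_space \<Rightarrow> complex) \<Rightarrow> ('a \<Rightarrow> complex) \<Rightarrow> 'a \<Rightarrow> complex" where
  "mollify w \<phi> x = (\<integral>y. w y * \<phi> (y - x) \<partial>lborel)"

text \<open>The constant is uniform in \<open>z\<close>, so that the remainder can be integrated against \<open>w\<close> when
differentiating \<open>mollify w \<phi>\<close>.\<close>

lemma test_function_taylor:
  fixes \<phi> :: "'a::euclidean_space \<Rightarrow> complex"
  assumes \<phi>: "test_function \<phi>"
  obtains M where "M > 0" "\<And>z h. norm (\<phi> (z + h) - \<phi> z - dir_deriv h \<phi> z) \<le> M * (norm h)\<^sup>2"
proof -
  have "\<exists>L>0. \<forall>x y. norm (dir_deriv b \<phi> x - dir_deriv b \<phi> y) \<le> L * norm (x - y)" for b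
  proof -
    have t: "test_function (dir_deriv b \<phi>)" using test_function_dir_deriv[OF \<phi>] .
    obtain r where "\<And>x. norm x \<ge> r \<Longrightarrow> dir_deriv b \<phi> x = 0" using test_function_support[OF t] by auto
    thus ?thesis using lipschitz_of_compact_support[OF test_function_Ck[OF t], of r] by (metis less_imp_le)
  qed
  then obtain L where L: "\<And>b. L b > 0" "\<And>b x y. norm (dir_deriv b \<phi> x - dir_deriv b \<phi> y) \<le> L b * norm (x - y)"
    by metis
  let ?M = "\<Sum>b\<in>Basis. L b"
  have D: "(\<phi> has_derivative (\<lambda>v. dir_deriv v \<phi> x)) (at x)" for x
    using test_function_Ck[OF \<phi>, of 1] by (auto intro: dir_deriv_works)
  have "norm (\<phi> (z + h) - \<phi> z - dir_deriv h \<phi> z) \<le> ?M * (norm h)\<^sup>2" for z h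
  proof -
    have "norm (\<phi> (z + h) - \<phi> z - dir_deriv (z + h - z) \<phi> z) \<le> norm (z + h - z) * (?M * norm h)"
    proof (rule differentiable_bound_linearization[where S="cball z (norm h)" and f'="\<lambda>x v. dir_deriv v \<phi> x"])
      show "z + t *\<^sub>R (z + h - z) \<in> cball z (norm h)" if "t \<in> {0..1}" for t
        using that by (auto simp: dist_norm mult_left_le_one_le)
      show "(\<phi> has_derivative (\<lambda>v. dir_deriv v \<phi> x)) (at x within cball z (norm h))" for x
        using D has_derivative_at_withinI by blast
      show "onorm ((\<lambda>v. dir_deriv v \<phi> x) - (\<lambda>v. dir_deriv v \<phi> z)) \<le> ?M * norm h" if "x \<in> cball z (norm h)" for x
      proof -
        have "onorm (\<lambda>v. dir_deriv v \<phi> x - dir_deriv v \<phi> z) \<le> (\<Sum>b\<in>Basis. norm (dir_deriv b \<phi> x - dir_deriv b \<phi> z))"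
          by (intro onorm_le_sum_Basis linear_compose_sub has_derivative_linear[OF D])
        also have "\<dots> \<le> (\<Sum>b\<in>Basis. L b * norm h)"
        proof (rule sum_mono)
          fix b :: 'a
          show "norm (dir_deriv b \<phi> x - dir_deriv b \<phi> z) \<le> L b * norm h"
            using L(2)[of b x z] L(1)[of b] that mult_left_mono[of "norm (x - z)" "norm h" "L b"]
            by (intro order_trans[OF L(2)]) (simp add: dist_norm norm_minus_commute)
        qed
        finally show ?thesis by (simp add: sum_distrib_right fun_diff_def)
      qed
    qed auto
    thus ?thesis by (simp add: power2_eq_square mult_ac)
  qed
  moreover have "?M > 0" by (intro sum_pos) (use L in auto)
  ultimately show ?thesis using that by blast
qed

lemma integrable_mollify:
  assumes "locally_integrable w" "test_function \<phi>"
  shows "integrable lborel (\<lambda>y. w y * \<phi> (y - x))"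
  by (intro integrable_mult_test test_function_translate assms)

lemma mollify_has_derivative:
  fixes w :: "'a::euclidean_space \<Rightarrow> complex"
  assumes w: "locally_integrable w" and \<phi>: "test_function \<phi>"
  shows "(mollify w \<phi> has_derivative (\<lambda>v. - mollify w (dir_deriv v \<phi>) x)) (at x)"
proof -
  obtain r where r: "r > 0" "\<And>x. norm x \<ge> r \<Longrightarrow> \<phi> x = 0" using test_function_support[OF \<phi>] by blast
  obtain M where M: "M > 0" "\<And>z h. norm (\<phi> (z + h) - \<phi> z - dir_deriv h \<phi> z) \<le> M * (norm h)\<^sup>2"
    using test_function_taylor[OF \<phi>] by blast
  have D: "(\<phi> has_derivative (\<lambda>v. dir_deriv v \<phi> x)) (at x)" for x
    using test_function_Ck[OF \<phi>, of 1] by (auto intro: dir_deriv_works)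
  have td: "test_function (dir_deriv v \<phi>)" for v using test_function_dir_deriv[OF \<phi>] .
  have dd0: "dir_deriv v \<phi> y = 0" if "norm y > r" for v y
    by (rule dir_deriv_zero_open[of "- cball 0 r"]) (use that r in auto)
  let ?B = "cball 0 (r + norm x + 1) :: 'a set"
  define I where "I = (\<integral>y. norm (indicator ?B y *\<^sub>R w y) \<partial>lborel)"
  have wI: "integrable lborel (\<lambda>y. norm (indicator ?B y *\<^sub>R w y))"
    by (rule locally_integrable_norm[OF w])
  show ?thesis
  proof (rule has_derivativeI_sandwich[where e=1 and H="\<lambda>y. I * M * norm (y - x)"])
    have "linear (\<lambda>v. - mollify w (dir_deriv v \<phi>) x)"
    proof (rule linearI)
      show "- mollify w (dir_deriv (v1 + v2) \<phi>) x = - mollify w (dir_deriv v1 \<phi>) x + - mollify w (dir_deriv v2 \<phi>) x" for v1 v2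
        using Bochner_Integration.integral_add[OF integrable_mollify[OF w td] integrable_mollify[OF w td], of v1 x v2 x]
        by (simp add: mollify_def linear_add[OF has_derivative_linear[OF D]] ring_distribs)
      show "- mollify w (dir_deriv (c *\<^sub>R v) \<phi>) x = c *\<^sub>R - mollify w (dir_deriv v \<phi>) x" for c v
        by (simp add: mollify_def linear_scale[OF has_derivative_linear[OF D]])
    qed
    thus "bounded_linear (\<lambda>v. - mollify w (dir_deriv v \<phi>) x)" using linear_conv_bounded_linear by blast
    show "((\<lambda>y. I * M * norm (y - x)) \<longlongrightarrow> 0) (at x)" by (auto intro!: tendsto_eq_intros)
    fix z assume z: "z \<noteq> x" "dist z x < 1"
    define h where "h = z - x"
    have h: "norm h < 1" "h \<noteq> 0" using z by (auto simp: h_def dist_norm)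
    have "mollify w \<phi> z - mollify w \<phi> x - (- mollify w (dir_deriv h \<phi>) x)
        = (\<integral>y. w y * (\<phi> (y - z) - \<phi> (y - x) + dir_deriv h \<phi> (y - x)) \<partial>lborel)"
      using integrable_mollify[OF w \<phi>] integrable_mollify[OF w td]
      by (simp add: mollify_def ring_distribs right_diff_distrib)
    also have "norm \<dots> \<le> (\<integral>y. M * (norm h)\<^sup>2 * norm (indicator ?B y *\<^sub>R w y) \<partial>lborel)"
    proof (rule Bochner_Integration.integral_norm_bound_integral)
      show "integrable lborel (\<lambda>y. w y * (\<phi> (y - z) - \<phi> (y - x) + dir_deriv h \<phi> (y - x)))"
        using integrable_mollify[OF w \<phi>] integrable_mollify[OF w td]
        by (simp add: ring_distribs right_diff_distrib)
      show "integrable lborel (\<lambda>y. M * (norm h)\<^sup>2 * norm (indicator ?B y *\<^sub>R w y))" using wI by simp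
      fix y
      show "norm (w y * (\<phi> (y - z) - \<phi> (y - x) + dir_deriv h \<phi> (y - x))) \<le> M * (norm h)\<^sup>2 * norm (indicator ?B y *\<^sub>R w y)"
      proof (cases "y \<in> ?B")
        case True
        have "norm (\<phi> (y - x + (- h)) - \<phi> (y - x) - dir_deriv (-h) \<phi> (y - x)) \<le> M * (norm h)\<^sup>2"
          using M(2)[of "y - x" "- h"] by simp
        moreover have "dir_deriv (-h) \<phi> (y - x) = - dir_deriv h \<phi> (y - x)"
          using linear_neg[OF has_derivative_linear[OF D]] .
        ultimately have "norm (\<phi> (y - z) - \<phi> (y - x) + dir_deriv h \<phi> (y - x)) \<le> M * (norm h)\<^sup>2"
          by (simp add: h_def)
        thus ?thesis using True by (simp add: norm_mult mult.commute[of _ "norm (w y)"] mult_left_mono)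
      next
        case False
        hence y: "norm y > r + norm x + 1" by simp
        have "norm (y - x) > r" using y norm_triangle_ineq2[of y x] by linarith
        moreover have "norm z < norm x + 1" using h norm_triangle_ineq2[of z x] by (simp add: h_def)
        hence "norm (y - z) > r" using y norm_triangle_ineq2[of y z] by linarith
        ultimately show ?thesis using r dd0 False by simp
      qed
    qed
    also have "\<dots> = (M * (norm h)\<^sup>2) * I" unfolding I_def by (rule integral_mult_right_zero)
    also have "\<dots> = I * M * (norm h)\<^sup>2" by simp
    finally show "norm (mollify w \<phi> z - mollify w \<phi> x - (- mollify w (dir_deriv (z - x) \<phi>) x)) / norm (z - x) \<le> I * M * norm (z - x)"
      using h by (simp add: h_def[symmetric] divide_simps power2_eq_square mult_ac)
  qed simp
qed

lemma dir_deriv_mollify: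
  assumes "locally_integrable w" "test_function \<phi>"
  shows "dir_deriv v (mollify w \<phi>) = (\<lambda>x. - mollify w (dir_deriv v \<phi>) x)"
  by (rule ext) (rule dir_deriv_eqI[OF mollify_has_derivative[OF assms]])

lemma Ck_mollify:
  assumes "locally_integrable w" "test_function \<phi>"
  shows "Ck n UNIV (mollify w \<phi>)"
  using assms(2)
proof (induction n arbitrary: \<phi>)
  case 0
  have "mollify w \<phi> differentiable at x" for x
    using mollify_has_derivative[OF assms(1) 0] by (auto simp: differentiable_def)
  thus ?case by (auto intro!: continuous_at_imp_continuous_on differentiable_imp_continuous_within)
next
  case (Suc n)
  have "Ck n UNIV (\<lambda>x. - mollify w (dir_deriv v \<phi>) x)" for v
    by (rule Ck_minus[OF open_UNIV Suc.IH[OF test_function_dir_deriv[OF Suc.prems]]])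
  thus ?case using mollify_has_derivative[OF assms(1) Suc.prems] dir_deriv_mollify[OF assms(1) Suc.prems]
    by (auto simp: differentiable_def)
qed

lemma laplacian_mollify:
  assumes w: "locally_integrable w" and \<phi>: "test_function \<phi>"
  shows "laplacian (mollify w \<phi>) x = mollify w (laplacian \<phi>) x"
proof -
  have td: "test_function (dir_deriv v \<phi>)" "test_function (dir_deriv v (dir_deriv v \<phi>))" for v
    using test_function_dir_deriv \<phi> by blast+
  have "dir_deriv b (dir_deriv b (mollify w \<phi>)) x = mollify w (dir_deriv b (dir_deriv b \<phi>)) x" for b
  proof -
    have "(dir_deriv b (mollify w \<phi>) has_derivative (\<lambda>v. - (- mollify w (dir_deriv v (dir_deriv b \<phi>)) x))) (at x)"
      unfolding dir_deriv_mollify[OF w \<phi>] by (intro has_derivative_minus mollify_has_derivative w td)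
    from dir_deriv_eqI[OF this] show ?thesis by simp
  qed
  thus ?thesis
    using integrable_mollify[OF w td(2)]
    by (simp add: laplacian_def mollify_def sum_distrib_left Bochner_Integration.integral_sum)
qed

section \<open>Fourier coefficients on circles\<close>

definition polar :: "real \<Rightarrow> real^2" where "polar \<theta> = vector [cos \<theta>, sin \<theta>]"

abbreviation e1 :: "real^2" where "e1 \<equiv> axis 1 1"
abbreviation e2 :: "real^2" where "e2 \<equiv> axis 2 1"

lemma polar_eq: "polar \<theta> = cos \<theta> *\<^sub>R e1 + sin \<theta> *\<^sub>R e2"
  by (simp add: polar_def vec_eq_iff forall_2 axis_def)

lemma norm_polar [simp]: "norm (polar \<theta>) = 1"
  by (simp add: polar_def norm_eq_sqrt_inner inner_vec_def sum_2 flip: power2_eq_square)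

lemma polar_2pi: "polar (2 * pi) = polar 0" by (simp add: polar_def)

lemma polar_surj:
  fixes x :: "real^2"
  obtains \<theta> where "0 \<le> \<theta>" "\<theta> < 2 * pi" "x = norm x *\<^sub>R polar \<theta>"
proof (cases "x = 0")
  case True
  thus ?thesis using that[of 0] by simp
next
  case False
  define z where "z = x /\<^sub>R norm x"
  have "norm z = 1" using False by (simp add: z_def)
  hence "(z $ 1)\<^sup>2 + (z $ 2)\<^sup>2 = 1"
    by (simp add: norm_eq_sqrt_inner inner_vec_def sum_2 flip: power2_eq_square)
  then obtain t where t: "0 \<le> t" "t < 2 * pi" "z $ 1 = cos t" "z $ 2 = sin t" by (rule sincos_total_2pi)
  have "z = polar t" using t by (simp add: polar_def vec_eq_iff forall_2)
  moreover have "x = norm x *\<^sub>R z" using False by (simp add: z_def)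
  ultimately show ?thesis using that t by metis
qed

lemma Basis_plane: "(Basis :: (real^2) set) = {e1, e2}"
proof -
  have "(Basis :: (real^2) set) = (\<lambda>i. axis i 1) ` {1, 2}"
    unfolding UNIV_2[symmetric] by (auto simp: Basis_vec_def)
  thus ?thesis by auto
qed

lemma e1_neq_e2: "e1 \<noteq> e2"
  by (simp add: axis_eq_axis)

lemma laplacian_plane:
  "laplacian f x = dir_deriv e1 (dir_deriv e1 f) x + dir_deriv e2 (dir_deriv e2 f) x"
  unfolding laplacian_def Basis_plane using e1_neq_e2 by simp

lemma continuous_polar [continuous_intros]:
  fixes f :: "'a::metric_space \<Rightarrow> real"
  shows
  "continuous_on S f \<Longrightarrow> continuous_on S (\<lambda>x. polar (f x))"
  unfolding polar_eq by (intro continuous_intros)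

text \<open>The coefficient over the circle of radius \<open>r\<close> about \<open>a\<close>, not divided by \<open>2 \<pi>\<close>.\<close>

definition fourier_coeff :: "(real^2 \<Rightarrow> complex) \<Rightarrow> real^2 \<Rightarrow> int \<Rightarrow> real \<Rightarrow> complex" where
  "fourier_coeff W a n r = integral (cbox 0 (2 * pi)) (\<lambda>\<theta>. W (a + r *\<^sub>R polar \<theta>) * cis (- (of_int n * \<theta>)))"

text \<open>Multiplication by \<open>cos\<close> or \<open>sin\<close> only shifts Fourier indices.\<close>

lemma orthogonal_mult_cos_sin:
  fixes F :: "real \<Rightarrow> complex"
  assumes F: "continuous_on {0..2 * pi} F"
    and z: "\<And>n::int. integral {0..2 * pi} (\<lambda>\<theta>. F \<theta> * cis (- (of_int n * \<theta>))) = 0"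
  shows "integral {0..2 * pi} (\<lambda>\<theta>. F \<theta> * of_real (\<alpha> * cos \<theta> + \<beta> * sin \<theta>) * cis (- (of_int n * \<theta>))) = 0"
proof -
  have I: "(\<lambda>\<theta>. F \<theta> * cis (- (of_int n * \<theta>))) integrable_on {0..2*pi}" for n :: int
    by (intro integrable_continuous_real continuous_intros F)
  let ?A = "(of_real \<alpha> - \<i> * of_real \<beta>) / 2" and ?B = "(of_real \<alpha> + \<i> * of_real \<beta>) / 2"
  have shift: "cis (\<theta>) * cis (- (of_int n * \<theta>)) = cis (- (of_int (n - 1) * \<theta>))"
       "cis (- \<theta>) * cis (- (of_int n * \<theta>)) = cis (- (of_int (n + 1) * \<theta>))" for \<theta>
    by (simp_all add: cis_mult algebra_simps)
  have "complex_of_real (\<alpha> * cos \<theta> + \<beta> * sin \<theta>) = ?A * cis \<theta> + ?B * cis (- \<theta>)" for \<theta>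
    by (simp add: complex_eq_iff field_simps)
  hence "F \<theta> * of_real (\<alpha> * cos \<theta> + \<beta> * sin \<theta>) * cis (- (of_int n * \<theta>))
      = ?A * (F \<theta> * (cis \<theta> * cis (- (of_int n * \<theta>)))) + ?B * (F \<theta> * (cis (- \<theta>) * cis (- (of_int n * \<theta>))))" for \<theta>
    by (simp only:) (simp add: algebra_simps)
  hence "integral {0..2 * pi} (\<lambda>\<theta>. F \<theta> * of_real (\<alpha> * cos \<theta> + \<beta> * sin \<theta>) * cis (- (of_int n * \<theta>)))
     = integral {0..2*pi} (\<lambda>\<theta>. ?A * (F \<theta> * cis (- (of_int (n - 1) * \<theta>))) + ?B * (F \<theta> * cis (- (of_int (n + 1) * \<theta>))))"
    by (simp only: shift)
  also have "\<dots> = ?A * integral {0..2*pi} (\<lambda>\<theta>. F \<theta> * cis (- (of_int (n - 1) * \<theta>)))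
      + ?B * integral {0..2*pi} (\<lambda>\<theta>. F \<theta> * cis (- (of_int (n + 1) * \<theta>)))"
    by (subst Henstock_Kurzweil_Integration.integral_add)
       (use I[of "n - 1"] I[of "n + 1"] in \<open>auto intro!: integrable_on_mult_right\<close>)
  finally show ?thesis by (simp only: z) simp
qed

lemma continuous_on_polynomial_polar:
  assumes "real_polynomial_function p"
  shows "continuous_on X (\<lambda>\<theta>. p (polar \<theta>))"
proof (rule continuous_on_compose2[of UNIV p X polar])
  show "continuous_on UNIV p"
    using assms continuous_on_polymonial_function real_polynomial_function_eq by blast
qed (auto intro: continuous_intros)

text \<open>A polynomial on the circle is built from linear forms, each a combination of \<open>cos\<close> and \<open>sin\<close>.  The
induction needs the statement for all \<open>F\<close> because a product replaces \<open>F\<close> by \<open>F\<close> times one of the factors.\<close>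

lemma orthogonal_mult_polynomial:
  fixes F :: "real \<Rightarrow> complex"
  assumes p: "real_polynomial_function p"
    and "continuous_on {0..2 * pi} F"
    and "\<And>n::int. integral {0..2 * pi} (\<lambda>\<theta>. F \<theta> * cis (- (of_int n * \<theta>))) = 0"
  shows "integral {0..2 * pi} (\<lambda>\<theta>. F \<theta> * of_real (p (polar \<theta>)) * cis (- (of_int n * \<theta>))) = 0"
  using assms
proof (induction p arbitrary: F n)
  case (linear f)
  have "f (polar \<theta>) = f e1 * cos \<theta> + f e2 * sin \<theta>" for \<theta>
    using linear(1) by (simp add: polar_eq bounded_linear.linear linear_add linear_scale)
  thus ?case using orthogonal_mult_cos_sin[OF linear(2,3), of "f e1" "f e2" n] by simp
next
  case (const c)
  have "integral {0..2 * pi} (\<lambda>\<theta>. of_real c * (F \<theta> * cis (- (of_int n * \<theta>)))) = 0"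
    by (simp only: integral_mult_right const) simp
  thus ?case by (simp add: mult_ac)
next
  case (add f g)
  have c: "continuous_on {0..2*pi} (\<lambda>\<theta>. f (polar \<theta>))" "continuous_on {0..2*pi} (\<lambda>\<theta>. g (polar \<theta>))"
    by (rule continuous_on_polynomial_polar, fact)+
  have I: "(\<lambda>\<theta>. F \<theta> * of_real (h (polar \<theta>)) * cis (- (of_int n * \<theta>))) integrable_on {0..2*pi}"
    if "continuous_on {0..2*pi} (\<lambda>\<theta>. h (polar \<theta>))" for h
    by (intro integrable_continuous_real continuous_intros add.prems(1) that)
  show ?case
    using add.IH(1)[OF add.prems] add.IH(2)[OF add.prems]
      Henstock_Kurzweil_Integration.integral_add[OF I[OF c(1)] I[OF c(2)]]
    by (simp add: ring_distribs)
next
  case (mult f g)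
  have c: "continuous_on {0..2*pi} (\<lambda>\<theta>. f (polar \<theta>))"
    by (rule continuous_on_polynomial_polar, fact)
  have "continuous_on {0..2*pi} (\<lambda>\<theta>. F \<theta> * of_real (f (polar \<theta>)))"
    by (intro continuous_intros mult.prems(1) c)
  from mult.IH(2)[OF this] mult.IH(1)[OF mult.prems] show ?case by (simp add: mult_ac)
qed

text \<open>\<open>V\<close> is orthogonal to all polynomials \<open>g\<close>, and these are dense on the circle by the Stone-Weierstrass
theorem.  Hence the integral of \<open>V cnj(V) = V cnj(V - g) + V cnj(g)\<close> is arbitrarily small.\<close>

theorem fourier_coeffs_zero_imp_zero:
  fixes V :: "real^2 \<Rightarrow> complex"
  assumes V: "continuous_on (sphere 0 1) V"
    and z: "\<And>n::int. integral {0..2 * pi} (\<lambda>\<theta>. V (polar \<theta>) * cis (- (of_int n * \<theta>))) = 0"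
    and x: "norm x = 1"
  shows "V x = 0"
proof -
  let ?F = "\<lambda>\<theta>. V (polar \<theta>)"
  have F: "continuous_on {0..2*pi} ?F"
    by (rule continuous_on_compose2[OF V]) (auto intro!: continuous_intros)
  define I where "I = integral {0..2*pi} (\<lambda>\<theta>. norm (?F \<theta>))"
  have nI: "(\<lambda>\<theta>. norm (?F \<theta>)) integrable_on {0..2*pi}"
    by (intro integrable_continuous_real continuous_intros F)
  have bound: "norm (integral {0..2*pi} (\<lambda>\<theta>. ?F \<theta> * cnj (?F \<theta>))) \<le> e * I" if e: "e > 0" for e
  proof -
    obtain g where g: "polynomial_function g" "\<And>x. x \<in> sphere 0 1 \<Longrightarrow> norm (V x - g x) < e"
      using Stone_Weierstrass_polynomial_function[OF compact_sphere V e] by blast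
    have gp: "real_polynomial_function (\<lambda>x. Re (g x))" "real_polynomial_function (\<lambda>x. Im (g x))"
      using g(1) bounded_linear_Re bounded_linear_Im by (auto simp: polynomial_function_def o_def)
    have gc: "continuous_on {0..2*pi} (\<lambda>\<theta>. g (polar \<theta>))"
      by (rule continuous_on_compose2[OF continuous_on_polymonial_function[OF g(1)]])
         (auto intro: continuous_intros)
    have zp: "integral {0..2*pi} (\<lambda>\<theta>. ?F \<theta> * of_real (p (polar \<theta>))) = 0" if "real_polynomial_function p" for p
      using orthogonal_mult_polynomial[OF that F z, of 0] by simp
    have "integral {0..2*pi} (\<lambda>\<theta>. ?F \<theta> * cnj (g (polar \<theta>)))
        = integral {0..2*pi} (\<lambda>\<theta>. ?F \<theta> * of_real (Re (g (polar \<theta>))) - \<i> * (?F \<theta> * of_real (Im (g (polar \<theta>)))))"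
      by (rule integral_cong) (simp add: complex_eq_iff algebra_simps)
    also have "\<dots> = integral {0..2*pi} (\<lambda>\<theta>. ?F \<theta> * of_real (Re (g (polar \<theta>))))
        - integral {0..2*pi} (\<lambda>\<theta>. \<i> * (?F \<theta> * of_real (Im (g (polar \<theta>)))))"
      by (intro Henstock_Kurzweil_Integration.integral_diff integrable_continuous_real continuous_intros F gc)
    also have "\<dots> = 0" using zp[OF gp(1)] zp[OF gp(2)] by simp
    finally have z0: "integral {0..2*pi} (\<lambda>\<theta>. ?F \<theta> * cnj (g (polar \<theta>))) = 0" .
    have "integral {0..2*pi} (\<lambda>\<theta>. ?F \<theta> * cnj (?F \<theta>))
        = integral {0..2*pi} (\<lambda>\<theta>. ?F \<theta> * cnj (?F \<theta>) - ?F \<theta> * cnj (g (polar \<theta>)))"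
      by (subst Henstock_Kurzweil_Integration.integral_diff)
         (auto intro!: integrable_continuous_real continuous_intros F gc simp: z0)
    also have "norm \<dots> \<le> integral {0..2*pi} (\<lambda>\<theta>. e * norm (?F \<theta>))"
    proof (rule Henstock_Kurzweil_Integration.integral_norm_bound_integral)
      show "(\<lambda>\<theta>. ?F \<theta> * cnj (?F \<theta>) - ?F \<theta> * cnj (g (polar \<theta>))) integrable_on {0..2*pi}"
        by (intro integrable_continuous_real continuous_intros F gc)
      show "(\<lambda>\<theta>. e * norm (?F \<theta>)) integrable_on {0..2*pi}"
        by (intro integrable_continuous_real continuous_intros F)
      fix \<theta>
      have "norm (?F \<theta> * cnj (?F \<theta>) - ?F \<theta> * cnj (g (polar \<theta>))) = norm (?F \<theta>) * norm (?F \<theta> - g (polar \<theta>))"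
        by (simp add: norm_mult flip: right_diff_distrib complex_cnj_diff)
      also have "\<dots> \<le> e * norm (?F \<theta>)"
        using g(2)[of "polar \<theta>"] by (simp add: mult.commute[of e] mult_left_mono less_imp_le)
      finally show "norm (?F \<theta> * cnj (?F \<theta>) - ?F \<theta> * cnj (g (polar \<theta>))) \<le> e * norm (?F \<theta>)" .
    qed
    also have "\<dots> = e * I" by (simp add: I_def)
    finally show ?thesis .
  qed
  have "I \<ge> 0" unfolding I_def by (intro Henstock_Kurzweil_Integration.integral_nonneg nI) auto
  have "integral {0..2*pi} (\<lambda>\<theta>. ?F \<theta> * cnj (?F \<theta>)) = 0"
  proof (rule ccontr)
    assume "integral {0..2*pi} (\<lambda>\<theta>. ?F \<theta> * cnj (?F \<theta>)) \<noteq> 0" (is "?J \<noteq> 0")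
    hence "norm ?J > 0" by simp
    hence "norm ?J \<le> norm ?J / (2 * (I + 1)) * I" using bound[of "norm ?J / (2 * (I + 1))"] \<open>I \<ge> 0\<close> by auto
    also have "\<dots> < norm ?J" using \<open>norm ?J > 0\<close> \<open>I \<ge> 0\<close> by (simp add: divide_simps)
    finally show False by simp
  qed
  moreover have "integral {0..2*pi} (\<lambda>\<theta>. ?F \<theta> * cnj (?F \<theta>)) = of_real (integral {0..2*pi} (\<lambda>\<theta>. (norm (?F \<theta>))\<^sup>2))"
  proof -
    have "((\<lambda>\<theta>. (norm (?F \<theta>))\<^sup>2) has_integral integral {0..2*pi} (\<lambda>\<theta>. (norm (?F \<theta>))\<^sup>2)) {0..2*pi}"
      by (intro integrable_integral integrable_continuous_real continuous_intros F)
    hence "((\<lambda>\<theta>. complex_of_real ((norm (?F \<theta>))\<^sup>2)) has_integral of_real (integral {0..2*pi} (\<lambda>\<theta>. (norm (?F \<theta>))\<^sup>2))) {0..2*pi}"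
      by (rule has_integral_of_real)
    thus ?thesis by (simp only: complex_norm_square integral_unique)
  qed
  ultimately have "integral {0..2*pi} (\<lambda>\<theta>. (norm (?F \<theta>))\<^sup>2) = 0" by simp
  hence "\<forall>\<theta>\<in>{0..2*pi}. (norm (?F \<theta>))\<^sup>2 = 0"
    by (subst (asm) integral_eq_0_iff) (auto intro!: continuous_intros F)
  moreover obtain \<theta> where "0 \<le> \<theta>" "\<theta> < 2 * pi" "x = norm x *\<^sub>R polar \<theta>" by (rule polar_surj)
  ultimately show ?thesis using x by auto
qed

subsection \<open>The radial equation\<close>

text \<open>The equation \<open>g'' = (c / t\<^sup>2 - k\<^sup>2) g\<close> is a perturbation of an oscillator with energy \<open>E\<close>.  The
perturbation gives \<open>|E'| \<le> (A / t\<^sup>2) E\<close>, and \<open>A / t\<^sup>2\<close> is the derivative of \<open>- A / t\<close>, so the weights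
\<open>exp (\<mp> A / t)\<close> turn this into monotonicity in the two directions.\<close>

lemma radial_energy_monotone:
  fixes g g' :: "real \<Rightarrow> real"
  assumes k: "k > 0" and ab: "0 < a" "a \<le> b"
    and g: "\<And>t. a \<le> t \<Longrightarrow> t \<le> b \<Longrightarrow> (g has_real_derivative g' t) (at t)"
    and g': "\<And>t. a \<le> t \<Longrightarrow> t \<le> b \<Longrightarrow> (g' has_real_derivative (c / t\<^sup>2 - k\<^sup>2) * g t) (at t)"
  defines "E \<equiv> \<lambda>t. (g' t)\<^sup>2 + k\<^sup>2 * (g t)\<^sup>2" and "A \<equiv> \<bar>c\<bar> / k"
  shows "E a * exp (- A / a) \<le> E b * exp (- A / b)" "E b * exp (A / b) \<le> E a * exp (A / a)"
proof -
  have E': "(E has_real_derivative (2 * g' t * g t * (c / t\<^sup>2))) (at t)" if "a \<le> t" "t \<le> b" for t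
    unfolding E_def by (auto intro!: derivative_eq_intros g[OF that] g'[OF that]) (simp add: algebra_simps)
  have bd: "\<bar>2 * g' t * g t * (c / t\<^sup>2)\<bar> \<le> A / t\<^sup>2 * E t" for t
  proof -
    have "0 \<le> (\<bar>g' t\<bar> - k * \<bar>g t\<bar>)\<^sup>2" by simp
    hence "2 * \<bar>g' t\<bar> * (k * \<bar>g t\<bar>) \<le> E t" by (simp add: E_def power2_diff power_mult_distrib)
    hence "\<bar>c\<bar> / (k * t\<^sup>2) * (2 * \<bar>g' t\<bar> * (k * \<bar>g t\<bar>)) \<le> \<bar>c\<bar> / (k * t\<^sup>2) * E t"
      using k by (intro mult_left_mono) auto
    moreover have "\<bar>2 * g' t * g t * (c / t\<^sup>2)\<bar> = \<bar>c\<bar> / (k * t\<^sup>2) * (2 * \<bar>g' t\<bar> * (k * \<bar>g t\<bar>))"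
      using k by (cases "t = 0") (simp_all add: abs_mult)
    moreover have "\<bar>c\<bar> / (k * t\<^sup>2) = A / t\<^sup>2" by (simp add: A_def)
    ultimately show ?thesis by (simp only:)
  qed
  have P: "((\<lambda>t. E t * exp (- A / t)) has_real_derivative (2 * g' t * g t * (c / t\<^sup>2) + A / t\<^sup>2 * E t) * exp (- A / t)) (at t)"
    if "a \<le> t" "t \<le> b" for t
    using ab that by (auto intro!: derivative_eq_intros E'[OF that]) (simp add: algebra_simps power2_eq_square)
  have N: "((\<lambda>t. E t * exp (A / t)) has_real_derivative (2 * g' t * g t * (c / t\<^sup>2) - A / t\<^sup>2 * E t) * exp (A / t)) (at t)"
    if "a \<le> t" "t \<le> b" for t
    using ab that by (auto intro!: derivative_eq_intros E'[OF that]) (simp add: algebra_simps power2_eq_square)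
  show "E a * exp (- A / a) \<le> E b * exp (- A / b)"
  proof (rule DERIV_nonneg_imp_nondecreasing[OF ab(2)])
    fix t assume t: "a \<le> t" "t \<le> b"
    have "0 \<le> (2 * g' t * g t * (c / t\<^sup>2) + A / t\<^sup>2 * E t) * exp (- A / t)"
      using bd[of t] by (intro mult_nonneg_nonneg) (simp_all only: abs_le_iff, linarith, simp)
    thus "\<exists>y. ((\<lambda>t. E t * exp (- A / t)) has_real_derivative y) (at t) \<and> 0 \<le> y"
      using P[OF t] by blast
  qed
  show "E b * exp (A / b) \<le> E a * exp (A / a)"
  proof (rule DERIV_nonpos_imp_nonincreasing[OF ab(2)])
    fix t assume t: "a \<le> t" "t \<le> b"
    have "(2 * g' t * g t * (c / t\<^sup>2) - A / t\<^sup>2 * E t) * exp (A / t) \<le> 0"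
      using bd[of t] by (intro mult_nonpos_nonneg) (simp_all only: abs_le_iff, linarith, simp)
    thus "\<exists>y. ((\<lambda>t. E t * exp (A / t)) has_real_derivative y) (at t) \<and> y \<le> 0"
      using N[OF t] by blast
  qed
qed

text \<open>The energy is zero at \<open>s\<close>; the two monotonicity statements carry this to the left and to the right.\<close>

lemma radial_equation_unique:
  fixes g g' :: "real \<Rightarrow> real"
  assumes k: "k > 0" and r: "0 \<le> r1" "r1 < s" "s < r2" "r1 < t" "t < r2"
    and g: "\<And>t. r1 < t \<Longrightarrow> t < r2 \<Longrightarrow> (g has_real_derivative g' t) (at t)"
    and g': "\<And>t. r1 < t \<Longrightarrow> t < r2 \<Longrightarrow> (g' has_real_derivative (c / t\<^sup>2 - k\<^sup>2) * g t) (at t)"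
    and z: "g s = 0" "g' s = 0"
  shows "g t = 0"
proof -
  let ?E = "\<lambda>t. (g' t)\<^sup>2 + k\<^sup>2 * (g t)\<^sup>2"
  have "\<exists>C>0. ?E t * C \<le> 0"
  proof (cases "t \<le> s")
    case True
    have "?E t * exp (- (\<bar>c\<bar> / k) / t) \<le> ?E s * exp (- (\<bar>c\<bar> / k) / s)"
      by (rule radial_energy_monotone(1)[OF k _ True]) (use r in \<open>auto intro!: g g'\<close>)
    thus ?thesis using z by (auto intro!: exI[of _ "exp (- (\<bar>c\<bar> / k) / t)"])
  next
    case False
    have "?E t * exp ((\<bar>c\<bar> / k) / t) \<le> ?E s * exp ((\<bar>c\<bar> / k) / s)"
      by (rule radial_energy_monotone(2)[OF k]) (use r False in \<open>auto intro!: g g'\<close>)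
    thus ?thesis using z by (auto intro!: exI[of _ "exp ((\<bar>c\<bar> / k) / t)"])
  qed
  hence "?E t \<le> 0" by (auto simp: mult_le_0_iff)
  moreover have "k\<^sup>2 * (g t)\<^sup>2 \<ge> 0" "(g' t)\<^sup>2 \<ge> 0" by auto
  ultimately have "k\<^sup>2 * (g t)\<^sup>2 = 0" by linarith
  thus ?thesis using k by simp
qed

text \<open>As \<open>g\<close> tends to zero, the mean value theorem makes \<open>g'\<close> small somewhere in every far unit interval.  So
the energy is small at arbitrarily large radii, and there it controls the energy at \<open>t\<close>.\<close>

lemma radial_equation_decay:
  fixes g g' :: "real \<Rightarrow> real"
  assumes k: "k > 0" and r: "0 \<le> r1" "r1 < t"
    and g: "\<And>t. r1 < t \<Longrightarrow> (g has_real_derivative g' t) (at t)"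
    and g': "\<And>t. r1 < t \<Longrightarrow> (g' has_real_derivative (c / t\<^sup>2 - k\<^sup>2) * g t) (at t)"
    and lim: "(g \<longlongrightarrow> 0) at_top"
  shows "g t = 0"
proof -
  let ?E = "\<lambda>t. (g' t)\<^sup>2 + k\<^sup>2 * (g t)\<^sup>2"
  have "?E t * exp (- (\<bar>c\<bar> / k) / t) \<le> e" if "e > 0" for e
  proof -
    define d where "d = sqrt (e / (4 + k\<^sup>2))"
    have "4 + k\<^sup>2 > 0" by (simp add: add_pos_nonneg)
    hence d: "d > 0" "d\<^sup>2 * (4 + k\<^sup>2) = e" using that by (auto simp: d_def)
    obtain N where N: "\<And>s. s \<ge> N \<Longrightarrow> \<bar>g s\<bar> < d"
      using lim d(1) unfolding tendsto_iff eventually_at_top_linorder by (auto simp: dist_norm)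
    define m where "m = max N t"
    obtain s where s: "m < s" "s < m + 1" "g (m + 1) - g m = (m + 1 - m) * g' s"
      using MVT2[of m "m + 1" g g'] g r unfolding m_def by (metis less_add_one less_max_iff_disj less_le_trans)
    have "N \<le> m" by (simp add: m_def)
    hence "\<bar>g' s\<bar> \<le> 2 * d" using s(3) N[of m] N[of "m + 1"] by auto
    hence "(g' s)\<^sup>2 \<le> (2 * d)\<^sup>2" using abs_le_square_iff[of "g' s" "2 * d"] d(1) by simp
    moreover have "(g s)\<^sup>2 \<le> d\<^sup>2" using N[of s] s(1) abs_le_square_iff[of "g s" d] d(1) by (auto simp: m_def)
    hence "k\<^sup>2 * (g s)\<^sup>2 \<le> k\<^sup>2 * d\<^sup>2" by (intro mult_left_mono) auto
    ultimately have "?E s \<le> e" using d(2) by (simp add: power_mult_distrib algebra_simps)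
    have "?E t * exp (- (\<bar>c\<bar> / k) / t) \<le> ?E s * exp (- (\<bar>c\<bar> / k) / s)"
      by (rule radial_energy_monotone(1)[OF k]) (use r s in \<open>auto intro!: g g' simp: m_def\<close>)
    also have "\<dots> \<le> ?E s * 1" using k r s by (intro mult_left_mono) (auto simp: m_def)
    finally show ?thesis using \<open>?E s \<le> e\<close> by simp
  qed
  hence "?E t * exp (- (\<bar>c\<bar> / k) / t) \<le> 0" by (rule field_le_epsilon) simp
  hence "?E t \<le> 0" by (simp add: mult_le_0_iff)
  moreover have "k\<^sup>2 * (g t)\<^sup>2 \<ge> 0" "(g' t)\<^sup>2 \<ge> 0" by auto
  ultimately have "k\<^sup>2 * (g t)\<^sup>2 = 0" by linarith
  thus ?thesis using k by simp
qed

lemma linear_dir_deriv: "f differentiable (at x) \<Longrightarrow> linear (\<lambda>v. dir_deriv v f x)"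
  by (rule has_derivative_linear[OF dir_deriv_works])

lemma radial_derivative:
  fixes V :: "real^2 \<Rightarrow> complex"
  assumes "V differentiable (at (a + r *\<^sub>R polar \<theta>))"
  shows "((\<lambda>r. V (a + r *\<^sub>R polar \<theta>)) has_vector_derivative
     (cos \<theta> *\<^sub>R dir_deriv e1 V (a + r *\<^sub>R polar \<theta>) + sin \<theta> *\<^sub>R dir_deriv e2 V (a + r *\<^sub>R polar \<theta>))) (at r within S)"
proof -
  have "((\<lambda>r. a + r *\<^sub>R polar \<theta>) has_derivative (\<lambda>h. h *\<^sub>R polar \<theta>)) (at r)"
    by (auto intro!: derivative_eq_intros)
  from has_derivative_compose[OF this dir_deriv_works[OF assms]]
  have "((\<lambda>r. V (a + r *\<^sub>R polar \<theta>)) has_derivative (\<lambda>h. dir_deriv (h *\<^sub>R polar \<theta>) V (a + r *\<^sub>R polar \<theta>))) (at r)" .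
  moreover have "dir_deriv (h *\<^sub>R polar \<theta>) V x = h *\<^sub>R (cos \<theta> *\<^sub>R dir_deriv e1 V x + sin \<theta> *\<^sub>R dir_deriv e2 V x)"
    if "V differentiable (at x)" for h x
    by (simp only: polar_eq linear_scale[OF linear_dir_deriv[OF that]] linear_add[OF linear_dir_deriv[OF that]])
  ultimately have "((\<lambda>r. V (a + r *\<^sub>R polar \<theta>)) has_vector_derivative
     (cos \<theta> *\<^sub>R dir_deriv e1 V (a + r *\<^sub>R polar \<theta>) + sin \<theta> *\<^sub>R dir_deriv e2 V (a + r *\<^sub>R polar \<theta>))) (at r)"
    using assms by (simp add: has_vector_derivative_def)
  thus ?thesis by (rule has_vector_derivative_at_within)
qed

lemma angular_derivative:
  fixes V :: "real^2 \<Rightarrow> complex"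
  assumes "V differentiable (at (a + r *\<^sub>R polar \<theta>))"
  shows "((\<lambda>\<theta>. V (a + r *\<^sub>R polar \<theta>)) has_vector_derivative
     r *\<^sub>R (- sin \<theta> *\<^sub>R dir_deriv e1 V (a + r *\<^sub>R polar \<theta>) + cos \<theta> *\<^sub>R dir_deriv e2 V (a + r *\<^sub>R polar \<theta>))) (at \<theta> within S)"
proof -
  have "((\<lambda>\<theta>. a + r *\<^sub>R polar \<theta>) has_derivative (\<lambda>h. h *\<^sub>R r *\<^sub>R (- sin \<theta> *\<^sub>R e1 + cos \<theta> *\<^sub>R e2))) (at \<theta>)"
    unfolding polar_eq by (auto intro!: derivative_eq_intros simp: algebra_simps)
  from has_derivative_compose[OF this dir_deriv_works[OF assms]]
  have "((\<lambda>\<theta>. V (a + r *\<^sub>R polar \<theta>)) has_derivative (\<lambda>h. dir_deriv (h *\<^sub>R r *\<^sub>R (- sin \<theta> *\<^sub>R e1 + cos \<theta> *\<^sub>R e2)) V (a + r *\<^sub>R polar \<theta>))) (at \<theta>)" .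
  hence "((\<lambda>\<theta>. V (a + r *\<^sub>R polar \<theta>)) has_vector_derivative
     r *\<^sub>R (- sin \<theta> *\<^sub>R dir_deriv e1 V (a + r *\<^sub>R polar \<theta>) + cos \<theta> *\<^sub>R dir_deriv e2 V (a + r *\<^sub>R polar \<theta>))) (at \<theta>)"
    by (simp only: has_vector_derivative_def linear_scale[OF linear_dir_deriv[OF assms]]
         linear_add[OF linear_dir_deriv[OF assms]])
  thus ?thesis by (rule has_vector_derivative_at_within)
qed

text \<open>The polar form of the Laplacian: the radial derivatives pass under the integral, and two integrations
by parts in the angle turn the angular part into the factor \<open>- n\<^sup>2\<close>.\<close>

lemma fourier_coeff_radial_equation:
  fixes W :: "real^2 \<Rightarrow> complex" and n :: int
  assumes S: "open S" "Ck 2 S W" and H: "\<And>x. x \<in> S \<Longrightarrow> laplacian W x + of_real (k\<^sup>2) * W x = 0"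
    and sub: "\<And>r \<theta>. r1 < r \<Longrightarrow> r < r2 \<Longrightarrow> a + r *\<^sub>R polar \<theta> \<in> S" and r1: "0 \<le> r1"
  obtains y' y'' where
    "\<And>r. r1 < r \<Longrightarrow> r < r2 \<Longrightarrow> (fourier_coeff W a n has_vector_derivative y' r) (at r)"
    "\<And>r. r1 < r \<Longrightarrow> r < r2 \<Longrightarrow> (y' has_vector_derivative y'' r) (at r)"
    "\<And>r. r1 < r \<Longrightarrow> r < r2 \<Longrightarrow> y'' r = (of_real ((of_int n)\<^sup>2 / r\<^sup>2 - k\<^sup>2)) * fourier_coeff W a n r - y' r / of_real r"
proof -
  let ?U = "{r1<..<r2}" and ?T = "cbox 0 (2*pi)"
  define p where "p r \<theta> = a + r *\<^sub>R polar \<theta>" for r \<theta>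
  define E where "E \<theta> = cis (- (of_int n * \<theta>))" for \<theta>
  have E: "(E has_vector_derivative (- (\<i> * of_int n)) * E \<theta>) (at \<theta> within X)" for \<theta> X
  proof -
    have "((\<lambda>z. exp (- (\<i> * of_int n) * z)) has_field_derivative
       - (\<i> * of_int n) * exp (- (\<i> * of_int n) * of_real \<theta>)) (at (of_real \<theta>))"
      by (auto intro!: derivative_eq_intros)
    from has_vector_derivative_real_field[OF this]
    have "((\<lambda>\<theta>. exp (- (\<i> * of_int n) * of_real \<theta>)) has_vector_derivative
       - (\<i> * of_int n) * exp (- (\<i> * of_int n) * of_real \<theta>)) (at \<theta> within X)"
      by (rule has_vector_derivative_at_within)
    moreover have "E = (\<lambda>\<theta>. exp (- (\<i> * of_int n) * of_real \<theta>))"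
      by (simp add: E_def[abs_def] cis_conv_exp mult_ac)
    ultimately show ?thesis by simp
  qed
  have Ec: "continuous_on X E" for X
    unfolding E_def cis_conv_exp by (intro continuous_intros)
  define D where "D i = dir_deriv i W" for i
  define DD where "DD i j = dir_deriv i (dir_deriv j W)" for i j
  have dW: "W differentiable (at x)" "D i differentiable (at x)" if "x \<in> S" for x i
    using S(2) that by (auto simp: numeral_2_eq_2 D_def)
  have cD: "continuous_on S W" "continuous_on S (D i)" "continuous_on S (DD i j)" for i j
    using S(2) Ck_imp_continuous_on[OF S(2)] Ck_imp_continuous_on[of 1 S "D i"]
    by (auto simp: numeral_2_eq_2 D_def DD_def)
  have pS: "p r \<theta> \<in> S" if "r \<in> ?U" for r \<theta> using sub that by (auto simp: p_def)
  have cp: "continuous_on (?U \<times> X) (\<lambda>(r,\<theta>). V (p r \<theta>))" if "continuous_on S V" for V :: "real^2 \<Rightarrow> complex" and X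
    unfolding split_beta
    by (rule continuous_on_compose2[OF that]) (auto intro!: continuous_intros pS simp: p_def[abs_def] split_beta pS[unfolded p_def])
  have cp1: "continuous_on X (\<lambda>\<theta>. V (p r \<theta>))" if "continuous_on S V" "r \<in> ?U" for V :: "real^2 \<Rightarrow> complex" and r X
    by (rule continuous_on_compose2[OF that(1)]) (auto intro!: continuous_intros simp: p_def[abs_def] pS[OF that(2), unfolded p_def])
  \<comment> \<open>\<open>F1\<close>, \<open>F2\<close> are the first two radial and \<open>G1\<close>, \<open>G2\<close> the first two angular derivatives of \<open>W\<close> along \<open>p\<close>.\<close>
  define F1 where "F1 r \<theta> = cos \<theta> *\<^sub>R D e1 (p r \<theta>) + sin \<theta> *\<^sub>R D e2 (p r \<theta>)" for r \<theta>
  define F2 where "F2 r \<theta> = cos \<theta> *\<^sub>R (cos \<theta> *\<^sub>R DD e1 e1 (p r \<theta>) + sin \<theta> *\<^sub>R DD e2 e1 (p r \<theta>))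
     + sin \<theta> *\<^sub>R (cos \<theta> *\<^sub>R DD e1 e2 (p r \<theta>) + sin \<theta> *\<^sub>R DD e2 e2 (p r \<theta>))" for r \<theta>
  define G1 where "G1 r \<theta> = r *\<^sub>R (- sin \<theta> *\<^sub>R D e1 (p r \<theta>) + cos \<theta> *\<^sub>R D e2 (p r \<theta>))" for r \<theta>
  define G2 where "G2 r \<theta> = r *\<^sub>R (- sin \<theta> *\<^sub>R (r *\<^sub>R (- sin \<theta> *\<^sub>R DD e1 e1 (p r \<theta>) + cos \<theta> *\<^sub>R DD e2 e1 (p r \<theta>)))
     + (- cos \<theta>) *\<^sub>R D e1 (p r \<theta>)
     + (cos \<theta> *\<^sub>R (r *\<^sub>R (- sin \<theta> *\<^sub>R DD e1 e2 (p r \<theta>) + cos \<theta> *\<^sub>R DD e2 e2 (p r \<theta>))) + (- sin \<theta>) *\<^sub>R D e2 (p r \<theta>)))" for r \<theta>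
  have dF: "((\<lambda>r. W (p r \<theta>)) has_vector_derivative F1 r \<theta>) (at r within X)" if "r \<in> ?U" for r \<theta> X
    unfolding p_def F1_def D_def by (rule radial_derivative) (use dW sub that in auto)
  have dD: "((\<lambda>r. D i (p r \<theta>)) has_vector_derivative (cos \<theta> *\<^sub>R DD e1 i (p r \<theta>) + sin \<theta> *\<^sub>R DD e2 i (p r \<theta>))) (at r within X)"
    if "r \<in> ?U" for r \<theta> i X
    unfolding p_def DD_def D_def by (rule radial_derivative) (use dW[unfolded D_def] sub that in auto)
  have dF1: "((\<lambda>r. F1 r \<theta>) has_vector_derivative F2 r \<theta>) (at r within X)" if "r \<in> ?U" for r \<theta> X
    unfolding F1_def F2_def
    by (intro has_vector_derivative_add dD that bounded_linear.has_vector_derivative[OF bounded_linear_scaleR_right])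
  have aF: "((\<lambda>\<theta>. W (p r \<theta>)) has_vector_derivative G1 r \<theta>) (at \<theta> within X)" if "r \<in> ?U" for r \<theta> X
    unfolding p_def G1_def D_def by (rule angular_derivative) (use dW sub that in auto)
  have aD: "((\<lambda>\<theta>. D i (p r \<theta>)) has_vector_derivative r *\<^sub>R (- sin \<theta> *\<^sub>R DD e1 i (p r \<theta>) + cos \<theta> *\<^sub>R DD e2 i (p r \<theta>))) (at \<theta> within X)"
    if "r \<in> ?U" for r \<theta> i X
    unfolding p_def DD_def D_def by (rule angular_derivative) (use dW[unfolded D_def] sub that in auto)
  have aG: "((\<lambda>\<theta>. G1 r \<theta>) has_vector_derivative G2 r \<theta>) (at \<theta> within X)" if "r \<in> ?U" for r \<theta> X
    unfolding G1_def G2_def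
    by (intro has_vector_derivative_add has_vector_derivative_scaleR aD that bounded_linear.has_vector_derivative[OF bounded_linear_scaleR_right])
       (auto intro!: derivative_eq_intros)
  define y' where "y' r = integral ?T (\<lambda>\<theta>. F1 r \<theta> * E \<theta>)" for r
  define y'' where "y'' r = integral ?T (\<lambda>\<theta>. F2 r \<theta> * E \<theta>)" for r
  have cF1: "continuous_on (?U \<times> ?T) (\<lambda>(r,\<theta>). F1 r \<theta> * E \<theta>)"
    unfolding F1_def split_beta
    using cp[OF cD(2)] by (intro continuous_intros continuous_on_compose2[OF Ec[of UNIV]]) (auto simp: split_beta)
  have cF2: "continuous_on (?U \<times> ?T) (\<lambda>(r,\<theta>). F2 r \<theta> * E \<theta>)"
    unfolding F2_def split_beta
    using cp[OF cD(3)] by (intro continuous_intros continuous_on_compose2[OF Ec[of UNIV]]) (auto simp: split_beta)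
  have ci: "(\<lambda>\<theta>. W (p r \<theta>) * E \<theta>) integrable_on ?T" "(\<lambda>\<theta>. F1 r \<theta> * E \<theta>) integrable_on ?T"
     "(\<lambda>\<theta>. F2 r \<theta> * E \<theta>) integrable_on ?T" "(\<lambda>\<theta>. G2 r \<theta> * E \<theta>) integrable_on ?T" if "r \<in> ?U" for r
    unfolding F1_def F2_def G2_def
    by (intro integrable_continuous continuous_intros Ec cp1 cD that)+
  have y1: "(fourier_coeff W a n has_vector_derivative y' r) (at r)" if "r \<in> ?U" for r
  proof -
    have "((\<lambda>r. integral ?T (\<lambda>\<theta>. W (p r \<theta>) * E \<theta>)) has_vector_derivative y' r) (at r within ?U)"
      unfolding y'_def
      by (rule leibniz_rule_vector_derivative[OF _ _ cF1 that])
         (use ci in \<open>auto intro!: has_vector_derivative_mult_left dF\<close>)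
    thus ?thesis
      using that by (simp add: fourier_coeff_def[abs_def] p_def[abs_def] E_def[abs_def] at_within_open[of r ?U])
  qed
  have y2: "(y' has_vector_derivative y'' r) (at r)" if "r \<in> ?U" for r
  proof -
    have "((\<lambda>r. integral ?T (\<lambda>\<theta>. F1 r \<theta> * E \<theta>)) has_vector_derivative y'' r) (at r within ?U)"
      unfolding y''_def
      by (rule leibniz_rule_vector_derivative[OF _ _ cF2 that])
         (use ci in \<open>auto intro!: has_vector_derivative_mult_left dF1\<close>)
    thus ?thesis
      using that by (simp add: y'_def[abs_def] at_within_open[of r ?U])
  qed
  have eq: "y'' r = (of_real ((of_int n)\<^sup>2 / r\<^sup>2 - k\<^sup>2)) * fourier_coeff W a n r - y' r / of_real r" if r: "r \<in> ?U" for r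
  proof -
    have r0: "r > 0" using r r1 by auto
    \<comment> \<open>Both integrations by parts at once: this function of \<open>\<theta>\<close> has the periodic antiderivative \<open>(G1 + \<i> n W) E\<close>.\<close>
    have "((\<lambda>\<theta>. G2 r \<theta> * E \<theta> + (of_int n)\<^sup>2 * (W (p r \<theta>) * E \<theta>)) has_integral
       (G1 r (2*pi) + \<i> * of_int n * W (p r (2*pi))) * E (2*pi) - (G1 r 0 + \<i> * of_int n * W (p r 0)) * E 0) {0..2*pi}"
    proof (rule fundamental_theorem_of_calculus)
      fix \<theta> :: real
      have "((\<lambda>\<theta>. (G1 r \<theta> + \<i> * of_int n * W (p r \<theta>)) * E \<theta>) has_vector_derivative
         (G1 r \<theta> + \<i> * of_int n * W (p r \<theta>)) * (- (\<i> * of_int n) * E \<theta>) + (G2 r \<theta> + \<i> * of_int n * G1 r \<theta>) * E \<theta>) (at \<theta> within {0..2*pi})"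
        by (intro has_vector_derivative_mult has_vector_derivative_add has_vector_derivative_mult_right aG aF E r)
      thus "((\<lambda>\<theta>. (G1 r \<theta> + \<i> * of_int n * W (p r \<theta>)) * E \<theta>) has_vector_derivative
          G2 r \<theta> * E \<theta> + (of_int n)\<^sup>2 * (W (p r \<theta>) * E \<theta>)) (at \<theta> within {0..2*pi})"
        by (rule has_vector_derivative_eq_rhs) (simp add: algebra_simps power2_eq_square)
    qed simp
    moreover have "E (2*pi) = E 0"
    proof -
      have "sin (of_int n * (2 * pi)) = 0" "cos (of_int n * (2*pi)) = 1"
        using sin_int_2pin[of n] cos_int_2pin[of n] by (simp_all add: mult.commute)
      thus ?thesis by (simp add: E_def complex_eq_iff)
    qed
    moreover have "G1 r (2*pi) = G1 r 0" "p r (2*pi) = p r 0" by (simp_all add: G1_def p_def polar_2pi)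
    ultimately have "integral {0..2*pi} (\<lambda>\<theta>. G2 r \<theta> * E \<theta> + (of_int n)\<^sup>2 * (W (p r \<theta>) * E \<theta>)) = 0"
      by (simp add: integral_unique)
    hence ang: "integral ?T (\<lambda>\<theta>. G2 r \<theta> * E \<theta>) + (of_int n)\<^sup>2 * integral ?T (\<lambda>\<theta>. W (p r \<theta>) * E \<theta>) = 0"
      using ci[OF r] by (subst (asm) Henstock_Kurzweil_Integration.integral_add) (auto intro: integrable_on_mult_right)
    have pw: "F2 r \<theta> = - of_real (k\<^sup>2) * W (p r \<theta>) - F1 r \<theta> / of_real r - G2 r \<theta> / of_real (r\<^sup>2)" for \<theta>
    proof -
      have "DD e1 e1 (p r \<theta>) + DD e2 e2 (p r \<theta>) = - of_real (k\<^sup>2) * W (p r \<theta>)"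
        using H[OF pS[OF r, of \<theta>]] by (simp add: laplacian_plane DD_def add_eq_0_iff)
      moreover have "F2 r \<theta> + F1 r \<theta> / of_real r + G2 r \<theta> / of_real (r\<^sup>2)
          = of_real ((sin \<theta>)\<^sup>2 + (cos \<theta>)\<^sup>2) * (DD e1 e1 (p r \<theta>) + DD e2 e2 (p r \<theta>))"
      proof -
        obtain s c where sc: "sin \<theta> = s" "cos \<theta> = c" by blast
        show ?thesis unfolding F2_def F1_def G2_def sc
          using r0 by (simp add: scaleR_conv_of_real field_simps power2_eq_square)
      qed
      ultimately show ?thesis by (simp add: algebra_simps del: of_real_add of_real_power)
    qed
    have "y'' r = integral ?T (\<lambda>\<theta>. (- of_real (k\<^sup>2)) * (W (p r \<theta>) * E \<theta>) - (1 / of_real r) * (F1 r \<theta> * E \<theta>) - (1 / of_real (r\<^sup>2)) * (G2 r \<theta> * E \<theta>))"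
      unfolding y''_def pw by (rule integral_cong) (simp add: algebra_simps)
    also have "\<dots> = (- of_real (k\<^sup>2)) * integral ?T (\<lambda>\<theta>. W (p r \<theta>) * E \<theta>) - (1 / of_real r) * y' r - (1 / of_real (r\<^sup>2)) * integral ?T (\<lambda>\<theta>. G2 r \<theta> * E \<theta>)"
      using ci[OF r] unfolding y'_def
      by (simp only: Henstock_Kurzweil_Integration.integral_diff integrable_on_mult_right integrable_diff integral_mult_right)
    also have "integral ?T (\<lambda>\<theta>. G2 r \<theta> * E \<theta>) = - (of_int n)\<^sup>2 * integral ?T (\<lambda>\<theta>. W (p r \<theta>) * E \<theta>)"
      using ang by (simp add: add_eq_0_iff2)
    also have "integral ?T (\<lambda>\<theta>. W (p r \<theta>) * E \<theta>) = fourier_coeff W a n r"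
      by (simp add: fourier_coeff_def p_def E_def)
    finally show ?thesis by (simp add: algebra_simps)
  qed
  show ?thesis by (rule that[of y' y'']) (use y1 y2 eq in auto)
qed

text \<open>The factor \<open>sqrt t\<close> removes the first-order term of Bessel's equation, at the price of the shift of
\<open>m\<close> by \<open>1/4\<close>.  The functional \<open>L\<close> is the real or the imaginary part.\<close>

lemma fourier_coeff_equation_real:
  fixes y y' y'' :: "real \<Rightarrow> complex" and L :: "complex \<Rightarrow> real"
  assumes L: "bounded_linear L" and t: "t > 0"
    and y: "(y has_vector_derivative y' t) (at t)" "(y' has_vector_derivative y'' t) (at t)"
    and eq: "y'' t = of_real (m / t\<^sup>2 - k\<^sup>2) * y t - y' t / of_real t"
  shows "((\<lambda>t. sqrt t * L (y t)) has_real_derivative (L (y t) / (2 * sqrt t) + sqrt t * L (y' t))) (at t)"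
    and "((\<lambda>t. L (y t) / (2 * sqrt t) + sqrt t * L (y' t)) has_real_derivative
           ((m - 1/4) / t\<^sup>2 - k\<^sup>2) * (sqrt t * L (y t))) (at t)"
proof -
  have dL: "((\<lambda>t. L (y t)) has_real_derivative L (y' t)) (at t)" "((\<lambda>t. L (y' t)) has_real_derivative L (y'' t)) (at t)"
    using bounded_linear.has_vector_derivative[OF L y(1)] bounded_linear.has_vector_derivative[OF L y(2)]
    by (simp_all add: has_real_derivative_iff_has_vector_derivative)
  show "((\<lambda>t. sqrt t * L (y t)) has_real_derivative (L (y t) / (2 * sqrt t) + sqrt t * L (y' t))) (at t)"
    using t by (auto intro!: derivative_eq_intros dL simp: divide_simps)
  have "y'' t = (m / t\<^sup>2 - k\<^sup>2) *\<^sub>R y t - (1 / t) *\<^sub>R y' t" using eq by (simp add: scaleR_conv_of_real)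
  hence Leq: "L (y'' t) = (m / t\<^sup>2 - k\<^sup>2) * L (y t) - L (y' t) / t"
    using bounded_linear.linear[OF L] by (simp add: linear_diff linear_scale)
  have "((\<lambda>t. L (y t) / (2 * sqrt t) + sqrt t * L (y' t)) has_real_derivative
      (L (y' t) * (2 * sqrt t) - L (y t) * (2 * (inverse (sqrt t) / 2))) / (2 * sqrt t * (2 * sqrt t))
        + (inverse (sqrt t) / 2 * L (y' t) + L (y'' t) * sqrt t)) (at t)"
    using t by (auto intro!: derivative_eq_intros dL)
  moreover have "(L (y' t) * (2 * sqrt t) - L (y t) * (2 * (inverse (sqrt t) / 2))) / (2 * sqrt t * (2 * sqrt t))
        + (inverse (sqrt t) / 2 * L (y' t) + L (y'' t) * sqrt t) = ((m - 1/4) / t\<^sup>2 - k\<^sup>2) * (sqrt t * L (y t))"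
  proof -
    define s where "s = sqrt t"
    have s: "s > 0" "t = s * s" using t by (auto simp: s_def)
    show ?thesis unfolding Leq s_def[symmetric] using s(1)
      by (simp add: s(2) field_simps power2_eq_square)
  qed
  ultimately show "((\<lambda>t. L (y t) / (2 * sqrt t) + sqrt t * L (y' t)) has_real_derivative
           ((m - 1/4) / t\<^sup>2 - k\<^sup>2) * (sqrt t * L (y t))) (at t)" by simp
qed

lemma zero_on_circle_if_fourier_coeffs_zero:
  fixes W :: "real^2 \<Rightarrow> complex"
  assumes W: "continuous_on S W" and S: "\<And>\<theta>. a + r *\<^sub>R polar \<theta> \<in> S"
    and z: "\<And>n. fourier_coeff W a n r = 0" and x: "norm (x - a) = r" and r: "r > 0"
  shows "W x = 0"
proof -
  have "W (a + r *\<^sub>R ((x - a) /\<^sub>R r)) = 0"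
  proof (rule fourier_coeffs_zero_imp_zero[of "\<lambda>e. W (a + r *\<^sub>R e)"])
    show "continuous_on (sphere 0 1) (\<lambda>e. W (a + r *\<^sub>R e))"
    proof (rule continuous_on_compose2[OF W])
      show "(\<lambda>e. a + r *\<^sub>R e) ` sphere 0 1 \<subseteq> S"
      proof clarify
        fix e :: "real^2" assume "e \<in> sphere 0 1"
        moreover obtain \<theta> where "e = norm e *\<^sub>R polar \<theta>" using polar_surj by blast
        ultimately show "a + r *\<^sub>R e \<in> S" using S[of \<theta>] by simp
      qed
    qed (intro continuous_intros)
    show "integral {0..2 * pi} (\<lambda>\<theta>. W (a + r *\<^sub>R polar \<theta>) * cis (- (real_of_int n * \<theta>))) = 0" for n
      using z[of n] by (simp add: fourier_coeff_def)
    show "norm ((x - a) /\<^sub>R r) = 1" using x r by simp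
  qed
  thus ?thesis using r by simp
qed

text \<open>All Fourier coefficients about \<open>a\<close> vanish for radii below \<open>\<epsilon>\<close>, in particular they have zero Cauchy
data at \<open>\<epsilon>/2\<close>, and the radial equation propagates this up to radius \<open>d\<close>.\<close>

theorem helmholtz_unique_continuation_ball:
  fixes W :: "real^2 \<Rightarrow> complex"
  assumes k: "k > 0" and W: "Ck 2 (ball a d) W"
    and H: "\<And>x. x \<in> ball a d \<Longrightarrow> laplacian W x + of_real (k\<^sup>2) * W x = 0"
    and \<epsilon>: "\<epsilon> > 0" and z: "\<And>x. x \<in> ball a \<epsilon> \<Longrightarrow> W x = 0" and x: "x \<in> ball a d"
  shows "W x = 0"
proof (cases "norm (x - a) < \<epsilon>")
  case True
  thus ?thesis using z by (simp add: dist_norm norm_minus_commute)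
next
  case False
  define t where "t = norm (x - a)"
  have t: "\<epsilon> \<le> t" "t < d" using False x by (auto simp: t_def dist_norm norm_minus_commute)
  have sub: "a + r *\<^sub>R polar \<theta> \<in> ball a d" if "0 < r" "r < d" for r \<theta> using that by (simp add: dist_norm)
  have "fourier_coeff W a n t = 0" for n
  proof -
    obtain y' y'' where y:
      "\<And>r. 0 < r \<Longrightarrow> r < d \<Longrightarrow> (fourier_coeff W a n has_vector_derivative y' r) (at r)"
      "\<And>r. 0 < r \<Longrightarrow> r < d \<Longrightarrow> (y' has_vector_derivative y'' r) (at r)"
      "\<And>r. 0 < r \<Longrightarrow> r < d \<Longrightarrow> y'' r = (of_real ((of_int n)\<^sup>2 / r\<^sup>2 - k\<^sup>2)) * fourier_coeff W a n r - y' r / of_real r"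
      using fourier_coeff_radial_equation[OF open_ball W H sub] by (metis order_refl)
    have y0: "fourier_coeff W a n r = 0" if "0 < r" "r < \<epsilon>" for r
      using z that by (simp add: fourier_coeff_def dist_norm)
    have y'0: "y' (\<epsilon>/2) = 0"
    proof -
      have "((\<lambda>_. 0) has_vector_derivative y' (\<epsilon>/2)) (at (\<epsilon>/2))"
        by (rule has_vector_derivative_transform_within_open[OF y(1), of "\<epsilon>/2" "{0<..<\<epsilon>}"])
           (use \<epsilon> t y0 in auto)
      thus ?thesis using vector_derivative_unique_at[OF _ has_vector_derivative_const] by blast
    qed
    have L0: "L (fourier_coeff W a n t) = 0" if L: "bounded_linear L" for L :: "complex \<Rightarrow> real"
    proof -
      have "sqrt t * L (fourier_coeff W a n t) = 0"
      proof (rule radial_equation_unique[OF k, of 0 "\<epsilon>/2" d t "\<lambda>t. sqrt t * L (fourier_coeff W a n t)"])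
        show "((\<lambda>t. sqrt t * L (fourier_coeff W a n t)) has_real_derivative
             (L (fourier_coeff W a n s) / (2 * sqrt s) + sqrt s * L (y' s))) (at s)" if "0 < s" "s < d" for s
          by (rule fourier_coeff_equation_real(1)[where y="fourier_coeff W a n" and y'=y' and y''=y'' and t=s, OF L that(1) y(1)[OF that] y(2)[OF that] y(3)[OF that]])
        show "((\<lambda>t. L (fourier_coeff W a n t) / (2 * sqrt t) + sqrt t * L (y' t)) has_real_derivative
           (((of_int n)\<^sup>2 - 1/4) / s\<^sup>2 - k\<^sup>2) * (sqrt s * L (fourier_coeff W a n s))) (at s)" if "0 < s" "s < d" for s
          by (rule fourier_coeff_equation_real(2)[where y="fourier_coeff W a n" and y'=y' and y''=y'' and t=s, OF L that(1) y(1)[OF that] y(2)[OF that] y(3)[OF that]])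
      qed (use t \<epsilon> y0[of "\<epsilon>/2"] y'0 linear_0[OF bounded_linear.linear[OF L]] in auto)
      thus ?thesis using t \<epsilon> by simp
    qed
    show ?thesis using L0[OF bounded_linear_Re] L0[OF bounded_linear_Im] by (simp add: complex_eq_iff)
  qed
  thus ?thesis
    by (intro zero_on_circle_if_fourier_coeffs_zero[where r=t and a=a, OF Ck_imp_continuous_on[OF W] sub])
       (use t \<epsilon> in \<open>auto simp: t_def\<close>)
qed

text \<open>Rellich's lemma.  Decay of \<open>sqrt |x| W\<close> makes \<open>sqrt r\<close> times each Fourier coefficient tend to zero, which
only the zero solution of the radial equation does.\<close>

theorem helmholtz_rellich:
  fixes W :: "real^2 \<Rightarrow> complex"
  assumes k: "k > 0" and R: "R \<ge> 0" and W: "Ck 2 (- cball 0 R) W"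
    and H: "\<And>x. norm x > R \<Longrightarrow> laplacian W x + of_real (k\<^sup>2) * W x = 0"
    and decay: "((\<lambda>x. sqrt (norm x) * norm (W x)) \<longlongrightarrow> 0) at_infinity"
    and x: "norm x > R"
  shows "W x = 0"
proof -
  define t where "t = norm x"
  have t: "R < t" "t > 0" using x R by (auto simp: t_def)
  have sub: "0 + r *\<^sub>R polar \<theta> \<in> - cball 0 R" if "R < r" for r \<theta> using that R by simp
  have opn: "open (- cball 0 R :: (real^2) set)" by auto
  have "fourier_coeff W 0 n t = 0" for n
  proof -
    have "\<exists>y' y''. \<forall>r\<in>{R<..<r2}. (fourier_coeff W 0 n has_vector_derivative y' r) (at r)
      \<and> (y' has_vector_derivative y'' r) (at r)
      \<and> y'' r = (of_real ((of_int n)\<^sup>2 / r\<^sup>2 - k\<^sup>2)) * fourier_coeff W 0 n r - y' r / of_real r" for r2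
      using fourier_coeff_radial_equation[OF opn W H sub R, of r2 n]
      by (metis ComplD greaterThanLessThan_iff mem_cball_0 not_le)
    then obtain Y' Y'' where Y: "\<And>r2 r. R < r \<Longrightarrow> r < r2 \<Longrightarrow> (fourier_coeff W 0 n has_vector_derivative Y' r2 r) (at r)"
      "\<And>r2 r. R < r \<Longrightarrow> r < r2 \<Longrightarrow> (Y' r2 has_vector_derivative Y'' r2 r) (at r)"
      "\<And>r2 r. R < r \<Longrightarrow> r < r2 \<Longrightarrow> Y'' r2 r = (of_real ((of_int n)\<^sup>2 / r\<^sup>2 - k\<^sup>2)) * fourier_coeff W 0 n r - Y' r2 r / of_real r"
      by (metis greaterThanLessThan_iff)
    \<comment> \<open>The derivatives are obtained on bounded ranges of radii; uniqueness of derivatives glues them.\<close>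
    define y' where "y' r = Y' (r + 1) r" for r
    define y'' where "y'' r = Y'' (r + 1) r" for r
    have uniq: "Y' r2 r = y' r" if "R < r" "r < r2" for r r2
      using vector_derivative_unique_at[OF Y(1)[OF that] Y(1)[of r "r + 1"]] that by (simp add: y'_def)
    have y: "(fourier_coeff W 0 n has_vector_derivative y' r) (at r)"
       "(y' has_vector_derivative y'' r) (at r)"
       "y'' r = (of_real ((of_int n)\<^sup>2 / r\<^sup>2 - k\<^sup>2)) * fourier_coeff W 0 n r - y' r / of_real r" if r: "R < r" for r
    proof -
      show "(fourier_coeff W 0 n has_vector_derivative y' r) (at r)"
        using Y(1)[of r "r + 1"] r by (simp add: y'_def)
      show "(y' has_vector_derivative y'' r) (at r)"
        by (rule has_vector_derivative_transform_within_open[of "Y' (r+1)" _ _ "{R<..<r+1}"])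
           (use Y(2)[of r "r+1"] r uniq in \<open>auto simp: y''_def\<close>)
      show "y'' r = (of_real ((of_int n)\<^sup>2 / r\<^sup>2 - k\<^sup>2)) * fourier_coeff W 0 n r - y' r / of_real r"
        using Y(3)[of r "r + 1"] r by (simp add: y'_def y''_def)
    qed
    have lim: "((\<lambda>r. sqrt r * norm (fourier_coeff W 0 n r)) \<longlongrightarrow> 0) at_top"
    proof (rule tendstoI)
      fix e :: real assume e: "e > 0"
      define d where "d = e / (4 * pi)"
      have d: "d > 0" using e by (simp add: d_def)
      obtain B where B: "\<And>x. norm x \<ge> B \<Longrightarrow> sqrt (norm x) * norm (W x) < d"
        using decay d unfolding tendsto_iff eventually_at_infinity by (auto simp: dist_norm)
      have "sqrt r * norm (fourier_coeff W 0 n r) < e" if r: "r > max (max B R) 1" for r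
      proof -
        have cont: "continuous_on (cbox 0 (2*pi)) (\<lambda>\<theta>. W (0 + r *\<^sub>R polar \<theta>) * cis (- (real_of_int n * \<theta>)))"
          by (intro continuous_intros continuous_on_compose2[OF Ck_imp_continuous_on[OF W]]) (use sub r in auto)
        have bnd: "norm (W (0 + r *\<^sub>R polar \<theta>) * cis (- (real_of_int n * \<theta>))) \<le> d / sqrt r" for \<theta>
          using B[of "r *\<^sub>R polar \<theta>"] r by (simp add: norm_mult field_simps)
        have "norm (fourier_coeff W 0 n r) \<le> d / sqrt r * (2 * pi - 0)"
          using integral_bound[of 0 "2 * pi", OF _ cont[unfolded cbox_interval] bnd]
          unfolding fourier_coeff_def cbox_interval by simp
        hence "sqrt r * norm (fourier_coeff W 0 n r) \<le> sqrt r * (d / sqrt r * (2 * pi))"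
          using r by (intro mult_left_mono) auto
        also have "\<dots> < e" using r e by (simp add: d_def)
        finally show ?thesis .
      qed
      moreover have "dist (sqrt r * norm (fourier_coeff W 0 n r)) 0 = sqrt r * norm (fourier_coeff W 0 n r)"
        if "r > max (max B R) 1" for r
        using that by (simp add: dist_norm abs_mult)
      ultimately show "\<forall>\<^sub>F r in at_top. dist (sqrt r * norm (fourier_coeff W 0 n r)) 0 < e"
        unfolding eventually_at_top_dense by (intro exI[of _ "max (max B R) 1"]) simp
    qed
    have L0: "L (fourier_coeff W 0 n t) = 0" if L: "bounded_linear L" and L1: "\<And>z. \<bar>L z\<bar> \<le> norm z" for L :: "complex \<Rightarrow> real"
    proof -
      have "sqrt t * L (fourier_coeff W 0 n t) = 0"
      proof (rule radial_equation_decay[OF k R t(1), of "\<lambda>t. sqrt t * L (fourier_coeff W 0 n t)"])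
        show "((\<lambda>t. sqrt t * L (fourier_coeff W 0 n t)) has_real_derivative
             (L (fourier_coeff W 0 n s) / (2 * sqrt s) + sqrt s * L (y' s))) (at s)" if "R < s" for s
          by (rule fourier_coeff_equation_real(1)[where y="fourier_coeff W 0 n" and y'=y' and y''=y'' and t=s, OF L _ y(1)[OF that] y(2)[OF that] y(3)[OF that]]) (use that R in simp)
        show "((\<lambda>t. L (fourier_coeff W 0 n t) / (2 * sqrt t) + sqrt t * L (y' t)) has_real_derivative
           (((of_int n)\<^sup>2 - 1/4) / s\<^sup>2 - k\<^sup>2) * (sqrt s * L (fourier_coeff W 0 n s))) (at s)" if "R < s" for s
          by (rule fourier_coeff_equation_real(2)[where y="fourier_coeff W 0 n" and y'=y' and y''=y'' and t=s, OF L _ y(1)[OF that] y(2)[OF that] y(3)[OF that]]) (use that R in simp)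
        show "((\<lambda>t. sqrt t * L (fourier_coeff W 0 n t)) \<longlongrightarrow> 0) at_top"
          by (rule tendsto_0_le[OF lim, of _ 1])
             (use L1 in \<open>auto simp: abs_mult eventually_at_top_linorder intro!: exI[of _ 0] mult_left_mono\<close>)
      qed
      thus ?thesis using t by simp
    qed
    show ?thesis
      using L0[OF bounded_linear_Re abs_Re_le_cmod] L0[OF bounded_linear_Im abs_Im_le_cmod] by (simp add: complex_eq_iff)
  qed
  thus ?thesis
    by (intro zero_on_circle_if_fourier_coeffs_zero[where r=t and a=0, OF Ck_imp_continuous_on[OF W] sub])
       (use t in \<open>auto simp: t_def\<close>)
qed

section \<open>Logarithmic potentials\<close>

lemma cball_in_borel [measurable]: "cball a r \<in> sets borel"
  by simp

text \<open>The function is dominated by the sum over \<open>n\<close> of \<open>a n\<close> times the indicator of the ball of radius \<open>r n\<close>.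
With radii shrinking this handles a singularity at the origin, with radii growing a tail at infinity.\<close>

lemma integrable_dyadic:
  fixes f :: "real^2 \<Rightarrow> real"
  assumes m: "f \<in> borel_measurable borel" and nn: "\<And>n. a n \<ge> 0" "\<And>n. r n \<ge> 0"
    and s: "summable (\<lambda>n::nat. a n * (r n)\<^sup>2)"
    and b: "\<And>z. z \<noteq> 0 \<Longrightarrow> f z \<noteq> 0 \<Longrightarrow> \<exists>n. norm z \<le> r n \<and> \<bar>f z\<bar> \<le> a n"
  shows "integrable lborel f"
proof -
  let ?v = "unit_ball_vol (real DIM(real^2))"
  have "(\<integral>\<^sup>+z. ennreal (norm (f z)) \<partial>lborel) \<le> (\<integral>\<^sup>+(z::real^2). (\<Sum>n. ennreal (a n) * indicator (cball 0 (r n)) z) \<partial>lborel)"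
  proof (rule nn_integral_mono_AE)
    have "AE z in lborel. (z::real^2) \<noteq> 0" by (rule AE_lborel_singleton)
    thus "AE z in lborel. ennreal (norm (f z)) \<le> (\<Sum>n. ennreal (a n) * indicator (cball 0 (r n)) z)"
    proof eventually_elim
      case (elim z)
      show ?case
      proof (cases "f z = 0")
        case False
        then obtain n where n: "norm z \<le> r n" "\<bar>f z\<bar> \<le> a n" using b elim by blast
        define F where "F n = ennreal (a n) * indicator (cball 0 (r n)) z" for n
        have "ennreal (norm (f z)) \<le> F n"
          using n by (simp add: ennreal_leI F_def)
        also have "\<dots> = (\<Sum>m\<in>{n}. F m)" by simp
        also have "\<dots> \<le> (\<Sum>n. F n)" by (rule sum_le_suminf) auto
        finally show ?thesis by (simp only: F_def)
      qed simp
    qed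
  qed
  also have "\<dots> = (\<Sum>n. ennreal (a n) * emeasure lborel (cball (0::real^2) (r n)))"
    by (subst nn_integral_suminf) (auto simp: nn_integral_cmult_indicator)
  also have "\<dots> = (\<Sum>n. ennreal (?v * (a n * (r n)\<^sup>2)))"
    using nn by (intro suminf_cong) (simp add: emeasure_cball ennreal_mult[symmetric] mult_ac)
  also have "\<dots> = ennreal (\<Sum>n. ?v * (a n * (r n)\<^sup>2))"
    using nn s by (intro suminf_ennreal2) (auto intro!: summable_mult)
  also have "\<dots> < \<infinity>" by simp
  finally show ?thesis using m by (intro integrableI_bounded) auto
qed

lemma integrable_norm_powr_near_0:
  assumes "0 < s" "s \<le> 2"
  shows "integrable lborel (\<lambda>z::real^2. indicator (cball 0 1) z * norm z powr (s - 2))"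
proof (rule integrable_dyadic[where r="\<lambda>n. (1/2) ^ n" and a="\<lambda>n. ((1/2) ^ Suc n) powr (s - 2)"])
  have eq: "((1/2) ^ Suc n) powr (s - 2) * ((1/2) ^ n)\<^sup>2 = (1/2) powr (s - 2) * ((1/2) powr s) ^ n" for n
  proof -
    have "((1/2) ^ Suc n) powr (s - 2) * ((1/2) ^ n)\<^sup>2 = (1/2) powr (real (Suc n) * (s - 2)) * (1/2) powr (real (2 * n))"
      by (simp only: powr_realpow[symmetric] powr_powr power_mult[symmetric] mult.commute[of n 2])
         (simp add: powr_realpow[symmetric] powr_powr powr_power mult.commute flip: powr_numeral)
    also have "\<dots> = (1/2) powr (s - 2) * (1/2) powr (s * real n)"
      by (simp add: powr_add[symmetric] algebra_simps)
    finally show ?thesis by (simp add: powr_powr[symmetric] powr_realpow)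
  qed
  have "(1/2::real) powr s < 1" using assms(1) by (simp add: powr_divide gr_one_powr)
  thus "summable (\<lambda>n. ((1/2) ^ Suc n) powr (s - 2) * ((1/2::real) ^ n)\<^sup>2)"
    unfolding eq by (intro summable_mult summable_geometric) simp
  fix z :: "real^2" assume z: "z \<noteq> 0" "indicator (cball 0 1) z * norm z powr (s - 2) \<noteq> 0"
  hence z1: "norm z \<le> 1" by (auto simp: indicator_def split: if_splits)
  obtain m where "(1/2) ^ m < norm z" using real_arch_pow_inv[of "norm z" "1/2"] z by auto
  define N where "N = (LEAST m. (1/2) ^ m < norm z)"
  have N: "(1/2) ^ N < norm z" unfolding N_def by (rule LeastI) fact
  have "N \<noteq> 0" using N z1 by (cases N) auto
  then obtain n where n: "N = Suc n" by (cases N) auto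
  have "norm z \<le> (1/2) ^ n" using not_less_Least[of n "\<lambda>m. (1/2) ^ m < norm z"] n by (simp add: N_def)
  moreover have "norm z powr (s - 2) \<le> ((1/2) ^ Suc n) powr (s - 2)"
    using N n assms(2) by (intro powr_mono2') auto
  ultimately show "\<exists>n. norm z \<le> (1/2) ^ n \<and> \<bar>indicator (cball 0 1) z * norm z powr (s - 2)\<bar> \<le> ((1/2) ^ Suc n) powr (s - 2)"
    using z1 by auto
qed auto

text \<open>Up to scaling, all the approximate identities \<open>smooth_delta\<close> below are this function.\<close>

lemma integrable_poisson_kernel:
  "integrable lborel (\<lambda>z::real^2. 4 / ((norm z)\<^sup>2 + 1)\<^sup>2)"
proof (rule integrable_dyadic[where r="\<lambda>n. 2 ^ Suc n" and a="\<lambda>n. 4 * (1/16) ^ n"])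
  have eq: "4 * (1/16::real) ^ n * (2 ^ Suc n)\<^sup>2 = 16 * (1/4) ^ n" for n
  proof -
    have "(2 ^ Suc n)\<^sup>2 = 4 * (4::real) ^ n" by (simp add: power_mult_distrib power2_eq_square power_mult[symmetric] flip: power_mult_distrib)
    moreover have "(1/16::real) ^ n * 4 ^ n = (1/4) ^ n" by (simp flip: power_mult_distrib)
    ultimately show ?thesis by simp
  qed
  show "summable (\<lambda>n. 4 * (1/16::real) ^ n * (2 ^ Suc n)\<^sup>2)"
    unfolding eq by (intro summable_mult summable_geometric) simp
  fix z :: "real^2"
  obtain m where "norm z < 2 ^ m" using real_arch_pow[of 2 "norm z"] by auto
  define N where "N = (LEAST m. norm z < 2 ^ m)"
  have N: "norm z < 2 ^ N" unfolding N_def by (rule LeastI) fact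
  have pos: "(norm z)\<^sup>2 + 1 > 0" by (simp add: add_nonneg_pos)
  show "\<exists>n. norm z \<le> 2 ^ Suc n \<and> \<bar>4 / ((norm z)\<^sup>2 + 1)\<^sup>2\<bar> \<le> 4 * (1/16) ^ n"
  proof (cases N)
    case 0
    have "1 \<le> ((norm z)\<^sup>2 + 1)\<^sup>2" by (rule one_le_power) simp
    thus ?thesis using 0 N by (intro exI[of _ 0]) (auto simp: divide_simps)
  next
    case (Suc n)
    have "2 ^ n \<le> norm z" using not_less_Least[of n "\<lambda>m. norm z < 2 ^ m"] Suc by (simp add: N_def)
    hence "(2 ^ n)\<^sup>2 \<le> (norm z)\<^sup>2" by (intro power_mono) auto
    hence "(2 ^ n)\<^sup>2 \<le> (norm z)\<^sup>2 + 1" by linarith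
    hence "((2 ^ n)\<^sup>2)\<^sup>2 \<le> ((norm z)\<^sup>2 + 1)\<^sup>2" by (intro power_mono) auto
    moreover have "((2 ^ n)\<^sup>2)\<^sup>2 = (16::real) ^ n" by (simp add: power_mult[symmetric] mult.commute[of n]) (simp add: power_mult)
    ultimately have "4 / ((norm z)\<^sup>2 + 1)\<^sup>2 \<le> 4 / 16 ^ n" using pos by (intro divide_left_mono) auto
    thus ?thesis using N Suc by (intro exI[of _ n]) (auto simp: power_one_over)
  qed
qed auto

lemma lborel_integral_affine:
  fixes f :: "'a::euclidean_space \<Rightarrow> 'b::{banach, second_countable_topology}"
  assumes [measurable]: "f \<in> borel_measurable borel" and c: "c \<noteq> 0"
  shows "(\<integral>x. f x \<partial>lborel) = \<bar>c\<bar> ^ DIM('a) *\<^sub>R (\<integral>x. f (t + c *\<^sub>R x) \<partial>lborel)"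
proof -
  have "(\<integral>x. f x \<partial>lborel) = (\<integral>x. f x \<partial>density (distr lborel borel (\<lambda>x. t + c *\<^sub>R x)) (\<lambda>_. ennreal (\<bar>c\<bar> ^ DIM('a))))"
    using lborel_affine[OF c, of t] by (simp add: ennreal_power)
  also have "\<dots> = (\<integral>x. \<bar>c\<bar> ^ DIM('a) *\<^sub>R f (t + c *\<^sub>R x) \<partial>lborel)"
    by (subst integral_density) (auto simp: integral_distr)
  finally show ?thesis by simp
qed

lemma lborel_integrable_translate:
  fixes f :: "'a::euclidean_space \<Rightarrow> 'b::{banach, second_countable_topology}"
  assumes "integrable lborel f"
  shows "integrable lborel (\<lambda>y. f (y - x))"
proof -
  have [measurable]: "f \<in> borel_measurable borel" using assms by auto
  have "integrable (distr lborel borel ((+) (- x))) f" using assms by (simp add: lborel_distr_plus)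
  thus ?thesis by (subst (asm) integrable_distr_eq) (auto simp: algebra_simps)
qed

text \<open>The bound does not depend on \<open>x\<close>: the integrand is at most \<open>1\<close> outside the unit ball about \<open>x\<close>, and the
integral over that ball is translation invariant.\<close>

lemma integrable_inverse_norm:
  fixes x :: "real^2" and R :: real
  shows "integrable lborel (\<lambda>y. indicator (cball 0 R) y * inverse (norm (y - x)))" (is "integrable lborel ?f")
    and "(\<integral>y. indicator (cball 0 R) y * inverse (norm (y - x)) \<partial>lborel) \<le>
       measure lborel (cball (0::real^2) R) + (\<integral>z. indicator (cball 0 1) z * inverse (norm (z::real^2)) \<partial>lborel)"
proof -
  let ?g = "\<lambda>z::real^2. indicator (cball 0 1) z * inverse (norm z)"
  have eqg: "?g = (\<lambda>z. indicator (cball 0 1) z * norm z powr (1 - 2))"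
    by (rule ext) (simp add: powr_minus)
  have g: "integrable lborel ?g" unfolding eqg by (rule integrable_norm_powr_near_0) auto
  have gx: "integrable lborel (\<lambda>y. ?g (y - x))" using lborel_integrable_translate[OF g] .
  have ind: "integrable lborel (\<lambda>y::real^2. indicator (cball 0 R) y :: real)"
    using borel_integrable_compact[of "cball (0::real^2) R" "\<lambda>_. 1::real"] by simp
  have le: "?f y \<le> indicator (cball 0 R) y + ?g (y - x)" for y
  proof (cases "norm (y - x) \<le> 1")
    case False
    hence "inverse (norm (y - x)) \<le> 1" by (simp add: divide_simps)
    thus ?thesis by (auto simp: indicator_def)
  qed (auto simp: indicator_def)
  have [measurable]: "?f \<in> borel_measurable borel"
    by (intro borel_measurable_times borel_measurable_indicator borel_measurable_inverse
         borel_measurable_continuous_onI continuous_intros) auto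
  show 1: "integrable lborel ?f"
    by (rule Bochner_Integration.integrable_bound[OF Bochner_Integration.integrable_add[OF ind gx]])
       (use le in \<open>auto simp: abs_of_nonneg intro!: AE_I2 order_trans[OF _ abs_ge_self]\<close>)
  have "integral\<^sup>L lborel ?f \<le> (\<integral>y. indicator (cball 0 R) y + ?g (y - x) \<partial>lborel)"
    using le by (intro integral_mono 1 Bochner_Integration.integrable_add ind gx) auto
  also have "\<dots> = measure lborel (cball (0::real^2) R) + (\<integral>y. ?g (y - x) \<partial>lborel)"
    using ind gx by (simp add: emeasure_cball)
  also have "(\<integral>y. ?g (y - x) \<partial>lborel) = (\<integral>z. ?g z \<partial>lborel)"
    using lborel_integral_translate[of ?g "- x"] borel_measurable_integrable[OF g] by simp
  finally show "integral\<^sup>L lborel ?f \<le> measure lborel (cball (0::real^2) R) + (\<integral>z. ?g z \<partial>lborel)" .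
qed

text \<open>The source of the Hoelder exponent \<open>1/2\<close>: \<open>ln t \<le> 2 sqrt (t - 1)\<close> for \<open>t \<ge> 1\<close>.\<close>

lemma ln_diff_le_sqrt:
  fixes a b :: real
  assumes "b > 0" "a \<ge> b"
  shows "ln a - ln b \<le> 2 * sqrt (a - b) / sqrt b"
proof -
  define t where "t = a / b"
  have t: "t \<ge> 1" using assms by (simp add: t_def)
  have "ln a - ln b = ln t" using assms by (simp add: t_def ln_div)
  also have "\<dots> = 2 * ln (sqrt t)" using t by (simp add: ln_sqrt)
  also have "\<dots> \<le> 2 * (sqrt t - 1)" using ln_le_minus_one[of "sqrt t"] t by simp
  also have "sqrt t \<le> 1 + sqrt (t - 1)" using sqrt_add_le_add_sqrt[of 1 "t - 1"] t by simp
  hence "2 * (sqrt t - 1) \<le> 2 * sqrt (t - 1)" by simp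
  also have "t - 1 = (a - b) / b" using assms by (simp add: t_def diff_divide_distrib)
  finally show ?thesis by (simp add: real_sqrt_divide)
qed

text \<open>For \<open>\<delta> = 0\<close> this is \<open>2 ln |u|\<close>, a multiple of the fundamental solution of the Laplacian; for \<open>\<delta> > 0\<close>
it is a smooth approximation.\<close>

definition log_kernel :: "real \<Rightarrow> real^2 \<Rightarrow> real" where
  "log_kernel \<delta> u = ln ((norm u)\<^sup>2 + \<delta>\<^sup>2)"

lemma log_kernel_measurable [measurable]: "log_kernel \<delta> \<in> borel_measurable borel"
  unfolding log_kernel_def[abs_def] by measurable

text \<open>The quotient bound of \<open>ln_diff_le_sqrt\<close> is applied to \<open>sqrt (|u|\<^sup>2 + \<delta>\<^sup>2)\<close>, which depends on \<open>u\<close> with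
Lipschitz constant \<open>1\<close> and is at least \<open>|u|\<close>.\<close>

lemma log_kernel_diff:
  assumes "u \<noteq> 0" "v \<noteq> 0"
  shows "\<bar>log_kernel \<delta> u - log_kernel \<delta> v\<bar> \<le> 4 * sqrt (norm (u - v)) * (inverse (sqrt (norm u)) + inverse (sqrt (norm v)))"
proof -
  have one: "log_kernel \<delta> u - log_kernel \<delta> v \<le> 4 * sqrt (norm (u - v)) * inverse (sqrt (norm v))"
    if "v \<noteq> 0" "norm v \<le> norm u" for u v
  proof -
    define a where "a = sqrt ((norm u)\<^sup>2 + \<delta>\<^sup>2)"
    define b where "b = sqrt ((norm v)\<^sup>2 + \<delta>\<^sup>2)"
    have nv: "norm v > 0" using that by simp
    have bv: "b \<ge> norm v" unfolding b_def by (simp add: real_le_rsqrt)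
    have ab: "a \<ge> b" unfolding a_def b_def using that by (auto intro: power_mono)
    have "norm u > 0" using nv that by linarith
    hence "(norm v)\<^sup>2 > 0" "(norm u)\<^sup>2 > 0" using nv by simp_all
    hence pos: "(norm v)\<^sup>2 + \<delta>\<^sup>2 > 0" "(norm u)\<^sup>2 + \<delta>\<^sup>2 > 0"
      using add_pos_nonneg[OF _ zero_le_power2] by blast+
    have "a - b \<le> norm u - norm v"
    proof -
      have "(a - b) * (a + b) = (norm u - norm v) * (norm u + norm v)"
        using pos by (simp add: a_def b_def algebra_simps power2_eq_square[symmetric])
      moreover have "norm u \<le> a" unfolding a_def by (simp add: real_le_rsqrt)
      hence "norm u + norm v \<le> a + b" using bv by simp
      hence "(norm u - norm v) * (norm u + norm v) \<le> (norm u - norm v) * (a + b)"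
        using that by (intro mult_left_mono) auto
      ultimately have "(a - b) * (a + b) \<le> (norm u - norm v) * (a + b)" by simp
      moreover have "a + b > 0" using nv bv ab by linarith
      ultimately show ?thesis by simp
    qed
    also have "\<dots> \<le> norm (u - v)" by (rule norm_triangle_ineq2)
    finally have ab2: "a - b \<le> norm (u - v)" .
    have "log_kernel \<delta> u - log_kernel \<delta> v = 2 * (ln a - ln b)"
      using pos by (simp add: log_kernel_def a_def b_def ln_sqrt)
    also have "\<dots> \<le> 2 * (2 * sqrt (a - b) / sqrt b)"
      using ln_diff_le_sqrt[of b a] ab bv nv by simp
    also have "\<dots> \<le> 2 * (2 * sqrt (norm (u - v)) / sqrt (norm v))"
      using ab2 bv nv by (intro mult_left_mono frac_le) auto
    finally show ?thesis by (simp add: divide_inverse)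
  qed
  have nn: "0 \<le> 4 * sqrt (norm (u - v)) * inverse (sqrt (norm u))" "0 \<le> 4 * sqrt (norm (u - v)) * inverse (sqrt (norm v))"
    by auto
  have mono: "log_kernel \<delta> v \<le> log_kernel \<delta> u" if "v \<noteq> 0" "norm v \<le> norm u" for u v
  proof -
    have "(norm v)\<^sup>2 > 0" using that by simp
    hence "(norm v)\<^sup>2 + \<delta>\<^sup>2 > 0" using add_pos_nonneg[OF _ zero_le_power2] by blast
    moreover have "(norm v)\<^sup>2 \<le> (norm u)\<^sup>2" using that by (intro power_mono) auto
    ultimately show ?thesis unfolding log_kernel_def by (intro ln_mono) auto
  qed
  show ?thesis
  proof (cases "norm v \<le> norm u")
    case True
    thus ?thesis using one[OF assms(2) True] mono[OF assms(2) True] nn by (simp only: distrib_left; linarith)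
  next
    case False
    hence le: "norm u \<le> norm v" by simp
    show ?thesis using one[OF assms(1) le] mono[OF assms(1) le] nn
      unfolding distrib_left norm_minus_commute[of v u] by linarith
  qed
qed

lemma log_kernel_bound:
  assumes "u \<noteq> 0" "0 \<le> \<delta>" "\<delta> \<le> 1"
  shows "\<bar>log_kernel \<delta> u\<bar> \<le> (norm u)\<^sup>2 + 4 * inverse (sqrt (norm u))"
proof -
  have nu: "norm u > 0" using assms by simp
  hence nu2: "(norm u)\<^sup>2 > 0" by simp
  have "\<delta>\<^sup>2 \<le> 1" using assms by (simp add: power_le_one)
  moreover have "(norm u)\<^sup>2 + \<delta>\<^sup>2 > 0" using add_pos_nonneg[OF nu2 zero_le_power2] .
  ultimately have "ln ((norm u)\<^sup>2 + \<delta>\<^sup>2) \<le> ln (1 + (norm u)\<^sup>2)" by (intro ln_mono) auto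
  also have "\<dots> \<le> (norm u)\<^sup>2" by (rule ln_add_one_self_le_self) simp
  finally have up: "log_kernel \<delta> u \<le> (norm u)\<^sup>2" by (simp add: log_kernel_def)
  have "- ln (sqrt (norm u)) = ln (inverse (sqrt (norm u)))" using nu by (simp add: ln_inverse)
  also have "\<dots> \<le> inverse (sqrt (norm u)) - 1" using nu by (intro ln_le_minus_one) simp
  finally have "- (4 * inverse (sqrt (norm u))) \<le> 4 * ln (sqrt (norm u))" by simp
  also have "\<dots> = ln ((norm u)\<^sup>2)" using nu by (simp add: ln_sqrt ln_realpow)
  also have "\<dots> \<le> log_kernel \<delta> u" using nu2 unfolding log_kernel_def by (intro ln_mono) auto
  finally have "- (4 * inverse (sqrt (norm u))) \<le> log_kernel \<delta> u" .
  moreover have "0 \<le> inverse (sqrt (norm u))" by simp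
  ultimately show ?thesis using up nu2 unfolding abs_le_iff by linarith
qed

text \<open>The Laplacian of \<open>log_kernel \<delta>\<close>.  It equals \<open>smooth_delta 1 (u / \<delta>) / \<delta>\<^sup>2\<close>, so in the plane its
integral is the same for all \<open>\<delta>\<close>, and it concentrates at the origin.\<close>

definition smooth_delta :: "real \<Rightarrow> real^2 \<Rightarrow> real" where
  "smooth_delta \<delta> u = 4 * \<delta>\<^sup>2 / ((norm u)\<^sup>2 + \<delta>\<^sup>2)\<^sup>2"

lemma Ck_log_kernel:
  assumes "\<delta> > 0"
  shows "Ck n UNIV (\<lambda>y. log_kernel \<delta> (y - x))"
  unfolding log_kernel_def
  by (intro Ck_ln Ck_add Ck_norm_sq Ck_const open_UNIV) (use assms in \<open>auto intro!: add_nonneg_pos\<close>)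

lemma laplacian_log_kernel:
  assumes d: "\<delta> > 0"
  shows "laplacian (\<lambda>y. complex_of_real (log_kernel \<delta> (y - x))) y = of_real (smooth_delta \<delta> (y - x))"
proof -
  define q where "q y = (norm (y - x))\<^sup>2 + \<delta>\<^sup>2" for y
  have q: "q y > 0" for y using d by (simp add: q_def add_nonneg_pos)
  have dq: "(q has_derivative (\<lambda>v. 2 * ((y - x) \<bullet> v))) (at y)" for y
    unfolding q_def power2_norm_eq_inner
    by (auto intro!: derivative_eq_intros simp: inner_commute)
  have d1: "dir_deriv b (\<lambda>y. complex_of_real (log_kernel \<delta> (y - x))) = (\<lambda>y. of_real (2 * ((y - x) \<bullet> b) * inverse (q y)))" for b
  proof
    fix y
    have "((\<lambda>y. ln (q y)) has_derivative (\<lambda>v. inverse (q y) * (2 * ((y - x) \<bullet> v)))) (at y)"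
      using has_derivative_ln[OF q dq] by (simp add: mult_ac divide_inverse)
    hence "((\<lambda>y. complex_of_real (ln (q y))) has_derivative (\<lambda>v. of_real (inverse (q y) * (2 * ((y - x) \<bullet> v))))) (at y)"
      by (rule bounded_linear.has_derivative[OF bounded_linear_of_real])
    hence "((\<lambda>y. complex_of_real (log_kernel \<delta> (y - x))) has_derivative (\<lambda>v. of_real (inverse (q y) * (2 * ((y - x) \<bullet> v))))) (at y)"
      unfolding log_kernel_def q_def .
    from dir_deriv_eqI[OF this]
    show "dir_deriv b (\<lambda>y. complex_of_real (log_kernel \<delta> (y - x))) y = of_real (2 * ((y - x) \<bullet> b) * inverse (q y))"
      by (simp add: mult_ac)
  qed
  have d2: "dir_deriv b (dir_deriv b (\<lambda>y. complex_of_real (log_kernel \<delta> (y - x)))) y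
      = of_real (2 * (b \<bullet> b) * inverse (q y) - 4 * ((y - x) \<bullet> b)\<^sup>2 * (inverse (q y))\<^sup>2)" for b
  proof -
    have "((\<lambda>y. 2 * ((y - x) \<bullet> b) * inverse (q y)) has_derivative
       (\<lambda>v. 2 * ((y - x) \<bullet> b) * (- (inverse (q y) * (2 * ((y - x) \<bullet> v)) * inverse (q y))) + (2 * (v \<bullet> b)) * inverse (q y))) (at y)"
      by (rule has_derivative_mult[OF _ Deriv.has_derivative_inverse[OF _ dq]])
         (use q[of y] in \<open>auto intro!: derivative_eq_intros\<close>)
    hence "((\<lambda>y. complex_of_real (2 * ((y - x) \<bullet> b) * inverse (q y))) has_derivative
       (\<lambda>v. of_real (2 * ((y - x) \<bullet> b) * (- (inverse (q y) * (2 * ((y - x) \<bullet> v)) * inverse (q y))) + (2 * (v \<bullet> b)) * inverse (q y)))) (at y)"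
      by (rule bounded_linear.has_derivative[OF bounded_linear_of_real])
    from dir_deriv_eqI[OF this, of b]
    show ?thesis unfolding d1
      by (simp only:) (rule arg_cong[where f=of_real], simp add: algebra_simps power2_eq_square)
  qed
  have "(\<Sum>b\<in>Basis. ((y - x) \<bullet> b)\<^sup>2) = (norm (y - x))\<^sup>2"
    by (simp add: power2_norm_eq_inner) (subst euclidean_inner, simp add: power2_eq_square)
  moreover have "(\<Sum>b\<in>(Basis::(real^2) set). 2 * (b \<bullet> b) * inverse (q y)) = 4 * inverse (q y)"
    by (simp add: inner_Basis)
  ultimately have "laplacian (\<lambda>y. complex_of_real (log_kernel \<delta> (y - x))) y
     = of_real (4 * inverse (q y) - 4 * (norm (y - x))\<^sup>2 * (inverse (q y))\<^sup>2)"
    unfolding laplacian_def d2 of_real_sum[symmetric] sum_subtractf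
    by (simp only: sum_distrib_left[symmetric] sum_distrib_right[symmetric])
  also have "4 * inverse (q y) - 4 * (norm (y - x))\<^sup>2 * (inverse (q y))\<^sup>2 = 4 * \<delta>\<^sup>2 / (q y)\<^sup>2"
  proof -
    have "(norm (y - x))\<^sup>2 = q y - \<delta>\<^sup>2" by (simp add: q_def)
    thus ?thesis using q[of y] by (simp add: field_simps power2_eq_square)
  qed
  finally show ?thesis by (simp add: smooth_delta_def q_def)
qed

text \<open>Substituting \<open>x = y - \<delta> z\<close> turns the integral into one of \<open>\<phi>(y - \<delta> z)\<close> against the fixed integrable
density \<open>smooth_delta 1\<close>, where dominated convergence applies.\<close>

lemma integral_smooth_delta_tendsto:
  fixes \<phi> :: "real^2 \<Rightarrow> complex"
  assumes c: "continuous_on UNIV \<phi>" and B: "\<And>x. norm (\<phi> x) \<le> B"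
  defines "m \<equiv> \<integral>z. smooth_delta 1 z \<partial>lborel"
  shows "\<And>\<delta>. \<delta> > 0 \<Longrightarrow> norm (\<integral>x. \<phi> x * of_real (smooth_delta \<delta> (y - x)) \<partial>lborel) \<le> B * m"
    and "(\<lambda>n. \<integral>x. \<phi> x * of_real (smooth_delta (inverse (real (Suc n))) (y - x)) \<partial>lborel) \<longlonglongrightarrow> \<phi> y * of_real m"
    and "m > 0"
proof -
  have [measurable]: "\<phi> \<in> borel_measurable borel" using c by (rule borel_measurable_continuous_onI)
  have sd: "smooth_delta 1 = (\<lambda>z. 4 / ((norm z)\<^sup>2 + 1)\<^sup>2)" by (simp add: smooth_delta_def fun_eq_iff)
  have P: "integrable lborel (smooth_delta 1)" unfolding sd by (rule integrable_poisson_kernel)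
  have Pnn: "smooth_delta \<delta> z \<ge> 0" for \<delta> z by (simp add: smooth_delta_def)
  have [measurable]: "smooth_delta \<delta> \<in> borel_measurable borel" for \<delta>
    unfolding smooth_delta_def[abs_def] by measurable
  have scale: "(\<integral>x. \<phi> x * of_real (smooth_delta \<delta> (y - x)) \<partial>lborel) = (\<integral>z. \<phi> (y - \<delta> *\<^sub>R z) * of_real (smooth_delta 1 z) \<partial>lborel)"
    if d: "\<delta> > 0" for \<delta>
  proof -
    have "(\<integral>x. \<phi> x * of_real (smooth_delta \<delta> (y - x)) \<partial>lborel)
       = \<bar>- \<delta>\<bar> ^ DIM(real^2) *\<^sub>R (\<integral>z. \<phi> (y + (- \<delta>) *\<^sub>R z) * of_real (smooth_delta \<delta> (y - (y + (- \<delta>) *\<^sub>R z))) \<partial>lborel)"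
      by (rule lborel_integral_affine) (use d in \<open>measurable, auto\<close>)
    also have "\<dots> = (\<integral>z. \<delta>\<^sup>2 *\<^sub>R (\<phi> (y - \<delta> *\<^sub>R z) * of_real (smooth_delta \<delta> (\<delta> *\<^sub>R z))) \<partial>lborel)"
      using d by simp
    also have "\<dots> = (\<integral>z. \<phi> (y - \<delta> *\<^sub>R z) * of_real (smooth_delta 1 z) \<partial>lborel)"
    proof (rule Bochner_Integration.integral_cong[OF refl])
      fix z :: "real^2"
      have "\<delta>\<^sup>2 * smooth_delta \<delta> (\<delta> *\<^sub>R z) = smooth_delta 1 z"
      proof -
        have "(norm (\<delta> *\<^sub>R z))\<^sup>2 + \<delta>\<^sup>2 = \<delta>\<^sup>2 * ((norm z)\<^sup>2 + 1)" by (simp add: power_mult_distrib algebra_simps)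
        thus ?thesis using d by (simp add: smooth_delta_def power_mult_distrib power2_eq_square)
      qed
      thus "\<delta>\<^sup>2 *\<^sub>R (\<phi> (y - \<delta> *\<^sub>R z) * of_real (smooth_delta \<delta> (\<delta> *\<^sub>R z))) = \<phi> (y - \<delta> *\<^sub>R z) * of_real (smooth_delta 1 z)"
        by (simp add: scaleR_conv_of_real mult_ac flip: of_real_mult of_real_power)
    qed
    finally show ?thesis .
  qed
  have bd: "norm (\<phi> x * of_real (smooth_delta 1 z)) \<le> B * smooth_delta 1 z" for x z
    using B[of x] Pnn[of 1 z] by (simp add: norm_mult mult_right_mono)
  have cm: "(\<lambda>z. \<phi> (y - \<delta> *\<^sub>R z) * of_real (smooth_delta 1 z)) \<in> borel_measurable borel" for \<delta>
    by measurable
  have int: "integrable lborel (\<lambda>z. \<phi> (y - \<delta> *\<^sub>R z) * of_real (smooth_delta 1 z))" for \<delta>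
    by (rule Bochner_Integration.integrable_bound[of _ "\<lambda>z. B * smooth_delta 1 z"])
       (use P cm bd order_trans[OF bd abs_ge_self] in auto)
  show "norm (\<integral>x. \<phi> x * of_real (smooth_delta \<delta> (y - x)) \<partial>lborel) \<le> B * m" if "\<delta> > 0" for \<delta>
  proof -
    have "norm (\<integral>z. \<phi> (y - \<delta> *\<^sub>R z) * of_real (smooth_delta 1 z) \<partial>lborel) \<le> (\<integral>z. B * smooth_delta 1 z \<partial>lborel)"
      by (rule Bochner_Integration.integral_norm_bound_integral) (use int P bd in auto)
    thus ?thesis using scale[OF that] by (simp add: m_def)
  qed
  have "(\<lambda>n. \<integral>z. \<phi> (y - inverse (real (Suc n)) *\<^sub>R z) * of_real (smooth_delta 1 z) \<partial>lborel) \<longlonglongrightarrow> (\<integral>z. \<phi> y * of_real (smooth_delta 1 z) \<partial>lborel)"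
  proof (rule integral_dominated_convergence[where w="\<lambda>z. B * smooth_delta 1 z"])
    show "integrable lborel (\<lambda>z. B * smooth_delta 1 z)" using P by simp
    show "AE z in lborel. norm (\<phi> (y - inverse (real (Suc n)) *\<^sub>R z) * complex_of_real (smooth_delta 1 z)) \<le> B * smooth_delta 1 z" for n
      using bd by (intro AE_I2)
    show "AE z in lborel. (\<lambda>n. \<phi> (y - inverse (real (Suc n)) *\<^sub>R z) * complex_of_real (smooth_delta 1 z)) \<longlonglongrightarrow> \<phi> y * of_real (smooth_delta 1 z)"
    proof (intro AE_I2 tendsto_mult tendsto_const)
      fix z
      have "(\<lambda>n. y - inverse (real (Suc n)) *\<^sub>R z) \<longlonglongrightarrow> y - 0 *\<^sub>R z"
        by (intro tendsto_intros LIMSEQ_inverse_real_of_nat)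
      moreover have "isCont \<phi> y" using c by (simp add: continuous_on_eq_continuous_at)
      ultimately show "(\<lambda>n. \<phi> (y - inverse (real (Suc n)) *\<^sub>R z)) \<longlonglongrightarrow> \<phi> y"
        using isCont_tendsto_compose[of y \<phi>] by simp
    qed
  qed (use cm in \<open>measurable\<close>)
  moreover have "(\<integral>z. \<phi> y * of_real (smooth_delta 1 z) \<partial>lborel) = \<phi> y * of_real m"
    unfolding m_def by simp
  ultimately show "(\<lambda>n. \<integral>x. \<phi> x * of_real (smooth_delta (inverse (real (Suc n))) (y - x)) \<partial>lborel) \<longlonglongrightarrow> \<phi> y * of_real m"
    using scale[of "inverse (real (Suc n))" for n] unfolding m_def by (simp del: of_nat_Suc)
  show "m > 0"
  proof (rule ccontr)
    assume "\<not> m > 0"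
    moreover have "m \<ge> 0" unfolding m_def using Pnn by (intro Bochner_Integration.integral_nonneg) auto
    ultimately have "m = 0" by simp
    hence "AE z in lborel. smooth_delta 1 (z::real^2) = 0"
      using integral_nonneg_eq_0_iff_AE[OF P] Pnn by (simp add: m_def)
    moreover have "smooth_delta 1 z \<noteq> 0" for z
    proof -
      have "(norm z)\<^sup>2 + 1 > 0" by (simp add: add_nonneg_pos)
      thus ?thesis by (simp add: smooth_delta_def)
    qed
    ultimately have "AE z in (lborel :: (real^2) measure). False" by simp
    thus False using AE_iff_measurable[of UNIV "lborel :: (real^2) measure" "\<lambda>_. False"] by simp
  qed
qed

section \<open>Compactly supported weak solutions of the Poisson equation\<close>

lemma continuous_of_hoelder:
  fixes W :: "'a::euclidean_space \<Rightarrow> complex"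
  assumes "\<And>x y. norm (W x - W y) \<le> C * sqrt (norm (x - y))"
  shows "continuous_on UNIV W"
proof (rule continuous_at_imp_continuous_on, rule ballI)
  fix x
  have "((\<lambda>y. W y - W x) \<longlongrightarrow> 0) (at x)"
  proof (rule Lim_null_comparison)
    show "\<forall>\<^sub>F y in at x. norm (W y - W x) \<le> C * sqrt (norm (y - x))" using assms by simp
    show "((\<lambda>y. C * sqrt (norm (y - x))) \<longlongrightarrow> 0) (at x)" by (auto intro!: tendsto_eq_intros)
  qed
  thus "isCont W x" by (simp add: isCont_def LIM_zero_iff)
qed

text \<open>A compactly supported weak solution of \<open>\<Delta>w = f\<close> is a multiple of the logarithmic potential of \<open>f\<close>: both
sides of the equation may be tested with \<open>log_kernel \<delta>\<close>, which turns \<open>w\<close> into a mollification of itself,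
and then \<open>\<delta>\<close> tends to zero.\<close>

locale compactly_supported_poisson =
  fixes w f :: "real^2 \<Rightarrow> complex" and R :: real
  assumes w: "locally_integrable w" and f: "f \<in> borel_measurable borel"
    and R: "R > 0"
    and w0: "\<And>x. norm x > R \<Longrightarrow> w x = 0" and f0: "\<And>x. norm x > R \<Longrightarrow> f x = 0"
    and f2: "integrable lborel (\<lambda>x. (norm (f x))\<^sup>2)"
    and eq: "\<And>\<phi>. test_function \<phi> \<Longrightarrow> (\<integral>x. w x * laplacian \<phi> x \<partial>lborel) = (\<integral>x. f x * \<phi> x \<partial>lborel)"
begin

lemma measurable_data [measurable]: "w \<in> borel_measurable borel" "f \<in> borel_measurable borel"
  using w f by (auto simp: locally_integrable_def)

definition "f_sq = (\<integral>x. (norm (f x))\<^sup>2 \<partial>lborel)"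
definition "newton_bound = measure lborel (cball (0::real^2) R) + (\<integral>z. indicator (cball 0 1) z * inverse (norm (z::real^2)) \<partial>lborel)"

lemma indicator_integrable: "integrable lborel (\<lambda>y::real^2. indicator (cball 0 R) y :: real)"
  using borel_integrable_compact[of "cball (0::real^2) R" "\<lambda>_. 1::real"] by simp

text \<open>By the arithmetic-geometric mean inequality the integrand is at most \<open>|f|\<^sup>2 + 1 / |y - x|\<close> on the support
of \<open>f\<close>; square integrability of \<open>f\<close> thus tames the kernel uniformly in \<open>x\<close>.\<close>

lemma f_singular:
  fixes x :: "real^2"
  shows "integrable lborel (\<lambda>y. norm (f y) * inverse (sqrt (norm (y - x))))"
    and "(\<integral>y. norm (f y) * inverse (sqrt (norm (y - x))) \<partial>lborel) \<le> f_sq + newton_bound"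
proof -
  let ?h = "\<lambda>y. (norm (f y))\<^sup>2 + indicator (cball 0 R) y * inverse (norm (y - x))"
  have h: "integrable lborel ?h" using f2 integrable_inverse_norm(1) by (rule Bochner_Integration.integrable_add)
  have le: "norm (f y) * inverse (sqrt (norm (y - x))) \<le> ?h y" for y
  proof (cases "norm y \<le> R")
    case True
    have "2 * norm (f y) * inverse (sqrt (norm (y - x))) \<le> (norm (f y))\<^sup>2 + (inverse (sqrt (norm (y - x))))\<^sup>2"
      by (rule sum_squares_bound)
    moreover have "(inverse (sqrt (norm (y - x))))\<^sup>2 = inverse (norm (y - x))"
      by (simp add: power_inverse)
    moreover have "0 \<le> norm (f y) * inverse (sqrt (norm (y - x)))" by simp
    ultimately have "norm (f y) * inverse (sqrt (norm (y - x))) \<le> (norm (f y))\<^sup>2 + inverse (norm (y - x))" by linarith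
    thus ?thesis using True by simp
  qed (use f0 in auto)
  show 1: "integrable lborel (\<lambda>y. norm (f y) * inverse (sqrt (norm (y - x))))"
  proof (rule Bochner_Integration.integrable_bound[OF h])
    show "AE y in lborel. norm (norm (f y) * inverse (sqrt (norm (y - x)))) \<le> norm (?h y)"
      using le by (intro AE_I2) (simp add: abs_of_nonneg)
  qed measurable
  have "(\<integral>y. norm (f y) * inverse (sqrt (norm (y - x))) \<partial>lborel) \<le> integral\<^sup>L lborel ?h"
    using le by (intro integral_mono 1 h)
  also have "\<dots> = f_sq + (\<integral>y. indicator (cball 0 R) y * inverse (norm (y - x)) \<partial>lborel)"
    unfolding f_sq_def by (rule Bochner_Integration.integral_add[OF f2 integrable_inverse_norm(1)])
  also have "\<dots> \<le> f_sq + newton_bound" unfolding newton_bound_def using integrable_inverse_norm(2) by simp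
  finally show "(\<integral>y. norm (f y) * inverse (sqrt (norm (y - x))) \<partial>lborel) \<le> f_sq + newton_bound" .
qed

lemma f_integrable: "integrable lborel (\<lambda>y. norm (f y))"
proof (rule Bochner_Integration.integrable_bound[OF Bochner_Integration.integrable_add[OF f2 indicator_integrable]])
  show "AE y in lborel. norm (norm (f y)) \<le> norm ((norm (f y))\<^sup>2 + indicator (cball 0 R) y)"
  proof (rule AE_I2)
    fix y
    have "2 * norm (f y) * 1 \<le> (norm (f y))\<^sup>2 + 1\<^sup>2" by (rule sum_squares_bound)
    moreover have "0 \<le> norm (f y)" by simp
    ultimately have "norm (f y) \<le> (norm (f y))\<^sup>2 + 1" unfolding one_power2 mult_1_right by linarith
    thus "norm (norm (f y)) \<le> norm ((norm (f y))\<^sup>2 + indicator (cball 0 R) y)"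
      using f0[of y] by (cases "norm y \<le> R") auto
  qed
qed measurable

definition log_potential :: "real \<Rightarrow> real^2 \<Rightarrow> complex" where
  "log_potential \<delta> x = (\<integral>y. f y * of_real (log_kernel \<delta> (y - x)) \<partial>lborel)"

definition integrand_bound :: "real^2 \<Rightarrow> real^2 \<Rightarrow> real" where
  "integrand_bound x y = norm (f y) * (R + norm x)\<^sup>2 + 4 * (norm (f y) * inverse (sqrt (norm (y - x))))"

lemma log_potential_integrand_bound:
  assumes "0 \<le> \<delta>" "\<delta> \<le> 1" "y \<noteq> x"
  shows "norm (f y * of_real (log_kernel \<delta> (y - x))) \<le> integrand_bound x y"
proof (cases "norm y \<le> R")
  case True
  have "\<bar>log_kernel \<delta> (y - x)\<bar> \<le> (norm (y - x))\<^sup>2 + 4 * inverse (sqrt (norm (y - x)))"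
    using assms by (intro log_kernel_bound) auto
  also have "norm (y - x) \<le> R + norm x" using True norm_triangle_ineq4[of y x] by linarith
  hence "(norm (y - x))\<^sup>2 \<le> (R + norm x)\<^sup>2" by (intro power_mono) auto
  finally have "\<bar>log_kernel \<delta> (y - x)\<bar> \<le> (R + norm x)\<^sup>2 + 4 * inverse (sqrt (norm (y - x)))" by simp
  hence "norm (f y) * \<bar>log_kernel \<delta> (y - x)\<bar> \<le> norm (f y) * ((R + norm x)\<^sup>2 + 4 * inverse (sqrt (norm (y - x))))"
    by (intro mult_left_mono) auto
  thus ?thesis by (simp add: integrand_bound_def norm_mult algebra_simps)
qed (use f0 in \<open>auto simp: integrand_bound_def\<close>)

lemma integrand_bound_integrable: "integrable lborel (integrand_bound x)"
  unfolding integrand_bound_def[abs_def] using f_integrable f_singular(1) by auto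

lemma log_potential_integrable:
  assumes "0 \<le> \<delta>" "\<delta> \<le> 1"
  shows "integrable lborel (\<lambda>y. f y * of_real (log_kernel \<delta> (y - x)))"
proof (rule Bochner_Integration.integrable_bound[OF integrand_bound_integrable[of x]])
  show "AE y in lborel. norm (f y * of_real (log_kernel \<delta> (y - x))) \<le> norm (integrand_bound x y)"
    using AE_lborel_singleton[of x]
    by eventually_elim (use log_potential_integrand_bound[OF assms] order_trans[OF _ abs_ge_self] in fastforce)
qed measurable

lemma log_potential_bounded:
  assumes "0 \<le> \<delta>" "\<delta> \<le> 1"
  shows "norm (log_potential \<delta> x) \<le> (R + norm x)\<^sup>2 * (\<integral>y. norm (f y) \<partial>lborel) + 4 * (f_sq + newton_bound)"
proof -
  have "norm (log_potential \<delta> x) \<le> (\<integral>y. norm (f y * of_real (log_kernel \<delta> (y - x))) \<partial>lborel)"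
    unfolding log_potential_def by (rule integral_norm_bound)
  also have "\<dots> \<le> integral\<^sup>L lborel (integrand_bound x)"
  proof (rule integral_mono_AE)
    show "integrable lborel (\<lambda>y. norm (f y * of_real (log_kernel \<delta> (y - x))))"
      using log_potential_integrable[OF assms] by (rule integrable_norm)
    show "AE y in lborel. norm (f y * of_real (log_kernel \<delta> (y - x))) \<le> integrand_bound x y"
      using AE_lborel_singleton[of x] by eventually_elim (rule log_potential_integrand_bound[OF assms])
  qed (rule integrand_bound_integrable)
  also have "\<dots> = (\<integral>y. norm (f y) * (R + norm x)\<^sup>2 \<partial>lborel) + (\<integral>y. 4 * (norm (f y) * inverse (sqrt (norm (y - x)))) \<partial>lborel)"
    unfolding integrand_bound_def by (rule Bochner_Integration.integral_add) (use f_integrable f_singular(1) in auto)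
  also have "\<dots> \<le> (R + norm x)\<^sup>2 * (\<integral>y. norm (f y) \<partial>lborel) + 4 * (f_sq + newton_bound)"
    using f_singular(2)[of x] by simp
  finally show ?thesis .
qed

lemma log_potential_hoelder: "norm (log_potential 0 x - log_potential 0 x') \<le> 8 * (f_sq + newton_bound) * sqrt (norm (x - x'))"
proof -
  let ?s = "\<lambda>x y. norm (f y) * inverse (sqrt (norm (y - x)))"
  have "log_potential 0 x - log_potential 0 x' = (\<integral>y. f y * of_real (log_kernel 0 (y - x)) - f y * of_real (log_kernel 0 (y - x')) \<partial>lborel)"
    unfolding log_potential_def by (rule Bochner_Integration.integral_diff[symmetric]) (intro log_potential_integrable; simp)+
  also have "norm \<dots> \<le> (\<integral>y. norm (f y * of_real (log_kernel 0 (y - x)) - f y * of_real (log_kernel 0 (y - x'))) \<partial>lborel)"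
    by (rule integral_norm_bound)
  also have "\<dots> \<le> (\<integral>y. 4 * sqrt (norm (x - x')) * (?s x y + ?s x' y) \<partial>lborel)"
  proof (rule integral_mono_AE)
    show "integrable lborel (\<lambda>y. norm (f y * of_real (log_kernel 0 (y - x)) - f y * of_real (log_kernel 0 (y - x'))))"
      by (intro integrable_norm Bochner_Integration.integrable_diff log_potential_integrable) auto
    show "integrable lborel (\<lambda>y. 4 * sqrt (norm (x - x')) * (?s x y + ?s x' y))"
      using f_singular(1) by (intro integrable_mult_right Bochner_Integration.integrable_add)
    show "AE y in lborel. norm (f y * of_real (log_kernel 0 (y - x)) - f y * of_real (log_kernel 0 (y - x'))) \<le> 4 * sqrt (norm (x - x')) * (?s x y + ?s x' y)"
      using AE_lborel_singleton[of x] AE_lborel_singleton[of x']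
    proof eventually_elim
      case (elim y)
      have "norm (f y * of_real (log_kernel 0 (y - x)) - f y * of_real (log_kernel 0 (y - x')))
        = norm (f y) * \<bar>log_kernel 0 (y - x) - log_kernel 0 (y - x')\<bar>"
        by (simp add: norm_mult flip: right_diff_distrib of_real_diff)
      also have "\<dots> \<le> norm (f y) * (4 * sqrt (norm ((y - x) - (y - x'))) * (inverse (sqrt (norm (y - x))) + inverse (sqrt (norm (y - x')))))"
        using elim by (intro mult_left_mono log_kernel_diff) auto
      also have "(y - x) - (y - x') = x' - x" by simp
      finally show ?case by (simp add: algebra_simps norm_minus_commute)
    qed
  qed
  also have "\<dots> = 4 * sqrt (norm (x - x')) * ((\<integral>y. ?s x y \<partial>lborel) + (\<integral>y. ?s x' y \<partial>lborel))"
    using f_singular(1) by simp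
  also have "\<dots> \<le> 4 * sqrt (norm (x - x')) * ((f_sq + newton_bound) + (f_sq + newton_bound))"
    using f_singular(2) by (intro mult_left_mono add_mono) auto
  finally show ?thesis by (simp add: algebra_simps)
qed

lemma log_potential_continuous: "continuous_on UNIV (log_potential 0)"
  by (rule continuous_of_hoelder[OF log_potential_hoelder])

lemma log_potential_tendsto: "(\<lambda>n. log_potential (inverse (real (Suc n))) x) \<longlonglongrightarrow> log_potential 0 x"
  unfolding log_potential_def
proof (rule integral_dominated_convergence[where w="integrand_bound x"])
  have le1: "inverse (real (Suc n)) \<le> 1" for n by (simp add: divide_simps)
  show "AE y in lborel. norm (f y * of_real (log_kernel (inverse (real (Suc n))) (y - x))) \<le> integrand_bound x y" for n
    using AE_lborel_singleton[of x] by eventually_elim (intro log_potential_integrand_bound le1, auto)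
  show "AE y in lborel. (\<lambda>n. f y * complex_of_real (log_kernel (inverse (real (Suc n))) (y - x))) \<longlonglongrightarrow> f y * of_real (log_kernel 0 (y - x))"
    using AE_lborel_singleton[of x]
  proof eventually_elim
    case (elim y)
    have "(\<lambda>n. (norm (y - x))\<^sup>2 + (inverse (real (Suc n)))\<^sup>2) \<longlonglongrightarrow> (norm (y - x))\<^sup>2 + 0\<^sup>2"
      by (intro tendsto_intros LIMSEQ_inverse_real_of_nat)
    moreover have "(norm (y - x))\<^sup>2 + 0\<^sup>2 \<noteq> 0" using elim by simp
    ultimately have "(\<lambda>n. log_kernel (inverse (real (Suc n))) (y - x)) \<longlonglongrightarrow> log_kernel 0 (y - x)"
      unfolding log_kernel_def by (rule tendsto_ln)
    thus ?case by (intro tendsto_intros)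
  qed
qed (use integrand_bound_integrable in \<open>auto\<close>)

text \<open>Test the equation with \<open>log_kernel \<delta> (y - x)\<close>, cut off outside the support of \<open>w\<close> and \<open>f\<close>.\<close>

lemma log_potential_eq_smoothed:
  assumes d: "\<delta> > 0"
  shows "log_potential \<delta> x = (\<integral>y. w y * of_real (smooth_delta \<delta> (y - x)) \<partial>lborel)"
proof -
  define \<phi> where "\<phi> y = complex_of_real (cutoff 0 (R + 1) y * log_kernel \<delta> (y - x))" for y
  have R1: "R + 1 > 0" using R by simp
  have "test_function \<phi>"
  proof (rule test_functionI[of _ "cball 0 (2 * (R + 1))"])
    show "Ck n UNIV \<phi>" for n unfolding \<phi>_def
      by (intro Ck_of_real Ck_mult Ck_cutoff[OF R1] Ck_log_kernel[OF d] open_UNIV)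
    show "\<phi> y = 0" if "y \<notin> cball 0 (2 * (R + 1))" for y
      using that cutoff_eq_0[OF R1, of y 0] by (simp add: \<phi>_def)
  qed auto
  from eq[OF this]
  have "(\<integral>y. w y * laplacian \<phi> y \<partial>lborel) = (\<integral>y. f y * \<phi> y \<partial>lborel)" .
  moreover have "w y * laplacian \<phi> y = w y * of_real (smooth_delta \<delta> (y - x))" for y
  proof (cases "norm y \<le> R")
    case True
    have "laplacian \<phi> y = laplacian (\<lambda>y. complex_of_real (log_kernel \<delta> (y - x))) y"
      by (rule laplacian_cong[of "ball 0 (R + 1)"])
         (use True in \<open>auto simp: \<phi>_def cutoff_eq_1[OF R1]\<close>)
    thus ?thesis using laplacian_log_kernel[OF d] by simp
  qed (use w0 in auto)
  moreover have "f y * \<phi> y = f y * of_real (log_kernel \<delta> (y - x))" for y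
    using cutoff_eq_1[OF R1, of y 0] f0[of y] by (cases "norm y \<le> R") (auto simp: \<phi>_def)
  ultimately show ?thesis by (simp add: log_potential_def)
qed

definition delta_mass where "delta_mass = (\<integral>z. smooth_delta 1 z \<partial>lborel)"

text \<open>Fubini's theorem moves the approximate identity in \<open>log_potential_eq_smoothed\<close> from \<open>w\<close> to \<open>\<phi>\<close>, where
it converges by continuity of \<open>\<phi>\<close>; on the other side the potentials converge boundedly.\<close>

lemma potential_pairing:
  assumes \<phi>: "test_function \<phi>"
  shows "(\<integral>x. \<phi> x * log_potential 0 x \<partial>lborel) = (\<integral>y. w y * (\<phi> y * of_real delta_mass) \<partial>lborel)"
proof -
  have c: "continuous_on UNIV \<phi>" using test_function_continuous[OF \<phi>] .
  obtain r where r: "r > 0" "\<And>x. norm x \<ge> r \<Longrightarrow> \<phi> x = 0" using test_function_support[OF \<phi>] by blast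
  obtain B where B: "B > 0" "\<And>x. norm (\<phi> x) \<le> B" using bounded_of_continuous_support[OF c, of r] r by auto
  have [measurable]: "\<phi> \<in> borel_measurable borel" using c by (rule borel_measurable_continuous_onI)
  have [measurable]: "smooth_delta \<delta> \<in> borel_measurable borel" for \<delta>
    unfolding smooth_delta_def[abs_def] by measurable
  have \<phi>i: "integrable lborel \<phi>"
    using integrable_mult_test[OF locally_integrable_continuous \<phi>, of "\<lambda>_. 1"] by simp
  have wi: "integrable lborel w"
  proof -
    have "w = (\<lambda>x. indicator (cball 0 R) x *\<^sub>R w x)" using w0 by (auto simp: fun_eq_iff indicator_def)
    moreover have "integrable lborel (\<lambda>x. indicator (cball 0 R) x *\<^sub>R w x)"
      using w by (simp add: locally_integrable_def set_integrable_def)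
    ultimately show ?thesis by simp
  qed
  have le1: "inverse (real (Suc n)) \<le> 1" for n by (simp add: divide_simps)
  define C where "C = (R + r)\<^sup>2 * (\<integral>y. norm (f y) \<partial>lborel) + 4 * (f_sq + newton_bound)"
  have Vm: "log_potential \<delta> \<in> borel_measurable borel" for \<delta>
    unfolding log_potential_def[abs_def] by measurable
  have L: "(\<lambda>n. \<integral>x. \<phi> x * log_potential (inverse (real (Suc n))) x \<partial>lborel) \<longlonglongrightarrow> (\<integral>x. \<phi> x * log_potential 0 x \<partial>lborel)"
  proof (rule integral_dominated_convergence[where w="\<lambda>x. norm (\<phi> x) * C"])
    show "integrable lborel (\<lambda>x. norm (\<phi> x) * C)" using \<phi>i by auto
    show "AE x in lborel. (\<lambda>n. \<phi> x * log_potential (inverse (real (Suc n))) x) \<longlonglongrightarrow> \<phi> x * log_potential 0 x"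
      by (intro AE_I2 tendsto_mult tendsto_const log_potential_tendsto)
    show "AE x in lborel. norm (\<phi> x * log_potential (inverse (real (Suc n))) x) \<le> norm (\<phi> x) * C" for n
    proof (rule AE_I2)
      fix x
      show "norm (\<phi> x * log_potential (inverse (real (Suc n))) x) \<le> norm (\<phi> x) * C"
      proof (cases "norm x \<ge> r")
        case False
        have "(R + norm x)\<^sup>2 \<le> (R + r)\<^sup>2" using False R by (intro power_mono) auto
        hence "(R + norm x)\<^sup>2 * (\<integral>y. norm (f y) \<partial>lborel) \<le> (R + r)\<^sup>2 * (\<integral>y. norm (f y) \<partial>lborel)"
          by (intro mult_right_mono Bochner_Integration.integral_nonneg) auto
        hence "norm (log_potential (inverse (real (Suc n))) x) \<le> C"
          using log_potential_bounded[OF _ le1, of n x] unfolding C_def by simp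
        thus ?thesis by (simp add: norm_mult mult_left_mono)
      qed (use r in auto)
    qed
  qed (use Vm in \<open>measurable\<close>)
  have E: "(\<integral>x. \<phi> x * log_potential \<delta> x \<partial>lborel) = (\<integral>y. w y * (\<integral>x. \<phi> x * of_real (smooth_delta \<delta> (y - x)) \<partial>lborel) \<partial>lborel)"
    if d: "\<delta> > 0" for \<delta>
  proof -
    let ?h = "\<lambda>x y. \<phi> x * (w y * of_real (smooth_delta \<delta> (y - x)))"
    have sb: "smooth_delta \<delta> u \<le> 4 / \<delta>\<^sup>2" "0 \<le> smooth_delta \<delta> u" for u
    proof -
      have "\<delta>\<^sup>2 > 0" using d by simp
      hence "(\<delta>\<^sup>2)\<^sup>2 \<le> ((norm u)\<^sup>2 + \<delta>\<^sup>2)\<^sup>2" by (intro power_mono) auto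
      hence "4 * \<delta>\<^sup>2 / ((norm u)\<^sup>2 + \<delta>\<^sup>2)\<^sup>2 \<le> 4 * \<delta>\<^sup>2 / (\<delta>\<^sup>2)\<^sup>2" using d \<open>\<delta>\<^sup>2 > 0\<close>
        by (intro divide_left_mono mult_pos_pos zero_less_power add_nonneg_pos) auto
      thus "smooth_delta \<delta> u \<le> 4 / \<delta>\<^sup>2" using d by (simp add: smooth_delta_def power2_eq_square)
      show "0 \<le> smooth_delta \<delta> u" by (simp add: smooth_delta_def)
    qed
    have int: "integrable (lborel \<Otimes>\<^sub>M lborel) (\<lambda>(x, y). ?h x y)"
    proof (rule Bochner_Integration.integrable_bound)
      show "integrable (lborel \<Otimes>\<^sub>M lborel) (\<lambda>(x, y). norm (\<phi> x) * (norm (w y) * (4 / \<delta>\<^sup>2)))"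
      proof (rule lborel_pair.Fubini_integrable)
        show "integrable lborel (\<lambda>x. \<integral>y. norm (case (x, y) of (x, y) \<Rightarrow> norm (\<phi> x) * (norm (w y) * (4 / \<delta>\<^sup>2))) \<partial>lborel)"
          using \<phi>i by (simp add: abs_mult)
        show "AE x in lborel. integrable lborel (\<lambda>y. case (x, y) of (x, y) \<Rightarrow> norm (\<phi> x) * (norm (w y) * (4 / \<delta>\<^sup>2)))"
          using wi by (intro AE_I2) auto
      qed measurable
      show "(\<lambda>(x, y). ?h x y) \<in> borel_measurable (lborel \<Otimes>\<^sub>M lborel)" by measurable
      show "AE z in lborel \<Otimes>\<^sub>M lborel. norm (case z of (x, y) \<Rightarrow> ?h x y) \<le> norm (case z of (x, y) \<Rightarrow> norm (\<phi> x) * (norm (w y) * (4 / \<delta>\<^sup>2)))"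
      proof (intro AE_I2, clarify)
        fix x y
        have "norm (w y) * smooth_delta \<delta> (y - x) \<le> norm (w y) * (4 / \<delta>\<^sup>2)"
          using sb by (intro mult_left_mono) auto
        from mult_left_mono[OF this norm_ge_zero[of "\<phi> x"]]
        show "norm (?h x y) \<le> norm (norm (\<phi> x) * (norm (w y) * (4 / \<delta>\<^sup>2)))"
          using sb(2)[of "y - x"] by (simp add: norm_mult)
      qed
    qed
    have "(\<integral>x. \<phi> x * log_potential \<delta> x \<partial>lborel) = (\<integral>x. (\<integral>y. ?h x y \<partial>lborel) \<partial>lborel)"
      unfolding log_potential_eq_smoothed[OF d] by simp
    also have "\<dots> = (\<integral>y. (\<integral>x. ?h x y \<partial>lborel) \<partial>lborel)"
      using lborel_pair.Fubini_integral[OF int] by simp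
    also have "\<dots> = (\<integral>y. w y * (\<integral>x. \<phi> x * of_real (smooth_delta \<delta> (y - x)) \<partial>lborel) \<partial>lborel)"
      by (intro Bochner_Integration.integral_cong refl)
         (subst integral_mult_right_zero[symmetric], simp add: mult_ac)
    finally show ?thesis .
  qed
  have "(\<lambda>n. \<integral>y. w y * (\<integral>x. \<phi> x * of_real (smooth_delta (inverse (real (Suc n))) (y - x)) \<partial>lborel) \<partial>lborel) \<longlonglongrightarrow> (\<integral>y. w y * (\<phi> y * of_real delta_mass) \<partial>lborel)"
  proof (rule integral_dominated_convergence[where w="\<lambda>y. norm (w y) * (B * delta_mass)"])
    show "integrable lborel (\<lambda>y. norm (w y) * (B * delta_mass))" using wi by auto
    show "AE y in lborel. (\<lambda>n. w y * (\<integral>x. \<phi> x * of_real (smooth_delta (inverse (real (Suc n))) (y - x)) \<partial>lborel)) \<longlonglongrightarrow> w y * (\<phi> y * of_real delta_mass)"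
      unfolding delta_mass_def by (intro AE_I2 tendsto_mult tendsto_const integral_smooth_delta_tendsto(2)[OF c B(2)])
    show "AE y in lborel. norm (w y * (\<integral>x. \<phi> x * of_real (smooth_delta (inverse (real (Suc n))) (y - x)) \<partial>lborel)) \<le> norm (w y) * (B * delta_mass)" for n
      unfolding norm_mult delta_mass_def
      by (intro AE_I2 mult_left_mono integral_smooth_delta_tendsto(1)[OF c B(2)]) auto
  qed measurable
  thus ?thesis using L E LIMSEQ_unique by simp
qed

theorem hoelder_representative:
  obtains W0 C where "\<And>x y. norm (W0 x - W0 y) \<le> C * sqrt (norm (x - y))" "C \<ge> 0"
    "AE x in lborel. w x = W0 x"
proof -
  have mpos: "delta_mass > 0"
    unfolding delta_mass_def using integral_smooth_delta_tendsto(3)[of "\<lambda>_. 0" 0] by simp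
  let ?u = "\<lambda>x. w x * of_real delta_mass - log_potential 0 x"
  have li: "locally_integrable ?u"
  proof -
    have "locally_integrable (log_potential 0)" using log_potential_continuous by (rule locally_integrable_continuous)
    thus ?thesis using w unfolding locally_integrable_def set_integrable_def
      by (auto simp: scaleR_diff_right simp flip: mult_scaleR_left)
  qed
  have "vanishes_weakly UNIV ?u"
    unfolding vanishes_weakly_def
  proof clarify
    fix \<phi> :: "real^2 \<Rightarrow> complex" assume \<phi>: "test_function \<phi>"
    have "(\<integral>x. ?u x * \<phi> x \<partial>lborel) = (\<integral>x. w x * (\<phi> x * of_real delta_mass) - \<phi> x * log_potential 0 x \<partial>lborel)"
      by (intro Bochner_Integration.integral_cong) (auto simp: algebra_simps)
    also have "\<dots> = (\<integral>x. w x * (\<phi> x * of_real delta_mass) \<partial>lborel) - (\<integral>x. \<phi> x * log_potential 0 x \<partial>lborel)"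
    proof (rule Bochner_Integration.integral_diff)
      show "integrable lborel (\<lambda>x. w x * (\<phi> x * of_real delta_mass))"
        using integrable_mult_test[OF w \<phi>] by (simp flip: mult.assoc)
      show "integrable lborel (\<lambda>x. \<phi> x * log_potential 0 x)"
        using integrable_mult_test[OF locally_integrable_continuous[OF log_potential_continuous] \<phi>] by (simp add: mult.commute)
    qed
    finally show "(\<integral>x. ?u x * \<phi> x \<partial>lborel) = 0" using potential_pairing[OF \<phi>] by simp
  qed
  from fundamental_lemma_calculus_variations[OF li this open_UNIV]
  have ae: "AE x in lborel. w x = log_potential 0 x / of_real delta_mass"
    by eventually_elim (use mpos in \<open>auto simp: field_simps\<close>)
  have FK: "f_sq + newton_bound \<ge> 0"
    unfolding f_sq_def newton_bound_def by (intro add_nonneg_nonneg Bochner_Integration.integral_nonneg) auto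
  show ?thesis
  proof (rule that[OF _ _ ae])
    show "norm (log_potential 0 x / of_real delta_mass - log_potential 0 y / of_real delta_mass) \<le> (8 * (f_sq + newton_bound) / delta_mass) * sqrt (norm (x - y))" for x y
    proof -
      have "norm (log_potential 0 x / of_real delta_mass - log_potential 0 y / of_real delta_mass) = norm (log_potential 0 x - log_potential 0 y) / delta_mass"
        using mpos by (simp add: norm_divide flip: diff_divide_distrib)
      also have "\<dots> \<le> 8 * (f_sq + newton_bound) * sqrt (norm (x - y)) / delta_mass"
        using log_potential_hoelder mpos by (intro divide_right_mono) auto
      finally show ?thesis by simp
    qed
    show "8 * (f_sq + newton_bound) / delta_mass \<ge> 0" using FK mpos by simp
  qed
qed

end

section \<open>Integrals over sectors\<close>

text \<open>The type \<open>real^2\<close> is not a product type; its Lebesgue measure is the image of the product measure.\<close>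

lemma integral_plane_product:
  fixes F G :: "real \<Rightarrow> complex"
  assumes F: "integrable lborel F" and G: "integrable lborel G"
  shows "(\<integral>v. F (v $ 1) * G (v $ 2) \<partial>(lborel :: (real^2) measure)) = (\<integral>x. F x \<partial>lborel) * (\<integral>y. G y \<partial>lborel)"
    and "integrable (lborel :: (real^2) measure) (\<lambda>v. F (v $ 1) * G (v $ 2))"
proof -
  let ?p = "\<lambda>(a, b). vector [a, b] :: real^2"
  have [measurable]: "F \<in> borel_measurable borel" "G \<in> borel_measurable borel" using F G by auto
  have pe: "?p = (\<lambda>z. fst z *\<^sub>R e1 + snd z *\<^sub>R e2)"
    by (simp add: fun_eq_iff vec_eq_iff forall_2 axis_def split_beta)
  have "(\<lambda>z. fst z *\<^sub>R e1 + snd z *\<^sub>R e2) \<in> borel_measurable borel"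
    by (intro borel_measurable_continuous_onI) (auto intro!: continuous_intros)
  hence [measurable]: "?p \<in> borel_measurable (lborel \<Otimes>\<^sub>M lborel)"
    by (simp add: pe lborel_prod)
  have eq: "(lborel :: (real^2) measure) = distr (lborel \<Otimes>\<^sub>M lborel) borel ?p"
  proof (rule lborel_eqI)
    fix l u :: "real^2"
    assume le: "\<And>b. b \<in> Basis \<Longrightarrow> l \<bullet> b \<le> u \<bullet> b"
    have lu: "l $ 1 \<le> u $ 1" "l $ 2 \<le> u $ 2" using le[of e1] le[of e2] by (simp_all add: Basis_plane inner_axis)
    have "?p -` box l u \<inter> space (lborel \<Otimes>\<^sub>M lborel) = {l $ 1 <..< u $ 1} \<times> {l $ 2 <..< u $ 2}"
      by (auto simp: mem_box Basis_plane inner_axis space_pair_measure)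
    hence "emeasure (distr (lborel \<Otimes>\<^sub>M lborel) borel ?p) (box l u)
        = emeasure (lborel \<Otimes>\<^sub>M lborel) ({l $ 1 <..< u $ 1} \<times> {l $ 2 <..< u $ 2})"
      by (subst emeasure_distr) auto
    also have "\<dots> = ennreal ((u $ 1 - l $ 1) * (u $ 2 - l $ 2))"
      using lu by (subst lborel.emeasure_pair_measure_Times) (auto simp: ennreal_mult)
    also have "(u $ 1 - l $ 1) * (u $ 2 - l $ 2) = (\<Prod>b\<in>Basis. (u - l) \<bullet> b)"
      unfolding Basis_plane using e1_neq_e2 by (simp add: inner_axis)
    finally show "emeasure (distr (lborel \<Otimes>\<^sub>M lborel) borel ?p) (box l u) = ennreal (\<Prod>b\<in>Basis. (u - l) \<bullet> b)" .
  qed simp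
  have m: "(\<lambda>v::real^2. F (v $ 1) * G (v $ 2)) \<in> borel_measurable borel" by measurable
  have int: "integrable (lborel \<Otimes>\<^sub>M lborel) (\<lambda>(x, y). F x * G y)"
  proof (rule lborel_pair.Fubini_integrable)
    show "integrable lborel (\<lambda>x. \<integral>y. norm (case (x, y) of (x, y) \<Rightarrow> F x * G y) \<partial>lborel)"
      using F by (simp add: norm_mult)
    show "AE x in lborel. integrable lborel (\<lambda>y. case (x, y) of (x, y) \<Rightarrow> F x * G y)"
      using G by (intro AE_I2) auto
  qed measurable
  show "integrable (lborel :: (real^2) measure) (\<lambda>v. F (v $ 1) * G (v $ 2))"
    unfolding eq by (subst integrable_distr_eq) (use int m in \<open>auto simp: case_prod_beta'\<close>)
  have "(\<integral>v. F (v $ 1) * G (v $ 2) \<partial>(lborel :: (real^2) measure)) = (\<integral>z. (case z of (x, y) \<Rightarrow> F x * G y) \<partial>(lborel \<Otimes>\<^sub>M lborel))"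
    unfolding eq by (subst integral_distr) (use m in \<open>auto simp: case_prod_beta'\<close>)
  also have "\<dots> = (\<integral>x. (\<integral>y. F x * G y \<partial>lborel) \<partial>lborel)"
    using lborel_pair.integral_fst'[OF int] by simp
  also have "\<dots> = (\<integral>x. F x \<partial>lborel) * (\<integral>y. G y \<partial>lborel)" by simp
  finally show "(\<integral>v. F (v $ 1) * G (v $ 2) \<partial>(lborel :: (real^2) measure)) = (\<integral>x. F x \<partial>lborel) * (\<integral>y. G y \<partial>lborel)" .
qed

definition cplx :: "real^2 \<Rightarrow> complex" where "cplx y = Complex (y $ 1) (y $ 2)"

lemma cplx_eq: "cplx y = of_real (y $ 1) + \<i> * of_real (y $ 2)"
  by (simp add: cplx_def complex_eq_iff)

lemma bounded_linear_cplx: "bounded_linear cplx"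
  unfolding cplx_eq[abs_def]
  by (intro bounded_linear_add bounded_linear_compose[OF bounded_linear_of_real bounded_linear_vec_nth]
      bounded_linear_compose[OF bounded_linear_mult_right, of _ \<i>])

lemma norm_cplx [simp]: "norm (cplx y) = norm y"
  by (simp add: cplx_def cmod_def norm_eq_sqrt_inner inner_vec_def sum_2 power2_eq_square)

lemma cplx_polar: "cplx (r *\<^sub>R polar \<theta>) = of_real r * cis \<theta>"
  by (simp add: cplx_def polar_def complex_eq_iff)

lemma continuous_cplx [continuous_intros]: "continuous_on S f \<Longrightarrow> continuous_on S (\<lambda>x. cplx (f x))"
  by (rule bounded_linear.continuous_on[OF bounded_linear_cplx])

lemma cplx_measurable [measurable]: "cplx \<in> borel_measurable borel"
  by (intro borel_measurable_continuous_onI continuous_intros)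

text \<open>The pair (radius, angle) is packed into a vector because the change of variables formula concerns maps of
\<open>real^n\<close> to itself.\<close>

definition polar_map :: "real^2 \<Rightarrow> real^2" where "polar_map v = v $ 1 *\<^sub>R polar (v $ 2)"

lemma wedge_eq_polar: "wedge a b r = {s *\<^sub>R polar \<theta> |s \<theta>. a < \<theta> \<and> \<theta> < b \<and> 0 < s \<and> s < r}"
proof -
  have "vector [s * cos \<theta>, s * sin \<theta>] = s *\<^sub>R polar \<theta>" for s \<theta>
    by (simp add: polar_def vec_eq_iff forall_2)
  thus ?thesis unfolding wedge_def by simp
qed

lemma polar_nonzero [simp]: "polar \<theta> \<noteq> 0"
  using norm_polar[of \<theta>] by (metis norm_zero zero_neq_one)

lemma polar_map_inj:
  assumes "b - a \<le> 2 * pi"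
  shows "inj_on polar_map {v. 0 < v $ 1 \<and> a < v $ 2 \<and> v $ 2 < b}"
proof (rule inj_onI)
  fix v w :: "real^2"
  assume v: "v \<in> {v. 0 < v $ 1 \<and> a < v $ 2 \<and> v $ 2 < b}" and w: "w \<in> {v. 0 < v $ 1 \<and> a < v $ 2 \<and> v $ 2 < b}"
    and eq: "polar_map v = polar_map w"
  have "norm (polar_map v) = norm (polar_map w)" using eq by simp
  hence 1: "v $ 1 = w $ 1" using v w by (simp add: polar_map_def)
  hence "polar (v $ 2) = polar (w $ 2)" using eq v by (simp add: polar_map_def)
  hence "sin (v $ 2) = sin (w $ 2) \<and> cos (v $ 2) = cos (w $ 2)" by (simp add: polar_def vec_eq_iff forall_2)
  then obtain n :: int where n: "v $ 2 = w $ 2 + 2 * pi * of_int n" using sin_cos_eq_iff by blast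
  have "\<bar>v $ 2 - w $ 2\<bar> < 2 * pi" using v w assms by auto
  hence "2 * pi * \<bar>of_int n\<bar> < 2 * pi * 1" using n by (simp add: abs_mult)
  hence "\<bar>of_int n :: real\<bar> < 1" using pi_gt_zero by (simp only: mult_less_cancel_left_pos)
  hence "n = 0" by linarith
  thus "v = w" using 1 n by (simp add: vec_eq_iff forall_2)
qed

lemma polar_map_has_derivative:
  "(polar_map has_derivative (\<lambda>h. h $ 1 *\<^sub>R polar (v $ 2) + (v $ 1 * h $ 2) *\<^sub>R (- sin (v $ 2) *\<^sub>R e1 + cos (v $ 2) *\<^sub>R e2))) (at v within S)"
proof -
  have vn: "((\<lambda>v::real^2. v $ i) has_derivative (\<lambda>h. h $ i)) (at v within S)" for i
    by (rule bounded_linear.has_derivative[OF bounded_linear_vec_nth]) simp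
  show ?thesis
    unfolding polar_map_def[abs_def] polar_eq
    by (auto intro!: derivative_eq_intros vn simp: algebra_simps)
qed

lemma det_polar_map:
  "det (matrix (\<lambda>h::real^2. h $ 1 *\<^sub>R polar \<theta> + (s * h $ 2) *\<^sub>R (- sin \<theta> *\<^sub>R e1 + cos \<theta> *\<^sub>R e2))) = s"
proof -
  have "s * (cos \<theta>)\<^sup>2 + s * (sin \<theta>)\<^sup>2 = s" by (simp flip: distrib_left)
  thus ?thesis by (simp add: det_2 matrix_def polar_def axis_def power2_eq_square algebra_simps)
qed

lemma wedge_image_polar_map:
  "wedge a b r = polar_map ` {v. 0 < v $ 1 \<and> v $ 1 < r \<and> a < v $ 2 \<and> v $ 2 < b}"
proof -
  have "s *\<^sub>R polar \<theta> = polar_map (vector [s, \<theta>])" for s \<theta> by (simp add: polar_map_def)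
  hence "s *\<^sub>R polar \<theta> \<in> polar_map ` {v. 0 < v $ 1 \<and> v $ 1 < r \<and> a < v $ 2 \<and> v $ 2 < b}"
    if "a < \<theta>" "\<theta> < b" "0 < s" "s < r" for s \<theta>
    using that by (auto intro!: imageI)
  moreover have "\<exists>s \<theta>. polar_map v = s *\<^sub>R polar \<theta> \<and> a < \<theta> \<and> \<theta> < b \<and> 0 < s \<and> s < r"
    if "0 < v $ 1" "v $ 1 < r" "a < v $ 2" "v $ 2 < b" for v
    using that by (intro exI[of _ "v $ 1"] exI[of _ "v $ 2"]) (simp add: polar_map_def)
  ultimately show ?thesis unfolding wedge_eq_polar by auto
qed

lemma open_wedge:
  assumes "b - a \<le> 2 * pi"
  shows "open (wedge a b r)"
proof -
  let ?S = "{v::real^2. 0 < v $ 1 \<and> v $ 1 < r \<and> a < v $ 2 \<and> v $ 2 < b}"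
  have "open ?S" by (intro open_Collect_conj open_Collect_less continuous_intros)
  moreover have "continuous_on ?S polar_map"
    unfolding polar_map_def[abs_def] by (intro continuous_intros)
  moreover have "inj_on polar_map ?S" by (rule inj_on_subset[OF polar_map_inj[OF assms]]) auto
  ultimately show ?thesis unfolding wedge_image_polar_map using invariance_of_domain by blast
qed

lemma wedge_norm: "y \<in> wedge a b r \<Longrightarrow> 0 < norm y \<and> norm y < r"
  by (auto simp: wedge_eq_polar)

lemma wedge_mono_radius: "r \<le> s \<Longrightarrow> wedge a b r \<subseteq> wedge a b s"
  unfolding wedge_eq_polar by (smt (verit) Collect_mono_iff)

lemma wedge_Int_ball: "r \<le> s \<Longrightarrow> wedge a b s \<inter> ball 0 r = wedge a b r"
proof
  assume "r \<le> s"
  show "wedge a b s \<inter> ball 0 r \<subseteq> wedge a b r" unfolding wedge_eq_polar by fastforce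
  show "wedge a b r \<subseteq> wedge a b s \<inter> ball 0 r"
    using wedge_mono_radius[OF \<open>r \<le> s\<close>] wedge_norm[of _ a b r] by auto
qed

text \<open>In polar coordinates the integrand separates into \<open>1 / s\<close> and \<open>cis (- 2 \<theta>)\<close>.  The radial part contributes
\<open>ln 2\<close>, whatever \<open>r\<close> is: this scale invariance is what makes the kernel detect the corner.\<close>

lemma sector_integral:
  assumes ab: "a < b" "b - a \<le> 2 * pi" and r: "0 < r"
  shows "(\<integral>y. indicator (wedge a b (2 * r) - wedge a b r) y *\<^sub>R inverse ((cplx y)\<^sup>2) \<partial>lborel)
     = of_real (ln 2) * (\<i> / 2) * (cis (- (2 * b)) - cis (- (2 * a)))"
proof -
  define S where "S = {v::real^2. r \<le> v $ 1 \<and> v $ 1 < 2 * r \<and> a < v $ 2 \<and> v $ 2 < b}"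
  \<comment> \<open>The complex integrand as a vector field, as the change of variables formula requires values in \<open>real^n\<close>.\<close>
  define h where "h y = (vector [Re (inverse ((cplx y)\<^sup>2)), Im (inverse ((cplx y)\<^sup>2))] :: real^2)" for y
  have ch: "cplx (h y) = inverse ((cplx y)\<^sup>2)" for y by (simp add: h_def cplx_def complex_eq_iff)
  have img: "polar_map ` S = wedge a b (2 * r) - wedge a b r"
  proof -
    have "wedge a b (2 * r) - wedge a b r = polar_map ` ({v. 0 < v $ 1 \<and> v $ 1 < 2 * r \<and> a < v $ 2 \<and> v $ 2 < b} - {v. 0 < v $ 1 \<and> v $ 1 < r \<and> a < v $ 2 \<and> v $ 2 < b})"
      unfolding wedge_image_polar_map
      by (rule inj_on_image_set_diff[OF polar_map_inj[OF ab(2)], symmetric]) (use r in auto)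
    also have "{v. 0 < v $ 1 \<and> v $ 1 < 2 * r \<and> a < v $ 2 \<and> v $ 2 < b} - {v. 0 < v $ 1 \<and> v $ 1 < r \<and> a < v $ 2 \<and> v $ 2 < b} = S"
      using r by (auto simp: S_def)
    finally show ?thesis ..
  qed
  have Sm: "S \<in> sets borel" unfolding S_def by measurable
  let ?D = "\<lambda>v. \<lambda>h::real^2. h $ 1 *\<^sub>R polar (v $ 2) + (v $ 1 * h $ 2) *\<^sub>R (- sin (v $ 2) *\<^sub>R e1 + cos (v $ 2) *\<^sub>R e2)"
  \<comment> \<open>The radial and the angular factor of the integrand, Jacobian included.\<close>
  define F where "F x = (indicator {r..<2*r} x *\<^sub>R complex_of_real (inverse x))" for x
  define G where "G x = (indicator {a<..<b} x *\<^sub>R cis (- (2 * x)))" for x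
  have "set_integrable lborel {r..2*r} (\<lambda>x. complex_of_real (inverse x))"
    unfolding set_integrable_def using r
    by (intro borel_integrable_compact continuous_intros) auto
  hence F: "integrable lborel F"
    unfolding F_def[abs_def] set_integrable_def[symmetric] by (rule set_integrable_subset) auto
  have "set_integrable lborel {a..b} (\<lambda>x. cis (- (2 * x)))"
    unfolding set_integrable_def by (intro borel_integrable_compact continuous_intros) auto
  hence G: "integrable lborel G"
    unfolding G_def[abs_def] set_integrable_def[symmetric] by (rule set_integrable_subset) auto
  have chd: "cplx (indicator S v *\<^sub>R (\<bar>det (matrix (?D v))\<bar> *\<^sub>R h (polar_map v))) = F (v $ 1) * G (v $ 2)" for v
  proof (cases "v \<in> S")
    case True
    hence v1: "v $ 1 > 0" using r by (auto simp: S_def)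
    have "cplx (\<bar>det (matrix (?D v))\<bar> *\<^sub>R h (polar_map v)) = of_real (v $ 1) * inverse ((of_real (v $ 1) * cis (v $ 2))\<^sup>2)"
      using v1 unfolding det_polar_map linear_scale[OF bounded_linear.linear[OF bounded_linear_cplx]] ch polar_map_def cplx_polar
      using cplx_polar[of 1] by (simp add: scaleR_conv_of_real)
    also have "\<dots> = of_real (inverse (v $ 1)) * cis (- (2 * (v $ 2)))"
      using v1 by (simp add: power_mult_distrib DeMoivre cis_inverse[symmetric] power2_eq_square field_simps) (simp add: cis_mult cis_divide field_simps)
    finally show ?thesis using True by (simp add: F_def G_def S_def)
  next
    case False
    thus ?thesis by (auto simp: F_def G_def S_def indicator_def linear_0[OF bounded_linear.linear[OF bounded_linear_cplx]])
  qed
  have cinv: "\<And>z. z = vector [Re (cplx z), Im (cplx z)]" by (simp add: cplx_def vec_eq_iff forall_2)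
  let ?E = "\<lambda>v. \<bar>det (matrix (?D v))\<bar> *\<^sub>R h (polar_map v)"
  have bl: "bounded_linear (\<lambda>z. vector [Re z, Im z] :: real^2)"
  proof -
    have "(\<lambda>z. vector [Re z, Im z] :: real^2) = (\<lambda>z. Re z *\<^sub>R e1 + Im z *\<^sub>R e2)"
      by (simp add: fun_eq_iff vec_eq_iff forall_2 axis_def)
    moreover have "bounded_linear (\<lambda>z. Re z *\<^sub>R e1 + Im z *\<^sub>R e2)"
      by (intro bounded_linear_add bounded_linear_compose[OF bounded_linear_scaleR_left] bounded_linear_Re bounded_linear_Im)
    ultimately show ?thesis by simp
  qed
  have E1: "integrable lborel (\<lambda>v. indicator S v *\<^sub>R ?E v)"
  proof -
    have "integrable lborel (\<lambda>v::real^2. vector [Re (F (v $ 1) * G (v $ 2)), Im (F (v $ 1) * G (v $ 2))] :: real^2)"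
      by (rule integrable_bounded_linear[OF bl integral_plane_product(2)[OF F G]])
    thus ?thesis unfolding chd[symmetric] cinv[symmetric] .
  qed
  have E1': "?E absolutely_integrable_on S"
    unfolding set_integrable_def using E1 by (simp add: integrable_completion)
  have injS: "inj_on polar_map S"
    by (rule inj_on_subset[OF polar_map_inj[OF ab(2)]]) (use r in \<open>auto simp: S_def\<close>)
  have "?E absolutely_integrable_on S \<and> integral S ?E = integral S ?E
     \<longleftrightarrow> h absolutely_integrable_on (polar_map ` S) \<and> integral (polar_map ` S) h = integral S ?E"
    by (rule has_absolute_integral_change_of_variables)
       (use Sm injS polar_map_has_derivative in auto)
  hence main: "h absolutely_integrable_on (polar_map ` S) \<and> integral (polar_map ` S) h = integral S ?E"
    using E1' by blast
  let ?A = "wedge a b (2 * r) - wedge a b r"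
  have Am: "?A \<in> sets borel" using open_wedge[OF ab(2)] by auto
  have hm: "h \<in> borel_measurable borel"
  proof -
    have "(\<lambda>y. inverse ((cplx y)\<^sup>2)) \<in> borel_measurable borel" by measurable
    moreover have "(\<lambda>z. vector [Re z, Im z] :: real^2) \<in> borel_measurable borel"
      by (rule borel_measurable_continuous_onI[OF linear_continuous_on[OF bl]])
    ultimately show ?thesis unfolding h_def[abs_def] by (rule measurable_compose)
  qed
  have "(\<integral>y. indicator ?A y *\<^sub>R h y \<partial>lborel) = (LINT y:?A|lebesgue. h y)"
    unfolding set_lebesgue_integral_def using Am hm
    by (intro integral_completion[symmetric] borel_measurable_scaleR borel_measurable_indicator) simp_all
  also have "\<dots> = integral ?A h" using main img by (intro set_lebesgue_integral_eq_integral(2)) auto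
  also have "\<dots> = integral S ?E" using main img by simp
  also have "\<dots> = (LINT v:S|lebesgue. ?E v)" by (rule set_lebesgue_integral_eq_integral(2)[OF E1', symmetric])
  also have "\<dots> = (\<integral>v. indicator S v *\<^sub>R ?E v \<partial>lborel)"
    unfolding set_lebesgue_integral_def using E1 by (intro integral_completion) auto
  finally have "cplx (\<integral>y. indicator ?A y *\<^sub>R h y \<partial>lborel) = cplx (\<integral>v. indicator S v *\<^sub>R ?E v \<partial>lborel)" by simp
  also have "\<dots> = (\<integral>v. F (v $ 1) * G (v $ 2) \<partial>(lborel :: (real^2) measure))"
    using integral_bounded_linear[OF bounded_linear_cplx E1] unfolding chd by (rule sym)
  also have "\<dots> = (\<integral>x. F x \<partial>lborel) * (\<integral>y. G y \<partial>lborel)" by (rule integral_plane_product(1)[OF F G])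
  also have "(\<integral>x. F x \<partial>lborel) = of_real (ln 2)"
  proof -
    have "(\<integral>x. indicator {r..2*r} x *\<^sub>R inverse x \<partial>lborel) = ln (2 * r) - ln r"
      by (rule integral_FTC_atLeastAtMost)
         (use r in \<open>auto intro!: derivative_eq_intros continuous_intros simp: has_real_derivative_iff_has_vector_derivative[symmetric] divide_inverse\<close>)
    also have "\<dots> = ln 2" using r by (simp add: ln_mult)
    finally have "complex_of_real (\<integral>x. indicator {r..2*r} x *\<^sub>R inverse x \<partial>lborel) = of_real (ln 2)" by simp
    moreover have "(\<integral>x. F x \<partial>lborel) = (\<integral>x. complex_of_real (indicator {r..2*r} x *\<^sub>R inverse x) \<partial>lborel)"
    proof (rule integral_cong_AE)
      show "AE x in lborel. F x = complex_of_real (indicator {r..2*r} x *\<^sub>R inverse x)"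
        using AE_lborel_singleton[of "2 * r"] by eventually_elim (auto simp: F_def indicator_def)
    qed (use F in auto)
    ultimately show ?thesis by (simp only: integral_complex_of_real)
  qed
  also have "(\<integral>y. G y \<partial>lborel) = (\<i> / 2) * (cis (- (2 * b)) - cis (- (2 * a)))"
  proof -
    have "(\<integral>x. indicator {a..b} x *\<^sub>R cis (- (2 * x)) \<partial>lborel) = (\<i> / 2) * cis (- (2 * b)) - (\<i> / 2) * cis (- (2 * a))"
    proof (rule integral_FTC_atLeastAtMost)
      fix x
      show "((\<lambda>x. \<i> / 2 * cis (- (2 * x))) has_vector_derivative cis (- (2 * x))) (at x within {a..b})"
        unfolding has_vector_derivative_def
        by (auto intro!: derivative_eq_intros simp: scaleR_conv_of_real complex_eq_iff)
    qed (use ab in \<open>auto intro!: continuous_intros\<close>)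
    moreover have "(\<integral>x. G x \<partial>lborel) = (\<integral>x. indicator {a..b} x *\<^sub>R cis (- (2 * x)) \<partial>lborel)"
    proof (rule integral_cong_AE)
      show "AE x in lborel. G x = indicator {a..b} x *\<^sub>R cis (- (2 * x))"
        using AE_lborel_singleton[of a] AE_lborel_singleton[of b]
        by eventually_elim (auto simp: G_def indicator_def)
      show "(\<lambda>x. indicator {a..b} x *\<^sub>R cis (- (2 * x))) \<in> borel_measurable lborel"
        by (rule borel_measurable_integrable[OF borel_integrable_compact[OF compact_Icc]]) (intro continuous_intros)
    qed (use G in auto)
    ultimately show ?thesis by (simp add: right_diff_distrib)
  qed
  finally have fin: "cplx (\<integral>y. indicator ?A y *\<^sub>R h y \<partial>lborel) = of_real (ln 2) * ((\<i> / 2) * (cis (- (2 * b)) - cis (- (2 * a))))" .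
  have "integrable lborel (\<lambda>y. indicator ?A y *\<^sub>R h y)"
    using main Am hm img unfolding set_integrable_def
    by (subst (asm) integrable_completion) (auto intro!: borel_measurable_scaleR borel_measurable_indicator)
  from integral_bounded_linear[OF bounded_linear_cplx this]
  have "cplx (\<integral>y. indicator ?A y *\<^sub>R h y \<partial>lborel) = (\<integral>y. indicator ?A y *\<^sub>R inverse ((cplx y)\<^sup>2) \<partial>lborel)"
    by (simp add: linear_scale[OF bounded_linear.linear[OF bounded_linear_cplx]] ch)
  thus ?thesis using fin by (simp add: mult.assoc)
qed

section \<open>Blow-up at the corner tip\<close>

lemma wedge_mono_angle:
  assumes "a' \<le> a" "b \<le> b'"
  shows "wedge a b s \<subseteq> wedge a' b' s"
proof
  fix y assume "y \<in> wedge a b s"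
  then obtain q \<theta> where "y = q *\<^sub>R polar \<theta>" "a < \<theta>" "\<theta> < b" "0 < q" "q < s" by (auto simp: wedge_eq_polar)
  thus "y \<in> wedge a' b' s"
    unfolding wedge_eq_polar using assms by (intro CollectI exI[of _ q] exI[of _ \<theta>]) auto
qed

text \<open>The pole is at distance \<open>t\<close> from the tip in the direction \<open>\<psi>\<close>.\<close>

definition tip_kernel :: "real \<Rightarrow> real \<Rightarrow> real^2 \<Rightarrow> complex" where
  "tip_kernel \<psi> t y = inverse ((cplx y - of_real t * cis \<psi>)\<^sup>2)"

lemma tip_kernel_measurable [measurable]: "tip_kernel \<psi> t \<in> borel_measurable borel"
  unfolding tip_kernel_def[abs_def] by measurable

text \<open>The direction opposite to the bisector makes an angle of more than zero with the closed wedge, even if the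
aperture exceeds \<open>\<pi>\<close>.  By the law of cosines the squared distance is \<open>s\<^sup>2 + t\<^sup>2 + 2 s t cos (\<theta> - m)\<close> with
the cosine bounded away from \<open>-1\<close>.\<close>

lemma exterior_distance:
  fixes a b :: real
  assumes ab: "a < b" "b - a < 2 * pi"
  obtains \<kappa> where "\<kappa> > 0" "\<And>y r t. y \<in> wedge a b r \<Longrightarrow> t \<ge> 0 \<Longrightarrow>
     \<kappa> * ((norm y)\<^sup>2 + t\<^sup>2) \<le> (norm (cplx y - of_real t * cis ((a + b) / 2 + pi)))\<^sup>2"
proof -
  define q where "q = max 0 (- cos ((b - a) / 2))"
  have "cos pi < cos ((b - a) / 2)" using ab by (intro cos_monotone_0_pi) auto
  hence q: "0 \<le> q" "q < 1" by (auto simp: q_def)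
  have "(1 - q) * ((norm y)\<^sup>2 + t\<^sup>2) \<le> (norm (cplx y - of_real t * cis ((a + b) / 2 + pi)))\<^sup>2"
    if y: "y \<in> wedge a b r" and t: "t \<ge> 0" for y r t
  proof -
    obtain s \<theta> where s: "y = s *\<^sub>R polar \<theta>" "a < \<theta>" "\<theta> < b" "0 < s" using y by (auto simp: wedge_eq_polar)
    define m where "m = (a + b) / 2"
    have am: "\<bar>\<theta> - m\<bar> \<le> (b - a) / 2" "(b - a) / 2 \<le> pi" using s ab by (auto simp: m_def field_simps abs_le_iff)
    have "cos ((b - a) / 2) \<le> cos \<bar>\<theta> - m\<bar>" by (rule cos_monotone_0_pi_le) (use am in auto)
    hence c: "- q \<le> cos (\<theta> - m)" by (simp add: q_def)
    have "(norm (cplx y - of_real t * cis (m + pi)))\<^sup>2 = s\<^sup>2 + t\<^sup>2 + 2 * s * t * cos (\<theta> - m)"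
    proof -
      have "(norm (cplx y - of_real t * cis (m + pi)))\<^sup>2 = (s * cos \<theta> + t * cos m)\<^sup>2 + (s * sin \<theta> + t * sin m)\<^sup>2"
        unfolding s(1) cplx_polar by (simp add: cmod_power2)
      also have "\<dots> = s\<^sup>2 * ((sin \<theta>)\<^sup>2 + (cos \<theta>)\<^sup>2) + t\<^sup>2 * ((sin m)\<^sup>2 + (cos m)\<^sup>2) + 2 * s * t * (cos \<theta> * cos m + sin \<theta> * sin m)"
        by algebra
      finally show ?thesis by (simp add: cos_diff)
    qed
    moreover have "2 * s * t * (- q) \<le> 2 * s * t * cos (\<theta> - m)" using c s t by (intro mult_left_mono) auto
    moreover have "q * (2 * s * t) \<le> q * (s\<^sup>2 + t\<^sup>2)" using q sum_squares_bound[of s t] by (intro mult_left_mono) auto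
    moreover have "norm y = s" using s by simp
    ultimately show ?thesis by (simp add: m_def algebra_simps)
  qed
  thus ?thesis using that[of "1 - q"] q by auto
qed

lemma tip_kernel_bound:
  assumes k: "\<kappa> > 0" and y: "y \<noteq> 0" and b: "\<kappa> * ((norm y)\<^sup>2 + t\<^sup>2) \<le> (norm (cplx y - of_real t * cis \<psi>))\<^sup>2"
  shows "norm (tip_kernel \<psi> t y) \<le> inverse \<kappa> * inverse ((norm y)\<^sup>2)"
    and "norm (tip_kernel \<psi> t y) * (\<kappa> * t\<^sup>2) \<le> 1"
proof -
  let ?d = "(norm (cplx y - of_real t * cis \<psi>))\<^sup>2"
  have ny: "(norm y)\<^sup>2 > 0" using y by simp
  have kn: "norm (tip_kernel \<psi> t y) = inverse ?d"
    by (simp add: tip_kernel_def norm_inverse norm_power)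
  have 1: "\<kappa> * (norm y)\<^sup>2 \<le> ?d" "\<kappa> * t\<^sup>2 \<le> ?d" using b k by (auto simp: distrib_left intro: order_trans[rotated])
  have p: "\<kappa> * (norm y)\<^sup>2 > 0" using k ny by simp
  hence "inverse ?d \<le> inverse (\<kappa> * (norm y)\<^sup>2)" using 1 by (intro le_imp_inverse_le)
  thus "norm (tip_kernel \<psi> t y) \<le> inverse \<kappa> * inverse ((norm y)\<^sup>2)" by (simp add: kn)
  have "?d > 0" using 1(1) p by linarith
  thus "norm (tip_kernel \<psi> t y) * (\<kappa> * t\<^sup>2) \<le> 1" using 1(2) by (simp add: kn divide_simps)
qed

text \<open>The kernel has degree \<open>-2\<close> in \<open>(y, t)\<close>, the area element degree \<open>2\<close>.\<close>

lemma tip_kernel_scale: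
  assumes ab: "b - a \<le> 2 * pi" and r: "r > 0"
  shows "(\<integral>y. indicator (wedge a b (2 * r)) y *\<^sub>R tip_kernel \<psi> (2 * t) y \<partial>lborel)
       = (\<integral>y. indicator (wedge a b r) y *\<^sub>R tip_kernel \<psi> t y \<partial>lborel)"
proof -
  have ws: "2 *\<^sub>R y \<in> wedge a b (2 * r) \<longleftrightarrow> y \<in> wedge a b r" for y
  proof
    assume "y \<in> wedge a b r"
    then obtain s \<theta> where "y = s *\<^sub>R polar \<theta>" "a < \<theta>" "\<theta> < b" "0 < s" "s < r" by (auto simp: wedge_eq_polar)
    thus "2 *\<^sub>R y \<in> wedge a b (2 * r)"
      unfolding wedge_eq_polar by (intro CollectI exI[of _ "2 * s"] exI[of _ \<theta>]) auto
  next
    assume "2 *\<^sub>R y \<in> wedge a b (2 * r)"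
    then obtain s \<theta> where s: "2 *\<^sub>R y = s *\<^sub>R polar \<theta>" "a < \<theta>" "\<theta> < b" "0 < s" "s < 2 * r" by (auto simp: wedge_eq_polar)
    have "y = (1/2) *\<^sub>R (2 *\<^sub>R y)" by simp
    also have "\<dots> = (s / 2) *\<^sub>R polar \<theta>" unfolding s(1) by simp
    finally show "y \<in> wedge a b r" using s unfolding wedge_eq_polar by (intro CollectI exI[of _ "s/2"] exI[of _ \<theta>]) auto
  qed
  have ts: "4 *\<^sub>R tip_kernel \<psi> (2 * t) (2 *\<^sub>R y) = tip_kernel \<psi> t y" for y
  proof -
    have "cplx (2 *\<^sub>R y) - of_real (2 * t) * cis \<psi> = 2 * (cplx y - of_real t * cis \<psi>)"
      unfolding linear_scale[OF bounded_linear.linear[OF bounded_linear_cplx]]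
      by (simp add: scaleR_conv_of_real algebra_simps)
    thus ?thesis unfolding tip_kernel_def
      by (simp only: power_mult_distrib inverse_mult_distrib scaleR_conv_of_real) simp
  qed
  have [measurable]: "wedge a b (2 * r) \<in> sets borel" using open_wedge[OF ab] by auto
  have "(\<integral>y. indicator (wedge a b (2 * r)) y *\<^sub>R tip_kernel \<psi> (2 * t) y \<partial>lborel)
     = \<bar>2\<bar> ^ DIM(real^2) *\<^sub>R (\<integral>y. indicator (wedge a b (2 * r)) (0 + 2 *\<^sub>R y) *\<^sub>R tip_kernel \<psi> (2 * t) (0 + 2 *\<^sub>R y) \<partial>lborel)"
    by (rule lborel_integral_affine) auto
  also have "\<dots> = 4 *\<^sub>R (\<integral>y. indicator (wedge a b r) y *\<^sub>R tip_kernel \<psi> (2 * t) (2 *\<^sub>R y) \<partial>lborel)"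
    by (simp add: indicator_def ws)
  also have "\<dots> = (\<integral>y. 4 *\<^sub>R (indicator (wedge a b r) y *\<^sub>R tip_kernel \<psi> (2 * t) (2 *\<^sub>R y)) \<partial>lborel)"
    by (rule Bochner_Integration.integral_scaleR_right[symmetric])
  also have "\<dots> = (\<integral>y. indicator (wedge a b r) y *\<^sub>R (4 *\<^sub>R tip_kernel \<psi> (2 * t) (2 *\<^sub>R y)) \<partial>lborel)"
    by (simp only: scaleR_left_commute)
  finally show ?thesis unfolding ts .
qed

lemma bounded_partial_sums_limit_zero:
  fixes A :: "nat \<Rightarrow> complex"
  assumes lim: "A \<longlonglongrightarrow> L" and b: "\<And>n. norm (\<Sum>i<n. A i) \<le> M"
  shows "L = 0"
proof (rule ccontr)
  assume L: "L \<noteq> 0"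
  obtain N where N: "\<And>n. n \<ge> N \<Longrightarrow> norm (A n - L) < norm L / 2"
    using LIMSEQ_D[OF lim, of "norm L / 2"] L by auto
  have "real m * norm L / 2 \<le> 2 * M" for m
  proof -
    have "(\<Sum>i<m. A (N + i)) = (\<Sum>i<N + m. A i) - (\<Sum>i<N. A i)"
      by (induction m) auto
    hence "norm (\<Sum>i<m. A (N + i)) \<le> 2 * M"
      using b[of "N + m"] b[of N] norm_triangle_ineq4[of "\<Sum>i<N + m. A i" "\<Sum>i<N. A i"] by simp
    moreover have "norm (\<Sum>i<m. A (N + i) - L) \<le> (\<Sum>i<m. norm L / 2)"
      by (rule order_trans[OF norm_sum sum_mono]) (use N in \<open>auto intro: less_imp_le\<close>)
    moreover have "of_nat m * L = (\<Sum>i<m. A (N + i)) - (\<Sum>i<m. A (N + i) - L)"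
      by (simp add: sum_subtractf)
    hence "real m * norm L \<le> norm (\<Sum>i<m. A (N + i)) + norm (\<Sum>i<m. A (N + i) - L)"
      using norm_triangle_ineq4[of "\<Sum>i<m. A (N + i)" "\<Sum>i<m. A (N + i) - L"] by (metis norm_mult norm_of_nat)
    ultimately show ?thesis by simp
  qed
  moreover obtain m where "real m * (norm L / 2) > 2 * M"
    using reals_Archimedean3[of "norm L / 2", rule_format, of "2 * M"] L by fastforce
  ultimately show False by (metis leD times_divide_eq_right)
qed

text \<open>One of the two sectors, with the pole approaching the tip from a direction that stays at a positive angle
from it.  The constant \<open>\<kappa>\<close> is a parameter because for both sectors it comes from the whole corner.\<close>

locale tip_integral =
  fixes a b \<psi> \<kappa> r :: real
  assumes ab: "a < b" "b - a \<le> 2 * pi" and r: "r > 0" and \<kappa>: "\<kappa> > 0"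
    and low: "\<And>y s t. y \<in> wedge a b s \<Longrightarrow> t \<ge> 0 \<Longrightarrow> \<kappa> * ((norm y)\<^sup>2 + t\<^sup>2) \<le> (norm (cplx y - of_real t * cis \<psi>))\<^sup>2"
begin

lemma wedge_borel [measurable]: "wedge a b s \<in> sets borel" using open_wedge[OF ab(2)] by auto

definition wedge_moment :: "real \<Rightarrow> complex" where
  "wedge_moment t = (\<integral>y. indicator (wedge a b r) y *\<^sub>R tip_kernel \<psi> t y \<partial>lborel)"

definition annulus_moment :: "real \<Rightarrow> complex" where
  "annulus_moment t = (\<integral>y. indicator (wedge a b (2 * r) - wedge a b r) y *\<^sub>R tip_kernel \<psi> t y \<partial>lborel)"

lemma integrable_tip_kernel:
  assumes t: "t > 0"
  shows "integrable lborel (\<lambda>y. indicator (wedge a b s) y *\<^sub>R tip_kernel \<psi> t y)"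
proof (rule Bochner_Integration.integrable_bound)
  show "integrable lborel (\<lambda>y::real^2. indicator (cball 0 s) y *\<^sub>R (1 / (\<kappa> * t\<^sup>2)))"
    by (rule borel_integrable_compact) auto
  show "AE y in lborel. norm (indicator (wedge a b s) y *\<^sub>R tip_kernel \<psi> t y) \<le> norm (indicator (cball 0 s) y *\<^sub>R (1 / (\<kappa> * t\<^sup>2)))"
  proof (rule AE_I2)
    fix y
    show "norm (indicator (wedge a b s) y *\<^sub>R tip_kernel \<psi> t y) \<le> norm (indicator (cball 0 s) y *\<^sub>R (1 / (\<kappa> * t\<^sup>2)))"
    proof (cases "y \<in> wedge a b s")
      case True
      have "y \<noteq> 0" "norm y \<le> s" using wedge_norm[OF True] by auto
      moreover have "norm (tip_kernel \<psi> t y) \<le> 1 / (\<kappa> * t\<^sup>2)"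
        using tip_kernel_bound(2)[OF \<kappa> \<open>y \<noteq> 0\<close> low[OF True]] t \<kappa> by (simp add: field_simps)
      ultimately show ?thesis using True \<kappa> by simp
    qed simp
  qed
qed measurable

text \<open>By scale invariance the moment for \<open>t\<close> is that of the wedge of twice the radius for \<open>2 t\<close>; only the outer
annulus survives in the difference.\<close>

lemma wedge_moment_diff:
  assumes t: "t > 0"
  shows "wedge_moment t - wedge_moment (2 * t) = annulus_moment (2 * t)"
proof -
  have "wedge_moment t = (\<integral>y. indicator (wedge a b (2 * r)) y *\<^sub>R tip_kernel \<psi> (2 * t) y \<partial>lborel)"
    unfolding wedge_moment_def using tip_kernel_scale[OF ab(2) r] by simp
  hence "wedge_moment t - wedge_moment (2 * t) = (\<integral>y. indicator (wedge a b (2 * r)) y *\<^sub>R tip_kernel \<psi> (2 * t) y - indicator (wedge a b r) y *\<^sub>R tip_kernel \<psi> (2 * t) y \<partial>lborel)"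
    unfolding wedge_moment_def using t by (simp add: Bochner_Integration.integral_diff integrable_tip_kernel)
  also have "\<dots> = annulus_moment (2 * t)"
    unfolding annulus_moment_def
  proof (intro Bochner_Integration.integral_cong refl)
    fix y
    have "y \<in> wedge a b r \<Longrightarrow> y \<in> wedge a b (2 * r)" using wedge_mono_radius[of r "2 * r" a b] r by auto
    thus "indicator (wedge a b (2 * r)) y *\<^sub>R tip_kernel \<psi> (2 * t) y - indicator (wedge a b r) y *\<^sub>R tip_kernel \<psi> (2 * t) y =
       indicator (wedge a b (2 * r) - wedge a b r) y *\<^sub>R tip_kernel \<psi> (2 * t) y"
      by (auto simp: indicator_def)
  qed
  finally show ?thesis .
qed

text \<open>On the annulus the kernel has no singularity in the limit, so the pole can be moved to the tip.\<close>

lemma annulus_moment_limit: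
  assumes T: "T \<longlonglongrightarrow> 0" "\<And>n. T n \<ge> 0"
  shows "(\<lambda>n. annulus_moment (T n)) \<longlonglongrightarrow> of_real (ln 2) * (\<i> / 2) * (cis (- (2 * b)) - cis (- (2 * a)))"
proof -
  let ?A = "wedge a b (2 * r) - wedge a b r"
  have "(\<lambda>n. annulus_moment (T n)) \<longlonglongrightarrow> (\<integral>y. indicator ?A y *\<^sub>R inverse ((cplx y)\<^sup>2) \<partial>lborel)"
    unfolding annulus_moment_def
  proof (rule integral_dominated_convergence[where w="\<lambda>y. indicator (cball 0 (2 * r)) y *\<^sub>R (inverse \<kappa> * inverse (r\<^sup>2))"])
    show "integrable lborel (\<lambda>y::real^2. indicator (cball 0 (2 * r)) y *\<^sub>R (inverse \<kappa> * inverse (r\<^sup>2)))"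
      by (rule borel_integrable_compact) auto
    show "AE y in lborel. (\<lambda>n. indicator ?A y *\<^sub>R tip_kernel \<psi> (T n) y) \<longlonglongrightarrow> indicator ?A y *\<^sub>R inverse ((cplx y)\<^sup>2)"
    proof (rule AE_I2)
      fix y
      show "(\<lambda>n. indicator ?A y *\<^sub>R tip_kernel \<psi> (T n) y) \<longlonglongrightarrow> indicator ?A y *\<^sub>R inverse ((cplx y)\<^sup>2)"
      proof (cases "y \<in> ?A")
        case True
        hence "y \<noteq> 0" using wedge_norm by auto
        hence nz: "(cplx y - of_real 0 * cis \<psi>)\<^sup>2 \<noteq> 0" by (metis diff_zero mult_zero_left norm_cplx norm_eq_zero of_real_0 power_not_zero)
        have "(\<lambda>n. inverse ((cplx y - of_real (T n) * cis \<psi>)\<^sup>2)) \<longlonglongrightarrow> inverse ((cplx y - of_real 0 * cis \<psi>)\<^sup>2)"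
          by (intro tendsto_intros T nz)
        thus ?thesis by (intro tendsto_scaleR tendsto_const) (simp add: tip_kernel_def)
      qed simp
    qed
    show "AE y in lborel. norm (indicator ?A y *\<^sub>R tip_kernel \<psi> (T n) y) \<le> indicator (cball 0 (2 * r)) y *\<^sub>R (inverse \<kappa> * inverse (r\<^sup>2))" for n
    proof (rule AE_I2)
      fix y
      show "norm (indicator ?A y *\<^sub>R tip_kernel \<psi> (T n) y) \<le> indicator (cball 0 (2 * r)) y *\<^sub>R (inverse \<kappa> * inverse (r\<^sup>2))"
      proof (cases "y \<in> ?A")
        case True
        hence w: "y \<in> wedge a b (2 * r)" by simp
        have n: "0 < norm y" "norm y < 2 * r" using wedge_norm[OF w] by auto
        have "\<not> norm y < r"
        proof
          assume "norm y < r"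
          hence "y \<in> wedge a b (2 * r) \<inter> ball 0 r" using w by simp
          thus False using wedge_Int_ball[of r "2 * r" a b] r True by auto
        qed
        hence "r\<^sup>2 \<le> (norm y)\<^sup>2" using r by (intro power_mono) auto
        hence "inverse \<kappa> * inverse ((norm y)\<^sup>2) \<le> inverse \<kappa> * inverse (r\<^sup>2)"
          using r \<kappa> by (intro mult_left_mono le_imp_inverse_le) auto
        moreover have "norm (tip_kernel \<psi> (T n) y) \<le> inverse \<kappa> * inverse ((norm y)\<^sup>2)"
          using n by (intro tip_kernel_bound(1)[OF \<kappa> _ low[OF w T(2)]]) auto
        ultimately show ?thesis using True n by simp
      qed (use \<kappa> in simp)
    qed
  qed measurable
  thus ?thesis using sector_integral[OF ab r] by simp
qed

end

lemma sum_telescope_halving: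
  fixes J :: "real \<Rightarrow> complex"
  shows "(\<Sum>i<n. J ((1/2) ^ Suc i) - J (2 * (1/2) ^ Suc i)) = J ((1/2) ^ n) - J 1"
  by (induction n) (auto simp: mult.assoc[symmetric])

text \<open>Replace \<open>g\<close> by its limiting values: the error is of size \<open>|y| powr (\<beta> - 2)\<close>, which is integrable, so the
moments of the step function stay bounded as well.  These moments telescope along \<open>t = t0 / 2^i\<close>, with
increments that converge to the annular sector integrals.  Bounded sums of a convergent sequence force its
limit to be zero.\<close>

theorem corner_condition:
  fixes g :: "real^2 \<Rightarrow> complex" and \<theta>0 \<theta>1 \<theta>2 :: real and p1 p2 :: complex
  assumes th: "\<theta>0 < \<theta>1" "\<theta>1 < \<theta>2" "\<theta>2 - \<theta>0 < 2 * pi" and r: "0 < r" "r \<le> 1"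
    and g: "g \<in> borel_measurable borel"
    and g1: "AE y in lborel. y \<in> wedge \<theta>0 \<theta>1 r \<longrightarrow> norm (g y - p1) \<le> C * norm y powr \<beta>"
    and g2: "AE y in lborel. y \<in> wedge \<theta>1 \<theta>2 r \<longrightarrow> norm (g y - p2) \<le> C * norm y powr \<beta>"
    and g0: "AE y in lborel. y \<in> ball 0 r \<longrightarrow> y \<notin> wedge \<theta>0 \<theta>1 r \<longrightarrow> y \<notin> wedge \<theta>1 \<theta>2 r \<longrightarrow> g y = 0"
    and \<beta>: "0 < \<beta>" "\<beta> \<le> 1" and C: "C \<ge> 0"
    and bd: "\<And>t. 0 < t \<Longrightarrow> t \<le> t0 \<Longrightarrow>
       norm (\<integral>y. indicator (ball 0 r) y *\<^sub>R (g y * tip_kernel ((\<theta>0 + \<theta>2) / 2 + pi) t y) \<partial>lborel) \<le> M"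
    and t0: "t0 > 0"
  shows "p1 * (cis (- (2 * \<theta>1)) - cis (- (2 * \<theta>0))) + p2 * (cis (- (2 * \<theta>2)) - cis (- (2 * \<theta>1))) = 0"
proof -
  define \<psi> where "\<psi> = (\<theta>0 + \<theta>2) / 2 + pi"
  obtain \<kappa> where \<kappa>: "\<kappa> > 0" "\<And>y r t. y \<in> wedge \<theta>0 \<theta>2 r \<Longrightarrow> t \<ge> 0 \<Longrightarrow>
     \<kappa> * ((norm y)\<^sup>2 + t\<^sup>2) \<le> (norm (cplx y - of_real t * cis \<psi>))\<^sup>2"
    using exterior_distance[OF less_trans[OF th(1,2)] th(3)] unfolding \<psi>_def by blast
  have sub: "wedge \<theta>0 \<theta>1 s \<subseteq> wedge \<theta>0 \<theta>2 s" "wedge \<theta>1 \<theta>2 s \<subseteq> wedge \<theta>0 \<theta>2 s" for s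
    by (intro wedge_mono_angle; use th in simp)+
  interpret A: tip_integral \<theta>0 \<theta>1 \<psi> \<kappa> r
    by unfold_locales (use th r \<kappa>(1) \<kappa>(2)[OF subsetD[OF sub(1)]] in auto)
  interpret B: tip_integral \<theta>1 \<theta>2 \<psi> \<kappa> r
    by unfold_locales (use th r \<kappa>(1) \<kappa>(2)[OF subsetD[OF sub(2)]] in auto)
  let ?W1 = "wedge \<theta>0 \<theta>1 r" and ?W2 = "wedge \<theta>1 \<theta>2 r"
  have disj: "?W1 \<inter> ?W2 = {}"
  proof -
    have "inj_on polar_map {v. 0 < v $ 1 \<and> \<theta>0 < v $ 2 \<and> v $ 2 < \<theta>2}"
      by (rule polar_map_inj) (use th in simp)
    hence neq: "polar_map v \<noteq> polar_map w" if "0 < v $ 1" "\<theta>0 < v $ 2" "v $ 2 < \<theta>1"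
        "0 < w $ 1" "\<theta>1 < w $ 2" "w $ 2 < \<theta>2" for v w
      using that th inj_onD[of polar_map _ v w] by force
    show ?thesis
    proof (rule ccontr)
      assume "?W1 \<inter> ?W2 \<noteq> {}"
      then obtain y where "y \<in> ?W1" "y \<in> ?W2" by blast
      then obtain v w where "y = polar_map v" "v \<in> {v. 0 < v $ 1 \<and> v $ 1 < r \<and> \<theta>0 < v $ 2 \<and> v $ 2 < \<theta>1}"
        "y = polar_map w" "w \<in> {v. 0 < v $ 1 \<and> v $ 1 < r \<and> \<theta>1 < v $ 2 \<and> v $ 2 < \<theta>2}"
        unfolding wedge_image_polar_map by blast
      thus False using neq[of v w] by simp
    qed
  qed
  define step where "step y = indicator ?W1 y *\<^sub>R p1 + indicator ?W2 y *\<^sub>R p2" for y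
  have [measurable]: "step \<in> borel_measurable borel" "g \<in> borel_measurable borel"
    using g unfolding step_def[abs_def] by measurable
  define G where "G y = indicator (cball 0 1) y * norm y powr (\<beta> - 2)" for y :: "real^2"
  have Gi: "integrable lborel G" unfolding G_def using integrable_norm_powr_near_0[of \<beta>] \<beta> by simp
  define M1 where "M1 = C * inverse \<kappa> * integral\<^sup>L lborel G"
  have err: "integrable lborel (\<lambda>y. indicator (ball 0 r) y *\<^sub>R ((g y - step y) * tip_kernel \<psi> t y))"
    and errb: "norm (\<integral>y. indicator (ball 0 r) y *\<^sub>R ((g y - step y) * tip_kernel \<psi> t y) \<partial>lborel) \<le> M1"
    if t: "t > 0" for t
  proof -
    have ae: "AE y in lborel. norm (indicator (ball 0 r) y *\<^sub>R ((g y - step y) * tip_kernel \<psi> t y)) \<le> C * inverse \<kappa> * G y"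
      using g1 g2 g0
    proof eventually_elim
      case (elim y)
      show ?case
      proof (cases "y \<in> ?W1 \<or> y \<in> ?W2")
        case True
        hence w: "y \<in> wedge \<theta>0 \<theta>2 r" using sub by auto
        have n: "0 < norm y" "norm y < r" using wedge_norm[OF w] by auto
        have "norm (g y - step y) \<le> C * norm y powr \<beta>"
          using True disj elim by (auto simp: step_def indicator_def disjoint_iff)
        moreover have "norm (tip_kernel \<psi> t y) \<le> inverse \<kappa> * inverse ((norm y)\<^sup>2)"
          using n t by (intro tip_kernel_bound(1)[OF \<kappa>(1) _ \<kappa>(2)[OF w]]) auto
        ultimately have "norm (g y - step y) * norm (tip_kernel \<psi> t y) \<le> (C * norm y powr \<beta>) * (inverse \<kappa> * inverse ((norm y)\<^sup>2))"
          using C by (intro mult_mono) auto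
        also have "\<dots> = C * inverse \<kappa> * (norm y powr \<beta> * inverse ((norm y)\<^sup>2))" by simp
        also have "norm y powr \<beta> * inverse ((norm y)\<^sup>2) = norm y powr (\<beta> - 2)"
          using n by (simp add: powr_diff divide_inverse powr_numeral)
        finally show ?thesis using n r by (simp add: G_def norm_mult)
      next
        case False
        hence "indicator (ball 0 r) y *\<^sub>R (g y - step y) = 0" using elim by (auto simp: step_def indicator_def)
        hence "indicator (ball 0 r) y *\<^sub>R ((g y - step y) * tip_kernel \<psi> t y) = 0"
          by (metis mult_scaleR_left mult_zero_left)
        moreover have "0 \<le> C * inverse \<kappa> * G y" using C \<kappa>(1) by (simp add: G_def)
        ultimately show ?thesis by (simp only: norm_zero)
      qed
    qed
    have Gi2: "integrable lborel (\<lambda>y. C * inverse \<kappa> * G y)" using Gi by simp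
    show i: "integrable lborel (\<lambda>y. indicator (ball 0 r) y *\<^sub>R ((g y - step y) * tip_kernel \<psi> t y))"
    proof (rule Bochner_Integration.integrable_bound[OF Gi2])
      show "AE y in lborel. norm (indicator (ball 0 r) y *\<^sub>R ((g y - step y) * tip_kernel \<psi> t y)) \<le> norm (C * inverse \<kappa> * G y)"
        using ae by eventually_elim (rule order_trans, assumption, simp)
      have [measurable]: "ball (0::real^2) r \<in> sets borel" by simp
      show "(\<lambda>y. indicator (ball 0 r) y *\<^sub>R ((g y - step y) * tip_kernel \<psi> t y)) \<in> borel_measurable lborel" by measurable
    qed
    have "norm (\<integral>y. indicator (ball 0 r) y *\<^sub>R ((g y - step y) * tip_kernel \<psi> t y) \<partial>lborel)
       \<le> (\<integral>y. norm (indicator (ball 0 r) y *\<^sub>R ((g y - step y) * tip_kernel \<psi> t y)) \<partial>lborel)"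
      by (rule integral_norm_bound)
    also have "\<dots> \<le> (\<integral>y. C * inverse \<kappa> * G y \<partial>lborel)"
      by (rule integral_mono_AE[OF integrable_norm[OF i] Gi2 ae])
    also have "\<dots> = M1" by (simp add: M1_def)
    finally show "norm (\<integral>y. indicator (ball 0 r) y *\<^sub>R ((g y - step y) * tip_kernel \<psi> t y) \<partial>lborel) \<le> M1" .
  qed
  define L where "L t = p1 * A.wedge_moment t + p2 * B.wedge_moment t" for t
  have Lb: "norm (L t) \<le> M + M1" if t: "0 < t" "t \<le> t0" for t
  proof -
    let ?s = "\<lambda>y. indicator (ball 0 r) y *\<^sub>R (step y * tip_kernel \<psi> t y)"
    have s: "?s y = p1 * (indicator ?W1 y *\<^sub>R tip_kernel \<psi> t y) + p2 * (indicator ?W2 y *\<^sub>R tip_kernel \<psi> t y)" for y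
      using wedge_norm[of y \<theta>0 \<theta>1 r] wedge_norm[of y \<theta>1 \<theta>2 r]
      by (auto simp: step_def indicator_def algebra_simps)
    have si: "integrable lborel ?s" unfolding s
      using t by (intro Bochner_Integration.integrable_add integrable_mult_right A.integrable_tip_kernel B.integrable_tip_kernel)
    have "integral\<^sup>L lborel ?s = L t"
      unfolding s L_def A.wedge_moment_def B.wedge_moment_def
      using Bochner_Integration.integral_add[OF integrable_mult_right integrable_mult_right,
          OF A.integrable_tip_kernel[OF t(1), of r] B.integrable_tip_kernel[OF t(1), of r], of p1 p2]
      by (simp only: integral_mult_right_zero)
    moreover have "(\<integral>y. indicator (ball 0 r) y *\<^sub>R (g y * tip_kernel \<psi> t y) \<partial>lborel)
       = (\<integral>y. indicator (ball 0 r) y *\<^sub>R ((g y - step y) * tip_kernel \<psi> t y) + ?s y \<partial>lborel)"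
      by (intro Bochner_Integration.integral_cong) (auto simp: algebra_simps)
    hence "(\<integral>y. indicator (ball 0 r) y *\<^sub>R (g y * tip_kernel \<psi> t y) \<partial>lborel)
       = (\<integral>y. indicator (ball 0 r) y *\<^sub>R ((g y - step y) * tip_kernel \<psi> t y) \<partial>lborel) + integral\<^sup>L lborel ?s"
      using err[OF t(1)] si by (simp only: Bochner_Integration.integral_add)
    ultimately have "L t = (\<integral>y. indicator (ball 0 r) y *\<^sub>R (g y * tip_kernel \<psi> t y) \<partial>lborel)
        - (\<integral>y. indicator (ball 0 r) y *\<^sub>R ((g y - step y) * tip_kernel \<psi> t y) \<partial>lborel)" by simp
    hence "norm (L t) \<le> norm (\<integral>y. indicator (ball 0 r) y *\<^sub>R (g y * tip_kernel \<psi> t y) \<partial>lborel)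
        + norm (\<integral>y. indicator (ball 0 r) y *\<^sub>R ((g y - step y) * tip_kernel \<psi> t y) \<partial>lborel)"
      by (simp only: norm_triangle_ineq4)
    also have "\<dots> \<le> M + M1"
      using bd[OF t] errb[OF t(1)] unfolding \<psi>_def[symmetric] by (rule add_mono)
    finally show ?thesis .
  qed
  define T where "T i = t0 * (1/2) ^ Suc i" for i
  have T: "T i > 0" "2 * T i \<le> t0" for i
    using t0 by (auto simp: T_def power_le_one)
  define c where "c i = p1 * A.annulus_moment (2 * T i) + p2 * B.annulus_moment (2 * T i)" for i
  have cL: "c i = L (T i) - L (2 * T i)" for i
    unfolding c_def L_def A.wedge_moment_diff[OF T(1), symmetric] B.wedge_moment_diff[OF T(1), symmetric] by (simp add: algebra_simps)
  have "norm (\<Sum>i<n. c i) \<le> 2 * (M + M1)" for n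
  proof -
    have "(\<Sum>i<n. c i) = L (t0 * (1/2) ^ n) - L (t0 * 1)"
      unfolding cL T_def using sum_telescope_halving[of "\<lambda>x. L (t0 * x)" n] by (simp add: mult_ac)
    moreover have "norm (L (t0 * (1/2) ^ n)) \<le> M + M1" "norm (L (t0 * 1)) \<le> M + M1"
      using t0 by (intro Lb; simp add: power_le_one)+
    ultimately show ?thesis using norm_triangle_ineq4[of "L (t0 * (1/2) ^ n)" "L (t0 * 1)"] by simp
  qed
  moreover have "c \<longlonglongrightarrow> p1 * (of_real (ln 2) * (\<i> / 2) * (cis (- (2 * \<theta>1)) - cis (- (2 * \<theta>0))))
       + p2 * (of_real (ln 2) * (\<i> / 2) * (cis (- (2 * \<theta>2)) - cis (- (2 * \<theta>1))))"
  proof -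
    have "(\<lambda>i. 2 * T i) \<longlonglongrightarrow> 0"
    proof -
      have "(\<lambda>i. t0 * (1/2) ^ i) \<longlonglongrightarrow> t0 * 0"
        by (intro tendsto_mult tendsto_const LIMSEQ_realpow_zero) auto
      moreover have "2 * T i = t0 * (1/2) ^ i" for i by (simp add: T_def)
      ultimately show ?thesis by simp
    qed
    thus ?thesis unfolding c_def
      using T(1) by (intro tendsto_add tendsto_mult tendsto_const A.annulus_moment_limit B.annulus_moment_limit) (auto intro: less_imp_le)
  qed
  ultimately have "p1 * (of_real (ln 2) * (\<i> / 2) * (cis (- (2 * \<theta>1)) - cis (- (2 * \<theta>0))))
       + p2 * (of_real (ln 2) * (\<i> / 2) * (cis (- (2 * \<theta>2)) - cis (- (2 * \<theta>1)))) = 0"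
    using bounded_partial_sums_limit_zero by blast
  hence "(of_real (ln 2) * (\<i> / 2)) * (p1 * (cis (- (2 * \<theta>1)) - cis (- (2 * \<theta>0))) + p2 * (cis (- (2 * \<theta>2)) - cis (- (2 * \<theta>1)))) = 0"
    by (simp only: distrib_left mult_ac)
  thus ?thesis by simp
qed

section \<open>The scattered field vanishes outside the medium\<close>

text \<open>By the Lindelof property countably many of the neighbourhoods suffice.\<close>

lemma AE_open_local:
  fixes P :: "'a::euclidean_space \<Rightarrow> bool"
  assumes "\<And>x. x \<in> G \<Longrightarrow> \<exists>U. open U \<and> x \<in> U \<and> (AE y in lborel. y \<in> U \<longrightarrow> P y)"
  shows "AE y in lborel. y \<in> G \<longrightarrow> P y"
proof -
  let ?F = "{U. open U \<and> (AE y in lborel. y \<in> U \<longrightarrow> P y)}"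
  obtain F' where F': "F' \<subseteq> ?F" "countable F'" "\<Union>F' = \<Union>?F"
    using Lindelof[of ?F] by blast
  have "AE y in lborel. \<forall>U\<in>F'. y \<in> U \<longrightarrow> P y"
    using F'(1,2) by (subst AE_ball_countable) auto
  thus ?thesis
  proof eventually_elim
    case (elim y)
    have "G \<subseteq> \<Union>?F" using assms by blast
    thus ?case using elim F'(3) by blast
  qed
qed

lemma AE_zero_continuous:
  fixes h :: "'a::euclidean_space \<Rightarrow> complex"
  assumes h: "continuous_on UNIV h" and U: "open U" "x \<in> U" and ae: "AE y in lborel. y \<in> U \<longrightarrow> h y = 0"
  shows "h x = 0"
proof (rule ccontr)
  assume "h x \<noteq> 0"
  let ?S = "{y \<in> U. h y \<noteq> 0}"
  have "open ({y. h y \<noteq> 0})" by (intro open_Collect_neq h continuous_intros)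
  moreover have "?S = U \<inter> {y. h y \<noteq> 0}" by auto
  ultimately have "open ?S" using U by auto
  moreover have "x \<in> ?S" using U \<open>h x \<noteq> 0\<close> by simp
  ultimately have "\<not> negligible ?S" using open_not_negligible by blast
  moreover have "AE y in lebesgue. y \<notin> ?S"
    unfolding AE_completion_iff using ae by eventually_elim auto
  hence "negligible ?S"
    unfolding negligible_iff_null_sets
    using AE_iff_null_sets[of ?S lebesgue] \<open>open ?S\<close> by auto
  ultimately show False by simp
qed

definition weak_helmholtz :: "real \<Rightarrow> 'a::euclidean_space set \<Rightarrow> ('a \<Rightarrow> complex) \<Rightarrow> bool" where
  "weak_helmholtz k U w \<longleftrightarrow>
     (\<forall>\<phi> K. test_function \<phi> \<and> compact K \<and> K \<subseteq> U \<and> (\<forall>x. x \<notin> K \<longrightarrow> \<phi> x = 0) \<longrightarrow>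
        (\<integral>x. w x * (laplacian \<phi> x + of_real (k\<^sup>2) * \<phi> x) \<partial>lborel) = 0)"

lemma laplacian_translate:
  assumes "test_function \<phi>"
  shows "laplacian (\<lambda>y. \<phi> (y - a)) x = laplacian \<phi> (x - a)"
proof -
  have "\<phi> differentiable at y" "dir_deriv b \<phi> differentiable at y" for y b
    using test_function_Ck[OF assms, of 2] by (auto simp: numeral_2_eq_2)
  moreover from this have "dir_deriv b (\<lambda>y. \<phi> (y - a)) = (\<lambda>x. dir_deriv b \<phi> (x - a))" for b
    by (intro ext dir_deriv_translate)
  ultimately have "dir_deriv b (dir_deriv b (\<lambda>y. \<phi> (y - a))) x = dir_deriv b (dir_deriv b \<phi>) (x - a)" for b
    by (simp add: dir_deriv_translate)
  thus ?thesis by (simp add: laplacian_def)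
qed

text \<open>If the translate of the kernel to \<open>x\<close> is supported in \<open>U\<close>, it is an admissible test function.\<close>

lemma mollify_helmholtz:
  assumes w: "locally_integrable w" and H: "weak_helmholtz k U w" and \<phi>: "test_function \<phi>"
    and K: "compact K" "\<And>z. z \<notin> K \<Longrightarrow> \<phi> z = 0" "(\<lambda>z. z + x) ` K \<subseteq> U"
  shows "laplacian (mollify w \<phi>) x + of_real (k\<^sup>2) * mollify w \<phi> x = 0"
proof -
  have "compact ((\<lambda>z. z + x) ` K)" using K(1) by (intro compact_continuous_image continuous_intros)
  moreover have "\<phi> (y - x) = 0" if "y \<notin> (\<lambda>z. z + x) ` K" for y
    using that K(2)[of "y - x"] image_eqI[of y "\<lambda>z. z + x" "y - x" K] by auto
  ultimately have "(\<integral>y. w y * (laplacian (\<lambda>y. \<phi> (y - x)) y + of_real (k\<^sup>2) * \<phi> (y - x)) \<partial>lborel) = 0"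
    using H K(3) test_function_translate[OF \<phi>, of x] unfolding weak_helmholtz_def by blast
  moreover have "(\<integral>y. w y * (laplacian (\<lambda>y. \<phi> (y - x)) y + of_real (k\<^sup>2) * \<phi> (y - x)) \<partial>lborel)
     = (\<integral>y. w y * laplacian \<phi> (y - x) + of_real (k\<^sup>2) * (w y * \<phi> (y - x)) \<partial>lborel)"
    by (intro Bochner_Integration.integral_cong) (auto simp: laplacian_translate[OF \<phi>] algebra_simps)
  moreover have "\<dots> = mollify w (laplacian \<phi>) x + of_real (k\<^sup>2) * mollify w \<phi> x"
    unfolding mollify_def
    using integrable_mollify[OF w \<phi>] integrable_mollify[OF w test_function_laplacian[OF \<phi>]] by simp
  ultimately show ?thesis by (simp add: laplacian_mollify[OF w \<phi>])
qed

lemma mollify_translated_test: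
  "mollify w (\<lambda>z. \<phi> (z - (- c))) c = (\<integral>y. w y * \<phi> y \<partial>lborel)"
  by (simp add: mollify_def)

text \<open>A pairing with a test function is a mollification evaluated at a point, so that results on the smooth
function \<open>mollify w \<phi>\<close> return to \<open>w\<close> without a limit of approximate identities.\<close>

lemma vanishes_weaklyI_mollify:
  assumes "\<And>\<phi> K. test_function \<phi> \<Longrightarrow> compact K \<Longrightarrow> K \<subseteq> ball 0 \<eta> \<Longrightarrow> (\<And>z. z \<notin> K \<Longrightarrow> \<phi> z = 0) \<Longrightarrow> mollify w \<phi> c = 0"
  shows "vanishes_weakly (ball c \<eta>) w"
  unfolding vanishes_weakly_def
proof clarify
  fix \<phi> K assume *: "test_function \<phi>" "compact K" "K \<subseteq> ball c \<eta>" "\<forall>x. x \<notin> K \<longrightarrow> \<phi> x = 0"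
  have "mollify w (\<lambda>z. \<phi> (z - (- c))) c = 0"
  proof (rule assms[of _ "(\<lambda>y. y - c) ` K"])
    show "test_function (\<lambda>z. \<phi> (z - (- c)))" by (rule test_function_translate[OF *(1)])
    show "compact ((\<lambda>y. y - c) ` K)" using *(2) by (intro compact_continuous_image continuous_intros)
    show "(\<lambda>y. y - c) ` K \<subseteq> ball 0 \<eta>" using *(3) by (auto simp: dist_norm norm_minus_commute)
    show "\<phi> (z - (- c)) = 0" if "z \<notin> (\<lambda>y. y - c) ` K" for z
      using that *(4) by (force simp: image_iff)
  qed
  thus "(\<integral>x. w x * \<phi> x \<partial>lborel) = 0" by (simp only: mollify_translated_test)
qed

lemma vanishes_weakly_mollify:
  assumes v: "vanishes_weakly U w" and \<phi>: "test_function \<phi>"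
    and K: "compact K" "\<And>z. z \<notin> K \<Longrightarrow> \<phi> z = 0" "(\<lambda>z. z + x) ` K \<subseteq> U"
  shows "mollify w \<phi> x = 0"
proof -
  have "compact ((\<lambda>z. z + x) ` K)" using K(1) by (intro compact_continuous_image continuous_intros)
  moreover have "\<phi> (y - x) = 0" if "y \<notin> (\<lambda>z. z + x) ` K" for y
    using that K(2)[of "y - x"] image_eqI[of y "\<lambda>z. z + x" "y - x" K] by auto
  ultimately show ?thesis
    using v K(3) test_function_translate[OF \<phi>, of x] unfolding vanishes_weakly_def mollify_def by blast
qed

text \<open>Mollification with kernels supported in a ball of radius \<open>\<eta>\<close> costs \<open>\<eta>\<close> in all radii; the choice of \<open>\<eta>\<close>
leaves room for \<open>c\<close> in the smaller ball.\<close>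

lemma weak_unique_continuation_step:
  fixes w :: "real^2 \<Rightarrow> complex"
  assumes k: "k > 0" and w: "locally_integrable w" and H: "weak_helmholtz k U w"
    and d: "ball a d \<subseteq> U" and \<epsilon>: "\<epsilon> > 0" and v: "vanishes_weakly (ball a \<epsilon>) w" and c: "c \<in> ball a d"
  obtains \<eta> where "\<eta> > 0" "vanishes_weakly (ball c \<eta>) w"
proof -
  define \<eta> where "\<eta> = min \<epsilon> (d - dist a c) / 2"
  have \<eta>: "\<eta> > 0" "\<eta> < \<epsilon>" "dist a c < d - \<eta>" using \<epsilon> c by (auto simp: \<eta>_def min_def field_simps)
  have "vanishes_weakly (ball c \<eta>) w"
  proof (rule vanishes_weaklyI_mollify)
    fix \<phi> :: "real^2 \<Rightarrow> complex" and K
    assume \<phi>: "test_function \<phi>" "compact K" "K \<subseteq> ball 0 \<eta>" "\<And>z. z \<notin> K \<Longrightarrow> \<phi> z = 0"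
    have im: "(\<lambda>z. z + x) ` K \<subseteq> ball a s" if "x \<in> ball a (s - \<eta>)" for x s
    proof clarify
      fix z assume "z \<in> K"
      hence "norm z < \<eta>" using \<phi>(3) by auto
      moreover have "norm (a - x) < s - \<eta>" using that by (simp add: dist_norm)
      moreover have "norm (a - (z + x)) \<le> norm (a - x) + norm z"
        using norm_triangle_ineq4[of "a - x" z] by (simp add: algebra_simps)
      ultimately show "z + x \<in> ball a s" by (simp add: dist_norm)
    qed
    show "mollify w \<phi> c = 0"
    proof (rule helmholtz_unique_continuation_ball[OF k, of a "d - \<eta>" "mollify w \<phi>" "\<epsilon> - \<eta>"])
      show "Ck 2 (ball a (d - \<eta>)) (mollify w \<phi>)" by (rule Ck_mono[OF Ck_mollify[OF w \<phi>(1)]]) simp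
      show "laplacian (mollify w \<phi>) x + of_real (k\<^sup>2) * mollify w \<phi> x = 0" if "x \<in> ball a (d - \<eta>)" for x
        by (rule mollify_helmholtz[OF w H \<phi>(1,2,4)]) (use im[OF that] d in auto)
      show "mollify w \<phi> x = 0" if "x \<in> ball a (\<epsilon> - \<eta>)" for x
        by (rule vanishes_weakly_mollify[OF v \<phi>(1,2,4) im[OF that]])
    qed (use \<eta> in auto)
  qed
  thus ?thesis using that \<eta> by blast
qed

text \<open>Mollification with kernels supported in the unit ball preserves the decay, as \<open>sqrt |x| \<le> 2 sqrt |y|\<close> for
\<open>|y - x| < 1\<close> and \<open>|x| \<ge> 2\<close>.\<close>

lemma weak_rellich:
  fixes w :: "real^2 \<Rightarrow> complex"
  assumes k: "k > 0" and R: "R \<ge> 0" and w: "locally_integrable w" and H: "weak_helmholtz k (- cball 0 R) w"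
    and decay: "\<And>\<epsilon>. \<epsilon> > 0 \<Longrightarrow> \<exists>N. AE y in lborel. norm y > N \<longrightarrow> sqrt (norm y) * norm (w y) \<le> \<epsilon>"
    and c: "norm c > R + 1"
  shows "vanishes_weakly (ball c 1) w"
proof (rule vanishes_weaklyI_mollify)
  fix \<phi> :: "real^2 \<Rightarrow> complex" and K
  assume \<phi>: "test_function \<phi>" "compact K" "K \<subseteq> ball 0 1" "\<And>z. z \<notin> K \<Longrightarrow> \<phi> z = 0"
  have \<phi>i: "integrable lborel \<phi>"
    using integrable_mult_test[OF locally_integrable_continuous \<phi>(1), of "\<lambda>_. 1"] by simp
  have [measurable]: "\<phi> \<in> borel_measurable borel" using test_function_continuous[OF \<phi>(1)] by (rule borel_measurable_continuous_onI)
  define I where "I = (\<integral>y. norm (\<phi> y) \<partial>lborel)"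
  have I0: "I \<ge> 0" unfolding I_def by (intro Bochner_Integration.integral_nonneg) auto
  show "mollify w \<phi> c = 0"
  proof (rule helmholtz_rellich[OF k, of "R + 1"])
    show "Ck 2 (- cball 0 (R + 1)) (mollify w \<phi>)" by (rule Ck_mono[OF Ck_mollify[OF w \<phi>(1)]]) simp
    show "laplacian (mollify w \<phi>) x + of_real (k\<^sup>2) * mollify w \<phi> x = 0" if "norm x > R + 1" for x
    proof (rule mollify_helmholtz[OF w H \<phi>(1,2,4)])
      show "(\<lambda>z. z + x) ` K \<subseteq> - cball 0 R"
      proof clarify
        fix z assume "z \<in> K" "z + x \<in> cball 0 R"
        moreover from this have "norm z < 1" using \<phi>(3) by auto
        ultimately show False using that norm_triangle_ineq4[of "z + x" z] by simp
      qed
    qed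
    show "((\<lambda>x. sqrt (norm x) * norm (mollify w \<phi> x)) \<longlongrightarrow> 0) at_infinity"
    proof (rule tendstoI)
      fix e :: real assume e: "e > 0"
      define \<epsilon> where "\<epsilon> = e / (4 * (I + 1))"
      have \<epsilon>: "\<epsilon> > 0" using e I0 by (simp add: \<epsilon>_def)
      obtain N where N: "AE y in lborel. norm y > N \<longrightarrow> sqrt (norm y) * norm (w y) \<le> \<epsilon>" using decay[OF \<epsilon>] by blast
      have "sqrt (norm x) * norm (mollify w \<phi> x) < e" if x: "norm x \<ge> max 2 (N + 2)" for x
      proof -
        define s where "s = sqrt (norm x - 1)"
        have s: "s > 0" using x by (simp add: s_def)
        have \<phi>x: "integrable lborel (\<lambda>y. norm (\<phi> (y - x)))"
          by (intro integrable_norm lborel_integrable_translate \<phi>i)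
        have "norm (mollify w \<phi> x) \<le> (\<integral>y. norm (w y * \<phi> (y - x)) \<partial>lborel)"
          unfolding mollify_def by (rule integral_norm_bound)
        also have "\<dots> \<le> (\<integral>y. \<epsilon> / s * norm (\<phi> (y - x)) \<partial>lborel)"
        proof (rule integral_mono_AE)
          show "integrable lborel (\<lambda>y. norm (w y * \<phi> (y - x)))" by (intro integrable_norm integrable_mollify w \<phi>(1))
          show "integrable lborel (\<lambda>y. \<epsilon> / s * norm (\<phi> (y - x)))" using \<phi>x by simp
          show "AE y in lborel. norm (w y * \<phi> (y - x)) \<le> \<epsilon> / s * norm (\<phi> (y - x))"
            using N
          proof eventually_elim
            case (elim y)
            show ?case
            proof (cases "\<phi> (y - x) = 0")
              case False
              hence "norm (y - x) < 1" using \<phi>(3,4) by (force simp: dist_norm)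
              hence ny: "norm y > norm x - 1" using norm_triangle_ineq2[of x y] by (simp add: norm_minus_commute)
              hence "s \<le> sqrt (norm y)" by (simp add: s_def)
              hence "s * norm (w y) \<le> sqrt (norm y) * norm (w y)" by (intro mult_right_mono) auto
              also have "\<dots> \<le> \<epsilon>" using elim ny x by simp
              finally have "norm (w y) \<le> \<epsilon> / s" using s by (simp add: field_simps)
              thus ?thesis unfolding norm_mult by (rule mult_right_mono) simp
            qed simp
          qed
        qed
        also have "\<dots> = \<epsilon> / s * I"
          using lborel_integral_translate[of "\<lambda>y. norm (\<phi> y)" "- x"] by (simp add: I_def)
        finally have "sqrt (norm x) * norm (mollify w \<phi> x) \<le> sqrt (norm x) * (\<epsilon> / s * I)" by (intro mult_left_mono) auto
        also have "sqrt (norm x) \<le> 2 * s"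
        proof -
          have "sqrt (norm x) \<le> sqrt (4 * (norm x - 1))" using x by (intro real_sqrt_le_mono) simp
          also have "\<dots> = 2 * s" unfolding s_def real_sqrt_mult by simp
          finally show ?thesis .
        qed
        hence "sqrt (norm x) * (\<epsilon> / s * I) \<le> (2 * s) * (\<epsilon> / s * I)" using \<epsilon> s I0 by (intro mult_right_mono) auto
        also have "\<dots> = 2 * \<epsilon> * I" using s by simp
        also have "\<dots> \<le> 2 * \<epsilon> * (I + 1)" using \<epsilon> by simp
        also have "\<dots> < e"
        proof -
          have "\<epsilon> * (4 * (I + 1)) = e" using I0 by (simp add: \<epsilon>_def)
          thus ?thesis using e by (simp add: algebra_simps)
        qed
        finally show ?thesis .
      qed
      thus "\<forall>\<^sub>F x in at_infinity. dist (sqrt (norm x) * norm (mollify w \<phi> x)) 0 < e"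
        unfolding eventually_at_infinity by (intro exI[of _ "max 2 (N + 2)"]) (simp add: dist_norm abs_mult)
    qed
  qed (use R c in auto)
qed

text \<open>The set \<open>Z\<close> of points near which \<open>w\<close> vanishes is nonempty by Rellich's lemma, and it is open and relatively
closed in the exterior because a zero spreads from any point to every ball about it in the exterior.  The
exterior is connected.\<close>

theorem weak_helmholtz_vanishes_outside:
  fixes w :: "real^2 \<Rightarrow> complex" and S :: "(real^2) set"
  assumes k: "k > 0" and w: "locally_integrable w" and S: "compact S" and H: "weak_helmholtz k (- S) w"
    and decay: "\<And>\<epsilon>. \<epsilon> > 0 \<Longrightarrow> \<exists>N. AE y in lborel. norm y > N \<longrightarrow> sqrt (norm y) * norm (w y) \<le> \<epsilon>"
  shows "AE x in lborel. x \<in> outside S \<longrightarrow> w x = 0"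
    and "\<And>R. R \<ge> 0 \<Longrightarrow> S \<subseteq> cball 0 R \<Longrightarrow> AE x in lborel. norm x > R + 1 \<longrightarrow> w x = 0"
proof -
  have far: "vanishes_weakly (ball c 1) w" if R: "R \<ge> 0" "S \<subseteq> cball 0 R" and c: "norm c > R + 1" for R c
  proof (rule weak_rellich[OF k R(1) w _ decay c])
    show "weak_helmholtz k (- cball 0 R) w" using H R(2) unfolding weak_helmholtz_def by blast
  qed
  show "AE x in lborel. norm x > R + 1 \<longrightarrow> w x = 0" if "R \<ge> 0" "S \<subseteq> cball 0 R" for R
  proof -
    have "AE x in lborel. x \<in> {x. norm x > R + 1} \<longrightarrow> w x = 0"
    proof (rule AE_open_local)
      fix x assume "x \<in> {x::real^2. norm x > R + 1}"
      thus "\<exists>U. open U \<and> x \<in> U \<and> (AE y in lborel. y \<in> U \<longrightarrow> w y = 0)"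
        using fundamental_lemma_calculus_variations[OF w far[OF that, of x] open_ball]
        by (intro exI[of _ "ball x 1"]) auto
    qed
    thus ?thesis by simp
  qed
  define Z where "Z = {x \<in> outside S. \<exists>\<eta>>0. vanishes_weakly (ball x \<eta>) w}"
  have op: "open (outside S)" using S by (simp add: open_outside compact_imp_closed)
  have sub: "outside S \<subseteq> - S" using outside_no_overlap by blast
  have conn: "connected (outside S)" using S by (intro connected_outside) (auto simp: compact_imp_bounded)
  have step: "c \<in> Z" if a: "a \<in> Z" and d: "ball a d \<subseteq> outside S" and c: "c \<in> ball a d" for a c d
  proof -
    obtain \<epsilon> where "\<epsilon> > 0" "vanishes_weakly (ball a \<epsilon>) w" using a by (auto simp: Z_def)
    then obtain \<eta> where "\<eta> > 0" "vanishes_weakly (ball c \<eta>) w"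
      using weak_unique_continuation_step[OF k w H order_trans[OF d sub] _ _ c] by blast
    thus ?thesis using c d by (auto simp: Z_def)
  qed
  have "Z = outside S"
  proof -
    have "openin (top_of_set (outside S)) Z"
    proof (subst openin_open_eq[OF op], intro conjI)
      show "open Z" unfolding open_contains_ball
      proof
        fix a assume a: "a \<in> Z"
        hence "a \<in> outside S" by (simp add: Z_def)
        then obtain d where d: "d > 0" "ball a d \<subseteq> outside S" using op open_contains_ball by blast
        show "\<exists>e>0. ball a e \<subseteq> Z" using step[OF a d(2)] d(1) by blast
      qed
    qed (auto simp: Z_def)
    moreover have "closedin (top_of_set (outside S)) Z"
      unfolding closedin_limpt
    proof (intro conjI allI impI)
      fix x assume x: "x islimpt Z \<and> x \<in> outside S"
      then obtain d where d: "d > 0" "ball x d \<subseteq> outside S" using op open_contains_ball by blast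
      obtain a where a: "a \<in> Z" "dist a x < d / 2" using x d(1) unfolding islimpt_approachable by (meson half_gt_zero)
      have "ball a (d / 2) \<subseteq> ball x d"
        using a(2) by (intro ball_subset_ball_iff[THEN iffD2]) (simp add: dist_commute)
      hence "ball a (d / 2) \<subseteq> outside S" using d by blast
      moreover have "x \<in> ball a (d / 2)" using a by simp
      ultimately show "x \<in> Z" using step[OF a(1)] by blast
    qed (auto simp: Z_def)
    moreover have "Z \<noteq> {}"
    proof -
      obtain R where R: "R > 0" "S \<subseteq> cball 0 R"
        using S compact_imp_bounded bounded_pos by (metis mem_cball_0 subsetI)
      have "\<not> bounded (outside S)" using S by (intro unbounded_outside compact_imp_bounded)
      then obtain c where c: "c \<in> outside S" "norm c > R + 1" unfolding bounded_iff by (meson not_le)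
      have "c \<in> Z" using far[OF _ R(2) c(2)] R(1) c(1) by (auto simp: Z_def intro!: exI[of _ 1])
      thus ?thesis by auto
    qed
    ultimately show ?thesis using conn unfolding connected_clopen by blast
  qed
  thus "AE x in lborel. x \<in> outside S \<longrightarrow> w x = 0"
  proof (intro AE_open_local)
    fix x assume "Z = outside S" "x \<in> outside S"
    then obtain \<eta> where "\<eta> > 0" "vanishes_weakly (ball x \<eta>) w" by (auto simp: Z_def)
    thus "\<exists>U. open U \<and> x \<in> U \<and> (AE y in lborel. y \<in> U \<longrightarrow> w y = 0)"
      using fundamental_lemma_calculus_variations[OF w _ open_ball, of x \<eta>] by (intro exI[of _ "ball x \<eta>"]) auto
  qed
qed

section \<open>Rigid motions\<close>

lemma lborel_rigid_motion:
  fixes Q :: "real^2 \<Rightarrow> real^2"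
  assumes Q: "orthogonal_transformation Q"
  shows "distr lborel borel (\<lambda>y. x0 + Q y) = lborel"
proof (rule lborel_eqI[symmetric])
  have "linear Q" using Q by (rule orthogonal_transformation_linear)
  hence [measurable]: "(\<lambda>y. x0 + Q y) \<in> borel_measurable borel"
    by (intro borel_measurable_continuous_onI continuous_intros linear_continuous_on linear_conv_bounded_linear[THEN iffD1])
  fix l u :: "real^2"
  assume le: "\<And>b. b \<in> Basis \<Longrightarrow> l \<bullet> b \<le> u \<bullet> b"
  let ?A = "(+) (- x0) ` box l u"
  have lm: "box l u \<in> lmeasurable" "?A \<in> lmeasurable"
    by simp (rule measurable_translation, simp)
  have bij: "bij Q" using Q by (rule orthogonal_transformation_bij)
  have oi: "orthogonal_transformation (inv Q)" using Q by (rule orthogonal_transformation_inv)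
  have pre: "(\<lambda>y. x0 + Q y) -` box l u = inv Q ` ?A"
  proof (intro set_eqI iffI)
    fix y assume "y \<in> (\<lambda>y. x0 + Q y) -` box l u"
    hence "Q y \<in> ?A" by (intro image_eqI[of _ _ "x0 + Q y"]) auto
    thus "y \<in> inv Q ` ?A" using bij by (intro image_eqI[of y "inv Q" "Q y"]) (simp_all only: inv_f_f[OF bij_is_inj])
  next
    fix y assume "y \<in> inv Q ` ?A"
    then obtain z where "z \<in> box l u" "y = inv Q (- x0 + z)" by auto
    thus "y \<in> (\<lambda>y. x0 + Q y) -` box l u" using bij by (simp add: surj_f_inv_f bij_is_surj)
  qed
  have sb: "inv Q ` ?A \<in> sets borel"
    unfolding pre[symmetric] by (rule measurable_sets_borel[of _ borel]) auto
  have lmi: "inv Q ` ?A \<in> lmeasurable" by (rule measurable_orthogonal_image[OF oi lm(2)])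
  have "emeasure (distr lborel borel (\<lambda>y. x0 + Q y)) (box l u) = emeasure lborel (inv Q ` ?A)"
    by (subst emeasure_distr) (auto simp: pre)
  also have "\<dots> = emeasure lebesgue (inv Q ` ?A)" using sb by simp
  also have "\<dots> = ennreal (measure lebesgue (inv Q ` ?A))"
    using lmi by (simp add: emeasure_eq_measure2 fmeasurableD2)
  also have "measure lebesgue (inv Q ` ?A) = measure lebesgue (box l u)"
    using measure_orthogonal_image[OF oi lm(2)] measure_translation[of "- x0" "box l u"] by simp
  also have "\<dots> = (\<Prod>b\<in>Basis. (u - l) \<bullet> b)"
    using le by (simp add: measure_completion measure_lborel_box_eq inner_diff_left)
  finally show "emeasure (distr lborel borel (\<lambda>y. x0 + Q y)) (box l u) = ennreal (\<Prod>b\<in>Basis. (u - l) \<bullet> b)" .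
qed simp

lemma AE_rigid_motion:
  fixes Q :: "real^2 \<Rightarrow> real^2"
  assumes Q: "orthogonal_transformation Q" and P: "AE x in lborel. P x"
  shows "AE y in lborel. P (x0 + Q y)"
proof (rule AE_distrD[where f="\<lambda>y. x0 + Q y" and M'=borel])
  have "linear Q" using Q by (rule orthogonal_transformation_linear)
  thus "(\<lambda>y. x0 + Q y) \<in> lborel \<rightarrow>\<^sub>M borel"
    by (simp, intro borel_measurable_continuous_onI continuous_intros linear_continuous_on linear_conv_bounded_linear[THEN iffD1])
  show "AE x in distr lborel borel (\<lambda>y. x0 + Q y). P x" unfolding lborel_rigid_motion[OF Q] by (rule P)
qed

lemma integral_rigid_motion:
  fixes Q :: "real^2 \<Rightarrow> real^2" and h :: "real^2 \<Rightarrow> complex"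
  assumes Q: "orthogonal_transformation Q" and [measurable]: "h \<in> borel_measurable borel"
  shows "(\<integral>x. h x \<partial>lborel) = (\<integral>y. h (x0 + Q y) \<partial>lborel)"
proof -
  have "linear Q" using Q by (rule orthogonal_transformation_linear)
  hence [measurable]: "(\<lambda>y. x0 + Q y) \<in> borel_measurable borel"
    by (intro borel_measurable_continuous_onI continuous_intros linear_continuous_on linear_conv_bounded_linear[THEN iffD1])
  have "(\<integral>x. h x \<partial>lborel) = (\<integral>x. h x \<partial>distr lborel borel (\<lambda>y. x0 + Q y))"
    by (simp add: lborel_rigid_motion[OF Q])
  also have "\<dots> = (\<integral>y. h (x0 + Q y) \<partial>lborel)" by (rule integral_distr) auto
  finally show ?thesis .
qed

section \<open>Testing with a holomorphic function\<close>

text \<open>The complex coordinate with respect to the frame \<open>Q e1\<close>, \<open>Q e2\<close>.  If \<open>Q\<close> reverses orientation, it is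
anti-holomorphic in the original coordinates; harmonicity does not see the difference.\<close>

definition frame_coord :: "(real^2 \<Rightarrow> real^2) \<Rightarrow> real^2 \<Rightarrow> complex" where
  "frame_coord Q x = Complex (x \<bullet> Q e1) (x \<bullet> Q e2)"

lemma bounded_linear_frame_coord: "bounded_linear (frame_coord Q)"
proof -
  have "frame_coord Q = (\<lambda>x. of_real (x \<bullet> Q e1) + \<i> * of_real (x \<bullet> Q e2))"
    by (simp add: fun_eq_iff frame_coord_def complex_eq_iff)
  moreover have "bounded_linear (\<lambda>x. complex_of_real (x \<bullet> Q e1) + \<i> * of_real (x \<bullet> Q e2))"
    by (intro bounded_linear_add bounded_linear_compose[OF bounded_linear_of_real bounded_linear_inner_left]
      bounded_linear_compose[OF bounded_linear_mult_right, of _ \<i>])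
  ultimately show ?thesis by simp
qed

lemma frame_coord_image:
  assumes Q: "orthogonal_transformation Q"
  shows "frame_coord Q (Q y) = cplx y"
proof -
  have "Q y \<bullet> Q b = y \<bullet> b" for b using Q by (simp add: orthogonal_transformation_def)
  thus ?thesis by (simp add: frame_coord_def cplx_def inner_axis)
qed

lemma norm_frame_coord:
  assumes Q: "orthogonal_transformation Q"
  shows "norm (frame_coord Q x) = norm x"
proof -
  obtain y where "x = Q y" using orthogonal_transformation_surj[OF Q] by (meson surjD)
  thus ?thesis using frame_coord_image[OF Q] orthogonal_transformation_norm[OF Q] by simp
qed

text \<open>The gradient of the coordinate has square zero.  Hence every holomorphic function of it is harmonic.\<close>

lemma frame_coord_isotropic:
  assumes Q: "orthogonal_transformation Q"
  shows "(frame_coord Q e1)\<^sup>2 + (frame_coord Q e2)\<^sup>2 = 0"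
proof -
  have ip: "Q a \<bullet> Q b = a \<bullet> b" for a b using Q by (simp add: orthogonal_transformation_def)
  have "Q e1 \<bullet> Q e1 = 1" "Q e2 \<bullet> Q e2 = 1" "Q e1 \<bullet> Q e2 = 0"
    unfolding ip by (simp_all add: inner_axis_axis)
  hence "(Q e1 $ 1)\<^sup>2 + (Q e1 $ 2)\<^sup>2 = 1" "(Q e2 $ 1)\<^sup>2 + (Q e2 $ 2)\<^sup>2 = 1" "Q e1 $ 1 * Q e2 $ 1 + Q e1 $ 2 * Q e2 $ 2 = 0"
    by (simp_all add: inner_vec_def sum_2 power2_eq_square)
  thus ?thesis
    by (simp add: frame_coord_def complex_eq_iff inner_axis inner_commute[of "axis _ _"] power2_eq_square)
qed

context
  fixes Q :: "real^2 \<Rightarrow> real^2" and \<zeta> :: "real^2"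
  assumes Q: "orthogonal_transformation Q"
begin

text \<open>Written as a product so that the rules for products and inverses of smooth functions apply directly.\<close>

definition pole2 :: "real^2 \<Rightarrow> complex" where
  "pole2 x = inverse (frame_coord Q (x - \<zeta>)) * inverse (frame_coord Q (x - \<zeta>))"

lemma frame_coord_nonzero: "x \<noteq> \<zeta> \<Longrightarrow> frame_coord Q (x - \<zeta>) \<noteq> 0"
  using norm_frame_coord[OF Q, of "x - \<zeta>"] by auto

lemma frame_coord_has_derivative:
  "((\<lambda>x. frame_coord Q (x - \<zeta>)) has_derivative frame_coord Q) (at x)"
  by (rule bounded_linear.has_derivative[OF bounded_linear_frame_coord, of "\<lambda>x. x - \<zeta>" "\<lambda>h. h"])
     (auto intro!: derivative_eq_intros)

lemma Ck_pole2: "Ck n (- {\<zeta>}) pole2"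
proof -
  have "Ck n UNIV (\<lambda>x. frame_coord Q (x - \<zeta>))"
    by (intro Ck_bounded_linear[OF bounded_linear_frame_coord] Ck_diff Ck_id_linear[OF bounded_linear_ident] Ck_const open_UNIV)
  hence "Ck n (- {\<zeta>}) (\<lambda>x. frame_coord Q (x - \<zeta>))" by (rule Ck_mono) simp
  thus ?thesis unfolding pole2_def[abs_def]
    by (intro Ck_mult Ck_inverse) (auto simp: frame_coord_nonzero)
qed

lemma dir_deriv_pole2:
  assumes "x \<noteq> \<zeta>"
  shows "dir_deriv v pole2 x = - 2 * frame_coord Q v * inverse (frame_coord Q (x - \<zeta>)) ^ 3"
proof -
  note d = Deriv.has_derivative_inverse[OF frame_coord_nonzero[OF assms] frame_coord_has_derivative]
  from dir_deriv_eqI[OF has_derivative_mult[OF d d], of v] show ?thesis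
    by (simp add: pole2_def[abs_def] power3_eq_cube)
qed

lemma laplacian_pole2:
  assumes x: "x \<noteq> \<zeta>"
  shows "laplacian pole2 x = 0"
proof -
  have "dir_deriv b (dir_deriv b pole2) x = 6 * (frame_coord Q b)\<^sup>2 * inverse (frame_coord Q (x - \<zeta>)) ^ 4" for b
  proof -
    have "dir_deriv b (dir_deriv b pole2) x = dir_deriv b (\<lambda>x. - 2 * frame_coord Q b * inverse (frame_coord Q (x - \<zeta>)) ^ 3) x"
      by (rule dir_deriv_cong[of "- {\<zeta>}"]) (use x dir_deriv_pole2 in auto)
    also have "\<dots> = 6 * (frame_coord Q b)\<^sup>2 * inverse (frame_coord Q (x - \<zeta>)) ^ 4"
    proof -
      note d = Deriv.has_derivative_inverse[OF frame_coord_nonzero[OF x] frame_coord_has_derivative]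
      from dir_deriv_eqI[OF has_derivative_mult_right[OF has_derivative_power[OF d, of 3], of "- 2 * frame_coord Q b"], of b]
      show ?thesis by (simp add: power2_eq_square eval_nat_numeral)
    qed
    finally show ?thesis .
  qed
  hence "laplacian pole2 x = 6 * ((frame_coord Q e1)\<^sup>2 + (frame_coord Q e2)\<^sup>2) * inverse (frame_coord Q (x - \<zeta>)) ^ 4"
    by (simp add: laplacian_plane algebra_simps)
  thus ?thesis using frame_coord_isotropic[OF Q] by simp
qed

lemma pole2_bounds:
  assumes s: "0 < s" "s \<le> norm (x - \<zeta>)"
  shows "norm (pole2 x) \<le> inverse s ^ 2" and "b \<in> Basis \<Longrightarrow> norm (dir_deriv b pole2 x) \<le> 2 * inverse s ^ 3"
proof -
  have i: "inverse (norm (x - \<zeta>)) \<le> inverse s" using s by (intro le_imp_inverse_le)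
  have "norm (pole2 x) = inverse (norm (x - \<zeta>)) ^ 2"
    by (simp add: pole2_def norm_mult norm_inverse norm_frame_coord[OF Q] power2_eq_square)
  thus "norm (pole2 x) \<le> inverse s ^ 2" using i s by (simp add: power_mono)
  show "norm (dir_deriv b pole2 x) \<le> 2 * inverse s ^ 3" if "b \<in> Basis"
  proof -
    have "x \<noteq> \<zeta>" using s by auto
    hence "norm (dir_deriv b pole2 x) = 2 * norm b * inverse (norm (x - \<zeta>)) ^ 3"
      by (simp add: dir_deriv_pole2 norm_mult norm_power norm_inverse norm_frame_coord[OF Q])
    also have "\<dots> \<le> 2 * inverse s ^ 3" using that i s by (simp add: power_mono)
    finally show ?thesis .
  qed
qed

lemma pole2_measurable [measurable]: "pole2 \<in> borel_measurable borel"
proof -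
  have "(\<lambda>x. frame_coord Q (x - \<zeta>)) \<in> borel_measurable borel"
    by (intro borel_measurable_continuous_onI bounded_linear.continuous_on[OF bounded_linear_frame_coord] continuous_intros)
  thus ?thesis unfolding pole2_def[abs_def] by measurable
qed

end

text \<open>Let \<open>\<zeta>\<close> be the pole.  The test function is \<open>pole2\<close>, cut off at distance \<open>r\<close> from the tip by \<open>\<xi>\<close> and at
distance \<open>\<eta>\<close> from \<open>\<zeta>\<close>.  Its Laplacian vanishes within distance \<open>r\<close> of the tip, except near \<open>\<zeta>\<close> where \<open>w\<close>
and \<open>f\<close> are zero.  In the remaining annulus, where \<open>\<xi>\<close> varies, the distance to \<open>\<zeta>\<close> is at least \<open>r / 2\<close>,
which bounds everything independently of \<open>t\<close>.\<close>

theorem tip_pairing_bounded: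
  fixes w f :: "real^2 \<Rightarrow> complex"
  assumes w: "locally_integrable w" and f: "locally_integrable f"
    and eq: "\<And>\<phi>. test_function \<phi> \<Longrightarrow> (\<integral>x. w x * laplacian \<phi> x \<partial>lborel) = (\<integral>x. f x * \<phi> x \<partial>lborel)"
    and Q: "orthogonal_transformation Q" and r: "r > 0" and s: "s > 0" and t0: "t0 \<le> r / 4"
    and z: "\<And>t. 0 < t \<Longrightarrow> t \<le> t0 \<Longrightarrow> AE x in lborel. x \<in> ball (x0 + Q (t *\<^sub>R polar \<psi>)) (s * t) \<longrightarrow> w x = 0 \<and> f x = 0"
  obtains M where "\<And>t. 0 < t \<Longrightarrow> t \<le> t0 \<Longrightarrow>
     norm (\<integral>y. indicator (ball 0 r) y *\<^sub>R (f (x0 + Q y) * tip_kernel \<psi> t y) \<partial>lborel) \<le> M"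
proof -
  have [measurable]: "w \<in> borel_measurable borel" "f \<in> borel_measurable borel"
    using w f by (auto simp: locally_integrable_def)
  let ?B = "cball x0 (2 * r)"
  have Bi: "integrable lborel (\<lambda>x. norm (indicator ?B x *\<^sub>R g x))" if "locally_integrable g" for g :: "real^2 \<Rightarrow> complex"
  proof -
    have "?B \<subseteq> cball 0 (norm x0 + 2 * r)"
    proof
      fix x assume "x \<in> ?B"
      thus "x \<in> cball 0 (norm x0 + 2 * r)" using norm_triangle_ineq2[of x x0] by (simp add: dist_norm norm_minus_commute)
    qed
    hence "set_integrable lborel ?B g"
      using that set_integrable_subset[of lborel "cball 0 (norm x0 + 2 * r)" g ?B] by (auto simp: locally_integrable_def)
    thus ?thesis unfolding set_integrable_def by (rule integrable_norm)
  qed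
  define Iw where "Iw = (\<integral>x. norm (indicator ?B x *\<^sub>R w x) \<partial>lborel)"
  define If where "If = (\<integral>x. norm (indicator ?B x *\<^sub>R f x) \<partial>lborel)"
  define \<xi> where "\<xi> x = complex_of_real (cutoff x0 r x)" for x
  have \<xi>C: "Ck n UNIV \<xi>" for n unfolding \<xi>_def by (intro Ck_of_real Ck_cutoff r open_UNIV)
  have \<xi>t: "test_function \<xi>"
    by (rule test_functionI[OF \<xi>C, of ?B])
       (auto simp: \<xi>_def dist_norm norm_minus_commute intro!: cutoff_eq_0[OF r])
  have tb: "\<exists>B>0. \<forall>x. norm (\<phi> x) \<le> B" if t: "test_function \<phi>" for \<phi> :: "real^2 \<Rightarrow> complex"
  proof -
    obtain q where "\<And>x. norm x \<ge> q \<Longrightarrow> \<phi> x = 0" using test_function_support[OF t] by auto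
    thus ?thesis using bounded_of_continuous_support[OF test_function_continuous[OF t], of q] by (metis less_imp_le)
  qed
  obtain B0 where B0: "B0 > 0" "\<And>x. norm (laplacian \<xi> x) \<le> B0"
    using tb[OF test_function_laplacian[OF \<xi>t]] by blast
  obtain B1 where B1: "\<And>b x. norm (dir_deriv b \<xi> x) \<le> B1 b"
    using tb[OF test_function_dir_deriv[OF \<xi>t]] by metis
  define \<sigma> where "\<sigma> = inverse (r / 2)"
  have \<sigma>: "\<sigma> > 0" using r by (simp add: \<sigma>_def)
  define C where "C = B0 * \<sigma>\<^sup>2 + (\<Sum>b\<in>Basis. B1 b * (2 * \<sigma> ^ 3)) + (\<Sum>b\<in>Basis. B1 b * (2 * \<sigma> ^ 3))"
  have B1nn: "0 \<le> B1 b" for b using B1[of b 0] norm_ge_zero order_trans by blast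
  have C0: "C \<ge> 0" unfolding C_def using B0 \<sigma> B1nn by (intro add_nonneg_nonneg sum_nonneg mult_nonneg_nonneg) auto
  have "norm (\<integral>y. indicator (ball 0 r) y *\<^sub>R (f (x0 + Q y) * tip_kernel \<psi> t y) \<partial>lborel) \<le> C * Iw + \<sigma>\<^sup>2 * If"
    if t: "0 < t" "t \<le> t0" for t
  proof -
    define \<zeta> where "\<zeta> = x0 + Q (t *\<^sub>R polar \<psi>)"
    \<comment> \<open>The inner cut-off vanishes off the ball of radius \<open>2 \<eta>\<close>, which must fit into the ball where \<open>w = f = 0\<close>.\<close>
    define \<eta> where "\<eta> = s * t / 3"
    have \<eta>: "\<eta> > 0" "2 * \<eta> < s * t" using s t by (auto simp: \<eta>_def)
    have d\<zeta>: "norm (\<zeta> - x0) = t" using t by (simp add: \<zeta>_def orthogonal_transformation_norm[OF Q])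
    have tr: "t \<le> r / 4" using t t0 by simp
    let ?v = "pole2 Q \<zeta>"
    define \<phi> where "\<phi> x = \<xi> x * of_real (1 - cutoff \<zeta> \<eta> x) * ?v x" for x
    have k1: "cutoff \<zeta> \<eta> x = 0" if "norm (x - \<zeta>) \<ge> 2 * \<eta>" for x using cutoff_eq_0[OF \<eta>(1) that] .
    have far: "r / 2 \<le> norm (x - \<zeta>)" if "norm (x - x0) \<ge> r" for x
      using that tr r norm_triangle_ineq2[of "x - x0" "\<zeta> - x0"] d\<zeta> by simp
    have \<xi>1: "\<xi> x = 1" if "norm (x - x0) \<le> r" for x using that cutoff_eq_1[OF r] by (simp add: \<xi>_def)
    have \<xi>0: "\<xi> x = 0" if "norm (x - x0) \<ge> 2 * r" for x using that cutoff_eq_0[OF r] by (simp add: \<xi>_def)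
    have \<xi>le: "norm (\<xi> x) \<le> 1" for x using cutoff_nonneg[OF r, of x0 x] cutoff_le_1[OF r, of x0 x] by (simp add: \<xi>_def)
    have \<phi>t: "test_function \<phi>"
    proof (rule test_functionI[of _ ?B])
      fix n
      have "Ck n (- {\<zeta>}) \<phi>"
        unfolding \<phi>_def
        by (intro Ck_mult Ck_of_real Ck_diff Ck_const Ck_mono[OF Ck_cutoff[OF \<eta>(1)]] Ck_mono[OF \<xi>C] Ck_pole2[OF Q]) auto
      moreover have "Ck n (ball \<zeta> \<eta>) \<phi>"
        by (subst Ck_cong[of "ball \<zeta> \<eta>" \<phi> "\<lambda>_. 0"])
           (auto simp: \<phi>_def dist_norm norm_minus_commute cutoff_eq_1[OF \<eta>(1)])
      \<comment> \<open>The product is smooth off the pole and identically zero near it.\<close>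
      ultimately have "Ck n (- {\<zeta>} \<union> ball \<zeta> \<eta>) \<phi>" by (intro Ck_Un) auto
      moreover have "- {\<zeta>} \<union> ball \<zeta> \<eta> = UNIV" using \<eta> by auto
      ultimately show "Ck n UNIV \<phi>" by simp
    next
      show "\<phi> x = 0" if "x \<notin> ?B" for x using that \<xi>0[of x] by (simp add: \<phi>_def dist_norm norm_minus_commute)
    qed auto
    have away: "AE x in lborel. x \<in> ball \<zeta> (s * t) \<longrightarrow> w x = 0 \<and> f x = 0" using z[OF t] by (simp add: \<zeta>_def)
    have lap: "norm (laplacian \<phi> x) \<le> C" "norm (x - x0) < r \<Longrightarrow> laplacian \<phi> x = 0" if x: "norm (x - \<zeta>) > 2 * \<eta>" for x
    proof -
      have op: "open {x. norm (x - \<zeta>) > 2 * \<eta>}" by (intro open_Collect_less continuous_intros)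
      have x\<zeta>: "x \<noteq> \<zeta>" using x \<eta> by auto
      have l1: "laplacian \<phi> x = laplacian (\<lambda>x. \<xi> x * ?v x) x"
        by (rule laplacian_cong[OF op]) (use x k1 in \<open>auto simp: \<phi>_def\<close>)
      have l2: "laplacian (\<lambda>x. \<xi> x * ?v x) x = 0" if "norm (x - x0) < r"
      proof -
        have "laplacian (\<lambda>x. \<xi> x * ?v x) x = laplacian ?v x"
          by (rule laplacian_cong[of "ball x0 r"]) (use that \<xi>1 in \<open>auto simp: dist_norm norm_minus_commute\<close>)
        thus ?thesis using laplacian_pole2[OF Q x\<zeta>] by simp
      qed
      thus "norm (x - x0) < r \<Longrightarrow> laplacian \<phi> x = 0" using l1 by simp
      show "norm (laplacian \<phi> x) \<le> C"
      proof (cases "norm (x - x0) < r")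
        case True
        thus ?thesis using l1 l2 C0 by simp
      next
        case False
        hence fx: "r / 2 \<le> norm (x - \<zeta>)" using far by simp
        have r2: "0 < r / 2" using r by simp
        have "laplacian (\<lambda>x. \<xi> x * ?v x) x = \<xi> x * laplacian ?v x + laplacian \<xi> x * ?v x
           + (\<Sum>b\<in>Basis. dir_deriv b \<xi> x * dir_deriv b ?v x) + (\<Sum>b\<in>Basis. dir_deriv b \<xi> x * dir_deriv b ?v x)"
          by (rule laplacian_mult_at[of "- {\<zeta>}"]) (use x\<zeta> Ck_mono[OF \<xi>C] Ck_pole2[OF Q] in auto)
        also have "\<dots> = laplacian \<xi> x * ?v x
           + (\<Sum>b\<in>Basis. dir_deriv b \<xi> x * dir_deriv b ?v x) + (\<Sum>b\<in>Basis. dir_deriv b \<xi> x * dir_deriv b ?v x)"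
          using laplacian_pole2[OF Q x\<zeta>] by simp
        finally have e: "laplacian \<phi> x = laplacian \<xi> x * ?v x
           + (\<Sum>b\<in>Basis. dir_deriv b \<xi> x * dir_deriv b ?v x) + (\<Sum>b\<in>Basis. dir_deriv b \<xi> x * dir_deriv b ?v x)"
          using l1 by simp
        have b1: "norm (laplacian \<xi> x * ?v x) \<le> B0 * \<sigma>\<^sup>2"
          unfolding norm_mult \<sigma>_def using B0 pole2_bounds(1)[OF Q r2 fx] by (intro mult_mono) auto
        have b2: "norm (\<Sum>b\<in>Basis. dir_deriv b \<xi> x * dir_deriv b ?v x) \<le> (\<Sum>b\<in>Basis. B1 b * (2 * \<sigma> ^ 3))"
        proof (rule order_trans[OF norm_sum sum_mono])
          fix b :: "real^2" assume "b \<in> Basis"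
          thus "norm (dir_deriv b \<xi> x * dir_deriv b ?v x) \<le> B1 b * (2 * \<sigma> ^ 3)"
            unfolding norm_mult \<sigma>_def using B1 B1nn pole2_bounds(2)[OF Q r2 fx] by (intro mult_mono) auto
        qed
        show ?thesis unfolding e C_def
          by (intro norm_triangle_le add_mono b1 b2)
      qed
    qed
    have outB: "laplacian \<phi> x = 0" if "x \<notin> ?B" for x
    proof -
      have z0: "\<phi> y = 0" if "y \<in> - ?B" for y using that \<xi>0[of y] by (simp add: \<phi>_def dist_norm norm_minus_commute)
      have z1: "dir_deriv b \<phi> y = 0" if "y \<in> - ?B" for b y
        by (rule dir_deriv_zero_open[of "- ?B"]) (use that z0 in auto)
      have "dir_deriv b (dir_deriv b \<phi>) x = 0" for b
        by (rule dir_deriv_zero_open[of "- ?B"]) (use that z1 in auto)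
      thus ?thesis by (simp add: laplacian_def)
    qed
    have "norm (\<integral>x. w x * laplacian \<phi> x \<partial>lborel) \<le> (\<integral>x. norm (w x * laplacian \<phi> x) \<partial>lborel)"
      by (rule integral_norm_bound)
    also have "\<dots> \<le> (\<integral>x. C * norm (indicator ?B x *\<^sub>R w x) \<partial>lborel)"
    proof (rule integral_mono_AE)
      show "integrable lborel (\<lambda>x. norm (w x * laplacian \<phi> x))"
        by (intro integrable_norm integrable_mult_test w test_function_laplacian \<phi>t)
      show "integrable lborel (\<lambda>x. C * norm (indicator ?B x *\<^sub>R w x))" by (rule integrable_mult_right[OF Bi[OF w]])
      show "AE x in lborel. norm (w x * laplacian \<phi> x) \<le> C * norm (indicator ?B x *\<^sub>R w x)"
        using away
      proof eventually_elim
        case (elim x)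
        show ?case
        proof (cases "x \<in> ball \<zeta> (s * t)")
          case True
          thus ?thesis using elim by simp
        next
          case False
          hence x: "norm (x - \<zeta>) > 2 * \<eta>" using \<eta> by (simp add: dist_norm norm_minus_commute)
          show ?thesis
          proof (cases "x \<in> ?B")
            case True
            have "norm (w x) * norm (laplacian \<phi> x) \<le> norm (w x) * C" using lap(1)[OF x] by (intro mult_left_mono) auto
            thus ?thesis using True by (simp add: norm_mult mult.commute)
          qed (simp add: outB)
        qed
      qed
    qed
    also have "\<dots> = C * Iw" unfolding Iw_def by (rule integral_mult_right_zero)
    finally have LHS: "norm (\<integral>x. f x * \<phi> x \<partial>lborel) \<le> C * Iw" using eq[OF \<phi>t] by simp
    \<comment> \<open>The error made by restricting the pairing to the ball of radius \<open>r\<close> and dropping both cut-offs.\<close>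
    define e where "e x = f x * \<phi> x - indicator (ball x0 r) x *\<^sub>R (f x * ?v x)" for x
    have [measurable]: "\<phi> \<in> borel_measurable borel"
      using test_function_continuous[OF \<phi>t] by (rule borel_measurable_continuous_onI)
    have [measurable]: "?v \<in> borel_measurable borel" by (rule pole2_measurable[OF Q])
    have [measurable]: "ball x0 r \<in> sets borel" by simp
    have em [measurable]: "e \<in> borel_measurable borel" unfolding e_def[abs_def] by measurable
    have eb: "AE x in lborel. norm (e x) \<le> \<sigma>\<^sup>2 * norm (indicator ?B x *\<^sub>R f x)"
      using away
    proof eventually_elim
      case (elim x)
      show ?case
      proof (cases "x \<in> ball \<zeta> (s * t)")
        case True
        thus ?thesis using elim by (simp add: e_def)
      next
        case False
        hence "norm (x - \<zeta>) \<ge> 2 * \<eta>" using \<eta> by (simp add: dist_norm norm_minus_commute)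
        hence \<phi>x: "\<phi> x = \<xi> x * ?v x" using k1 by (simp add: \<phi>_def)
        show ?thesis
        proof (cases "norm (x - x0) < r")
          case True
          thus ?thesis using \<xi>1[of x] by (simp add: e_def \<phi>x dist_norm norm_minus_commute)
        next
          case False
          hence ex: "e x = f x * (\<xi> x * ?v x)" by (simp add: e_def \<phi>x dist_norm norm_minus_commute)
          show ?thesis
          proof (cases "x \<in> ?B")
            case True
            have "norm (?v x) \<le> \<sigma>\<^sup>2" using pole2_bounds(1)[OF Q _ far] False r by (simp add: \<sigma>_def)
            hence "norm (\<xi> x) * norm (?v x) \<le> 1 * \<sigma>\<^sup>2" using \<xi>le by (intro mult_mono) auto
            hence "norm (f x) * (norm (\<xi> x) * norm (?v x)) \<le> norm (f x) * \<sigma>\<^sup>2" by (intro mult_left_mono) auto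
            thus ?thesis using True by (simp add: ex norm_mult mult.commute)
          next
            case False
            thus ?thesis using \<xi>0[of x] by (simp add: ex dist_norm norm_minus_commute)
          qed
        qed
      qed
    qed
    have \<sigma>i: "integrable lborel (\<lambda>x. \<sigma>\<^sup>2 * norm (indicator ?B x *\<^sub>R f x))" by (rule integrable_mult_right[OF Bi[OF f]])
    have ei: "integrable lborel e"
      by (rule Bochner_Integration.integrable_bound[OF \<sigma>i]) (use eb em in \<open>auto elim!: eventually_mono intro: order_trans[OF _ abs_ge_self]\<close>)
    have "norm (integral\<^sup>L lborel e) \<le> (\<integral>x. norm (e x) \<partial>lborel)" by (rule integral_norm_bound)
    also have "\<dots> \<le> (\<integral>x. \<sigma>\<^sup>2 * norm (indicator ?B x *\<^sub>R f x) \<partial>lborel)"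
      by (rule integral_mono_AE[OF integrable_norm[OF ei] \<sigma>i eb])
    also have "\<dots> = \<sigma>\<^sup>2 * If" unfolding If_def by (rule integral_mult_right_zero)
    finally have E: "norm (integral\<^sup>L lborel e) \<le> \<sigma>\<^sup>2 * If" .
    have "(\<integral>x. indicator (ball x0 r) x *\<^sub>R (f x * ?v x) \<partial>lborel) = (\<integral>x. f x * \<phi> x - e x \<partial>lborel)"
      by (simp add: e_def)
    also have "\<dots> = (\<integral>x. f x * \<phi> x \<partial>lborel) - integral\<^sup>L lborel e"
      by (rule Bochner_Integration.integral_diff[OF integrable_mult_test[OF f \<phi>t] ei])
    finally have "norm (\<integral>x. indicator (ball x0 r) x *\<^sub>R (f x * ?v x) \<partial>lborel) \<le> C * Iw + \<sigma>\<^sup>2 * If"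
      using LHS E norm_triangle_ineq4[of "\<integral>x. f x * \<phi> x \<partial>lborel" "integral\<^sup>L lborel e"] by simp
    also have "(\<integral>x. indicator (ball x0 r) x *\<^sub>R (f x * ?v x) \<partial>lborel)
       = (\<integral>y. indicator (ball x0 r) (x0 + Q y) *\<^sub>R (f (x0 + Q y) * ?v (x0 + Q y)) \<partial>lborel)"
      by (rule integral_rigid_motion[OF Q]) measurable
    also have "\<dots> = (\<integral>y. indicator (ball 0 r) y *\<^sub>R (f (x0 + Q y) * tip_kernel \<psi> t y) \<partial>lborel)"
    proof (rule Bochner_Integration.integral_cong[OF refl])
      fix y
      have "frame_coord Q (x0 + Q y - \<zeta>) = frame_coord Q (Q y) - frame_coord Q (Q (t *\<^sub>R polar \<psi>))"
        using linear_diff[OF bounded_linear.linear[OF bounded_linear_frame_coord], of Q "Q y" "Q (t *\<^sub>R polar \<psi>)"]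
        by (simp add: \<zeta>_def)
      also have "\<dots> = cplx y - of_real t * cis \<psi>" by (simp only: frame_coord_image[OF Q] cplx_polar)
      finally have "?v (x0 + Q y) = tip_kernel \<psi> t y"
        by (simp add: pole2_def[OF Q] tip_kernel_def power2_eq_square)
      moreover have "indicator (ball x0 r) (x0 + Q y) = (indicator (ball 0 r) y :: real)"
        using orthogonal_transformation_norm[OF Q] by (simp add: indicator_def dist_norm)
      ultimately show "indicator (ball x0 r) (x0 + Q y) *\<^sub>R (f (x0 + Q y) * ?v (x0 + Q y)) = indicator (ball 0 r) y *\<^sub>R (f (x0 + Q y) * tip_kernel \<psi> t y)"
        by simp
    qed
    finally show ?thesis .
  qed
  thus ?thesis using that by blast
qed

section \<open>Trigonometry of admissible corners\<close>

text \<open>The real part gives \<open>p1 sin\<^sup>2 \<omega>1 = p2 sin\<^sup>2 \<omega>2\<close>, the imaginary part \<open>p1 sin \<omega>1 cos \<omega>1 = - p2 sin \<omega>2 cos \<omega>2\<close>.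
If one sector is a half-plane, the first equation kills the coefficient of the other one.  Otherwise both
sines are nonzero, and eliminating \<open>p1\<close> leaves \<open>p2 sin \<omega>2 sin (\<omega>1 + \<omega>2) = 0\<close>: either the whole corner is
flat and \<open>p1 = p2\<close>, or both coefficients vanish.\<close>

lemma admissible_excludes_relation:
  fixes \<omega>1 \<omega>2 p1 p2 :: real
  assumes w: "\<omega>1 > 0" "\<omega>2 > 0" "\<omega>1 + \<omega>2 < 2 * pi"
    and adm: "admissible \<omega>1 \<omega>2 p1 p2"
    and eq: "of_real p1 * (1 - cis (2 * \<omega>1)) + of_real p2 * (cis (- (2 * \<omega>2)) - 1) = 0"
  shows False
proof -
  have re: "p1 * (1 - cos (2 * \<omega>1)) + p2 * (cos (2 * \<omega>2) - 1) = 0"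
    and im: "p1 * sin (2 * \<omega>1) + p2 * sin (2 * \<omega>2) = 0"
    using arg_cong[OF eq, of Re] arg_cong[OF eq, of Im] by simp_all
  have r: "p1 * (sin \<omega>1)\<^sup>2 = p2 * (sin \<omega>2)\<^sup>2"
    using re unfolding cos_double_sin by (simp add: algebra_simps)
  have i: "p1 * (sin \<omega>1 * cos \<omega>1) = - (p2 * (sin \<omega>2 * cos \<omega>2))"
    using im unfolding sin_double by (simp add: algebra_simps)
  have s0: "sin x = 0 \<longleftrightarrow> x = pi" if "0 < x" "x < 2 * pi" for x :: real
  proof
    assume "sin x = 0"
    then obtain n :: int where n: "x = of_int n * pi" using sin_zero_iff_int2 by blast
    have "0 < real_of_int n" using that(1) n pi_gt_zero by (simp add: zero_less_mult_iff)
    moreover have "real_of_int n < 2" using that(2) n pi_gt_zero by simp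
    ultimately have "n = 1" by linarith
    thus "x = pi" using n by simp
  qed simp
  show False
  proof (cases "\<omega>1 = pi")
    case True
    hence "sin \<omega>2 \<noteq> 0" using s0[of \<omega>2] w by simp
    hence "p2 = 0" using r True by simp
    thus False using adm True w by (simp add: admissible_def)
  next
    case n1: False
    show False
    proof (cases "\<omega>2 = pi")
      case True
      have "sin \<omega>1 \<noteq> 0" using s0[of \<omega>1] w n1 by simp
      hence "p1 = 0" using r True by simp
      thus False using adm True w by (simp add: admissible_def)
    next
      case n2: False
      have s: "sin \<omega>1 \<noteq> 0" "sin \<omega>2 \<noteq> 0" using s0[of \<omega>1] s0[of \<omega>2] w n1 n2 by auto
      have "p2 * sin \<omega>2 * sin (\<omega>1 + \<omega>2) = cos \<omega>1 * (p2 * (sin \<omega>2)\<^sup>2) + sin \<omega>1 * (p2 * (sin \<omega>2 * cos \<omega>2))"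
        by (simp add: sin_add power2_eq_square algebra_simps)
      also have "\<dots> = cos \<omega>1 * (p1 * (sin \<omega>1)\<^sup>2) - sin \<omega>1 * (p1 * (sin \<omega>1 * cos \<omega>1))"
        using r i by simp
      also have "\<dots> = 0" by (simp add: power2_eq_square)
      finally have z: "p2 * sin \<omega>2 * sin (\<omega>1 + \<omega>2) = 0" .
      show False
      proof (cases "\<omega>1 + \<omega>2 = pi")
        case True
        hence "sin \<omega>1 = sin \<omega>2" using sin_pi_minus[of \<omega>2] by (simp add: eq_diff_eq flip: True)
        hence "p1 = p2" using r s by simp
        thus False using adm True by (simp add: admissible_def)
      next
        case False
        hence "sin (\<omega>1 + \<omega>2) \<noteq> 0" using s0[of "\<omega>1 + \<omega>2"] w by simp
        hence "p2 = 0" using z s by simp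
        moreover hence "p1 = 0" using r s by simp
        ultimately show False using adm False by (simp add: admissible_def)
      qed
    qed
  qed
qed

section \<open>Borel representatives and local square integrability\<close>

lemma ex_borel_version:
  fixes u :: "'a::euclidean_space \<Rightarrow> complex"
  assumes "u \<in> borel_measurable lebesgue"
  obtains u' where "u' \<in> borel_measurable borel" "AE x in lborel. u x = u' x"
proof -
  have "(\<lambda>x. Re (u x)) \<in> borel_measurable lebesgue" "(\<lambda>x. Im (u x)) \<in> borel_measurable lebesgue"
    using assms by auto
  then obtain a b where ab: "a \<in> borel_measurable lborel" "b \<in> borel_measurable lborel"
    "AE x in lborel. Re (u x) = a x" "AE x in lborel. Im (u x) = b x"
    using completion_ex_borel_measurable_real by metis
  have "(\<lambda>x. Complex (a x) (b x)) = (\<lambda>x. of_real (a x) + \<i> * of_real (b x))"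
    by (simp add: fun_eq_iff complex_eq_iff)
  hence "(\<lambda>x. Complex (a x) (b x)) \<in> borel_measurable borel" using ab(1,2) by auto
  moreover have "AE x in lborel. u x = Complex (a x) (b x)"
    using ab(3,4) by eventually_elim (simp add: complex_eq_iff)
  ultimately show ?thesis using that by blast
qed

definition locally_L2 :: "('a::euclidean_space \<Rightarrow> complex) \<Rightarrow> bool" where
  "locally_L2 w \<longleftrightarrow> w \<in> borel_measurable borel \<and> (\<forall>r. set_integrable lborel (cball 0 r) (\<lambda>x. (norm (w x))\<^sup>2))"

text \<open>The Cauchy-Schwarz inequality for the finite sum; it covers sums of fields and multiplication by bounded
coefficients at once.\<close>

lemma locally_L2_bound:
  assumes g: "\<And>i. i \<in> I \<Longrightarrow> locally_L2 (g i)" "finite I" and w: "w \<in> borel_measurable borel"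
    and b: "AE x in lborel. norm (w x) \<le> (\<Sum>i\<in>I. c i * norm (g i x))"
  shows "locally_L2 w"
  unfolding locally_L2_def
proof (intro conjI allI)
  fix r
  have [measurable]: "w \<in> borel_measurable borel" by (rule w)
  have "set_integrable lborel (cball 0 r) (\<lambda>x. (\<Sum>i\<in>I. (c i)\<^sup>2) * (\<Sum>i\<in>I. (norm (g i x))\<^sup>2))"
  proof -
    have "integrable lborel (\<lambda>x. \<Sum>j\<in>I. (\<Sum>i\<in>I. (c i)\<^sup>2) * (indicat_real (cball 0 r) x *\<^sub>R (norm (g j x))\<^sup>2))"
      using g(1) unfolding locally_L2_def set_integrable_def
      by (intro Bochner_Integration.integrable_sum integrable_mult_right) blast
    moreover have "indicat_real (cball 0 r) x *\<^sub>R ((\<Sum>i\<in>I. (c i)\<^sup>2) * (\<Sum>j\<in>I. (norm (g j x))\<^sup>2))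
        = (\<Sum>j\<in>I. (\<Sum>i\<in>I. (c i)\<^sup>2) * (indicat_real (cball 0 r) x *\<^sub>R (norm (g j x))\<^sup>2))" for x
      by (simp add: sum_distrib_left[of _ _ I] mult.left_commute)
    ultimately show ?thesis unfolding set_integrable_def by simp
  qed
  thus "set_integrable lborel (cball 0 r) (\<lambda>x. (norm (w x))\<^sup>2)"
    unfolding set_integrable_def
  proof (rule Bochner_Integration.integrable_bound)
    show "AE x in lborel. norm (indicat_real (cball 0 r) x *\<^sub>R (norm (w x))\<^sup>2) \<le> norm (indicat_real (cball 0 r) x *\<^sub>R ((\<Sum>i\<in>I. (c i)\<^sup>2) * (\<Sum>i\<in>I. (norm (g i x))\<^sup>2)))"
      using b
    proof eventually_elim
      case (elim x)
      have "(norm (w x))\<^sup>2 \<le> (\<Sum>i\<in>I. c i * norm (g i x))\<^sup>2" using elim by (intro power_mono) auto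
      also have "\<dots> \<le> (\<Sum>i\<in>I. (c i)\<^sup>2) * (\<Sum>i\<in>I. (norm (g i x))\<^sup>2)" by (rule Cauchy_Schwarz_ineq_sum)
      finally have "(norm (w x))\<^sup>2 \<le> (\<Sum>i\<in>I. (c i)\<^sup>2) * (\<Sum>i\<in>I. (norm (g i x))\<^sup>2)" .
      hence "(norm (w x))\<^sup>2 \<le> \<bar>(\<Sum>i\<in>I. (c i)\<^sup>2) * (\<Sum>i\<in>I. (norm (g i x))\<^sup>2)\<bar>" by (rule order_trans[OF _ abs_ge_self])
      thus ?case by (simp add: indicator_def)
    qed
  qed measurable
qed (rule w)

lemma locally_L2_continuous: "continuous_on UNIV w \<Longrightarrow> locally_L2 w"
  unfolding locally_L2_def set_integrable_def
  by (intro conjI allI borel_measurable_continuous_onI borel_integrable_compact continuous_intros)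
     (auto intro: continuous_on_subset)

lemma locally_L2_imp_locally_integrable:
  assumes "locally_L2 w"
  shows "locally_integrable w"
  unfolding locally_integrable_def
proof (intro conjI allI)
  have [measurable]: "w \<in> borel_measurable borel" using assms by (simp add: locally_L2_def)
  show "w \<in> borel_measurable borel" by measurable
  fix r
  have i: "integrable lborel (\<lambda>x::'a. indicator (cball 0 r) x *\<^sub>R (1::real))" by (rule borel_integrable_compact) auto
  have j: "integrable lborel (\<lambda>x. indicator (cball 0 r) x *\<^sub>R (norm (w x))\<^sup>2)"
    using assms by (simp add: locally_L2_def set_integrable_def)
  show "set_integrable lborel (cball 0 r) w"
    unfolding set_integrable_def
  proof (rule Bochner_Integration.integrable_bound[OF Bochner_Integration.integrable_add[OF i j]])
    show "AE x in lborel. norm (indicat_real (cball 0 r) x *\<^sub>R w x) \<le> norm (indicat_real (cball 0 r) x *\<^sub>R 1 + indicat_real (cball 0 r) x *\<^sub>R (norm (w x))\<^sup>2)"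
    proof (rule AE_I2)
      fix x
      have "2 * norm (w x) * 1 \<le> (norm (w x))\<^sup>2 + 1\<^sup>2" by (rule sum_squares_bound)
      moreover have "0 \<le> norm (w x)" by simp
      ultimately have "norm (w x) \<le> 1 + (norm (w x))\<^sup>2" unfolding one_power2 mult_1_right by linarith
      thus "norm (indicat_real (cball 0 r) x *\<^sub>R w x) \<le> norm (indicat_real (cball 0 r) x *\<^sub>R 1 + indicat_real (cball 0 r) x *\<^sub>R (norm (w x))\<^sup>2)"
        by (simp add: indicator_def)
    qed
  qed measurable
qed

section \<open>The corner and its exterior\<close>

text \<open>The image of the closed rectangle under polar coordinates is compact.\<close>

lemma closure_wedge:
  assumes y: "y \<in> closure (wedge a b R)"
  obtains s \<theta> where "y = s *\<^sub>R polar \<theta>" "0 \<le> s" "s \<le> R" "a \<le> \<theta>" "\<theta> \<le> b"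
proof -
  let ?g = "\<lambda>(s, \<theta>). s *\<^sub>R polar \<theta>"
  have "continuous_on ({0..R} \<times> {a..b}) ?g"
    unfolding split_beta by (intro continuous_intros)
  hence "compact (?g ` ({0..R} \<times> {a..b}))"
    by (rule compact_continuous_image) (intro compact_Times compact_Icc)
  moreover have "wedge a b R \<subseteq> ?g ` ({0..R} \<times> {a..b})"
  proof
    fix y assume "y \<in> wedge a b R"
    then obtain s \<theta> where s: "y = s *\<^sub>R polar \<theta>" "a < \<theta>" "\<theta> < b" "0 < s" "s < R"
      unfolding wedge_eq_polar by blast
    show "y \<in> ?g ` ({0..R} \<times> {a..b})"
      by (rule image_eqI[of _ _ "(s, \<theta>)"]) (use s in simp_all)
  qed
  ultimately have "closure (wedge a b R) \<subseteq> ?g ` ({0..R} \<times> {a..b})"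
    by (intro closure_minimal compact_imp_closed)
  hence "y \<in> ?g ` ({0..R} \<times> {a..b})" using y by blast
  thus ?thesis using that by (elim imageE SigmaE) simp
qed

lemma AE_not_on_ray:
  "AE y in lborel. \<forall>s. y \<noteq> s *\<^sub>R polar \<theta>"
proof -
  let ?a = "polar (\<theta> + pi / 2)"
  have "negligible {y::real^2. ?a \<bullet> y = 0}" by (rule negligible_hyperplane) simp
  hence "AE y in lebesgue. y \<notin> {y::real^2. ?a \<bullet> y = 0}"
    unfolding negligible_iff_null_sets by (rule AE_not_in)
  hence "AE y in lborel. y \<notin> {y::real^2. ?a \<bullet> y = 0}"
    by (rule AE_completion_iff[THEN iffD1])
  thus ?thesis
  proof eventually_elim
    case (elim y)
    have "?a \<bullet> (s *\<^sub>R polar \<theta>) = 0" for s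
      by (simp add: polar_def inner_vec_def sum_2 cos_add sin_add)
    thus ?case using elim by auto
  qed
qed

text \<open>Near the tip the interior of \<open>\<Sigma>\<close> is the wedge, which \<open>exterior_distance\<close> keeps away from the opposite ray.
An open set that misses the interior misses its closure \<open>\<Sigma>\<close>.\<close>

lemma corner_exterior_cone:
  assumes corner: "has_corner \<Sigma> x0 Q R \<theta>0 \<theta>2" and cl: "closure (interior \<Sigma>) = \<Sigma>"
  obtains s where "s > 0"
    "\<And>t. 0 < t \<Longrightarrow> t * (1 + s) < R \<Longrightarrow>
       ball (x0 + Q (t *\<^sub>R polar ((\<theta>0 + \<theta>2) / 2 + pi))) (s * t) \<subseteq> - \<Sigma>"
proof -
  define \<psi> where "\<psi> = (\<theta>0 + \<theta>2) / 2 + pi"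
  have Q: "orthogonal_transformation Q" and \<theta>: "\<theta>0 < \<theta>2" "\<theta>2 - \<theta>0 < 2 * pi"
    and K: "ball x0 R \<inter> interior \<Sigma> = (\<lambda>y. x0 + Q y) ` wedge \<theta>0 \<theta>2 R"
    using corner by (auto simp: has_corner_def)
  have nQ: "norm (Q y) = norm y" for y by (rule orthogonal_transformation_norm[OF Q])
  obtain \<kappa> where \<kappa>: "\<kappa> > 0" "\<And>y r t. y \<in> wedge \<theta>0 \<theta>2 r \<Longrightarrow> t \<ge> 0 \<Longrightarrow>
     \<kappa> * ((norm y)\<^sup>2 + t\<^sup>2) \<le> (norm (cplx y - of_real t * cis \<psi>))\<^sup>2"
    using exterior_distance[OF \<theta>] unfolding \<psi>_def by blast
  define s where "s = sqrt \<kappa>"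
  have s: "s > 0" "s\<^sup>2 = \<kappa>" using \<kappa> by (auto simp: s_def)
  have ext: "ball (x0 + Q (t *\<^sub>R polar \<psi>)) (s * t) \<subseteq> - \<Sigma>" if t: "0 < t" "t * (1 + s) < R" for t
  proof -
    let ?\<zeta> = "x0 + Q (t *\<^sub>R polar \<psi>)"
    have "ball ?\<zeta> (s * t) \<inter> interior \<Sigma> = {}"
    proof (rule ccontr)
      assume "ball ?\<zeta> (s * t) \<inter> interior \<Sigma> \<noteq> {}"
      then obtain x where x: "x \<in> ball ?\<zeta> (s * t)" "x \<in> interior \<Sigma>" by blast
      have x\<zeta>: "norm (x - ?\<zeta>) < s * t" using x(1) by (simp add: dist_norm norm_minus_commute)
      have "norm (x - x0) \<le> norm (x - ?\<zeta>) + norm (Q (t *\<^sub>R polar \<psi>))"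
        using norm_triangle_ineq[of "x - ?\<zeta>" "Q (t *\<^sub>R polar \<psi>)"] by (simp add: algebra_simps)
      also have "\<dots> < t * (1 + s)" using x\<zeta> t by (simp add: nQ algebra_simps)
      also have "\<dots> < R" by (rule t)
      finally have "x \<in> ball x0 R" by (simp add: dist_norm norm_minus_commute)
      then obtain y where y: "x = x0 + Q y" "y \<in> wedge \<theta>0 \<theta>2 R" using x(2) K by blast
      have "x - ?\<zeta> = Q (y - t *\<^sub>R polar \<psi>)"
        using y(1) linear_diff[OF orthogonal_transformation_linear[OF Q], of y "t *\<^sub>R polar \<psi>"] by simp
      hence "norm (x - ?\<zeta>) = norm (cplx (y - t *\<^sub>R polar \<psi>))" by (simp add: nQ)
      also have "cplx (y - t *\<^sub>R polar \<psi>) = cplx y - of_real t * cis \<psi>"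
        by (simp only: linear_diff[OF bounded_linear.linear[OF bounded_linear_cplx]] cplx_polar)
      finally have "\<kappa> * ((norm y)\<^sup>2 + t\<^sup>2) \<le> (norm (x - ?\<zeta>))\<^sup>2" using \<kappa>(2)[OF y(2), of t] t by simp
      also have "\<dots> < (s * t)\<^sup>2" using x\<zeta> by (intro power_strict_mono) auto
      also have "\<dots> = \<kappa> * t\<^sup>2" using s by (simp add: power_mult_distrib)
      finally have "\<kappa> * ((norm y)\<^sup>2 + t\<^sup>2) < \<kappa> * t\<^sup>2" .
      thus False using \<kappa>(1) by (simp add: mult_less_cancel_left_pos)
    qed
    hence "ball ?\<zeta> (s * t) \<inter> closure (interior \<Sigma>) = {}"
      using open_Int_closure_eq_empty[OF open_ball] by blast
    thus ?thesis unfolding cl by blast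
  qed
  show ?thesis by (rule that[OF s(1)]) (use ext in \<open>simp add: \<psi>_def\<close>)
qed

lemma continuous_on_rigid_motion:
  fixes Q :: "real^2 \<Rightarrow> real^2"
  assumes "orthogonal_transformation Q"
  shows "continuous_on UNIV (\<lambda>y. x0 + Q y)"
  using orthogonal_transformation_linear[OF assms]
  by (intro continuous_intros linear_continuous_on linear_conv_bounded_linear[THEN iffD1])

text \<open>The rigid motion maps the complement of the closed wedge, within the ball, to an open set that misses the
interior of \<open>\<Sigma>\<close>, hence misses \<open>\<Sigma>\<close>.\<close>

lemma corner_in_closure_wedge:
  assumes corner: "has_corner \<Sigma> x0 Q R \<theta>0 \<theta>2" and cl: "closure (interior \<Sigma>) = \<Sigma>"
    and y: "norm y < R" "x0 + Q y \<in> \<Sigma>"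
  shows "y \<in> closure (wedge \<theta>0 \<theta>2 R)"
proof (rule ccontr)
  assume ny: "y \<notin> closure (wedge \<theta>0 \<theta>2 R)"
  have Q: "orthogonal_transformation Q"
    and K: "ball x0 R \<inter> interior \<Sigma> = (\<lambda>y. x0 + Q y) ` wedge \<theta>0 \<theta>2 R"
    using corner by (auto simp: has_corner_def)
  have nQ: "norm (Q y) = norm y" for y by (rule orthogonal_transformation_norm[OF Q])
  define U where "U = ball 0 R - closure (wedge \<theta>0 \<theta>2 R)"
  have U: "open U" "y \<in> U" using y ny by (auto simp: U_def open_Diff)
  have "open ((\<lambda>y. x0 + Q y) ` U)"
  proof (rule invariance_of_domain[OF continuous_on_subset[OF continuous_on_rigid_motion[OF Q] subset_UNIV] U(1)])
    show "inj_on (\<lambda>y. x0 + Q y) U"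
      using orthogonal_transformation_inj[OF Q] by (auto simp: inj_on_def)
  qed
  moreover have "(\<lambda>y. x0 + Q y) ` U \<inter> interior \<Sigma> = {}"
  proof (rule ccontr)
    assume "(\<lambda>y. x0 + Q y) ` U \<inter> interior \<Sigma> \<noteq> {}"
    then obtain v where v: "v \<in> U" "x0 + Q v \<in> interior \<Sigma>" by auto
    have "x0 + Q v \<in> ball x0 R" using v(1) by (simp add: U_def dist_norm nQ)
    then obtain v' where v': "v' \<in> wedge \<theta>0 \<theta>2 R" "x0 + Q v = x0 + Q v'" using K v(2) by blast
    hence "v = v'" using orthogonal_transformation_inj[OF Q] by (auto dest: injD)
    thus False using v(1) v'(1) closure_subset by (auto simp: U_def)
  qed
  ultimately have "(\<lambda>y. x0 + Q y) ` U \<inter> closure (interior \<Sigma>) = {}"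
    using open_Int_closure_eq_empty by blast
  thus False using U(2) y(2) unfolding cl by blast
qed

section \<open>The scattering theorem\<close>

lemma locally_lipschitz_of_Ck:
  fixes u :: "'a::euclidean_space \<Rightarrow> complex"
  assumes u: "Ck 1 UNIV u"
  obtains L where "L > 0" "\<And>x. norm (x - a) \<le> 1 \<Longrightarrow> norm (u x - u a) \<le> L * norm (x - a)"
proof -
  define v where "v x = complex_of_real (cutoff a 1 x) * u x" for x
  have "Ck 1 UNIV v" unfolding v_def by (intro Ck_mult Ck_of_real Ck_cutoff u open_UNIV) simp
  moreover have "v x = 0" if "norm x > norm a + 2" for x
    using cutoff_eq_0[of 1 x a] that norm_triangle_ineq2[of x a] by (simp add: v_def)
  ultimately obtain L where L: "L > 0" "\<And>x y. norm (v x - v y) \<le> L * norm (x - y)"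
    using lipschitz_of_compact_support[of v "norm a + 2"] by blast
  have "v x = u x" if "norm (x - a) \<le> 1" for x using cutoff_eq_1[of 1 x a] that by (simp add: v_def)
  hence "norm (u x - u a) \<le> L * norm (x - a)" if "norm (x - a) \<le> 1" for x
    using L(2)[of x a] that by simp
  thus ?thesis using that L(1) by blast
qed

text \<open>The tip is a limit of exterior points \<open>Z t\<close> at which \<open>W\<close> vanishes.\<close>

lemma zero_at_tip:
  fixes W :: "real^2 \<Rightarrow> complex"
  assumes W: "\<And>x y. norm (W x - W y) \<le> C * sqrt (norm (x - y))" and C: "C \<ge> 0" and t0: "t0 > 0"
    and z: "\<And>t. 0 < t \<Longrightarrow> t \<le> t0 \<Longrightarrow> W (Z t) = 0 \<and> norm (Z t - a) = t"
  shows "W a = 0"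
proof -
  have "norm (W a) \<le> e" if e: "e > 0" for e
  proof -
    define t where "t = min t0 ((e / (C + 1))\<^sup>2)"
    have t: "0 < t" "t \<le> t0" using t0 e C by (auto simp: t_def)
    have "sqrt t \<le> sqrt ((e / (C + 1))\<^sup>2)" by (rule real_sqrt_le_mono) (simp add: t_def)
    hence st: "sqrt t \<le> e / (C + 1)" using e C by simp
    have "norm (W a) = norm (W (Z t) - W a)" using z[OF t] by simp
    also have "\<dots> \<le> C * sqrt t" using W[of "Z t" a] z[OF t] by simp
    also have "\<dots> \<le> (C + 1) * (e / (C + 1))" using st C t e by (intro mult_mono) auto
    also have "\<dots> = e" using C by simp
    finally show ?thesis .
  qed
  hence "norm (W a) \<le> 0" by (rule field_le_epsilon) simp
  thus ?thesis by simp
qed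

text \<open>Subtracting the equation of the incident wave from that of the total field and passing to Borel versions
gives \<open>\<Delta>w = k\<^sup>2 (u_in - \<rho> u)\<close> for the scattered field.\<close>

lemma weak_equation:
  fixes \<rho>' :: "real^2 \<Rightarrow> real" and u' :: "real^2 \<Rightarrow> complex"
  assumes \<rho>: "\<rho> \<in> borel_measurable lebesgue" and u: "u \<in> borel_measurable lebesgue"
    and \<rho>': "\<rho>' \<in> borel_measurable borel" "AE x in lborel. \<rho> x = \<rho>' x"
    and u': "u' \<in> borel_measurable borel" "AE x in lborel. u x = u' x"
    and lu: "locally_integrable u'" and lh: "locally_integrable (\<lambda>x. of_real (\<rho>' x) * u' x)"
    and me: "medium_equation k \<rho> u" and inc: "incident_wave k u_in" and \<phi>: "test_function \<phi>"
  shows "(\<integral>x. (u' x - u_in x) * laplacian \<phi> x \<partial>lborel)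
    = (\<integral>x. of_real (k\<^sup>2) * (u_in x - of_real (\<rho>' x) * u' x) * \<phi> x \<partial>lborel)"
proof -
  have [measurable]: "\<phi> \<in> borel_measurable borel" "laplacian \<phi> \<in> borel_measurable borel"
    using test_function_continuous[OF \<phi>] test_function_continuous[OF test_function_laplacian[OF \<phi>]]
    by (auto intro: borel_measurable_continuous_onI)
  have [measurable]: "\<rho>' \<in> borel_measurable borel" "u' \<in> borel_measurable borel" by (rule \<rho>' u')+
  have L: "\<phi> \<in> borel_measurable lebesgue" "laplacian \<phi> \<in> borel_measurable lebesgue"
    by (auto intro: measurable_completion)
  have C2: "Ck 2 UNIV u_in" and H: "\<And>x. laplacian u_in x = - of_real (k\<^sup>2) * u_in x"
    using inc by (auto simp: incident_wave_def C_diff_eq_Ck add_eq_0_iff2)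
  have li: "locally_integrable u_in" by (rule locally_integrable_continuous[OF Ck_imp_continuous_on[OF C2]])
  note i = integrable_mult_test[OF lu test_function_laplacian[OF \<phi>]] integrable_mult_test[OF lh \<phi>]
     integrable_mult_test[OF li test_function_laplacian[OF \<phi>]] integrable_mult_test[OF li \<phi>]
  have "0 = (LINT x|lebesgue. u x * laplacian \<phi> x + of_real (k\<^sup>2 * \<rho> x) * u x * \<phi> x)"
    using me \<phi> by (simp add: medium_equation_def)
  also have "\<dots> = (LINT x|lebesgue. u' x * laplacian \<phi> x + of_real (k\<^sup>2) * (of_real (\<rho>' x) * u' x * \<phi> x))"
  proof (rule integral_cong_AE)
    have "(\<lambda>x. complex_of_real (k\<^sup>2 * \<rho> x)) \<in> borel_measurable lebesgue"
      using measurable_compose[OF \<rho>, of "\<lambda>t. complex_of_real (k\<^sup>2 * t)" borel] by simp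
    thus "(\<lambda>x. u x * laplacian \<phi> x + complex_of_real (k\<^sup>2 * \<rho> x) * u x * \<phi> x) \<in> borel_measurable lebesgue"
      using u L by (intro borel_measurable_add borel_measurable_times)
    show "(\<lambda>x. u' x * laplacian \<phi> x + of_real (k\<^sup>2) * (of_real (\<rho>' x) * u' x * \<phi> x)) \<in> borel_measurable lebesgue"
      by (rule measurable_completion) measurable
    have "AE x in lborel. u x * laplacian \<phi> x + complex_of_real (k\<^sup>2 * \<rho> x) * u x * \<phi> x = u' x * laplacian \<phi> x + of_real (k\<^sup>2) * (of_real (\<rho>' x) * u' x * \<phi> x)"
      using \<rho>'(2) u'(2) by eventually_elim (simp add: mult_ac)
    thus "AE x in lebesgue. u x * laplacian \<phi> x + complex_of_real (k\<^sup>2 * \<rho> x) * u x * \<phi> x = u' x * laplacian \<phi> x + of_real (k\<^sup>2) * (of_real (\<rho>' x) * u' x * \<phi> x)"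
      by (rule AE_completion_iff[THEN iffD2])
  qed
  also have "\<dots> = (\<integral>x. u' x * laplacian \<phi> x + of_real (k\<^sup>2) * (of_real (\<rho>' x) * u' x * \<phi> x) \<partial>lborel)"
    by (rule integral_completion) measurable
  also have "\<dots> = (\<integral>x. u' x * laplacian \<phi> x \<partial>lborel) + of_real (k\<^sup>2) * (\<integral>x. of_real (\<rho>' x) * u' x * \<phi> x \<partial>lborel)"
    using Bochner_Integration.integral_add[OF i(1) integrable_mult_right[OF i(2)], of "of_real (k\<^sup>2)"]
    by (simp only: integral_mult_right_zero)
  finally have 1: "(\<integral>x. u' x * laplacian \<phi> x \<partial>lborel) = - of_real (k\<^sup>2) * (\<integral>x. of_real (\<rho>' x) * u' x * \<phi> x \<partial>lborel)"
    by (simp add: eq_neg_iff_add_eq_0)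
  have "(\<integral>x. u_in x * laplacian \<phi> x \<partial>lborel) = (\<integral>x. laplacian u_in x * \<phi> x \<partial>lborel)"
    by (rule integral_laplacian_symmetric[OF C2 \<phi>])
  also have "\<dots> = (\<integral>x. - of_real (k\<^sup>2) * (u_in x * \<phi> x) \<partial>lborel)" by (simp add: H mult.assoc)
  also have "\<dots> = - of_real (k\<^sup>2) * (\<integral>x. u_in x * \<phi> x \<partial>lborel)" by (rule integral_mult_right_zero)
  finally have 2: "(\<integral>x. u_in x * laplacian \<phi> x \<partial>lborel) = - of_real (k\<^sup>2) * (\<integral>x. u_in x * \<phi> x \<partial>lborel)" .
  have "(\<integral>x. (u' x - u_in x) * laplacian \<phi> x \<partial>lborel) = (\<integral>x. u' x * laplacian \<phi> x - u_in x * laplacian \<phi> x \<partial>lborel)"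
    by (simp add: left_diff_distrib)
  also have "\<dots> = of_real (k\<^sup>2) * ((\<integral>x. u_in x * \<phi> x \<partial>lborel) - (\<integral>x. of_real (\<rho>' x) * u' x * \<phi> x \<partial>lborel))"
    using Bochner_Integration.integral_diff[OF i(1) i(3)] by (simp add: 1 2 algebra_simps)
  also have "\<dots> = of_real (k\<^sup>2) * (\<integral>x. u_in x * \<phi> x - of_real (\<rho>' x) * u' x * \<phi> x \<partial>lborel)"
    using Bochner_Integration.integral_diff[OF i(4) i(2)] by simp
  also have "\<dots> = (\<integral>x. of_real (k\<^sup>2) * (u_in x * \<phi> x - of_real (\<rho>' x) * u' x * \<phi> x) \<partial>lborel)"
    by (rule integral_mult_right_zero[symmetric])
  also have "\<dots> = (\<integral>x. of_real (k\<^sup>2) * (u_in x - of_real (\<rho>' x) * u' x) * \<phi> x \<partial>lborel)"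
    by (simp add: algebra_simps)
  finally show ?thesis .
qed

lemma far_field_zero_decay:
  fixes w u_inf :: "real^2 \<Rightarrow> complex"
  assumes ff: "far_field_pattern k w u_inf" and z: "\<And>\<theta>. \<theta> \<in> sphere 0 1 \<Longrightarrow> u_inf \<theta> = 0" and \<epsilon>: "\<epsilon> > 0"
  obtains N where "\<And>x. norm x > N \<Longrightarrow> sqrt (norm x) * norm (w x) \<le> \<epsilon>"
proof -
  obtain e where e: "e \<in> O[at_infinity](\<lambda>x. of_real (1 / norm x))"
    and w: "\<forall>\<^sub>F x in at_infinity. w x = of_real (norm x powr (-1/2)) * exp (\<i> * of_real (k * norm x)) * (u_inf (sgn x) + e x)"
    using ff unfolding far_field_pattern_def by blast
  obtain c where c: "c > 0" "\<forall>\<^sub>F x in at_infinity. norm (e x) \<le> c * norm (complex_of_real (1 / norm x))"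
    using e by (elim landau_o.bigE)
  have "\<forall>\<^sub>F x::real^2 in at_infinity. norm x \<ge> max 1 (c / \<epsilon>)" unfolding eventually_at_infinity by blast
  with w c(2) have "\<forall>\<^sub>F x in at_infinity. sqrt (norm x) * norm (w x) \<le> \<epsilon>"
  proof eventually_elim
    case (elim x)
    have nx: "norm x \<ge> 1" "c / \<epsilon> \<le> norm x" using elim by auto
    have "x \<noteq> 0" using nx(1) norm_zero[where 'a="real^2"] by (metis not_one_le_zero)
    hence "sgn x \<in> sphere 0 1" by (simp add: norm_sgn)
    hence "norm (w x) = norm x powr (-1/2) * norm (e x)"
      using elim(1) z by (simp add: norm_mult)
    moreover have "sqrt (norm x) * norm x powr (-1/2) = 1"
      using \<open>x \<noteq> 0\<close> by (simp add: powr_half_sqrt[symmetric] powr_add[symmetric])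
    ultimately have "sqrt (norm x) * norm (w x) = norm (e x)" by (simp add: mult.assoc[symmetric])
    also have "\<dots> \<le> c / norm x" using elim(2) by (simp add: norm_divide)
    also have "\<dots> \<le> \<epsilon>" using nx(2) \<epsilon> \<open>x \<noteq> 0\<close> by (simp add: pos_divide_le_eq mult.commute)
    finally show ?case .
  qed
  then obtain b where "\<And>x. norm x \<ge> b \<Longrightarrow> sqrt (norm x) * norm (w x) \<le> \<epsilon>"
    unfolding eventually_at_infinity by blast
  thus ?thesis using that[of b] by simp
qed

text \<open>This is where the three parts of the argument meet: \<open>w\<close> vanishes outside \<open>\<Sigma>\<close>, hence at the tip; \<open>f\<close> has the
limits \<open>- k\<^sup>2 p\<^sub>j u_in(x0)\<close> at the tip with a Hoelder rate; and its pairing with the double pole is bounded.\<close>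

lemma corner_coefficient_relation:
  fixes k :: real and \<rho> \<rho>' :: "real^2 \<Rightarrow> real" and w f u' u_in :: "real^2 \<Rightarrow> complex" and S :: "(real^2) set"
  assumes k: "k > 0" and S: "compact S" and cl: "closure (interior (- outside S)) = - outside S"
    and \<rho>': "\<rho>' \<in> borel_measurable borel" and M: "AE x in lborel. \<bar>\<rho>' x\<bar> \<le> M"
    and \<rho>S: "AE x in lborel. x \<notin> S \<longrightarrow> \<rho>' x = 1"
    and u': "locally_L2 u'" and inc: "Ck 2 UNIV u_in" and u0: "u_in x0 \<noteq> 0"
    and w_def: "w = (\<lambda>x. u' x - u_in x)" and f_def: "f = (\<lambda>x. of_real (k\<^sup>2) * (u_in x - of_real (\<rho>' x) * u' x))"
    and eq: "\<And>\<phi>. test_function \<phi> \<Longrightarrow> (\<integral>x. w x * laplacian \<phi> x \<partial>lborel) = (\<integral>x. f x * \<phi> x \<partial>lborel)"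
    and decay: "\<And>\<epsilon>. \<epsilon> > 0 \<Longrightarrow> \<exists>N. AE y in lborel. norm y > N \<longrightarrow> sqrt (norm y) * norm (w y) \<le> \<epsilon>"
    and corner: "has_corner (- outside S) x0 Q R \<theta>0 \<theta>2" and th: "\<theta>0 < \<theta>1" "\<theta>1 < \<theta>2"
    and h1: "AE y in lborel. y \<in> wedge \<theta>0 \<theta>1 R \<longrightarrow> \<bar>\<rho>' (x0 + Q y) - 1 - p1\<bar> \<le> C1 * norm y powr \<alpha>1"
    and h2: "AE y in lborel. y \<in> wedge \<theta>1 \<theta>2 R \<longrightarrow> \<bar>\<rho>' (x0 + Q y) - 1 - p2\<bar> \<le> C2 * norm y powr \<alpha>2"
    and C12: "C1 > 0" "\<alpha>1 > 0" "C2 > 0" "\<alpha>2 > 0"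
  shows "of_real p1 * (cis (- (2 * \<theta>1)) - cis (- (2 * \<theta>0))) + of_real p2 * (cis (- (2 * \<theta>2)) - cis (- (2 * \<theta>1))) = 0"
proof -
  have [measurable]: "u' \<in> borel_measurable borel" using u' by (simp add: locally_L2_def)
  have [measurable]: "\<rho>' \<in> borel_measurable borel" by (rule \<rho>')
  have uc: "continuous_on UNIV u_in" using Ck_imp_continuous_on[OF inc] .
  have [measurable]: "u_in \<in> borel_measurable borel" by (rule borel_measurable_continuous_onI[OF uc])
  have wm [measurable]: "w \<in> borel_measurable borel" and fm [measurable]: "f \<in> borel_measurable borel"
    unfolding w_def f_def by measurable
  have fL2: "locally_L2 f"
  proof (rule locally_L2_bound[of "{0,1::nat}" "\<lambda>i. if i = 0 then u_in else u'" f "\<lambda>i. if i = 0 then k\<^sup>2 else k\<^sup>2 * M"])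
    show "AE x in lborel. norm (f x) \<le> (\<Sum>i\<in>{0,1::nat}. (if i = 0 then k\<^sup>2 else k\<^sup>2 * M) * norm ((if i = 0 then u_in else u') x))"
      using M
    proof eventually_elim
      case (elim x)
      have "norm (f x) = k\<^sup>2 * norm (u_in x - of_real (\<rho>' x) * u' x)" by (simp add: f_def norm_mult norm_power)
      also have "\<dots> \<le> k\<^sup>2 * (norm (u_in x) + \<bar>\<rho>' x\<bar> * norm (u' x))"
        using norm_triangle_ineq4[of "u_in x" "of_real (\<rho>' x) * u' x"] by (intro mult_left_mono) (auto simp: norm_mult)
      also have "\<dots> \<le> k\<^sup>2 * (norm (u_in x) + M * norm (u' x))"
        using elim by (intro mult_left_mono add_left_mono mult_right_mono) auto
      finally show ?case by (simp add: algebra_simps)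
    qed
  qed (use u' locally_L2_continuous[OF uc] fm in auto)
  have wL2: "locally_L2 w"
  proof (rule locally_L2_bound[of "{0,1::nat}" "\<lambda>i. if i = 0 then u_in else u'" w "\<lambda>i. 1"])
    show "AE x in lborel. norm (w x) \<le> (\<Sum>i\<in>{0,1::nat}. 1 * norm ((if i = 0 then u_in else u') x))"
      using norm_triangle_ineq4 by (intro AE_I2) (auto simp: w_def add.commute)
  qed (use u' locally_L2_continuous[OF uc] wm in auto)
  note wl = locally_L2_imp_locally_integrable[OF wL2] and fl = locally_L2_imp_locally_integrable[OF fL2]
  \<comment> \<open>Off the support of the medium the right-hand side is \<open>- k\<^sup>2 w\<close>, so \<open>w\<close> solves the Helmholtz equation there.\<close>
  have fw: "AE x in lborel. x \<notin> S \<longrightarrow> f x = - of_real (k\<^sup>2) * w x"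
    using \<rho>S by eventually_elim (auto simp: f_def w_def algebra_simps)
  have H: "weak_helmholtz k (- S) w"
    unfolding weak_helmholtz_def
  proof clarify
    fix \<phi> :: "real^2 \<Rightarrow> complex" and K
    assume \<phi>: "test_function \<phi>" "compact K" "K \<subseteq> - S" "\<forall>x. x \<notin> K \<longrightarrow> \<phi> x = 0"
    have [measurable]: "\<phi> \<in> borel_measurable borel" using test_function_continuous[OF \<phi>(1)] by (rule borel_measurable_continuous_onI)
    have i: "integrable lborel (\<lambda>x. w x * laplacian \<phi> x)" "integrable lborel (\<lambda>x. w x * \<phi> x)" "integrable lborel (\<lambda>x. f x * \<phi> x)"
      by (intro integrable_mult_test wl fl test_function_laplacian \<phi>(1))+
    have "(\<integral>x. w x * (laplacian \<phi> x + of_real (k\<^sup>2) * \<phi> x) \<partial>lborel)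
       = (\<integral>x. w x * laplacian \<phi> x + of_real (k\<^sup>2) * (w x * \<phi> x) \<partial>lborel)"
      by (simp add: algebra_simps)
    also have "\<dots> = (\<integral>x. f x * \<phi> x \<partial>lborel) + (\<integral>x. of_real (k\<^sup>2) * (w x * \<phi> x) \<partial>lborel)"
      using Bochner_Integration.integral_add[OF i(1) integrable_mult_right[OF i(2)], of "of_real (k\<^sup>2)"] eq[OF \<phi>(1)] by simp
    also have "(\<integral>x. f x * \<phi> x \<partial>lborel) = (\<integral>x. - (of_real (k\<^sup>2) * (w x * \<phi> x)) \<partial>lborel)"
    proof (rule integral_cong_AE)
      show "AE x in lborel. f x * \<phi> x = - (of_real (k\<^sup>2) * (w x * \<phi> x))"
        using fw
      proof eventually_elim
        case (elim x)
        show ?case using elim \<phi>(3,4) by (cases "x \<in> K") (auto simp: mult_ac)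
      qed
    qed measurable
    finally show "(\<integral>x. w x * (laplacian \<phi> x + of_real (k\<^sup>2) * \<phi> x) \<partial>lborel) = 0" by simp
  qed
  have wout: "AE x in lborel. x \<in> outside S \<longrightarrow> w x = 0"
    by (rule weak_helmholtz_vanishes_outside(1)[OF k wl S H decay])
  have outS: "outside S \<subseteq> - S" using outside_no_overlap by blast
  have fout: "AE x in lborel. x \<in> outside S \<longrightarrow> f x = 0"
    using wout fw by eventually_elim (use outS in auto)
  obtain R0 where R0: "R0 > 0" "S \<subseteq> cball 0 R0"
    using S compact_imp_bounded bounded_pos by (metis mem_cball_0 subsetI)
  have wfar: "AE x in lborel. norm x > R0 + 1 \<longrightarrow> w x = 0"
    by (rule weak_helmholtz_vanishes_outside(2)[OF k wl S H decay]) (use R0 in auto)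
  have ffar: "AE x in lborel. norm x > R0 + 1 \<longrightarrow> f x = 0"
    using wfar fw by eventually_elim (use R0 in auto)
  \<comment> \<open>The fields vanish far out only almost everywhere; truncation gives versions that vanish pointwise.\<close>
  let ?B = "cball (0::real^2) (R0 + 1)"
  define w1 where "w1 x = indicator ?B x *\<^sub>R w x" for x
  define f1 where "f1 x = indicator ?B x *\<^sub>R f x" for x
  have [measurable]: "w1 \<in> borel_measurable borel" "f1 \<in> borel_measurable borel" unfolding w1_def f1_def by measurable
  have ww: "AE x in lborel. w x = w1 x" using wfar by eventually_elim (auto simp: w1_def indicator_def)
  have ff: "AE x in lborel. f x = f1 x" using ffar by eventually_elim (auto simp: f1_def indicator_def)
  interpret P: compactly_supported_poisson w1 f1 "R0 + 1"
  proof
    have "locally_L2 w1"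
      by (rule locally_L2_bound[of "{0::nat}" "\<lambda>_. w" w1 "\<lambda>_. 1"]) (use wL2 in \<open>auto simp: w1_def indicator_def\<close>)
    thus "locally_integrable w1" by (rule locally_L2_imp_locally_integrable)
    show "integrable lborel (\<lambda>x. (norm (f1 x))\<^sup>2)"
    proof -
      have "(\<lambda>x. (norm (f1 x))\<^sup>2) = (\<lambda>x. indicator ?B x *\<^sub>R (norm (f x))\<^sup>2)"
        by (auto simp: f1_def indicator_def fun_eq_iff)
      thus ?thesis using fL2 by (simp add: locally_L2_def set_integrable_def)
    qed
    show "(\<integral>x. w1 x * laplacian \<phi> x \<partial>lborel) = (\<integral>x. f1 x * \<phi> x \<partial>lborel)" if \<phi>: "test_function \<phi>" for \<phi>
    proof -
      have [measurable]: "\<phi> \<in> borel_measurable borel" "laplacian \<phi> \<in> borel_measurable borel"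
        using test_function_continuous[OF \<phi>] test_function_continuous[OF test_function_laplacian[OF \<phi>]]
        by (auto intro: borel_measurable_continuous_onI)
      have "(\<integral>x. w1 x * laplacian \<phi> x \<partial>lborel) = (\<integral>x. w x * laplacian \<phi> x \<partial>lborel)"
        by (rule integral_cong_AE) (use ww in \<open>auto elim!: eventually_mono\<close>)
      moreover have "(\<integral>x. f1 x * \<phi> x \<partial>lborel) = (\<integral>x. f x * \<phi> x \<partial>lborel)"
        by (rule integral_cong_AE) (use ff in \<open>auto elim!: eventually_mono\<close>)
      ultimately show ?thesis using eq[OF \<phi>] by simp
    qed
  qed (use R0 in \<open>auto simp: w1_def f1_def\<close>)
  obtain W0 CW where W0: "\<And>x y. norm (W0 x - W0 y) \<le> CW * sqrt (norm (x - y))" "CW \<ge> 0" "AE x in lborel. w1 x = W0 x"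
    using P.hoelder_representative by metis
  have wW: "AE x in lborel. w x = W0 x" using ww W0(3) by eventually_elim simp
  have W0c: "continuous_on UNIV W0" by (rule continuous_of_hoelder[OF W0(1)])
  have Q: "orthogonal_transformation Q" and R: "R > 0" and \<theta>: "\<theta>2 - \<theta>0 < 2 * pi"
    using corner by (auto simp: has_corner_def)
  define \<psi> where "\<psi> = (\<theta>0 + \<theta>2) / 2 + pi"
  obtain s where s: "s > 0" "\<And>t. 0 < t \<Longrightarrow> t * (1 + s) < R \<Longrightarrow> ball (x0 + Q (t *\<^sub>R polar \<psi>)) (s * t) \<subseteq> - (- outside S)"
    using corner_exterior_cone[OF corner cl] unfolding \<psi>_def by blast
  define r where "r = min 1 R"
  have r: "0 < r" "r \<le> 1" "r \<le> R" using R by (auto simp: r_def)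
  \<comment> \<open>Small enough for the pole to stay within \<open>r / 4\<close> of the tip and for the exterior balls to exist.\<close>
  define t0 where "t0 = r / (4 * (1 + s))"
  have t0: "t0 > 0" "t0 \<le> r / 4" "t0 * (1 + s) = r / 4"
    using r s(1) by (auto simp: t0_def field_simps)
  have nQ: "norm (Q y) = norm y" for y by (rule orthogonal_transformation_norm[OF Q])
  have ext: "ball (x0 + Q (t *\<^sub>R polar \<psi>)) (s * t) \<subseteq> outside S" if t: "0 < t" "t \<le> t0" for t
  proof -
    have "t * (1 + s) \<le> t0 * (1 + s)" using t s(1) by (intro mult_right_mono) auto
    hence "t * (1 + s) < R" using t0 r by simp
    thus ?thesis using s(2)[OF t(1)] by simp
  qed
  have W0x0: "W0 x0 = 0"
  proof (rule zero_at_tip[OF W0(1,2) t0(1)])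
    fix t assume t: "0 < t" "t \<le> t0"
    have "AE x in lborel. x \<in> ball (x0 + Q (t *\<^sub>R polar \<psi>)) (s * t) \<longrightarrow> W0 x = 0"
      using wout wW by eventually_elim (use ext[OF t] in auto)
    hence "W0 (x0 + Q (t *\<^sub>R polar \<psi>)) = 0"
      by (rule AE_zero_continuous[OF W0c open_ball, rotated]) (use s t in simp)
    thus "W0 (x0 + Q (t *\<^sub>R polar \<psi>)) = 0 \<and> norm (x0 + Q (t *\<^sub>R polar \<psi>) - x0) = t"
      using t by (simp add: nQ)
  qed
  have "AE x in lborel. x \<in> ball (x0 + Q (t *\<^sub>R polar \<psi>)) (s * t) \<longrightarrow> w x = 0 \<and> f x = 0" if t: "0 < t" "t \<le> t0" for t
    using wout fout by eventually_elim (use ext[OF t] in auto)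
  then obtain M' where M': "\<And>t. 0 < t \<Longrightarrow> t \<le> t0 \<Longrightarrow>
     norm (\<integral>y. indicator (ball 0 r) y *\<^sub>R (f (x0 + Q y) * tip_kernel \<psi> t y) \<partial>lborel) \<le> M'"
    using tip_pairing_bounded[OF wl fl eq Q r(1) s(1) t0(2)] by blast
  obtain L where L: "L > 0" "\<And>x. norm (x - x0) \<le> 1 \<Longrightarrow> norm (u_in x - u_in x0) \<le> L * norm (x - x0)"
    using locally_lipschitz_of_Ck[OF Ck_le[OF inc]] by (metis one_le_numeral)
  define B where "B = norm (u_in x0) + L"
  have Mnn: "0 \<le> M"
  proof (rule ccontr)
    assume "\<not> 0 \<le> M"
    hence "AE x in (lborel :: (real^2) measure). False" using M by (auto elim!: eventually_mono)
    thus False using AE_iff_measurable[of UNIV "lborel :: (real^2) measure" "\<lambda>_. False"] by simp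
  qed
  \<comment> \<open>The rate combines those of the medium with the exponents \<open>1\<close> of the incident wave and \<open>1/2\<close> of \<open>w\<close>.\<close>
  define \<beta> where "\<beta> = min (min \<alpha>1 \<alpha>2) (1/2)"
  have \<beta>: "0 < \<beta>" "\<beta> \<le> 1" "\<beta> \<le> \<alpha>1" "\<beta> \<le> \<alpha>2" "\<beta> \<le> 1/2" using C12 by (auto simp: \<beta>_def)
  define C where "C = k\<^sup>2 * ((C1 + C2) * B + (\<bar>p1\<bar> + \<bar>p2\<bar>) * L + M * CW)"
  have B0: "B \<ge> 0" using L by (simp add: B_def)
  have C0: "C \<ge> 0" unfolding C_def using C12 B0 L Mnn W0(2) by (intro mult_nonneg_nonneg add_nonneg_nonneg) auto
  let ?c = "\<lambda>p. - of_real (k\<^sup>2) * of_real p * u_in x0"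
  have est: "norm (f (x0 + Q y) - ?c p) \<le> C * norm y powr \<beta>"
    if y: "0 < norm y" "norm y < r" and h: "\<bar>\<rho>' (x0 + Q y) - 1 - p\<bar> \<le> Cj * norm y powr \<alpha>"
      and wy: "w (x0 + Q y) = W0 (x0 + Q y)" and My: "\<bar>\<rho>' (x0 + Q y)\<bar> \<le> M"
      and j: "Cj \<ge> 0" "Cj \<le> C1 + C2" "\<bar>p\<bar> \<le> \<bar>p1\<bar> + \<bar>p2\<bar>" "\<beta> \<le> \<alpha>" for y p Cj \<alpha>
  proof -
    define x where "x = x0 + Q y"
    define q where "q = norm y powr \<beta>"
    have y1: "norm y \<le> 1" using y r by simp
    have nx: "norm (x - x0) = norm y" by (simp add: x_def nQ)
    have q: "norm y powr \<alpha> \<le> q" "norm y \<le> q" "sqrt (norm y) \<le> q" "0 \<le> q"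
    proof -
      show "norm y powr \<alpha> \<le> q" unfolding q_def using y y1 j(4) by (intro powr_mono') auto
      have "norm y powr 1 \<le> q" unfolding q_def using y y1 \<beta> by (intro powr_mono') auto
      thus "norm y \<le> q" using y by simp
      have "norm y powr (1/2) \<le> q" unfolding q_def using y y1 \<beta> by (intro powr_mono') auto
      thus "sqrt (norm y) \<le> q" using y by (simp add: powr_half_sqrt)
      show "0 \<le> q" by (simp add: q_def)
    qed
    have ul: "norm (u_in x - u_in x0) \<le> L * norm y" using L(2)[of x] y1 nx by simp
    have ub: "norm (u_in x) \<le> B"
    proof -
      have "norm (u_in x) \<le> norm (u_in x0) + norm (u_in x - u_in x0)" using norm_triangle_ineq[of "u_in x0" "u_in x - u_in x0"] by simp
      also have "L * norm y \<le> L * 1" using L y1 by (intro mult_left_mono) auto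
      ultimately show ?thesis using ul by (simp add: B_def)
    qed
    have wb: "norm (w x) \<le> CW * sqrt (norm y)"
      using W0(1)[of x x0] W0x0 wy nx by (simp add: x_def)
    \<comment> \<open>The three sources of error: the medium, the incident wave, and the scattered field at the tip.\<close>
    have "f x - ?c p = - of_real (k\<^sup>2) * (of_real (\<rho>' x - 1 - p) * u_in x + of_real p * (u_in x - u_in x0) + of_real (\<rho>' x) * w x)"
      by (simp add: f_def w_def algebra_simps)
    hence "norm (f x - ?c p) = k\<^sup>2 * norm (of_real (\<rho>' x - 1 - p) * u_in x + of_real p * (u_in x - u_in x0) + of_real (\<rho>' x) * w x)"
      by (simp add: norm_mult norm_power)
    also have "\<dots> \<le> k\<^sup>2 * ((C1 + C2) * B * q + (\<bar>p1\<bar> + \<bar>p2\<bar>) * L * q + M * CW * q)"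
    proof (intro mult_left_mono norm_triangle_le add_mono)
      have "\<bar>\<rho>' x - 1 - p\<bar> \<le> (C1 + C2) * q"
        using h q j by (intro order_trans[OF h[folded x_def]] mult_mono) auto
      hence "\<bar>\<rho>' x - 1 - p\<bar> * norm (u_in x) \<le> ((C1 + C2) * q) * B"
        using ub C12 q by (intro mult_mono) auto
      thus "norm (of_real (\<rho>' x - 1 - p) * u_in x) \<le> (C1 + C2) * B * q" by (simp add: norm_mult mult_ac del: of_real_diff)
      have "\<bar>p\<bar> * norm (u_in x - u_in x0) \<le> (\<bar>p1\<bar> + \<bar>p2\<bar>) * (L * q)"
        using j ul q L by (intro mult_mono order_trans[OF ul] mult_left_mono) auto
      thus "norm (of_real p * (u_in x - u_in x0)) \<le> (\<bar>p1\<bar> + \<bar>p2\<bar>) * L * q" by (simp add: norm_mult mult_ac)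
      have "\<bar>\<rho>' x\<bar> * norm (w x) \<le> M * (CW * q)"
        using My wb q W0(2) Mnn by (intro mult_mono order_trans[OF wb] mult_left_mono) (auto simp: x_def)
      thus "norm (of_real (\<rho>' x) * w x) \<le> M * CW * q" by (simp add: norm_mult mult_ac)
    qed simp
    also have "\<dots> = C * q" by (simp add: C_def algebra_simps)
    finally show ?thesis by (simp add: x_def q_def)
  qed
  have subr: "y \<in> wedge a b R" if "y \<in> wedge a b r" for y a b using wedge_mono_radius[OF r(3)] that by blast
  note wWr = AE_rigid_motion[OF Q wW, of x0] and Mr = AE_rigid_motion[OF Q M, of x0]
  have g1: "AE y in lborel. y \<in> wedge \<theta>0 \<theta>1 r \<longrightarrow> norm (f (x0 + Q y) - ?c p1) \<le> C * norm y powr \<beta>"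
    using h1 wWr Mr
  proof eventually_elim
    case (elim y)
    show ?case
    proof
      assume y: "y \<in> wedge \<theta>0 \<theta>1 r"
      show "norm (f (x0 + Q y) - ?c p1) \<le> C * norm y powr \<beta>"
        by (rule est[of y p1 C1 \<alpha>1]) (use elim subr[OF y] wedge_norm[OF y] C12 \<beta> in auto)
    qed
  qed
  have g2: "AE y in lborel. y \<in> wedge \<theta>1 \<theta>2 r \<longrightarrow> norm (f (x0 + Q y) - ?c p2) \<le> C * norm y powr \<beta>"
    using h2 wWr Mr
  proof eventually_elim
    case (elim y)
    show ?case
    proof
      assume y: "y \<in> wedge \<theta>1 \<theta>2 r"
      show "norm (f (x0 + Q y) - ?c p2) \<le> C * norm y powr \<beta>"
        by (rule est[of y p2 C2 \<alpha>2]) (use elim subr[OF y] wedge_norm[OF y] C12 \<beta> in auto)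
    qed
  qed
  have g0: "AE y in lborel. y \<in> ball 0 r \<longrightarrow> y \<notin> wedge \<theta>0 \<theta>1 r \<longrightarrow> y \<notin> wedge \<theta>1 \<theta>2 r \<longrightarrow> f (x0 + Q y) = 0"
    using AE_rigid_motion[OF Q fout, of x0] AE_not_on_ray[of \<theta>0] AE_not_on_ray[of \<theta>1] AE_not_on_ray[of \<theta>2]
  proof eventually_elim
    case (elim y)
    show ?case
    proof (intro impI)
      assume y: "y \<in> ball 0 r" "y \<notin> wedge \<theta>0 \<theta>1 r" "y \<notin> wedge \<theta>1 \<theta>2 r"
      show "f (x0 + Q y) = 0"
      proof (rule ccontr)
        assume "f (x0 + Q y) \<noteq> 0"
        hence "x0 + Q y \<notin> outside S" using elim(1) by blast
        hence "y \<in> closure (wedge \<theta>0 \<theta>2 R)" using corner_in_closure_wedge[OF corner cl] y(1) r(3) by simp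
        then obtain q \<theta> where q: "y = q *\<^sub>R polar \<theta>" "0 \<le> q" "\<theta>0 \<le> \<theta>" "\<theta> \<le> \<theta>2" using closure_wedge by metis
        have "y \<noteq> 0" using elim(2) by (metis scaleR_zero_left)
        hence "q > 0" using q by auto
        moreover have "q < r" using y(1) q by simp
        moreover have "\<theta> \<noteq> \<theta>0" "\<theta> \<noteq> \<theta>1" "\<theta> \<noteq> \<theta>2" using elim q(1) by auto
        ultimately have "y \<in> wedge \<theta>0 \<theta>1 r \<or> y \<in> wedge \<theta>1 \<theta>2 r"
          using q unfolding wedge_eq_polar by (cases "\<theta> < \<theta>1") fastforce+
        thus False using y by blast
      qed
    qed
  qed
  have gm: "(\<lambda>y. f (x0 + Q y)) \<in> borel_measurable borel"
    by (rule measurable_compose[OF borel_measurable_continuous_onI[OF continuous_on_rigid_motion[OF Q]] fm])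
  have "?c p1 * (cis (- (2 * \<theta>1)) - cis (- (2 * \<theta>0))) + ?c p2 * (cis (- (2 * \<theta>2)) - cis (- (2 * \<theta>1))) = 0"
    by (rule corner_condition[OF th \<theta> r(1,2) gm g1 g2 g0 \<beta>(1,2) C0 M'[unfolded \<psi>_def] t0(1)])
  hence "(- of_real (k\<^sup>2) * u_in x0) * (of_real p1 * (cis (- (2 * \<theta>1)) - cis (- (2 * \<theta>0))) + of_real p2 * (cis (- (2 * \<theta>2)) - cis (- (2 * \<theta>1)))) = 0"
    by (simp add: algebra_simps)
  thus ?thesis using k u0 by simp
qed

theorem theorem3:
  fixes k :: real
    and \<rho> :: "real^2 \<Rightarrow> real"
    and x0 :: "real^2"
    and u_in u u_inf :: "real^2 \<Rightarrow> complex"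
  assumes "k > 0"
    and "L_infinity \<rho>"
    and "compact (ess_supp (\<lambda>x. \<rho> x - 1))"
    and "closure (interior (total_supp (\<lambda>x. \<rho> x - 1))) = total_supp (\<lambda>x. \<rho> x - 1)"
    and "admissible_two_split_corner \<rho> x0"
    and "incident_wave k u_in"
    and "u_in x0 \<noteq> 0"
    and "total_field k \<rho> u_in u"
    and "far_field_pattern k (\<lambda>x. u x - u_in x) u_inf"
  shows "\<exists>\<theta>\<in>sphere 0 1. u_inf \<theta> \<noteq> 0"
proof (rule ccontr)
  assume "\<not> (\<exists>\<theta>\<in>sphere 0 1. u_inf \<theta> \<noteq> 0)"
  hence inf0: "\<And>\<theta>. \<theta> \<in> sphere 0 1 \<Longrightarrow> u_inf \<theta> = 0" by blast
  define S where "S = ess_supp (\<lambda>x. \<rho> x - 1)"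
  have ts: "total_supp (\<lambda>x. \<rho> x - 1) = - outside S" by (simp add: total_supp_def S_def)
  have \<rho>m: "\<rho> \<in> borel_measurable lebesgue" using assms(2) by (simp add: L_infinity_def)
  obtain M where "AE x in lebesgue. \<bar>\<rho> x\<bar> \<le> M" using assms(2) by (auto simp: L_infinity_def)
  hence M: "AE x in lborel. \<bar>\<rho> x\<bar> \<le> M" by (rule AE_completion_iff[THEN iffD1])
  obtain \<rho>' where \<rho>': "\<rho>' \<in> borel_measurable borel" "AE x in lborel. \<rho> x = \<rho>' x"
    using completion_ex_borel_measurable_real[OF \<rho>m] by auto
  have um: "u \<in> borel_measurable lebesgue" and u2: "\<And>K. compact K \<Longrightarrow> set_integrable lebesgue K (\<lambda>x. (cmod (u x))\<^sup>2)"
    and me: "medium_equation k \<rho> u"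
    using assms(8) by (auto simp: total_field_def H1_loc_def L2_loc_def)
  obtain u' where u': "u' \<in> borel_measurable borel" "AE x in lborel. u x = u' x" using ex_borel_version[OF um] by blast
  have [measurable]: "\<rho>' \<in> borel_measurable borel" "u' \<in> borel_measurable borel" by (rule \<rho>' u')+
  have M': "AE x in lborel. \<bar>\<rho>' x\<bar> \<le> M" using M \<rho>'(2) by eventually_elim simp
  have uL2: "locally_L2 u'"
    unfolding locally_L2_def
  proof (intro conjI allI)
    fix r
    have m: "(\<lambda>x. indicat_real (cball 0 r) x *\<^sub>R (cmod (u' x))\<^sup>2) \<in> borel_measurable borel" by measurable
    have int: "integrable lebesgue (\<lambda>x. indicat_real (cball 0 r) x *\<^sub>R (cmod (u x))\<^sup>2)"
      using u2[OF compact_cball] by (simp add: set_integrable_def)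
    have ae: "AE x in lebesgue. indicat_real (cball 0 r) x *\<^sub>R (cmod (u x))\<^sup>2 = indicat_real (cball 0 r) x *\<^sub>R (cmod (u' x))\<^sup>2"
      by (rule AE_completion_iff[THEN iffD2]) (use u'(2) in \<open>auto elim!: eventually_mono\<close>)
    have mL: "(\<lambda>x. indicat_real (cball 0 r) x *\<^sub>R (cmod (u' x))\<^sup>2) \<in> borel_measurable lebesgue"
      by (rule measurable_completion) (use m in simp)
    have "integrable lebesgue (\<lambda>x. indicat_real (cball 0 r) x *\<^sub>R (cmod (u' x))\<^sup>2)"
      by (rule iffD1[OF integrable_cong_AE[OF borel_measurable_integrable[OF int] mL ae] int])
    thus "set_integrable lborel (cball 0 r) (\<lambda>x. (cmod (u' x))\<^sup>2)"
      unfolding set_integrable_def using m by (subst (asm) integrable_completion) auto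
  qed (rule u')
  have hL2: "locally_L2 (\<lambda>x. of_real (\<rho>' x) * u' x)"
  proof (rule locally_L2_bound[of "{0::nat}" "\<lambda>_. u'" _ "\<lambda>_. M"])
    show "AE x in lborel. cmod (of_real (\<rho>' x) * u' x) \<le> (\<Sum>i\<in>{0::nat}. M * cmod (u' x))"
      using M' by eventually_elim (simp add: norm_mult mult_right_mono)
  qed (use uL2 in auto)
  have \<rho>S: "AE x in lborel. x \<notin> S \<longrightarrow> \<rho>' x = 1"
  proof -
    have "AE x in lborel. x \<in> - S \<longrightarrow> \<rho> x - 1 = 0"
    proof (rule AE_open_local)
      fix x assume "x \<in> - S"
      then obtain U where U: "open U" "x \<in> U" "AE x in lebesgue. x \<in> U \<longrightarrow> \<rho> x - 1 = 0"
        by (auto simp: S_def ess_supp_def)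
      show "\<exists>U. open U \<and> x \<in> U \<and> (AE y in lborel. y \<in> U \<longrightarrow> \<rho> y - 1 = 0)"
        using U(1,2) AE_completion_iff[THEN iffD1, OF U(3)] by blast
    qed
    thus ?thesis using \<rho>'(2) by eventually_elim auto
  qed
  have inc: "Ck 2 UNIV u_in" using assms(6) by (simp add: incident_wave_def C_diff_eq_Ck)
  have decay: "\<exists>N. AE y in lborel. norm y > N \<longrightarrow> sqrt (norm y) * norm (u' y - u_in y) \<le> \<epsilon>" if \<epsilon>: "\<epsilon> > 0" for \<epsilon>
  proof -
    obtain N where N: "\<And>x. norm x > N \<Longrightarrow> sqrt (norm x) * norm (u x - u_in x) \<le> \<epsilon>"
      by (rule far_field_zero_decay[OF assms(9) _ \<epsilon>]) (use inf0 in blast)+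
    have "AE y in lborel. norm y > N \<longrightarrow> sqrt (norm y) * norm (u' y - u_in y) \<le> \<epsilon>"
      using u'(2) by eventually_elim (use N in metis)
    thus ?thesis by blast
  qed
  obtain \<theta>0 \<theta>1 \<theta>2 p1 p2 Q R where c: "has_corner (- outside S) x0 Q R \<theta>0 \<theta>2" "\<theta>0 < \<theta>1" "\<theta>1 < \<theta>2"
    and hl: "holder_limit (\<lambda>y. \<rho> (x0 + Q y) - 1) (wedge \<theta>0 \<theta>1 R) p1" "holder_limit (\<lambda>y. \<rho> (x0 + Q y) - 1) (wedge \<theta>1 \<theta>2 R) p2"
    and adm: "admissible (\<theta>1 - \<theta>0) (\<theta>2 - \<theta>1) p1 p2"
    using assms(5) unfolding admissible_two_split_corner_def two_split_corner_def ts by blast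
  have Q: "orthogonal_transformation Q" and \<theta>: "\<theta>2 - \<theta>0 < 2 * pi" using c(1) by (auto simp: has_corner_def)
  have hl': "\<exists>C>0. \<exists>\<alpha>>0. AE y in lborel. y \<in> K \<longrightarrow> \<bar>\<rho>' (x0 + Q y) - 1 - p\<bar> \<le> C * norm y powr \<alpha>"
    if h: "holder_limit (\<lambda>y. \<rho> (x0 + Q y) - 1) K p" for K p
  proof -
    obtain C \<alpha> where C: "C > 0" "\<alpha> > 0" "AE y in lebesgue. y \<in> K \<longrightarrow> \<bar>\<rho> (x0 + Q y) - 1 - p\<bar> \<le> C * norm y powr \<alpha>"
      using h unfolding holder_limit_def by blast
    have "AE y in lborel. y \<in> K \<longrightarrow> \<bar>\<rho>' (x0 + Q y) - 1 - p\<bar> \<le> C * norm y powr \<alpha>"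
      using AE_completion_iff[THEN iffD1, OF C(3)] AE_rigid_motion[OF Q \<rho>'(2), of x0] by eventually_elim auto
    thus ?thesis using C(1,2) by blast
  qed
  obtain C1 \<alpha>1 where 1: "C1 > 0" "\<alpha>1 > 0" "AE y in lborel. y \<in> wedge \<theta>0 \<theta>1 R \<longrightarrow> \<bar>\<rho>' (x0 + Q y) - 1 - p1\<bar> \<le> C1 * norm y powr \<alpha>1"
    using hl'[OF hl(1)] by blast
  obtain C2 \<alpha>2 where 2: "C2 > 0" "\<alpha>2 > 0" "AE y in lborel. y \<in> wedge \<theta>1 \<theta>2 R \<longrightarrow> \<bar>\<rho>' (x0 + Q y) - 1 - p2\<bar> \<le> C2 * norm y powr \<alpha>2"
    using hl'[OF hl(2)] by blast
  have cond: "of_real p1 * (cis (- (2 * \<theta>1)) - cis (- (2 * \<theta>0))) + of_real p2 * (cis (- (2 * \<theta>2)) - cis (- (2 * \<theta>1))) = 0"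
    by (rule corner_coefficient_relation[OF assms(1) assms(3)[folded S_def] assms(4)[unfolded ts] \<rho>'(1) M' \<rho>S uL2 inc assms(7) refl refl
          weak_equation[OF \<rho>m um \<rho>' u' locally_L2_imp_locally_integrable[OF uL2] locally_L2_imp_locally_integrable[OF hL2] me assms(6)]
          decay c(1,2,3) 1(3) 2(3) 1(1,2) 2(1,2)])
  \<comment> \<open>Dividing by \<open>cis (- 2 \<theta>1)\<close> expresses the relation by the two apertures.\<close>
  have "of_real p1 * (1 - cis (2 * (\<theta>1 - \<theta>0))) + of_real p2 * (cis (- (2 * (\<theta>2 - \<theta>1))) - 1)
     = cis (2 * \<theta>1) * (of_real p1 * (cis (- (2 * \<theta>1)) - cis (- (2 * \<theta>0))) + of_real p2 * (cis (- (2 * \<theta>2)) - cis (- (2 * \<theta>1))))"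
    by (simp add: right_diff_distrib distrib_left mult.left_commute[of "cis (2 * \<theta>1)"] cis_mult)
  also have "\<dots> = 0" unfolding cond by simp
  finally show False
    by (rule admissible_excludes_relation[OF _ _ _ adm, rotated 3]) (use c \<theta> in auto)
qed

end
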